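(* Let $u$ be the solution map of the lognormal parametric elliptic problem described in the context. Assume that $\rho=(\rho_j)_{j\ge1}$ is a sequence of positive numbers such that $$\sup_{x\in D}\sum_{j\ge1}\rho_j|\psi_j(x)|<\infty,$$ with $(\rho_j^{-1})_{j\ge1}\in\ell^q(\mathbb{N})$ for some $0<q<\infty$. Let $r\ge1$ be an integer such that $q>\frac2r$, let $c>0$ be such that $\sup_{x\in D}\sum_{j\ge1}c\rho_j|\psi_j(x)|<\frac{\ln2}{\sqrt r}$, let $b=(b_j)_{j\ge1}$ with $b_j:=(c\rho_j)^{-1}$, and define $$\kappa_\nu:=\prod_{j\ge1}\left(\sum_{l=0}^r\binom{\nu_j}{l}b_j^{-2l}\right)^{-1/2},\qquad\nu\in\mathcal{F}.$$ Then there is a constant $C$ independent of $n$ such that for all $n\ge1$ $$\|u-u_{\Lambda_n}\|_{L^2(U,V,d\gamma)}\le Cn^{-s},\qquad s:=\frac1q,$$ where $u_{\Lambda_n}:=\sum_{\nu\in\Lambda_n}h_\nu H_\nu$ is the truncated Hermite series and $\Lambda_n$ is a downward closed set corresponding to the $n$ largest $\kappa_\nu$.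
   Context: Setting: $D\subset\mathbb{R}^k$ is a bounded Lipschitz domain ($k=1,2$ or $3$), $f\in L^2(D)$, $\psi_j\in L^\infty(D)$ for $j\ge1$, $V:=H^1_0(D)$, $U:=\mathbb{R}^{\mathbb{N}}$, equipped with the tensorized Gaussian probability measure $d\gamma:=\bigotimes_{j\ge1}g(y_j)dy_j$, $g(t):=\frac1{\sqrt{2\pi}}e^{-t^2/2}$. For $y=(y_j)_{j\ge1}\in U$ (outside a $\gamma$-null set), let $a(y):=\exp\left(\sum_{j\ge1}y_j\psi_j\right)$ and let $u(y)\in V$ be the weak solution of $-\mathrm{div}(a(y)\nabla u(y))=f$ in $D$ with $u(y)=0$ on $\partial D$, i.e. $\int_Da(y)\nabla u(y)\cdot\nabla v=\int_Dfv$ for all $v\in V$. Suprema over $x\in D$ are understood up to null sets. $\mathcal{F}$ is the set of finitely supported sequences $\nu=(\nu_j)_{j\ge1}$ of nonnegative integers, with $\widetilde\nu\le\nu$ iff $\widetilde\nu_j\le\nu_j$ for all $j$. A set $\Lambda\subset\mathcal{F}$ is downward closed if $\nu\in\Lambda$, $\widetilde\nu\le\nu$ imply $\widetilde\nu\in\Lambda$. By convention $\binom kl=0$ when $l>k$. A set corresponding to the $n$ largest $\kappa_\nu$ is a set $\Lambda\subset\mathcal{F}$ with $\#(\Lambda)=n$ such that $\kappa_\nu\ge\kappa_\mu$ for all $\nu\in\Lambda$, $\mu\notin\Lambda$. $(H_k)_{k\ge0}$ are the univariate Hermite polynomials normalized by $\int_{\mathbb{R}}|H_k(t)|^2g(t)\,dt=1$,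 $H_\nu(y):=\prod_{j\ge1}H_{\nu_j}(y_j)$, and $h_\nu:=\int_Uu(y)H_\nu(y)\,d\gamma\in V$. *)

theory Defs
  imports "HOL-Analysis.Analysis" "HOL-Probability.Probability"
    "HOL-Computational_Algebra.Polynomial"
begin

section \<open>Domains and function spaces\<close>

text \<open>
  A domain is a nonempty connected open set.  It is Lipschitz if, near each boundary point and in
  suitable orthonormal coordinates, it is the strict epigraph of a Lipschitz function.
  Here \<open>e\<close> is the "vertical" unit vector, and \<open>g\<close> is a function of the orthogonal projection
  onto the hyperplane perpendicular to \<open>e\<close>.
\<close>

definition lipschitz_domain :: "'a::euclidean_space set \<Rightarrow> bool" where
  "lipschitz_domain D \<longleftrightarrow> open D \<and> connected D \<and> D \<noteq> {} \<and>
     (\<forall>z\<in>frontier D. \<exists>W e L. \<exists>g::'a \<Rightarrow> real. open W \<and> z \<in> W \<and> norm e = 1 \<and>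
        L-lipschitz_on {x. x \<bullet> e = 0} g \<and>
        D \<inter> W = {x\<in>W. g (x - (x \<bullet> e) *\<^sub>R e) < x \<bullet> e})"

text \<open>
  Elements of the function spaces over \<open>D\<close> are represented by functions on the ambient space, of
  which only the restriction to \<open>D\<close> up to null sets matters; the norms below are seminorms on
  representatives.
\<close>

definition L2_fun :: "'a::euclidean_space set \<Rightarrow> ('a \<Rightarrow> 'b::euclidean_space) set" where
  "L2_fun D = {v. v \<in> borel_measurable (lebesgue_on D) \<and>
                  integrable (lebesgue_on D) (\<lambda>x. (norm (v x))\<^sup>2)}"

definition Linf_fun :: "'a::euclidean_space set \<Rightarrow> ('a \<Rightarrow> real) set" where
  "Linf_fun D = {v. v \<in> borel_measurable (lebesgue_on D) \<and>
                    esssup (lebesgue_on D) (\<lambda>x. ennreal \<bar>v x\<bar>) < \<infinity>}"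

primrec Ck :: "nat \<Rightarrow> ('a::euclidean_space \<Rightarrow> real) \<Rightarrow> bool" where
  "Ck 0 \<phi> \<longleftrightarrow> continuous_on UNIV \<phi>"
| "Ck (Suc m) \<phi> \<longleftrightarrow> (\<forall>x. \<phi> differentiable (at x)) \<and>
     (\<forall>i\<in>Basis. Ck m (\<lambda>x. frechet_derivative \<phi> (at x) i))"

definition test_fun :: "'a::euclidean_space set \<Rightarrow> ('a \<Rightarrow> real) set" where
  "test_fun D = {\<phi>. (\<forall>m. Ck m \<phi>) \<and> compact (closure {x. \<phi> x \<noteq> 0}) \<and>
                     closure {x. \<phi> x \<noteq> 0} \<subseteq> D}"

definition has_weak_gradient ::
  "'a::euclidean_space set \<Rightarrow> ('a \<Rightarrow> real) \<Rightarrow> ('a \<Rightarrow> 'a) \<Rightarrow> bool" where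
  "has_weak_gradient D v w \<longleftrightarrow> v \<in> L2_fun D \<and> w \<in> L2_fun D \<and>
     (\<forall>\<phi>\<in>test_fun D. \<forall>i\<in>Basis.
        (\<integral>x. v x * frechet_derivative \<phi> (at x) i \<partial>lebesgue_on D) =
        - (\<integral>x. (w x \<bullet> i) * \<phi> x \<partial>lebesgue_on D))"

definition H1 :: "'a::euclidean_space set \<Rightarrow> ('a \<Rightarrow> real) set" where
  "H1 D = {v. \<exists>w. has_weak_gradient D v w}"

text \<open>Weak gradients are unique up to null sets.\<close>

definition wgrad :: "'a::euclidean_space set \<Rightarrow> ('a \<Rightarrow> real) \<Rightarrow> 'a \<Rightarrow> 'a" where
  "wgrad D v = (SOME w. has_weak_gradient D v w)"

definition H1_norm :: "'a::euclidean_space set \<Rightarrow> ('a \<Rightarrow> real) \<Rightarrow> real" where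
  "H1_norm D v = sqrt ((\<integral>x. (v x)\<^sup>2 \<partial>lebesgue_on D) +
                       (\<integral>x. (norm (wgrad D v x))\<^sup>2 \<partial>lebesgue_on D))"

definition H10 :: "'a::euclidean_space set \<Rightarrow> ('a \<Rightarrow> real) set" where
  "H10 D = {v\<in>H1 D. \<exists>\<phi>. (\<forall>n. \<phi> n \<in> test_fun D) \<and>
                          (\<lambda>n. H1_norm D (\<lambda>x. v x - \<phi> n x)) \<longlonglongrightarrow> 0}"

text \<open>
  The norm of the energy space \<open>V = H\<^sup>1\<^sub>0(D)\<close> is the \<open>L\<^sup>2\<close> norm of the gradient, which for bounded
  \<open>D\<close> is equivalent to the full \<open>H\<^sup>1\<close> norm on \<open>V\<close>.
\<close>

definition V_norm :: "'a::euclidean_space set \<Rightarrow> ('a \<Rightarrow> real) \<Rightarrow> real" where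
  "V_norm D v = sqrt (\<integral>x. (norm (wgrad D v x))\<^sup>2 \<partial>lebesgue_on D)"

section \<open>Bochner integration with values in V\<close>

text \<open>
  \<open>V\<close> depends on the term \<open>D\<close> and hence is not a type, so the library's Bochner integral (for values
  in a second countable normed type) does not apply; the definitions below are its definitions
  relativised to \<open>V\<close>, for a finite measure.  Strong measurability means being an
  almost everywhere limit of simple \<open>V\<close>-valued functions.
\<close>

definition V_simple ::
  "'a::euclidean_space set \<Rightarrow> 'y measure \<Rightarrow> ('y \<Rightarrow> 'a \<Rightarrow> real) \<Rightarrow> bool" where
  "V_simple D M s \<longleftrightarrow> simple_function M s \<and> s ` space M \<subseteq> H10 D"

definition V_simple_integral :: "'y measure \<Rightarrow> ('y \<Rightarrow> 'a \<Rightarrow> real) \<Rightarrow> 'a \<Rightarrow> real" where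
  "V_simple_integral M s = (\<lambda>x. \<Sum>v\<in>s ` space M. measure M {y\<in>space M. s y = v} * v x)"

definition V_measurable ::
  "'a::euclidean_space set \<Rightarrow> 'y measure \<Rightarrow> ('y \<Rightarrow> 'a \<Rightarrow> real) \<Rightarrow> bool" where
  "V_measurable D M F \<longleftrightarrow> (\<exists>s. (\<forall>i. V_simple D M (s i)) \<and>
     (AE y in M. F y \<in> H10 D \<and> (\<lambda>i. V_norm D (\<lambda>x. F y x - s i y x)) \<longlonglongrightarrow> 0))"

definition has_V_integral ::
  "'a::euclidean_space set \<Rightarrow> 'y measure \<Rightarrow> ('y \<Rightarrow> 'a \<Rightarrow> real) \<Rightarrow> ('a \<Rightarrow> real) \<Rightarrow> bool" where
  "has_V_integral D M F h \<longleftrightarrow> V_measurable D M F \<and> h \<in> H10 D \<and>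
     (\<exists>s. (\<forall>i. V_simple D M (s i)) \<and>
        (\<lambda>i. \<integral>\<^sup>+y. ennreal (V_norm D (\<lambda>x. F y x - s i y x)) \<partial>M) \<longlonglongrightarrow> 0 \<and>
        (\<lambda>i. V_norm D (\<lambda>x. V_simple_integral M (s i) x - h x)) \<longlonglongrightarrow> 0)"

definition V_integral ::
  "'a::euclidean_space set \<Rightarrow> 'y measure \<Rightarrow> ('y \<Rightarrow> 'a \<Rightarrow> real) \<Rightarrow> 'a \<Rightarrow> real" where
  "V_integral D M F = (SOME h. has_V_integral D M F h)"

definition L2_V :: "'a::euclidean_space set \<Rightarrow> 'y measure \<Rightarrow> ('y \<Rightarrow> 'a \<Rightarrow> real) set" where
  "L2_V D M = {F. V_measurable D M F \<and> (\<integral>\<^sup>+y. ennreal ((V_norm D (F y))\<^sup>2) \<partial>M) < \<infinity>}"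

definition L2_V_norm :: "'a::euclidean_space set \<Rightarrow> 'y measure \<Rightarrow> ('y \<Rightarrow> 'a \<Rightarrow> real) \<Rightarrow> real" where
  "L2_V_norm D M F = sqrt (enn2real (\<integral>\<^sup>+y. ennreal ((V_norm D (F y))\<^sup>2) \<partial>M))"

section \<open>The lognormal elliptic problem\<close>

text \<open>Sequences indexed by \<open>j \<ge> 1\<close> are represented by functions on \<open>nat\<close>, the index starting at 0.\<close>

definition gauss_seq :: "(nat \<Rightarrow> real) measure" where
  "gauss_seq = (\<Pi>\<^sub>M j\<in>(UNIV::nat set). density lborel std_normal_density)"

definition lognormal_coeff :: "(nat \<Rightarrow> 'a \<Rightarrow> real) \<Rightarrow> (nat \<Rightarrow> real) \<Rightarrow> 'a \<Rightarrow> real" where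
  "lognormal_coeff \<psi> y x = exp (\<Sum>j. y j * \<psi> j x)"

definition weak_solution ::
  "'a::euclidean_space set \<Rightarrow> ('a \<Rightarrow> real) \<Rightarrow> ('a \<Rightarrow> real) \<Rightarrow> ('a \<Rightarrow> real) \<Rightarrow> bool" where
  "weak_solution D a f v \<longleftrightarrow> v \<in> H10 D \<and>
     (\<forall>w\<in>H10 D. (\<integral>x. a x * (wgrad D v x \<bullet> wgrad D w x) \<partial>lebesgue_on D) =
                  (\<integral>x. f x * w x \<partial>lebesgue_on D))"

section \<open>Hermite expansions\<close>

text \<open>
  The recursion gives the monic orthogonal polynomials for the standard Gaussian (it is Rodrigues'
  formula); the \<open>k\<close>-th one has squared norm \<open>k!\<close>.
\<close>

primrec hermite_monic :: "nat \<Rightarrow> real poly" where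
  "hermite_monic 0 = 1"
| "hermite_monic (Suc k) = [:0, 1:] * hermite_monic k - pderiv (hermite_monic k)"

definition hermite :: "nat \<Rightarrow> real \<Rightarrow> real" where
  "hermite k t = poly (hermite_monic k) t / sqrt (fact k)"

definition multi_indices :: "(nat \<Rightarrow> nat) set" where
  "multi_indices = {\<nu>. finite {j. \<nu> j \<noteq> 0}}"

text \<open>All but finitely many factors of the following two infinite products equal 1.\<close>

definition hermite_multi :: "(nat \<Rightarrow> nat) \<Rightarrow> (nat \<Rightarrow> real) \<Rightarrow> real" where
  "hermite_multi \<nu> y = (\<Prod>j. hermite (\<nu> j) (y j))"

definition kappa :: "nat \<Rightarrow> (nat \<Rightarrow> real) \<Rightarrow> (nat \<Rightarrow> nat) \<Rightarrow> real" where
  "kappa r b \<nu> =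
     (\<Prod>j. (\<Sum>l=0..r. real (\<nu> j choose l) * b j powi (- 2 * int l)) powr (- 1 / 2))"

definition hermite_coeff ::
  "'a::euclidean_space set \<Rightarrow> ((nat \<Rightarrow> real) \<Rightarrow> 'a \<Rightarrow> real) \<Rightarrow> (nat \<Rightarrow> nat) \<Rightarrow> 'a \<Rightarrow> real" where
  "hermite_coeff D u \<nu> = V_integral D gauss_seq (\<lambda>y x. u y x * hermite_multi \<nu> y)"

definition hermite_trunc ::
  "'a::euclidean_space set \<Rightarrow> ((nat \<Rightarrow> real) \<Rightarrow> 'a \<Rightarrow> real) \<Rightarrow> (nat \<Rightarrow> nat) set \<Rightarrow>
   (nat \<Rightarrow> real) \<Rightarrow> 'a \<Rightarrow> real" where
  "hermite_trunc D u \<Lambda> y x = (\<Sum>\<nu>\<in>\<Lambda>. hermite_coeff D u \<nu> x * hermite_multi \<nu> y)"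

definition downward_closed :: "(nat \<Rightarrow> nat) set \<Rightarrow> bool" where
  "downward_closed \<Lambda> \<longleftrightarrow>
     \<Lambda> \<subseteq> multi_indices \<and> (\<forall>\<nu>\<in>\<Lambda>. \<forall>\<mu>\<in>multi_indices. \<mu> \<le> \<nu> \<longrightarrow> \<mu> \<in> \<Lambda>)"

definition n_largest :: "((nat \<Rightarrow> nat) \<Rightarrow> real) \<Rightarrow> nat \<Rightarrow> (nat \<Rightarrow> nat) set \<Rightarrow> bool" where
  "n_largest \<kappa> n \<Lambda> \<longleftrightarrow> \<Lambda> \<subseteq> multi_indices \<and> finite \<Lambda> \<and> card \<Lambda> = n \<and>
     (\<forall>\<nu>\<in>\<Lambda>. \<forall>\<mu>\<in>multi_indices - \<Lambda>. \<kappa> \<mu> \<le> \<kappa> \<nu>)"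

end

theory Submission
  imports Defs "HOL-Real_Asymp.Real_Asymp"
begin

text \<open>
  Write \<open>H\<close> for the normalised Hermite polynomials of the Gaussian sequence, \<open>h \<nu>\<close> for the Hermite coefficients
  of the solution and \<open>\<kappa> \<nu>\<close> for the weights.  Everything follows from one weighted estimate,
  \<open>(\<Sum>\<nu>. (norm (h \<nu>) / \<kappa> \<nu>)\<^sup>2) < \<infinity>\<close>.  By Parseval the squared error of the truncation to \<open>\<Lambda>\<close> is the sum of
  \<open>(norm (h \<nu>))\<^sup>2\<close> over the \<open>\<nu>\<close> outside \<open>\<Lambda>\<close>, hence at most a constant times the square of the largest
  weight outside \<open>\<Lambda>\<close>.  The condition \<open>q > 2 / r\<close> makes the weights \<open>q\<close>-summable (\<open>kappa_powr_sum_bounded\<close>), and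
  the \<open>n\<close> largest terms of a \<open>q\<close>-summable family leave only terms of size \<open>O(n powr (- 1 / q))\<close>
  (\<open>n_largest_tail_bound\<close>).

  The weighted estimate combines two facts about the Taylor coefficients \<open>t \<mu>\<close> of \<open>y \<mapsto> u y\<close>, that is, the partial
  derivatives divided by \<open>\<mu>!\<close>.  Put \<open>\<sigma> j = sqrt r * c * \<rho> j\<close>.

  First, Gaussian integration by parts moves derivatives onto the Hermite polynomials
  (\<open>hcoef_T_incr\<close>, \<open>hcoef_T_binomial\<close>), so Bessel's inequality gives
  \<open>(\<Sum>\<nu>. (\<nu> choose \<mu>) * (norm (h \<nu>))\<^sup>2) \<le> \<mu>! * E (norm (t \<mu>))\<^sup>2\<close>.  Multiplying out the product that defines \<open>\<kappa> \<nu>\<close> turns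
  \<open>1 / (\<kappa> \<nu>)\<^sup>2\<close> into the sum of \<open>(\<nu> choose \<mu>) * \<Prod>\<^sub>j b j powr (- 2 * \<mu> j)\<close> over the \<open>\<mu>\<close> with all
  entries at most \<open>r\<close>.  For these \<open>\<mu>! \<le> r ^ \<bar>\<mu>\<bar>\<close>, which is absorbed by the factor \<open>sqrt r\<close> in \<open>\<sigma>\<close>: it remains to
  bound \<open>\<Sum>\<mu>. \<sigma> ^ (2 * \<mu>) * E (norm (t \<mu>))\<^sup>2\<close>.

  Second, differentiating the equation shows that the Taylor coefficients solve a triangular system in which \<open>t (\<mu> - m)\<close>
  enters the equation of \<open>t \<mu>\<close> with the coefficient \<open>a * \<psi> ^ m / m!\<close>.  Testing with \<open>\<sigma> ^ (2 * \<mu>) * t \<mu>\<close> and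
  summing, the off-diagonal terms are controlled by \<open>(\<Sum>m\<noteq>0. (\<sigma> * \<bar>\<psi>\<bar>) ^ m / m!) \<le> exp K - 1\<close>, where \<open>K\<close> bounds
  \<open>\<Sum>j. \<sigma> j * \<bar>\<psi> j\<bar>\<close>.  This is less than 1 exactly because \<open>K < ln 2\<close>, so the diagonal absorbs them
  (\<open>taylor_energy_bound\<close>).  The resulting bound for a fixed \<open>y\<close> contains the factor \<open>exp (2 * B * K)\<close> with
  \<open>B = sup\<^sub>j \<bar>y j\<bar> / \<sigma> j\<close>, which is integrable because the inverses of the \<open>\<sigma> j\<close> are summable to some power
  (\<open>weight_finite\<close>, \<open>good_bounded\<close>).

  The functional analysis is carried out in one Hilbert space, the square integrable vector fields on the whole space.  A function
  \<open>v\<close> in \<open>H10 D\<close> is identified with its weak gradient extended by zero.  By Poincare's inequality these gradients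
  form a closed subspace, the energy norm is the norm of that space, and the weak equation becomes the equation of a coercive
  symmetric form given by a multiplication operator (\<open>weak_solution_iff\<close>).
\<close>

section \<open>Coercive symmetric forms on a closed subspace\<close>

text \<open>
  The quadratic functional \<open>A v \<bullet> v - 2 * F v\<close> is bounded below on \<open>V\<close>.  By the parallelogram identity and
  coercivity its minimising sequences are Cauchy, and the vanishing of its first variation at the minimiser is the claim.
  With \<open>A\<close> the identity this is the Riesz representation theorem on \<open>V\<close>.
\<close>

lemma coercive_form_represents:
 fixes A :: "'h::{real_inner,complete_space} \<Rightarrow>\<^sub>L 'h" and F :: "'h => real"
 assumes V: "subspace V" "closed V" and \<alpha>: "\<alpha> > 0"
  and sym: "\<And>v w. v \<in> V ==> w \<in> V ==> A v \<bullet> w = A w \<bullet> v"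
  and coer: "\<And>v. v \<in> V ==> A v \<bullet> v \<ge> \<alpha> * (norm v)^2"
  and Fadd: "\<And>v w. v \<in> V ==> w \<in> V ==> F (v + w) = F v + F w"
  and Fscale: "\<And>t v. v \<in> V ==> F (t *\<^sub>R v) = t * F v"
  and Fbd: "\<And>v. v \<in> V ==> \<bar>F v\<bar> <= C * norm v"
 shows "\<exists>w\<in>V. \<forall>v\<in>V. A w \<bullet> v = F v"
proof -
 note V0 = subspace_0[OF V(1)] and Vadd = subspace_add[OF V(1)] and Vsc = subspace_scale[OF V(1)]
  and Vdiff = subspace_diff[OF V(1)]
 define J where "J v = A v \<bullet> v - 2 * F v" for v
 have Jlow: "J v \<ge> - C\<^sup>2 / \<alpha>" if "v \<in> V" for v
 proof -
  have "J v \<ge> \<alpha> * (norm v)^2 - 2 * (C * norm v)"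
   unfolding J_def using coer[OF that] Fbd[OF that] by linarith
  moreover have "\<alpha> * (norm v)^2 - 2 * (C * norm v) + C^2 / \<alpha> = (\<alpha> * norm v - C)^2 / \<alpha>"
   using \<alpha> by (simp add: field_simps power2_eq_square)
  moreover have "(\<alpha> * norm v - C)^2 / \<alpha> \<ge> 0" using \<alpha> by simp
  ultimately show ?thesis by simp
 qed
 define d where "d = Inf (J ` V)"
 have bdd: "bdd_below (J ` V)" using Jlow by (auto intro!: bdd_belowI2)
 have ne: "J ` V ~= {}" using V0 by auto
 have dle: "d <= J v" if "v \<in> V" for v
  unfolding d_def using bdd that by (auto intro: cInf_lower)
 have "\<exists>v\<in>V. J v < d + inverse (real (Suc n))" for n
 proof -
  have "Inf (J ` V) < d + inverse (real (Suc n))" unfolding d_def by simp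
  then show ?thesis using cInf_lessD[OF ne] by auto
 qed
 then obtain s where s: "\<And>n. s n \<in> V" "\<And>n. J (s n) < d + inverse (real (Suc n))" by metis
 \<comment> \<open>parallelogram identity at the midpoint\<close>
 have par: "\<alpha> * (norm (v - w))^2 <= 2 * (J v - d) + 2 * (J w - d)" if v: "v \<in> V" and w: "w \<in> V" for v w
 proof -
  let ?m = "(1/2) *\<^sub>R (v + w)"
  have m: "?m \<in> V" using v w Vadd Vsc by blast
  have Fm: "F ?m = (F v + F w) / 2" using Fscale[OF Vadd[OF v w]] Fadd[OF v w] by simp
  have Am: "A ?m \<bullet> ?m = (A v \<bullet> v + 2 * (A v \<bullet> w) + A w \<bullet> w) / 4"
   using sym[OF v w] by (simp add: blinfun.add_right blinfun.scaleR_right inner_add inner_simps field_simps)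
  have Ad: "A (v - w) \<bullet> (v - w) = A v \<bullet> v - 2 * (A v \<bullet> w) + A w \<bullet> w"
   using sym[OF v w] by (simp add: blinfun.diff_right inner_diff field_simps)
  have "A (v - w) \<bullet> (v - w) = 2 * J v + 2 * J w - 4 * J ?m"
   unfolding J_def Ad Am Fm by (simp add: field_simps)
  then show ?thesis using coer[OF Vdiff[OF v w]] dle[OF m] by argo
 qed
 have aux: "x < y" if "x <= 2 * (a - d) + 2 * (b - d)" "a < d + i" "b < d + j" "i <= k" "j <= k" "k < y / 4"
  for x y a b i j k :: real
  using that by (simp add: algebra_simps)
 have "Cauchy s"
 proof (rule metric_CauchyI)
  fix e :: real assume e: "e > 0"
  then obtain N where N: "inverse (real (Suc N)) < \<alpha> * e^2 / 4"
   using reals_Archimedean[of "\<alpha> * e^2 / 4"] \<alpha> by auto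
  have "dist (s m) (s n) < e" if mn: "m \<ge> N" "n \<ge> N" for m n
  proof -
   have "inverse (real (Suc m)) <= inverse (real (Suc N))" "inverse (real (Suc n)) <= inverse (real (Suc N))"
    using mn by (auto intro!: le_imp_inverse_le)
   then have "\<alpha> * (norm (s m - s n))^2 < \<alpha> * e^2"
    using aux[OF par[OF s(1)[of m] s(1)[of n]] s(2)[of m] s(2)[of n] _ _ N] by blast
   then have "(norm (s m - s n))^2 < e^2" using \<alpha> by simp
   then show ?thesis using e by (simp add: dist_norm power2_less_imp_less)
  qed
  then show "\<exists>M. \<forall>m\<ge>M. \<forall>n\<ge>M. dist (s m) (s n) < e" by blast
 qed
 then obtain w where lim: "s \<longlonglongrightarrow> w" using Cauchy_convergent_iff convergent_def by blast
 have w: "w \<in> V" using closed_sequentially[OF V(2)] s(1) lim by blast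
 have Flim: "(%n. F (s n)) \<longlonglongrightarrow> F w"
 proof -
  have "(%n. C * norm (s n - w)) \<longlonglongrightarrow> C * 0"
   by (intro tendsto_intros tendsto_norm_zero) (simp add: LIM_zero lim)
  moreover have "\<bar>F (s n) - F w\<bar> <= C * norm (s n - w)" for n
  proof -
   have "F (s n - w) + F w = F (s n)" using Fadd[OF Vdiff[OF s(1) w] w] by simp
   then show ?thesis using Fbd[OF Vdiff[OF s(1)[of n] w]] by simp
  qed
  ultimately have "(%n. F (s n) - F w) \<longlonglongrightarrow> 0"
   using Lim_null_comparison[of "%n. F (s n) - F w" "%n. C * norm (s n - w)" sequentially] by simp
  then show ?thesis by (simp add: LIM_zero_iff)
 qed
 have Jw: "J w <= d"
 proof (rule LIMSEQ_le)
  show "(%n. J (s n)) \<longlonglongrightarrow> J w" unfolding J_def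
   by (intro tendsto_intros lim Flim)
  show "(%n. d + inverse (real (Suc n))) \<longlonglongrightarrow> d"
   using LIMSEQ_inverse_real_of_nat_add[of d] by simp
  show "\<exists>N. \<forall>n\<ge>N. J (s n) <= d + inverse (real (Suc n))" using s(2) less_imp_le by blast
 qed
 have "A w \<bullet> v = F v" if v: "v \<in> V" for v
 proof -
  define b where "b = A w \<bullet> v - F v"
  define q where "q = A v \<bullet> v"
  have q: "q \<ge> 0" using coer[OF v] \<alpha> unfolding q_def
   by (meson less_imp_le mult_nonneg_nonneg order_trans zero_le_power2)
  have quad: "0 <= 2 * t * b + t^2 * q" for t
  proof -
   have "J (w + t *\<^sub>R v) = J w + 2 * t * b + t^2 * q"
    unfolding J_def b_def q_def using sym[OF v w] Fadd[OF w Vsc[OF v, of t]] Fscale[OF v, of t]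
    by (simp add: blinfun.add_right blinfun.scaleR_right inner_add inner_simps field_simps power2_eq_square)
   then show ?thesis using dle[OF Vadd[OF w Vsc[OF v, of t]]] Jw by linarith
  qed
  define k where "k = q + 1"
  have k: "k > 0" using q by (simp add: k_def)
  have "0 <= (2 * (- b / k) * b + (- b / k)^2 * q) * k^2"
   using mult_nonneg_nonneg[OF quad[of "- b / k"] zero_le_power2[of k]] by simp
  also have "\<dots> = - 2 * b^2 * k + b^2 * q" using k by (simp add: field_simps power2_eq_square)
  also have "\<dots> = - (b\<^sup>2 * (q + 2))" by (simp add: k_def algebra_simps)
  finally have "b^2 <= 0" using q by (simp add: mult_le_0_iff)
  then show ?thesis unfolding b_def by simp
 qed
 with w show ?thesis by blast
qed

text \<open>
  Difference quotients are what the estimates for operators and solutions produce directly.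
\<close>

lemma has_vector_derivative_iff_quotient:
 fixes f :: "real => 'a::real_normed_vector"
 shows "(f has_vector_derivative f') (at t) \<longleftrightarrow> ((%s. (1/(s-t)) *\<^sub>R (f s - f t)) \<longlongrightarrow> f') (at t)"
proof -
 have "norm (f s - f t - (s - t) *\<^sub>R f') / norm (s - t) = norm ((1/(s-t)) *\<^sub>R (f s - f t) - f')"
  if "s ~= t" for s
 proof -
  have "(1/(s-t)) *\<^sub>R (f s - f t) - f' = (1/(s-t)) *\<^sub>R (f s - f t - (s - t) *\<^sub>R f')"
   using that by (simp add: scaleR_diff_right)
  then show ?thesis by simp
 qed
 then have "((%s. norm (f s - f t - (s - t) *\<^sub>R f') / norm (s - t)) \<longlongrightarrow> 0) (at t)
  \<longleftrightarrow> ((%s. norm ((1/(s-t)) *\<^sub>R (f s - f t) - f')) \<longlongrightarrow> 0) (at t)"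
  by (intro Lim_cong_within) auto
 also have "\<dots> \<longleftrightarrow> ((%s. (1/(s-t)) *\<^sub>R (f s - f t)) \<longlongrightarrow> f') (at t)"
  unfolding tendsto_norm_zero_iff by (rule LIM_zero_iff)
 finally show ?thesis
  unfolding has_vector_derivative_def has_derivative_iff_norm using bounded_linear_scaleR_left by blast
qed

definition form_solution :: "'h::{real_inner,complete_space} set => ('h \<Rightarrow>\<^sub>L 'h) => 'h => 'h" where
 "form_solution V A g = (THE w. w \<in> V \<and> (\<forall>v\<in>V. A w \<bullet> v = g \<bullet> v))"

definition coercive_on :: "'h::real_inner set => real => ('h \<Rightarrow>\<^sub>L 'h) => bool" where
 "coercive_on V \<alpha> A \<longleftrightarrow> 0 < \<alpha> \<and> (\<forall>v\<in>V. \<forall>w\<in>V. A v \<bullet> w = A w \<bullet> v) \<and>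
  (\<forall>v\<in>V. \<alpha> * (norm v)^2 <= A v \<bullet> v)"

text \<open>
  The subspace stays a set rather than a type because it depends on the domain of the differential equation.
\<close>

locale closed_subspace =
 fixes V :: "'h::{real_inner,complete_space} set"
 assumes V_subspace: "subspace V" and V_closed: "closed V"
begin

lemma form_solution_unique:
 assumes A: "coercive_on V \<alpha> A" and w: "w \<in> V" "\<And>v. v \<in> V ==> A w \<bullet> v = g \<bullet> v"
  and w': "w' \<in> V" "\<And>v. v \<in> V ==> A w' \<bullet> v = g \<bullet> v"
 shows "w = w'"
proof -
 have d: "w - w' \<in> V" using w w' V_subspace subspace_diff by blast
 have "A (w - w') \<bullet> (w - w') = 0" using w(2)[OF d] w'(2)[OF d] by (simp add: blinfun.diff_right inner_diff_left)
 then have "\<alpha> * (norm (w - w'))^2 <= 0" using A d unfolding coercive_on_def by fastforce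
 then show ?thesis using A unfolding coercive_on_def by (simp add: mult_le_0_iff)
qed

lemma form_solution:
 assumes A: "coercive_on V \<alpha> A"
 shows "form_solution V A g \<in> V" "\<And>v. v \<in> V ==> A (form_solution V A g) \<bullet> v = g \<bullet> v"
proof -
 have "\<exists>w\<in>V. \<forall>v\<in>V. A w \<bullet> v = g \<bullet> v"
 proof (rule coercive_form_represents[OF V_subspace V_closed])
  show "\<alpha> > 0" "\<And>v w. v \<in> V ==> w \<in> V ==> A v \<bullet> w = A w \<bullet> v"
   "\<And>v. v \<in> V ==> \<alpha> * (norm v)^2 <= A v \<bullet> v"
   using A unfolding coercive_on_def by blast+
  show "\<bar>g \<bullet> v\<bar> <= norm g * norm v" for v by (rule Cauchy_Schwarz_ineq2)
 qed (simp_all add: inner_add_right)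
 then have "\<exists>!w. w \<in> V \<and> (\<forall>v\<in>V. A w \<bullet> v = g \<bullet> v)"
  using form_solution_unique[OF A, where g = g] by (intro ex_ex1I) auto
 from theI'[OF this, folded form_solution_def]
 show "form_solution V A g \<in> V" "\<And>v. v \<in> V ==> A (form_solution V A g) \<bullet> v = g \<bullet> v"
  by simp_all
qed

lemma form_solution_eqI:
 assumes A: "coercive_on V \<alpha> A" and w: "w \<in> V" "\<And>v. v \<in> V ==> A w \<bullet> v = g \<bullet> v"
 shows "form_solution V A g = w"
 using form_solution_unique[OF A form_solution[OF A] w] .

lemma norm_form_solution_le:
 assumes A: "coercive_on V \<alpha> A"
 shows "norm (form_solution V A g) <= norm g / \<alpha>"
proof -
 let ?w = "form_solution V A g"
 have \<alpha>: "\<alpha> > 0" using A coercive_on_def by blast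
 have "\<alpha> * (norm ?w)^2 <= A ?w \<bullet> ?w" using A form_solution[OF A] coercive_on_def by blast
 also have "\<dots> = g \<bullet> ?w" using form_solution[OF A] by blast
 also have "\<dots> <= norm g * norm ?w" by (rule norm_cauchy_schwarz)
 finally have "(\<alpha> * norm ?w) * norm ?w <= norm g * norm ?w" by (simp add: power2_eq_square mult.assoc)
 then have "\<alpha> * norm ?w <= norm g"
  by (metis mult_right_le_imp_le norm_ge_zero norm_zero mult_zero_right order_le_less zero_less_norm_iff)
 then show ?thesis using \<alpha> by (simp add: field_simps)
qed

lemma bounded_linear_form_solution:
 assumes A: "coercive_on V \<alpha> A"
 shows "bounded_linear (form_solution V A)"
proof (rule bounded_linear_intro)
 fix g h and t :: real
 note V = subspace_add[OF V_subspace] subspace_scale[OF V_subspace]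
 show "form_solution V A (g + h) = form_solution V A g + form_solution V A h"
  by (intro form_solution_eqI[OF A] V form_solution(1)[OF A])
   (simp add: form_solution(2)[OF A] blinfun.add_right inner_add_left)
 show "form_solution V A (t *\<^sub>R g) = t *\<^sub>R form_solution V A g"
  by (intro form_solution_eqI[OF A] V form_solution(1)[OF A])
   (simp add: form_solution(2)[OF A] blinfun.scaleR_right)
 show "norm (form_solution V A g) <= norm g * (1 / \<alpha>)"
  using norm_form_solution_le[OF A] by simp
qed

text \<open>
  The resolvent identity.  It carries both the continuity and the differentiability of the solution in the operator.
\<close>

lemma form_solution_perturb:
 assumes A: "coercive_on V \<alpha> A" and B: "coercive_on V \<beta> B"
 shows "form_solution V B h - form_solution V A g
   = form_solution V A ((h - g) - (B - A) (form_solution V B h))"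
proof -
 let ?w = "form_solution V A g" and ?z = "form_solution V B h"
 have "form_solution V A ((h - g) - (B - A) ?z) = ?z - ?w"
 proof (rule form_solution_eqI[OF A])
  show "?z - ?w \<in> V" using form_solution(1)[OF A] form_solution(1)[OF B] V_subspace subspace_diff by blast
  show "A (?z - ?w) \<bullet> v = (h - g - (B - A) ?z) \<bullet> v" if "v \<in> V" for v
   using form_solution(2)[OF A that] form_solution(2)[OF B that]
   by (simp add: blinfun.diff_right blinfun.diff_left inner_diff_left)
 qed
 then show ?thesis by simp
qed

lemma tendsto_form_solution:
 assumes A: "coercive_on V \<alpha> A" and ev: "\<forall>\<^sub>F s in F. coercive_on V \<beta> (B s)"
  and lim: "(B \<longlongrightarrow> A) F" "(h \<longlongrightarrow> g) F" and \<beta>: "\<beta> > 0"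
 shows "((%s. form_solution V (B s) (h s)) \<longlongrightarrow> form_solution V A g) F"
proof -
 let ?w = "form_solution V A g"
 have "((%s. norm (h s - g - (B s - A) ?w) / \<beta>) \<longlongrightarrow> norm (g - g - (A - A) ?w) / \<beta>) F"
  using \<beta> by (intro tendsto_intros lim) auto
 then have l: "((%s. norm (h s - g - (B s - A) ?w) / \<beta>) \<longlongrightarrow> 0) F" by (simp add: blinfun.zero_left)
 have "\<forall>\<^sub>F s in F. norm (form_solution V (B s) (h s) - ?w) <= norm (h s - g - (B s - A) ?w) / \<beta>"
  using ev
 proof eventually_elim
  case (elim s)
  have "norm (?w - form_solution V (B s) (h s)) <= norm ((g - h s) - (A - B s) ?w) / \<beta>"
   unfolding form_solution_perturb[OF elim A] by (rule norm_form_solution_le[OF elim])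
  also have "(g - h s) - (A - B s) ?w = - (h s - g - (B s - A) ?w)"
   by (simp add: blinfun.diff_left)
  finally show ?case by (simp only: norm_minus_cancel norm_minus_commute)
 qed
 then have "((%s. form_solution V (B s) (h s) - ?w) \<longlongrightarrow> 0) F"
  using l by (rule Lim_null_comparison)
 then show ?thesis by (simp add: LIM_zero_iff)
qed

lemma has_vector_derivative_form_solution:
 assumes co: "\<And>s. dist s t < 1 ==> coercive_on V \<alpha> (A s)"
  and A: "(A has_vector_derivative A') (at t)" and g: "(g has_vector_derivative g') (at t)"
 shows "((%s. form_solution V (A s) (g s)) has_vector_derivative
     form_solution V (A t) (g' - A' (form_solution V (A t) (g t)))) (at t)"
proof -
 let ?w = "%s. form_solution V (A s) (g s)"
 have co_t: "coercive_on V \<alpha> (A t)" using co by simp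
 have ev: "\<forall>\<^sub>F s in at t. coercive_on V \<alpha> (A s)"
  unfolding eventually_at using co by (intro exI[of _ 1]) auto
 have cA: "(A \<longlongrightarrow> A t) (at t)" and cg: "(g \<longlongrightarrow> g t) (at t)"
  using A g has_vector_derivative_continuous continuous_within by blast+
 have cw: "(?w \<longlongrightarrow> ?w t) (at t)" by (rule tendsto_form_solution[OF co_t ev cA cg])
   (use co_t coercive_on_def in blast)
 interpret S: bounded_linear "form_solution V (A t)" by (rule bounded_linear_form_solution[OF co_t])
 have qA: "((%s. (1/(s-t)) *\<^sub>R (A s - A t)) \<longlongrightarrow> A') (at t)"
 and qg: "((%s. (1/(s-t)) *\<^sub>R (g s - g t)) \<longlongrightarrow> g') (at t)"
  using A g unfolding has_vector_derivative_iff_quotient by auto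
 have "((%s. form_solution V (A t) ((1/(s-t)) *\<^sub>R (g s - g t) - ((1/(s-t)) *\<^sub>R (A s - A t)) (?w s)))
   \<longlongrightarrow> form_solution V (A t) (g' - A' (?w t))) (at t)"
  by (intro S.tendsto tendsto_diff qg blinfun.tendsto qA cw)
 moreover have "\<forall>\<^sub>F s in at t. form_solution V (A t) ((1/(s-t)) *\<^sub>R (g s - g t) - ((1/(s-t)) *\<^sub>R (A s - A t)) (?w s))
   = (1/(s-t)) *\<^sub>R (?w s - ?w t)"
  using ev
  by eventually_elim (simp add: form_solution_perturb[OF co_t] S.scaleR[symmetric] blinfun.scaleR_left
    blinfun.diff_left scaleR_diff_right)
 ultimately show ?thesis
  unfolding has_vector_derivative_iff_quotient by (rule Lim_transform_eventually)
qed

end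

section \<open>Square integrable fields and multiplication operators\<close>

text \<open>
  Fields live on the whole space and not on a domain, so that the Hilbert space built from them is a type.
\<close>

definition square_int :: "('a::euclidean_space => 'b::euclidean_space) => bool" where
 "square_int f \<longleftrightarrow> f \<in> borel_measurable lebesgue \<and> integrable lebesgue (%x. (norm (f x))^2)"

lemma square_int_measurable: "square_int f ==> f \<in> borel_measurable lebesgue"
 by (simp add: square_int_def)

lemma integrable_inner_square_int:
 assumes "square_int f" "square_int g"
 shows "integrable lebesgue (%x. f x \<bullet> g x)"
proof (rule Bochner_Integration.integrable_bound)
 show "integrable lebesgue (%x. (norm (f x))^2 + (norm (g x))^2)"
  using assms by (auto simp: square_int_def)
 show "(%x. f x \<bullet> g x) \<in> borel_measurable lebesgue" using assms[THEN square_int_measurable] by measurable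
 have "norm (f x \<bullet> g x) <= norm ((norm (f x))^2 + (norm (g x))^2)" for x
 proof -
  have "\<bar>f x \<bullet> g x\<bar> <= norm (f x) * norm (g x)" by (rule Cauchy_Schwarz_ineq2)
  also have "\<dots> <= (norm (f x))^2 + (norm (g x))^2"
   using sum_squares_bound[of "norm (f x)" "norm (g x)"] mult_nonneg_nonneg[OF norm_ge_zero[of "f x"] norm_ge_zero[of "g x"]]
   by linarith
  finally show ?thesis by simp
 qed
 then show "AE x in lebesgue. norm (f x \<bullet> g x) <= norm ((norm (f x))^2 + (norm (g x))^2)" by simp
qed

lemma square_int_add:
 assumes "square_int f" "square_int g"
 shows "square_int (%x. f x + g x)"
proof -
 have eq: "(%x. (norm (f x + g x))^2) = (%x. (norm (f x))^2 + (norm (g x))^2 + 2 * (f x \<bullet> g x))"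
  by (simp add: power2_norm_eq_inner inner_add inner_commute[of "g _" "f _"] fun_eq_iff)
 have "integrable lebesgue (%x. (norm (f x))^2 + (norm (g x))^2 + 2 * (f x \<bullet> g x))"
  by (intro Bochner_Integration.integrable_add integrable_mult_right integrable_inner_square_int assms)
   (use assms square_int_def in blast)+
 moreover have "(%x. f x + g x) \<in> borel_measurable lebesgue"
  using assms[THEN square_int_measurable] by measurable
 ultimately show ?thesis by (simp add: square_int_def eq)
qed

lemma square_int_scaleR: "square_int f ==> square_int (%x. c *\<^sub>R f x)"
 unfolding square_int_def by (auto simp: power_mult_distrib)

lemma square_int_zero: "square_int (%x. 0)"
 unfolding square_int_def by auto

lemma square_int_uminus: "square_int f ==> square_int (%x. - f x)"
 unfolding square_int_def by auto

lemma square_int_diff: "square_int f ==> square_int g ==> square_int (%x. f x - g x)"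
 using square_int_add[of f "%x. - g x"] square_int_uminus[of g] by simp

lemma square_int_bounded_mult:
 fixes c :: "'a::euclidean_space => real"
 assumes "c \<in> borel_measurable lebesgue" "\<And>x. \<bar>c x\<bar> <= B" "square_int f"
 shows "square_int (%x. c x *\<^sub>R f x)"
 unfolding square_int_def
proof
 show m: "(%x. c x *\<^sub>R f x) \<in> borel_measurable lebesgue"
  by (intro borel_measurable_scaleR assms(1) square_int_measurable[OF assms(3)])
 show "integrable lebesgue (%x. (norm (c x *\<^sub>R f x))^2)"
 proof (rule Bochner_Integration.integrable_bound)
  show "integrable lebesgue (%x. B^2 * (norm (f x))^2)"
   by (rule integrable_mult_right) (use assms(3) in \<open>simp only: square_int_def\<close>)
  show "(%x. (norm (c x *\<^sub>R f x))^2) \<in> borel_measurable lebesgue"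
   by (rule borel_measurable_power[OF measurable_compose[OF m borel_measurable_norm]])
  have sq: "(c x)^2 <= B^2" for x
   using power_mono[OF assms(2)[of x] abs_ge_zero, of 2] unfolding power2_abs .
  have "norm ((norm (c x *\<^sub>R f x))^2) <= norm (B^2 * (norm (f x))^2)" for x
   using mult_right_mono[OF sq[of x] zero_le_power2[of "norm (f x)"]]
   by (simp only: real_norm_def norm_scaleR power_mult_distrib power2_abs abs_mult abs_power2)
  then show "AE x in lebesgue. norm ((norm (c x *\<^sub>R f x))^2) <= norm (B^2 * (norm (f x))^2)"
   by (intro AE_I2)
 qed
qed

definition l2_eq :: "('a::euclidean_space => 'b::euclidean_space) => ('a => 'b) => bool" where
 "l2_eq f g \<longleftrightarrow> square_int f \<and> square_int g \<and> (AE x in lebesgue. f x = g x)"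

lemma l2_eq_refl: "l2_eq f f \<longleftrightarrow> square_int f" by (simp add: l2_eq_def)

lemma l2_eq_add:
 assumes "l2_eq f f'" "l2_eq g g'"
 shows "l2_eq (%x. f x + g x) (%x. f' x + g' x)"
proof -
 have "AE x in lebesgue. f x = f' x" "AE x in lebesgue. g x = g' x" using assms by (simp_all add: l2_eq_def)
 then have "AE x in lebesgue. f x + g x = f' x + g' x" by eventually_elim simp
 then show ?thesis using assms by (simp add: l2_eq_def square_int_add)
qed

lemma l2_eq_diff:
 assumes "l2_eq f f'" "l2_eq g g'"
 shows "l2_eq (%x. f x - g x) (%x. f' x - g' x)"
proof -
 have "AE x in lebesgue. f x = f' x" "AE x in lebesgue. g x = g' x" using assms by (simp_all add: l2_eq_def)
 then have "AE x in lebesgue. f x - g x = f' x - g' x" by eventually_elim simp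
 then show ?thesis using assms by (simp add: l2_eq_def square_int_diff)
qed

lemma l2_eq_scaleR:
 assumes "l2_eq f f'"
 shows "l2_eq (%x. c *\<^sub>R f x) (%x. c *\<^sub>R f' x)"
proof -
 have "AE x in lebesgue. f x = f' x" using assms by (simp add: l2_eq_def)
 then have "AE x in lebesgue. c *\<^sub>R f x = c *\<^sub>R f' x" by eventually_elim simp
 then show ?thesis using assms by (simp add: l2_eq_def square_int_scaleR)
qed

text \<open>
  The relation is a partial equivalence: only square integrable fields represent a class.
\<close>

quotient_type (overloaded) ('a, 'b) l2 = "'a::euclidean_space => 'b::euclidean_space" / partial: l2_eq
proof (rule part_equivpI)
 show "\<exists>f::'a => 'b. l2_eq f f" using square_int_zero l2_eq_refl by blast
 show "symp l2_eq" by (auto simp: symp_def l2_eq_def)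
 show "transp l2_eq" unfolding transp_def l2_eq_def by auto
qed

instantiation l2 :: (euclidean_space, euclidean_space) real_inner
begin

lift_definition zero_l2 :: "('a, 'b) l2" is "%x. 0" by (simp add: l2_eq_def square_int_zero)
lift_definition plus_l2 :: "('a, 'b) l2 => ('a, 'b) l2 => ('a, 'b) l2" is "%f g x. f x + g x"
 by (rule l2_eq_add)
lift_definition uminus_l2 :: "('a, 'b) l2 => ('a, 'b) l2" is "%f x. - f x"
 unfolding l2_eq_def by (simp add: square_int_uminus)
lift_definition minus_l2 :: "('a, 'b) l2 => ('a, 'b) l2 => ('a, 'b) l2" is "%f g x. f x - g x"
 by (rule l2_eq_diff)
lift_definition scaleR_l2 :: "real => ('a, 'b) l2 => ('a, 'b) l2" is "%c f x. c *\<^sub>R f x"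
 by (rule l2_eq_scaleR)
lift_definition inner_l2 :: "('a, 'b) l2 => ('a, 'b) l2 => real" is "%f g. \<integral>x. f x \<bullet> g x \<partial>lebesgue"
 unfolding l2_eq_def
proof (elim conjE)
 fix f g f' g' :: "'a => 'b"
 assume s: "square_int f" "square_int g" "square_int f'" "square_int g'"
  and eq: "AE x in lebesgue. f x = f' x" "AE x in lebesgue. g x = g' x"
 show "(\<integral>x. f x \<bullet> g x \<partial>lebesgue) = (\<integral>x. f' x \<bullet> g' x \<partial>lebesgue)"
 proof (rule integral_cong_AE)
  show "(%x. f x \<bullet> g x) \<in> borel_measurable lebesgue" "(%x. f' x \<bullet> g' x) \<in> borel_measurable lebesgue"
   using s[THEN square_int_measurable] by measurable
  show "AE x in lebesgue. f x \<bullet> g x = f' x \<bullet> g' x" using eq by eventually_elim simp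
 qed
qed

definition norm_l2 :: "('a, 'b) l2 => real" where "norm_l2 f = sqrt (f \<bullet> f)"
definition dist_l2 :: "('a, 'b) l2 => ('a, 'b) l2 => real" where "dist_l2 f g = norm (f - g)"
definition sgn_l2 :: "('a, 'b) l2 => ('a, 'b) l2" where "sgn_l2 f = inverse (norm f) *\<^sub>R f"
definition uniformity_l2 :: "(('a, 'b) l2 \<times> ('a, 'b) l2) filter" where
 "uniformity_l2 = (INF e\<in>{0<..}. principal {(f, g). dist f g < e})"
definition open_l2 :: "('a, 'b) l2 set => bool" where
 "open_l2 U \<longleftrightarrow> (\<forall>f\<in>U. \<forall>\<^sub>F (f', g) in uniformity. f' = f \<longrightarrow> g \<in> U)"

instance
proof
 fix f g h :: "('a, 'b) l2" and a b :: real and U :: "('a, 'b) l2 set"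
 show "dist f g = norm (f - g)" by (rule dist_l2_def)
 show "f + g + h = f + (g + h)" by transfer (auto simp: l2_eq_def add.assoc intro!: square_int_add)
 show "f + g = g + f" by transfer (auto simp: l2_eq_def add.commute intro!: square_int_add)
 show "0 + f = f" by transfer (auto simp: l2_eq_def)
 show "- f + f = 0" by transfer (auto simp: l2_eq_def square_int_zero)
 show "f - g = f + - g" by transfer (auto simp: l2_eq_def intro!: square_int_diff)
 show "a *\<^sub>R (f + g) = a *\<^sub>R f + a *\<^sub>R g"
  by transfer (auto simp: l2_eq_def scaleR_add_right intro!: square_int_add square_int_scaleR)
 show "(a + b) *\<^sub>R f = a *\<^sub>R f + b *\<^sub>R f"
  by transfer (auto simp: l2_eq_def scaleR_add_left intro!: square_int_add square_int_scaleR)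
 show "a *\<^sub>R b *\<^sub>R f = (a * b) *\<^sub>R f" by transfer (auto simp: l2_eq_def intro!: square_int_scaleR)
 show "1 *\<^sub>R f = f" by transfer (auto simp: l2_eq_def)
 show "sgn f = inverse (norm f) *\<^sub>R f" by (rule sgn_l2_def)
 show "(uniformity :: (('a, 'b) l2 \<times> ('a, 'b) l2) filter) = (INF e\<in>{0<..}. principal {(f, g). dist f g < e})"
  by (rule uniformity_l2_def)
 show "open U \<longleftrightarrow> (\<forall>f\<in>U. \<forall>\<^sub>F (f', g) in uniformity. f' = f \<longrightarrow> g \<in> U)" by (rule open_l2_def)
 show "f \<bullet> g = g \<bullet> f" by transfer (simp add: inner_commute)
 show "(f + g) \<bullet> h = f \<bullet> h + g \<bullet> h"
  by transfer (simp add: l2_eq_def inner_add_left integrable_inner_square_int)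
 show "(a *\<^sub>R f) \<bullet> g = a * (f \<bullet> g)" by transfer simp
 show "0 <= f \<bullet> f" by transfer simp
 show "f \<bullet> f = 0 \<longleftrightarrow> f = 0"
 proof transfer
  fix f :: "'a => 'b" assume "l2_eq f f"
  then have f: "square_int f" by (simp add: l2_eq_def)
  have "(\<integral>x. f x \<bullet> f x \<partial>lebesgue) = 0 \<longleftrightarrow> (AE x in lebesgue. f x \<bullet> f x = 0)"
   by (rule integral_nonneg_eq_0_iff_AE) (auto intro: integrable_inner_square_int f)
  then show "(\<integral>x. f x \<bullet> f x \<partial>lebesgue) = 0 \<longleftrightarrow> l2_eq f (%x. 0)"
   by (simp add: l2_eq_def f square_int_zero)
 qed
 show "norm f = sqrt (f \<bullet> f)" by (rule norm_l2_def)
qed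

end

lift_definition l2_class :: "('a::euclidean_space => 'b::euclidean_space) => ('a, 'b) l2" is
 "%f. if square_int f then f else (%x. 0)"
 by (simp add: l2_eq_def square_int_zero)

definition l2_fun :: "('a::euclidean_space, 'b::euclidean_space) l2 => 'a => 'b" where
 "l2_fun p = (SOME f. square_int f \<and> l2_class f = p)"

lemma l2_class_surj: "\<exists>f. square_int f \<and> l2_class f = p"
proof transfer
 fix p :: "'a => 'b" assume p: "l2_eq p p"
 then have "square_int p" by (simp add: l2_eq_def)
 with p have "square_int p \<and> l2_eq (if square_int p then p else (%x. 0)) p" by simp
 then show "\<exists>f. square_int f \<and> l2_eq (if square_int f then f else (%x. 0)) p" by blast
qed

lemma square_int_l2_fun: "square_int (l2_fun p)" and l2_class_l2_fun [simp]: "l2_class (l2_fun p) = p"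
 using someI_ex[OF l2_class_surj[of p]] unfolding l2_fun_def by auto

lemma l2_fun_measurable [measurable]: "l2_fun p \<in> borel_measurable lebesgue"
 using square_int_l2_fun square_int_def by blast

lemma l2_class_eq_iff:
 "square_int f ==> square_int g ==> l2_class f = l2_class g \<longleftrightarrow> (AE x in lebesgue. f x = g x)"
 by transfer (simp add: l2_eq_def)

lemma l2_fun_l2_class: "square_int f ==> AE x in lebesgue. l2_fun (l2_class f) x = f x"
 using l2_class_eq_iff[OF square_int_l2_fun, of f "l2_class f"] by simp

lemma l2_class_add: "square_int f ==> square_int g ==> l2_class (%x. f x + g x) = l2_class f + l2_class g"
 by transfer (simp add: l2_eq_def square_int_add)

lemma l2_class_diff: "square_int f ==> square_int g ==> l2_class (%x. f x - g x) = l2_class f - l2_class g"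
 by transfer (simp add: l2_eq_def square_int_diff)

lemma l2_class_scaleR: "square_int f ==> l2_class (%x. c *\<^sub>R f x) = c *\<^sub>R l2_class f"
 by transfer (simp add: l2_eq_def square_int_scaleR)

lemma inner_l2_class:
 "square_int f ==> square_int g ==> l2_class f \<bullet> l2_class g = (\<integral>x. f x \<bullet> g x \<partial>lebesgue)"
 by transfer simp

lemma norm_l2_class: "square_int f ==> (norm (l2_class f))^2 = (\<integral>x. (norm (f x))^2 \<partial>lebesgue)"
 by (simp add: power2_norm_eq_inner inner_l2_class)

lemma nn_integral_norm_l2_class:
 "square_int f ==> (\<integral>\<^sup>+x. ennreal ((norm (f x))^2) \<partial>lebesgue) = ennreal ((norm (l2_class f))^2)"
 by (simp add: norm_l2_class nn_integral_eq_integral square_int_def)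

lemma square_intI_nn:
 assumes "f \<in> borel_measurable lebesgue" "(\<integral>\<^sup>+x. ennreal ((norm (f x))^2) \<partial>lebesgue) < \<infinity>"
 shows "square_int f"
 unfolding square_int_def using assms by (auto intro!: integrableI_nonneg)

text \<open>
  A subsequence with geometric steps, to which the completeness argument for rapidly converging sequences applies.
\<close>

lemma Cauchy_rapid_subseq:
 fixes s :: "nat => 'a::metric_space"
 assumes "Cauchy s"
 obtains r where "strict_mono r" "\<And>k m. m \<ge> r k ==> dist (s (r k)) (s m) <= (1/2) ^ k"
proof -
 have "\<exists>N. \<forall>m\<ge>N. \<forall>n\<ge>N. dist (s m) (s n) < (1/2)^k" for k :: nat
  using metric_CauchyD[OF assms] by simp
 then obtain N where N: "\<And>k m n. m \<ge> N k ==> n \<ge> N k ==> dist (s m) (s n) < (1/2)^k" by metis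
 define r where "r k = (\<Sum>i\<le>k. N i) + k" for k :: nat
 have "strict_mono r" unfolding r_def by (rule strict_monoI_Suc) simp
 moreover have "N k <= r k" for k unfolding r_def by (simp add: member_le_sum trans_le_add1)
 ultimately show thesis using that[of r] N by (meson less_imp_le order_trans)
qed

text \<open>
  The squared increments have a finite integral even after multiplication with \<open>2 ^ k\<close>, so almost everywhere they decay
  geometrically and the sequence converges; Fatou's lemma bounds the distance to the limit.  The measure is arbitrary because the
  lemma serves both the completeness of \<open>l2\<close> and the completeness of the Hermite polynomials.
\<close>

lemma rapid_L2_limit:
 fixes g :: "nat => 'm => 'b::euclidean_space"
 assumes [measurable]: "\<And>k. g k \<in> borel_measurable M"
  and dnorm: "\<And>k l. k <= l ==> (\<integral>\<^sup>+x. ennreal ((norm (g l x - g k x))^2) \<partial>M) <= ennreal ((1/4)^k)"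
 obtains G where "G \<in> borel_measurable M"
  "\<And>k. (\<integral>\<^sup>+x. ennreal ((norm (G x - g k x))^2) \<partial>M) <= ennreal ((1/4)^k)"
proof -
 have "(\<integral>\<^sup>+x. (\<Sum>k. ennreal (2^k * (norm (g (Suc k) x - g k x))^2)) \<partial>M)
   = (\<Sum>k. ennreal (2^k) * (\<integral>\<^sup>+x. ennreal ((norm (g (Suc k) x - g k x))^2) \<partial>M))"
  by (subst nn_integral_suminf) (auto simp: ennreal_mult nn_integral_cmult)
 also have "\<dots> <= (\<Sum>k. ennreal (2^k) * ennreal ((1/4)^k))"
  by (intro suminf_le mult_left_mono dnorm) auto
 also have "\<dots> = (\<Sum>k. ennreal ((1/2)^k))"
  by (simp add: ennreal_mult[symmetric] power_mult_distrib[symmetric])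
 also have "\<dots> < \<infinity>" by (subst suminf_ennreal_eq[OF _ geometric_sums]) auto
 finally have "AE x in M. (\<Sum>k. ennreal (2^k * (norm (g (Suc k) x - g k x))^2)) ~= \<infinity>"
  by (intro nn_integral_PInf_AE) auto
 then have conv: "AE x in M. convergent (%k. g k x)"
 proof eventually_elim
  case (elim x)
  define d where "d k = norm (g (Suc k) x - g k x)" for k
  have sm: "summable (%k. 2^k * (d k)^2)"
   using elim unfolding d_def by (intro summable_suminf_not_top) auto
  have "summable (%k. g (Suc k) x - g k x)"
  proof (rule summable_comparison_test)
   show "summable (%k. (1/2)^k + 2^k * (d k)^2)" using sm by (intro summable_add) auto
   have "d k <= (1/2)^k + 2^k * (d k)^2" for k
   proof (cases "d k <= (1/2)^k")
    case False
    then have "1 <= 2^k * d k" by (simp add: field_simps power_one_over)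
    then have "d k * 1 <= d k * (2^k * d k)" by (intro mult_left_mono) (auto simp: d_def)
    moreover have "d k * (2^k * d k) = 2^k * (d k)^2" by (simp add: power2_eq_square)
    moreover have "0 <= (1/2::real)^k" by simp
    ultimately show ?thesis by linarith
   qed (simp add: add_increasing2)
   then show "\<exists>N. \<forall>k\<ge>N. norm (g (Suc k) x - g k x) <= (1/2)^k + 2^k * (d k)^2"
    unfolding d_def by blast
  qed
  then have "convergent (%n. \<Sum>k<n. g (Suc k) x - g k x)" by (simp add: summable_iff_convergent)
  then have "convergent (%n. g n x - g 0 x)"
   unfolding sum_lessThan_telescope[of "%k. g k x"] .
  then have "convergent (%n. (g n x - g 0 x) + g 0 x)" by (intro convergent_add convergent_const)
  then show ?case by simp
 qed
 define G where "G x = lim (%k. g k x)" for x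
 have [measurable]: "G \<in> borel_measurable M" unfolding G_def by measurable
 have lim: "AE x in M. (%k. g k x) \<longlonglongrightarrow> G x"
  using conv by eventually_elim (simp add: G_def convergent_LIMSEQ_iff)
 have Gd: "(\<integral>\<^sup>+x. ennreal ((norm (G x - g k x))^2) \<partial>M) <= ennreal ((1/4)^k)" for k
 proof -
  have "(\<integral>\<^sup>+x. ennreal ((norm (G x - g k x))^2) \<partial>M)
    = (\<integral>\<^sup>+x. liminf (%l. ennreal ((norm (g l x - g k x))^2)) \<partial>M)"
  proof (rule nn_integral_cong_AE)
   show "AE x in M. ennreal ((norm (G x - g k x))^2) = liminf (%l. ennreal ((norm (g l x - g k x))^2))"
    using lim
   proof eventually_elim
    case (elim x)
    have "(%l. ennreal ((norm (g l x - g k x))^2)) \<longlonglongrightarrow> ennreal ((norm (G x - g k x))^2)"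
     by (intro tendsto_intros elim)
    from lim_imp_Liminf[OF sequentially_bot this] show ?case by (rule sym)
   qed
  qed
  also have "\<dots> <= liminf (%l. \<integral>\<^sup>+x. ennreal ((norm (g l x - g k x))^2) \<partial>M)"
   by (rule nn_integral_liminf) auto
  also have "\<dots> <= ennreal ((1/4)^k)"
   by (rule Liminf_le[OF sequentially_bot eventually_mono[OF eventually_ge_at_top[of k] dnorm]])
  finally show ?thesis .
 qed
 show thesis by (rule that[OF \<open>G \<in> borel_measurable M\<close> Gd])
qed

instance l2 :: (euclidean_space, euclidean_space) complete_space
proof
 fix s :: "nat => ('a, 'b) l2" assume C: "Cauchy s"
 obtain r where r: "strict_mono r" "\<And>k m. m \<ge> r k ==> dist (s (r k)) (s m) <= (1/2) ^ k"
  using Cauchy_rapid_subseq[OF C] by blast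
 define g where "g k = l2_fun (s (r k))" for k
 have [measurable]: "g k \<in> borel_measurable lebesgue" for k unfolding g_def by simp
 have gs: "square_int (g k)" for k unfolding g_def by (rule square_int_l2_fun)
 have gc: "l2_class (g k) = s (r k)" for k unfolding g_def by simp
 have dnorm: "(\<integral>\<^sup>+x. ennreal ((norm (g l x - g k x))^2) \<partial>lebesgue) <= ennreal ((1/4)^k)" if "k <= l" for k l
 proof -
  have "(\<integral>\<^sup>+x. ennreal ((norm (g l x - g k x))^2) \<partial>lebesgue) = ennreal ((norm (s (r l) - s (r k)))^2)"
   using nn_integral_norm_l2_class[OF square_int_diff[OF gs gs]] by (simp add: l2_class_diff gs gc)
  also have "norm (s (r l) - s (r k)) <= (1/2)^k"
   using r(2)[of k "r l"] r(1) that by (simp add: dist_norm norm_minus_commute strict_mono_less_eq)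
  then have "(norm (s (r l) - s (r k)))^2 <= ((1/2)^k)^2" by (intro power_mono) auto
  also have "((1/2)^k)^2 = (1/4::real)^k" by (simp add: power2_eq_square flip: power_mult_distrib)
  finally show ?thesis by (simp add: ennreal_leI)
 qed
 obtain G where [measurable]: "G \<in> borel_measurable lebesgue"
  and Gd: "\<And>k. (\<integral>\<^sup>+x. ennreal ((norm (G x - g k x))^2) \<partial>lebesgue) <= ennreal ((1/4)^k)"
  using rapid_L2_limit[of g lebesgue, OF _ dnorm] by (metis \<open>\<And>k. g k \<in> borel_measurable lebesgue\<close>)
 have Gk: "square_int (%x. G x - g k x)" for k
 proof (rule square_intI_nn)
  show "(\<integral>\<^sup>+x. ennreal ((norm (G x - g k x))^2) \<partial>lebesgue) < \<infinity>"
   by (rule le_less_trans[OF Gd]) simp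
 qed measurable
 have G: "square_int G" using square_int_add[OF Gk[of 0] gs[of 0]] by simp
 have "norm (s (r k) - l2_class G) <= (1/2)^k" for k
 proof -
  have "ennreal ((norm (l2_class G - s (r k)))^2) <= ennreal ((1/4)^k)"
   using Gd[of k] nn_integral_norm_l2_class[OF Gk[of k]] by (simp add: l2_class_diff G gs gc)
  then have "(norm (l2_class G - s (r k)))^2 <= ((1/2)^k)^2"
   by (simp add: power2_eq_square flip: power_mult_distrib)
  then have "norm (l2_class G - s (r k)) <= (1/2)^k" by (rule power2_le_imp_le) simp
  then show ?thesis by (simp only: norm_minus_commute)
 qed
 then have "(%k. s (r k) - l2_class G) \<longlonglongrightarrow> 0"
  by (intro Lim_null_comparison[OF always_eventually LIMSEQ_realpow_zero[of "1/2"]]) auto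
 then have "(s \<circ> r) \<longlonglongrightarrow> l2_class G" by (simp add: LIM_zero_iff o_def)
 then show "convergent s" using Cauchy_converges_subseq[OF C r(1)] convergent_def by blast
qed

text \<open>
  Boundedness is demanded everywhere and not just almost everywhere: the coefficients are modified on a null set beforehand.
\<close>

definition multiplier :: "('a::euclidean_space => real) => bool" where
 "multiplier c \<longleftrightarrow> c \<in> borel_measurable lebesgue \<and> (\<exists>B. \<forall>x. \<bar>c x\<bar> <= B)"

lift_definition mult_op :: "('a::euclidean_space => real) => ('a, 'b::euclidean_space) l2 \<Rightarrow>\<^sub>L ('a, 'b) l2" is
 "%c p. if multiplier c then l2_class (%x. c x *\<^sub>R l2_fun p x) else 0"
proof -
 fix c :: "'a => real"
 show "bounded_linear (%p::('a,'b) l2. if multiplier c then l2_class (%x. c x *\<^sub>R l2_fun p x) else 0)"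
 proof (cases "multiplier c")
  case True
  then obtain B where B: "\<And>x. \<bar>c x\<bar> <= B" and [measurable]: "c \<in> borel_measurable lebesgue"
   unfolding multiplier_def by blast
  note sq = square_int_bounded_mult[OF \<open>c \<in> _\<close> B square_int_l2_fun]
  have "bounded_linear (%p::('a,'b) l2. l2_class (%x. c x *\<^sub>R l2_fun p x))"
  proof (rule bounded_linear_intro)
   fix p q :: "('a, 'b) l2" and t :: real
   have "AE x in lebesgue. l2_fun (p + q) x = l2_fun p x + l2_fun q x"
    using l2_fun_l2_class[OF square_int_add[OF square_int_l2_fun[of p] square_int_l2_fun[of q]]]
    by (simp add: l2_class_add square_int_l2_fun)
   then have "AE x in lebesgue. c x *\<^sub>R l2_fun (p + q) x = c x *\<^sub>R l2_fun p x + c x *\<^sub>R l2_fun q x"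
    by eventually_elim (simp add: scaleR_add_right)
   then show "l2_class (%x. c x *\<^sub>R l2_fun (p + q) x)
     = l2_class (%x. c x *\<^sub>R l2_fun p x) + l2_class (%x. c x *\<^sub>R l2_fun q x)"
    unfolding l2_class_add[OF sq sq, symmetric] by (subst l2_class_eq_iff[OF sq square_int_add[OF sq sq]])
   have "AE x in lebesgue. l2_fun (t *\<^sub>R p) x = t *\<^sub>R l2_fun p x"
    using l2_fun_l2_class[OF square_int_scaleR[OF square_int_l2_fun[of p], of t]]
    by (simp add: l2_class_scaleR square_int_l2_fun)
   then have "AE x in lebesgue. c x *\<^sub>R l2_fun (t *\<^sub>R p) x = t *\<^sub>R (c x *\<^sub>R l2_fun p x)"
    by eventually_elim simp
   then show "l2_class (%x. c x *\<^sub>R l2_fun (t *\<^sub>R p) x) = t *\<^sub>R l2_class (%x. c x *\<^sub>R l2_fun p x)"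
    unfolding l2_class_scaleR[OF sq, symmetric] by (subst l2_class_eq_iff[OF sq square_int_scaleR[OF sq]])
   have "(norm (l2_class (%x. c x *\<^sub>R l2_fun p x)))^2 <= (\<integral>x. B^2 * (norm (l2_fun p x))^2 \<partial>lebesgue)"
    unfolding norm_l2_class[OF sq]
   proof (rule integral_mono)
    show "integrable lebesgue (%x. (norm (c x *\<^sub>R l2_fun p x))^2)"
     using sq[of p] unfolding square_int_def by (rule conjunct2)
    show "integrable lebesgue (%x. B^2 * (norm (l2_fun p x))^2)"
     by (rule integrable_mult_right) (use square_int_l2_fun[of p] in \<open>simp only: square_int_def\<close>)
    show "(norm (c x *\<^sub>R l2_fun p x))^2 <= B^2 * (norm (l2_fun p x))^2" for x
     using power_mono[OF B[of x] abs_ge_zero, of 2]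
     unfolding norm_scaleR power_mult_distrib power2_abs by (rule mult_right_mono[OF _ zero_le_power2])
   qed
   also have "\<dots> = B^2 * (norm p)^2" using norm_l2_class[OF square_int_l2_fun, of p] by simp
   finally have "(norm (l2_class (%x. c x *\<^sub>R l2_fun p x)))^2 <= (norm p * B)^2"
    by (simp only: power_mult_distrib mult.commute)
   moreover have "0 <= norm p * B" using order_trans[OF abs_ge_zero B] by simp
   ultimately show "norm (l2_class (%x. c x *\<^sub>R l2_fun p x)) <= norm p * B"
    by (rule power2_le_imp_le)
  qed
  then show ?thesis using True by simp
 qed simp
qed

lemma mult_op_apply:
 assumes "multiplier c"
 shows "mult_op c p = l2_class (%x. c x *\<^sub>R l2_fun p x)"
 using assms by transfer simp

lemma square_int_multiplier: "multiplier c ==> square_int f ==> square_int (%x. c x *\<^sub>R f x)"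
 unfolding multiplier_def using square_int_bounded_mult by blast

lemma l2_fun_mult_op:
 assumes "multiplier c" shows "AE x in lebesgue. l2_fun (mult_op c p) x = c x *\<^sub>R l2_fun p x"
 unfolding mult_op_apply[OF assms]
 by (rule l2_fun_l2_class[OF square_int_multiplier[OF assms square_int_l2_fun]])

lemma mult_op_inner:
 assumes "multiplier c"
 shows "mult_op c p \<bullet> q = (\<integral>x. c x * (l2_fun p x \<bullet> l2_fun q x) \<partial>lebesgue)"
 using inner_l2_class[OF square_int_multiplier[OF assms square_int_l2_fun] square_int_l2_fun, of p q]
 by (simp add: mult_op_apply[OF assms])

lemma integrable_mult_inner:
 assumes "multiplier c"
 shows "integrable lebesgue (%x. c x * (l2_fun p x \<bullet> l2_fun q x))"
 using integrable_inner_square_int[OF square_int_multiplier[OF assms square_int_l2_fun] square_int_l2_fun, of p q]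
 by simp

lemma mult_op_sym:
 fixes p q :: "('a::euclidean_space, 'b::euclidean_space) l2"
 shows "mult_op c p \<bullet> q = mult_op c q \<bullet> p"
proof (cases "multiplier c")
 case True
 then show ?thesis
  unfolding mult_op_inner[OF True] by (simp add: inner_commute[of "l2_fun p _" "l2_fun q _"])
next
 case False
 then have "mult_op c = (0 :: ('a, 'b) l2 \<Rightarrow>\<^sub>L _)" by transfer simp
 then show ?thesis by simp
qed

lemma norm_mult_op_le:
 assumes c: "multiplier c" and B: "\<And>x. \<bar>c x\<bar> <= B"
 shows "norm (mult_op c :: ('a::euclidean_space, 'b::euclidean_space) l2 \<Rightarrow>\<^sub>L _) <= B"
proof (rule norm_blinfun_bound)
 show B0: "0 <= B" by (rule order_trans[OF abs_ge_zero B])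
 fix p :: "('a, 'b) l2"
 have "(norm (mult_op c p))^2 = (\<integral>x. (norm (c x *\<^sub>R l2_fun p x))^2 \<partial>lebesgue)"
  unfolding mult_op_apply[OF c] by (rule norm_l2_class[OF square_int_multiplier[OF c square_int_l2_fun]])
 also have "\<dots> <= (\<integral>x. B^2 * (norm (l2_fun p x))^2 \<partial>lebesgue)"
 proof (rule integral_mono)
  show "integrable lebesgue (%x. (norm (c x *\<^sub>R l2_fun p x))^2)"
   using square_int_multiplier[OF c square_int_l2_fun[of p]] unfolding square_int_def by (rule conjunct2)
  show "integrable lebesgue (%x. B^2 * (norm (l2_fun p x))^2)"
   by (rule integrable_mult_right) (use square_int_l2_fun[of p] in \<open>simp only: square_int_def\<close>)
  show "(norm (c x *\<^sub>R l2_fun p x))^2 <= B^2 * (norm (l2_fun p x))^2" for x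
   using power_mono[OF B[of x] abs_ge_zero, of 2]
     unfolding norm_scaleR power_mult_distrib power2_abs by (rule mult_right_mono[OF _ zero_le_power2])
 qed
 also have "\<dots> = (B * norm p)^2" using norm_l2_class[OF square_int_l2_fun, of p] by (simp add: power_mult_distrib)
 finally show "norm (mult_op c p) <= B * norm p" by (rule power2_le_imp_le) (simp add: B0)
qed

lemma multiplierI:
 "c \<in> borel_measurable lebesgue ==> (\<And>x. \<bar>c x\<bar> <= B) ==> multiplier c"
 unfolding multiplier_def by blast

lemma multiplier_measurable: "multiplier c ==> c \<in> borel_measurable lebesgue"
 unfolding multiplier_def by blast

lemma multiplier_lin:
 assumes "multiplier c" "multiplier d"
 shows "multiplier (%x. s * c x + t * d x)"
proof -
 obtain B C where B: "\<And>x. \<bar>c x\<bar> <= B" and C: "\<And>x. \<bar>d x\<bar> <= C"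
  using assms unfolding multiplier_def by blast
 show ?thesis
 proof (rule multiplierI)
  show "(%x. s * c x + t * d x) \<in> borel_measurable lebesgue" 
   by (intro borel_measurable_add borel_measurable_times borel_measurable_const assms[THEN multiplier_measurable])
  show "\<bar>s * c x + t * d x\<bar> <= \<bar>s\<bar> * B + \<bar>t\<bar> * C" for x
   by (rule order_trans[OF abs_triangle_ineq])
    (simp only: abs_mult add_mono mult_left_mono B C abs_ge_zero)
 qed
qed

lemma mult_op_lin:
 assumes c: "multiplier c" "multiplier d"
 shows "mult_op (%x. s * c x + t * d x) = s *\<^sub>R mult_op c + t *\<^sub>R mult_op d"
proof (rule blinfun_eqI)
 fix p :: "('a, 'b) l2"
 note sq = square_int_multiplier[OF c(1) square_int_l2_fun[of p]] square_int_multiplier[OF c(2) square_int_l2_fun[of p]]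
 have "mult_op (%x. s * c x + t * d x) p = l2_class (%x. s *\<^sub>R (c x *\<^sub>R l2_fun p x) + t *\<^sub>R (d x *\<^sub>R l2_fun p x))"
  by (simp add: mult_op_apply[OF multiplier_lin[OF c]] scaleR_add_left)
 also have "\<dots> = l2_class (%x. s *\<^sub>R (c x *\<^sub>R l2_fun p x)) + l2_class (%x. t *\<^sub>R (d x *\<^sub>R l2_fun p x))"
  by (rule l2_class_add[OF square_int_scaleR[OF sq(1)] square_int_scaleR[OF sq(2)]])
 also have "\<dots> = s *\<^sub>R mult_op c p + t *\<^sub>R mult_op d p"
  by (simp only: mult_op_apply[OF c(1)] mult_op_apply[OF c(2)] l2_class_scaleR[OF sq(1)] l2_class_scaleR[OF sq(2)])
 finally show "mult_op (%x. s * c x + t * d x) p = (s *\<^sub>R mult_op c + t *\<^sub>R mult_op d) p"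
  by (simp add: blinfun.add_left blinfun.scaleR_left)
qed

section \<open>Multi-indices and summability of the weights\<close>

lemma finite_below_multi_index:
 fixes N :: "nat => nat"
 assumes "finite J" "\<And>j. j \<notin> J ==> N j = 0"
 shows "finite {..N}"
proof -
 have "{..N} \<subseteq> {\<mu>. \<forall>j. (j \<in> J \<longrightarrow> \<mu> j \<in> {..Max (insert 0 (N ` J))}) \<and> (j \<notin> J \<longrightarrow> \<mu> j = 0)}"
 proof
  fix \<mu> assume "\<mu> \<in> {..N}"
  then have le: "\<mu> j <= N j" for j by (simp add: le_fun_def)
  have "\<mu> j <= Max (insert 0 (N ` J))" if "j \<in> J" for j
   by (rule order_trans[OF le Max_ge]) (use assms(1) that in auto)
  moreover have "\<mu> j = 0" if "j \<notin> J" for j using le[of j] assms(2)[OF that] by simp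
  ultimately show "\<mu> \<in> {\<mu>. \<forall>j. (j \<in> J \<longrightarrow> \<mu> j \<in> {..Max (insert 0 (N ` J))}) \<and> (j \<notin> J \<longrightarrow> \<mu> j = 0)}"
   by simp
 qed
 then show ?thesis using finite_subset finite_set_of_finite_funs[OF assms(1) finite_atMost] by blast
qed

text \<open>
  Distributivity in the form used throughout: a sum over a box of multi-indices of a product factorises.
\<close>

lemma sum_below_multi_index_prod:
 fixes f :: "nat => nat => 'a::comm_semiring_1"
 assumes "finite J" "\<And>j. j \<notin> J ==> N j = 0"
 shows "(\<Sum>\<mu>\<in>{..N}. \<Prod>j\<in>J. f j (\<mu> j)) = (\<Prod>j\<in>J. \<Sum>l\<le>N j. f j l)"
 using assms
proof (induction J arbitrary: N rule: finite_induct)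
 case empty
 then have "N = (%_. 0)" by auto
 then have "{..N} = {%_. 0}" by (auto simp: le_fun_def)
 then show ?case by simp
next
 case (insert i J)
 have N': "\<And>j. j \<notin> J ==> (N(i := 0)) j = 0" using insert.prems by auto
 have "(\<Sum>\<mu>\<in>{..N}. \<Prod>j\<in>insert i J. f j (\<mu> j)) = (\<Sum>(l, \<mu>)\<in>{..N i} \<times> {..N(i := 0)}. f i l * (\<Prod>j\<in>J. f j (\<mu> j)))"
 proof (rule sum.reindex_bij_witness[where j = "%\<mu>. (\<mu> i, \<mu>(i := 0))" and i = "%(l, \<mu>). \<mu>(i := l)"])
  fix \<mu> assume \<mu>: "\<mu> \<in> {..N}"
  then show "(case (\<mu> i, \<mu>(i := 0)) of (l, \<mu>) => \<mu>(i := l)) = \<mu>" by simp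
  show "(\<mu> i, \<mu>(i := 0)) \<in> {..N i} \<times> {..N(i := 0)}" using \<mu> by (auto simp: le_fun_def)
  have "(\<Prod>j\<in>J. f j ((\<mu>(i := 0)) j)) = (\<Prod>j\<in>J. f j (\<mu> j))"
   using insert.hyps by (intro prod.cong) auto
  then show "(case (\<mu> i, \<mu>(i := 0)) of (l, \<mu>) => f i l * (\<Prod>j\<in>J. f j (\<mu> j))) = (\<Prod>j\<in>insert i J. f j (\<mu> j))"
   using insert.hyps by simp
 next
  fix p assume p: "p \<in> {..N i} \<times> {..N(i := 0)}"
  obtain l \<mu> where lm: "p = (l, \<mu>)" by (cases p)
  have "\<mu> i <= (N(i := 0)) i" using p lm by (auto simp: le_fun_def simp del: fun_upd_apply)
  then have "\<mu> i = 0" by simp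
  moreover have "\<mu> j <= N j" if "j ~= i" for j
  proof -
   have "\<mu> j <= (N(i := 0)) j" using p lm by (auto simp: le_fun_def simp del: fun_upd_apply)
   then show ?thesis using that by simp
  qed
  ultimately show "((case p of (l, \<mu>) => \<mu>(i := l)) i, (case p of (l, \<mu>) => \<mu>(i := l))(i := 0)) = p"
   "(case p of (l, \<mu>) => \<mu>(i := l)) \<in> {..N}"
   using p lm by (auto simp: le_fun_def fun_eq_iff)
 qed
 also have "\<dots> = (\<Sum>l\<le>N i. f i l) * (\<Sum>\<mu>\<in>{..N(i := 0)}. \<Prod>j\<in>J. f j (\<mu> j))"
  by (simp add: sum_product sum.cartesian_product)
 also have "\<dots> = (\<Sum>l\<le>N i. f i l) * (\<Prod>j\<in>J. \<Sum>l\<le>(N(i := 0)) j. f j l)"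
  by (subst insert.IH[OF N']) auto
 also have "(\<Prod>j\<in>J. \<Sum>l\<le>(N(i := 0)) j. f j l) = (\<Prod>j\<in>J. \<Sum>l\<le>N j. f j l)"
  using insert.hyps by (intro prod.cong) auto
 finally show ?case using insert.hyps by simp
qed

lemma multi_indicesD: "\<nu> \<in> multi_indices ==> finite {j. \<nu> j ~= 0}"
 by (simp add: multi_indices_def)

lemma multi_indices_upd: "\<nu> \<in> multi_indices ==> \<nu>(j := k) \<in> multi_indices"
 unfolding multi_indices_def
 by (auto intro: finite_subset[of _ "insert j {i. \<nu> i ~= 0}"])

lemma multi_indices_le: "\<nu> \<in> multi_indices ==> \<mu> <= \<nu> ==> \<mu> \<in> multi_indices"
 unfolding multi_indices_def le_fun_def mem_Collect_eq
 by (erule finite_subset[rotated]) (metis (mono_tags, lifting) Collect_mono le_zero_eq)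

lemma finite_multi_indices_below: "\<nu> \<in> multi_indices ==> finite {..\<nu>}"
 by (rule finite_below_multi_index[OF multi_indicesD]) auto

text \<open>
  Finitely many multi-indices lie in a common finite box, in which all later sums can be carried out.
\<close>

lemma finite_multi_indices_bounded:
 assumes "finite F" "F \<subseteq> multi_indices"
 obtains J N where "finite J" "\<And>j. j \<notin> J ==> N j = 0" "F \<subseteq> {..N}" "N \<in> multi_indices"
  "\<And>\<nu> j. \<nu> \<in> F ==> \<nu> j ~= 0 ==> j \<in> J"
proof
 let ?J = "\<Union>\<nu>\<in>F. {j. \<nu> j ~= 0}" and ?N = "%j. \<Sum>\<nu>\<in>F. \<nu> j"
 show J: "finite ?J" using assms multi_indicesD by (intro finite_UN_I) auto
 show N0: "\<And>j. j \<notin> ?J ==> ?N j = 0" by (intro sum.neutral) auto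
 show "F \<subseteq> {..?N}"
 proof
  fix \<nu> assume "\<nu> \<in> F"
  then have "\<nu> j <= ?N j" for j using assms(1) by (intro member_le_sum[of \<nu> F "%\<nu>. \<nu> j"]) auto
  then show "\<nu> \<in> {..?N}" by (simp add: le_fun_def)
 qed
 have "{j. ?N j ~= 0} \<subseteq> ?J"
 proof (rule subsetI, rule ccontr)
  fix j assume "j \<in> {j. ?N j ~= 0}" "j \<notin> ?J"
  then show False using N0[of j] by simp
 qed
 then show "?N \<in> multi_indices" unfolding multi_indices_def mem_Collect_eq
  by (rule finite_subset[OF _ J])
 show "j \<in> ?J" if "\<nu> \<in> F" "\<nu> j ~= 0" for \<nu> j using that by blast
qed

text \<open>
  The square of the inverse of one factor of the weight.
\<close>

definition kappa_factor :: "nat => real => nat => real" where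
 "kappa_factor r \<beta> n = (\<Sum>l\<le>r. real (n choose l) * (inverse \<beta>) ^ (2 * l))"

lemma kappa_factor_0 [simp]: "kappa_factor r \<beta> 0 = 1"
proof -
 have "kappa_factor r \<beta> 0 = (\<Sum>l\<le>r. if l = 0 then 1 else 0)"
  unfolding kappa_factor_def by (intro sum.cong) (auto simp: binomial_eq_0)
 then show ?thesis by simp
qed

lemma kappa_factor_ge:
 assumes "l <= r" shows "real (n choose l) * (inverse \<beta>) ^ (2 * l) <= kappa_factor r \<beta> n"
 unfolding kappa_factor_def using assms
 by (intro member_le_sum[of l "{..r}" "%l. real (n choose l) * (inverse \<beta>) ^ (2 * l)"])
  (auto intro!: mult_nonneg_nonneg simp: power_mult)

lemma kappa_factor_ge_1: "1 <= kappa_factor r \<beta> n"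
 using kappa_factor_ge[of 0 r n \<beta>] by simp

lemma kappa_factor_mono: "m <= n ==> kappa_factor r \<beta> m <= kappa_factor r \<beta> n"
 unfolding kappa_factor_def
 by (intro sum_mono mult_right_mono) (auto simp: power_mult intro: binomial_right_mono)

text \<open>
  A multi-index vanishes outside a finite set, and a factor at a vanishing entry is 1, so the infinite product is finite.
\<close>

lemma kappa_eq:
 assumes "finite J" "\<And>j. j \<notin> J ==> \<nu> j = 0"
 shows "kappa r b \<nu> = (\<Prod>j\<in>J. kappa_factor r (b j) (\<nu> j) powr (- 1 / 2))"
proof -
 have f: "(\<Sum>l=0..r. real (\<nu> j choose l) * b j powi (- 2 * int l)) = kappa_factor r (b j) (\<nu> j)" for j
 proof -
  have "b j powi (- 2 * int l) = (inverse (b j)) ^ (2 * l)" for l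
   by (metis int_ops(7) mult_minus_left of_nat_numeral power_int_minus power_int_of_nat power_inverse)
  then show ?thesis by (simp add: kappa_factor_def atLeast0AtMost)
 qed
 show ?thesis unfolding kappa_def f
  by (rule prodinf_finite[OF assms(1)]) (use assms(2) in auto)
qed

lemma kappa_pos: assumes "\<nu> \<in> multi_indices" shows "0 < kappa r b \<nu>"
proof -
 have "0 < kappa_factor r (b j) (\<nu> j)" for j using kappa_factor_ge_1[of r "b j" "\<nu> j"] by linarith
 then show ?thesis
  by (subst kappa_eq[OF multi_indicesD[OF assms]]) (auto intro!: prod_pos simp: less_imp_neq[symmetric])
qed

lemma kappa_antimono:
 assumes \<nu>: "\<nu> \<in> multi_indices" and le: "\<mu> <= \<nu>"
 shows "kappa r b \<nu> <= kappa r b \<mu>"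
proof -
 have z: "\<mu> j = 0" if "j \<notin> {j. \<nu> j ~= 0}" for j using le that by (auto simp: le_fun_def dest: spec[of _ j])
 have "kappa_factor r (b j) (\<nu> j) powr (- 1 / 2) <= kappa_factor r (b j) (\<mu> j) powr (- 1 / 2)" for j
 proof (rule powr_mono2')
  show "0 < kappa_factor r (b j) (\<mu> j)" using kappa_factor_ge_1[of r "b j" "\<mu> j"] by linarith
  show "kappa_factor r (b j) (\<mu> j) <= kappa_factor r (b j) (\<nu> j)"
   using le by (intro kappa_factor_mono) (simp add: le_fun_def)
 qed simp
 then have "(\<Prod>j | \<nu> j ~= 0. kappa_factor r (b j) (\<nu> j) powr (- 1 / 2))
   <= (\<Prod>j | \<nu> j ~= 0. kappa_factor r (b j) (\<mu> j) powr (- 1 / 2))"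
  by (intro prod_mono) simp
 moreover have "kappa r b \<nu> = (\<Prod>j | \<nu> j ~= 0. kappa_factor r (b j) (\<nu> j) powr (- 1 / 2))"
  by (rule kappa_eq[OF multi_indicesD[OF \<nu>]]) simp
 moreover have "kappa r b \<mu> = (\<Prod>j | \<nu> j ~= 0. kappa_factor r (b j) (\<mu> j) powr (- 1 / 2))"
  by (rule kappa_eq[OF multi_indicesD[OF \<nu>] z])
 ultimately show ?thesis by simp
qed

text \<open>
  Multiplying out the product over the coordinates gives one term for each choice of an exponent at most \<open>r\<close>
  in each coordinate.
\<close>

lemma inverse_kappa_square:
 assumes J: "finite J" "\<And>j. j \<notin> J ==> \<nu> j = 0"
 shows "inverse ((kappa r b \<nu>)^2) =
  (\<Sum>\<mu>\<in>{..(%j. if j \<in> J then r else 0)}. \<Prod>j\<in>J. real (\<nu> j choose \<mu> j) * (inverse (b j)) ^ (2 * \<mu> j))"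
proof -
 have p: "inverse ((x powr (- 1 / 2))^2) = x" if "1 <= x" for x :: real
 proof -
  have "(x powr (- 1 / 2))^2 = x powr (- 1)" by (simp add: power2_eq_square flip: powr_add)
  then show ?thesis using that by (simp add: powr_minus)
 qed
 have "inverse ((kappa r b \<nu>)^2) = (\<Prod>j\<in>J. inverse ((kappa_factor r (b j) (\<nu> j) powr (- 1 / 2))^2))"
  by (simp add: kappa_eq[OF J] prod_power_distrib prod_inversef[symmetric] o_def)
 also have "\<dots> = (\<Prod>j\<in>J. kappa_factor r (b j) (\<nu> j))" by (simp only: p[OF kappa_factor_ge_1])
 also have "\<dots> = (\<Prod>j\<in>J. \<Sum>l\<le>(if j \<in> J then r else 0). real (\<nu> j choose l) * (inverse (b j)) ^ (2 * l))"
  by (intro prod.cong) (auto simp: kappa_factor_def)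
 also have "\<dots> = (\<Sum>\<mu>\<in>{..(%j. if j \<in> J then r else 0)}. \<Prod>j\<in>J. real (\<nu> j choose \<mu> j) * (inverse (b j)) ^ (2 * \<mu> j))"
  by (rule sum_below_multi_index_prod[symmetric, OF J(1)]) auto
 finally show ?thesis .
qed

text \<open>
  The factor is at least \<open>\<beta> powr (- 2)\<close> for every positive entry and grows like the power \<open>r\<close> of the entry, so that
  the sum over large entries converges because \<open>r * q / 2 > 1\<close>.  What matters is that the sum over the positive entries is
  of order \<open>\<beta> powr q\<close>, uniformly for bounded \<open>\<beta>\<close>.
\<close>

lemma sum_kappa_factor_powr_le:
 fixes q :: real
 assumes q: "0 < q" "2 / real r < q" and r: "1 <= r"
 shows "\<exists>D\<ge>0. \<forall>\<beta> N. 0 < \<beta> \<longrightarrow> \<beta> <= B \<longrightarrow> (\<Sum>l\<le>N. kappa_factor r \<beta> l powr (- q / 2)) <= 1 + D * \<beta> powr q"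
proof -
 \<comment> \<open>decay exponent of the terms; it exceeds 1 by assumption\<close>
 define s where "s = real r * q / 2"
 have s: "1 < s" using q r by (simp add: s_def field_simps)
 have sm: "summable (%l. real l powr (- s))" using s by (simp add: summable_real_powr_iff)
 define Z where "Z = (\<Sum>l. real l powr (- s))"
 define D where "D = real r + real r powr s * Z * (\<bar>B\<bar> powr ((real r - 1) * q))"
 have Z: "0 <= Z" unfolding Z_def by (intro suminf_nonneg sm) auto
 have D: "0 <= D" unfolding D_def using Z by (intro add_nonneg_nonneg mult_nonneg_nonneg) auto
 have main: "(\<Sum>l\<le>N. kappa_factor r \<beta> l powr (- q / 2)) <= 1 + D * \<beta> powr q" if \<beta>: "0 < \<beta>" "\<beta> <= B" for \<beta> N
 proof -
  have low: "kappa_factor r \<beta> l powr (- q / 2) <= \<beta> powr q" if l: "1 <= l" for l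
  proof -
   have "inverse \<beta> ^ 2 <= real l * inverse \<beta> ^ 2"
    using mult_right_mono[of 1 "real l" "inverse \<beta> ^ 2"] l by simp
   also have "\<dots> <= kappa_factor r \<beta> l" using kappa_factor_ge[of 1 r l \<beta>] r by simp
   finally have "kappa_factor r \<beta> l powr (- q / 2) <= (inverse \<beta> ^ 2) powr (- q / 2)"
    using \<beta> q by (intro powr_mono2') auto
   also have "inverse \<beta> ^ 2 = \<beta> powr (- 2)" using \<beta> by (simp add: powr_minus power_inverse)
   also have "(\<beta> powr (- 2)) powr (- q / 2) = \<beta> powr q" by (simp add: powr_powr)
   finally show ?thesis .
  qed
  have high: "kappa_factor r \<beta> l powr (- q / 2) <= real r powr s * \<bar>B\<bar> powr ((real r - 1) * q) * real l powr (- s) * \<beta> powr q"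
   if l: "r <= l" for l
  proof -
   have lp: "0 < l" "0 < r" using l r by auto
   have "(real l / real r) ^ r * inverse \<beta> ^ (2 * r) <= real (l choose r) * inverse \<beta> ^ (2 * r)"
    using binomial_ge_n_over_k_pow_k[OF l, where 'a = real] \<beta> by (intro mult_right_mono) auto
   also have "\<dots> <= kappa_factor r \<beta> l" using kappa_factor_ge[of r r l \<beta>] by simp
   finally have "kappa_factor r \<beta> l powr (- q / 2) <= ((real l / real r) ^ r * inverse \<beta> ^ (2 * r)) powr (- q / 2)"
    using \<beta> q lp by (intro powr_mono2') auto
   also have "(real l / real r) ^ r * inverse \<beta> ^ (2 * r) = (real l / real r) powr real r * \<beta> powr (- 2 * real r)"
    using \<beta> lp by (simp add: powr_realpow[symmetric] powr_minus[symmetric] inverse_powr powr_powr)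
   also have "(\<dots>) powr (- q / 2) = (real l / real r) powr (- s) * \<beta> powr (real r * q)"
    using \<beta> lp by (simp add: powr_mult powr_powr s_def)
   also have "(real l / real r) powr (- s) = real r powr s * real l powr (- s)"
    using lp by (simp add: powr_divide powr_minus field_simps)
   also have "\<beta> powr (real r * q) = \<beta> powr ((real r - 1) * q) * \<beta> powr q"
    by (simp add: powr_add[symmetric] algebra_simps)
   also have "\<beta> powr ((real r - 1) * q) <= \<bar>B\<bar> powr ((real r - 1) * q)"
    using \<beta> q r by (intro powr_mono2) auto
   finally show ?thesis by (simp add: mult_left_mono mult_right_mono mult_ac)
  qed
  have "kappa_factor r \<beta> l powr (- q / 2) <= (if l = 0 then 1 else 0) + (if l \<in> {1..<r} then \<beta> powr q else 0)
    + real r powr s * \<bar>B\<bar> powr ((real r - 1) * q) * real l powr (- s) * \<beta> powr q" for l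
  proof -
   have nn: "0 <= real r powr s * \<bar>B\<bar> powr ((real r - 1) * q) * real l powr (- s) * \<beta> powr q" by simp
   consider "l = 0" | "1 <= l" "l < r" | "r <= l" "1 <= l" by linarith
   then show ?thesis
   proof cases
    case 2
    then show ?thesis using add_increasing2[OF nn low[OF 2(1)]] by simp
   qed (use nn high[of l] in auto)
  qed
  then have "(\<Sum>l\<le>N. kappa_factor r \<beta> l powr (- q / 2))
    <= (\<Sum>l\<le>N. (if l = 0 then 1 else 0) + (if l \<in> {1..<r} then \<beta> powr q else 0)
    + real r powr s * \<bar>B\<bar> powr ((real r - 1) * q) * real l powr (- s) * \<beta> powr q)" by (rule sum_mono)
  also have "\<dots> = (\<Sum>l\<le>N. if l = 0 then 1 else 0) + (\<Sum>l\<le>N. if l \<in> {1..<r} then \<beta> powr q else 0)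
    + (real r powr s * \<bar>B\<bar> powr ((real r - 1) * q) * \<beta> powr q) * (\<Sum>l\<le>N. real l powr (- s))"
  proof -
   have "(\<Sum>l\<le>N. real r powr s * \<bar>B\<bar> powr ((real r - 1) * q) * real l powr (- s) * \<beta> powr q)
     = (real r powr s * \<bar>B\<bar> powr ((real r - 1) * q) * \<beta> powr q) * (\<Sum>l\<le>N. real l powr (- s))"
    by (subst sum_distrib_left, intro sum.cong refl) (simp only: mult_ac)
   then show ?thesis by (simp only: sum.distrib)
  qed
  also have "\<dots> <= 1 + real r * \<beta> powr q + (real r powr s * \<bar>B\<bar> powr ((real r - 1) * q) * \<beta> powr q) * Z"
  proof (intro add_mono mult_left_mono)
   show "(\<Sum>l\<le>N. if l = 0 then 1 else 0) <= (1::real)" by simp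
   have "(\<Sum>l\<le>N. if l \<in> {1..<r} then \<beta> powr q else 0) = (\<Sum>l\<in>{..N} \<inter> {1..<r}. \<beta> powr q)"
    by (rule sum.inter_restrict[symmetric]) simp
   also have "\<dots> = real (card ({..N} \<inter> {1..<r})) * \<beta> powr q" by simp
   also have "card ({..N} \<inter> {1..<r}) <= card {1..<r}" by (intro card_mono) auto
   then have "real (card ({..N} \<inter> {1..<r})) * \<beta> powr q <= real r * \<beta> powr q" by (intro mult_right_mono) auto
   finally show "(\<Sum>l\<le>N. if l \<in> {1..<r} then \<beta> powr q else 0) <= real r * \<beta> powr q" .
   show "(\<Sum>l\<le>N. real l powr (- s)) <= Z" unfolding Z_def by (intro sum_le_suminf sm) auto
  qed auto
  also have "\<dots> = 1 + D * \<beta> powr q" unfolding D_def by (simp add: algebra_simps)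
  finally show ?thesis .
 qed
 show ?thesis using D main by blast
qed

text \<open>
  The sum over a box factorises into one-dimensional sums, each at most \<open>1 + D * b j powr q\<close>, and the product of these is bounded
  because the \<open>b j powr q\<close> are summable.
\<close>

lemma kappa_powr_sum_bounded:
 fixes q :: real and b :: "nat => real"
 assumes q: "0 < q" "2 / real r < q" and r: "1 <= r"
  and b: "\<And>j. 0 < b j" "summable (%j. b j powr q)"
 shows "\<exists>C. \<forall>F. finite F \<longrightarrow> F \<subseteq> multi_indices \<longrightarrow> (\<Sum>\<nu>\<in>F. kappa r b \<nu> powr q) <= C"
proof -
 define S where "S = (\<Sum>j. b j powr q)"
 have leS: "b j powr q <= S" for j
  using sum_le_suminf[OF b(2), of "{j}"] by (simp add: S_def)
 have bB: "b j <= S powr (1/q)" for j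
 proof -
  have "b j = (b j powr q) powr (1/q)" using q b(1)[of j] by (simp add: powr_powr)
  also have "\<dots> <= S powr (1/q)" using leS[of j] q by (intro powr_mono2) auto
  finally show ?thesis .
 qed
 obtain D where D: "D \<ge> 0"
  "\<And>\<beta> N. 0 < \<beta> ==> \<beta> <= S powr (1/q) ==> (\<Sum>l\<le>N. kappa_factor r \<beta> l powr (- q / 2)) <= 1 + D * \<beta> powr q"
  using sum_kappa_factor_powr_le[OF q r, of "S powr (1/q)"] by blast
 have "(\<Sum>\<nu>\<in>F. kappa r b \<nu> powr q) <= exp (D * S)" if F: "finite F" "F \<subseteq> multi_indices" for F
 proof -
  obtain J N where J: "finite J" "\<And>j. j \<notin> J ==> N j = 0" "F \<subseteq> {..N}" "N \<in> multi_indices"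
   using finite_multi_indices_bounded[OF F] by metis
  have "(\<Sum>\<nu>\<in>F. kappa r b \<nu> powr q) <= (\<Sum>\<nu>\<in>{..N}. kappa r b \<nu> powr q)"
   using J finite_multi_indices_below by (intro sum_mono2) auto
  also have "\<dots> = (\<Sum>\<nu>\<in>{..N}. \<Prod>j\<in>J. kappa_factor r (b j) (\<nu> j) powr (- q / 2))"
  proof (rule sum.cong[OF refl])
   fix \<nu> assume \<nu>: "\<nu> \<in> {..N}"
   have "\<nu> j = 0" if "j \<notin> J" for j using \<nu> J(2)[OF that] by (auto simp: le_fun_def dest: spec[of _ j])
   then have "kappa r b \<nu> = (\<Prod>j\<in>J. kappa_factor r (b j) (\<nu> j) powr (- 1 / 2))"
    by (rule kappa_eq[OF J(1)])
   then show "kappa r b \<nu> powr q = (\<Prod>j\<in>J. kappa_factor r (b j) (\<nu> j) powr (- q / 2))"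
    by (simp add: prod_powr_distrib powr_powr)
  qed
  also have "\<dots> = (\<Prod>j\<in>J. \<Sum>l\<le>N j. kappa_factor r (b j) l powr (- q / 2))"
   by (rule sum_below_multi_index_prod[OF J(1,2)])
  also have "\<dots> <= (\<Prod>j\<in>J. exp (D * b j powr q))"
  proof (rule prod_mono, rule conjI)
   fix j
   show "0 <= (\<Sum>l\<le>N j. kappa_factor r (b j) l powr (- q / 2))" by (intro sum_nonneg) auto
   show "(\<Sum>l\<le>N j. kappa_factor r (b j) l powr (- q / 2)) <= exp (D * b j powr q)"
    by (rule order_trans[OF D(2)[OF b(1) bB] exp_ge_add_one_self])
  qed
  also have "\<dots> = exp (D * (\<Sum>j\<in>J. b j powr q))" by (simp add: exp_sum[OF J(1)] sum_distrib_left)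
  also have "\<dots> <= exp (D * S)"
   using D(1) sum_le_suminf[OF b(2) J(1)] by (auto simp: S_def intro!: mult_left_mono)
  finally show ?thesis .
 qed
 then show ?thesis by blast
qed

text \<open>
  Greedy choice: add to the set a maximiser of \<open>\<kappa>\<close> outside it, taking among the maximisers one of smallest total
  degree.  An index strictly below it has at least the same weight and smaller degree, hence was chosen before.
\<close>

lemma exists_n_largest_downward_closed:
 fixes \<kappa> :: "(nat => nat) => real"
 assumes pos: "\<And>\<nu>. \<nu> \<in> multi_indices ==> 0 < \<kappa> \<nu>"
  and anti: "\<And>\<mu> \<nu>. \<nu> \<in> multi_indices ==> \<mu> <= \<nu> ==> \<kappa> \<nu> <= \<kappa> \<mu>"
  and fin: "\<And>\<epsilon>. 0 < \<epsilon> ==> finite {\<nu>\<in>multi_indices. \<epsilon> <= \<kappa> \<nu>}"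
 shows "\<exists>\<Lambda>. downward_closed \<Lambda> \<and> n_largest \<kappa> n \<Lambda>"
proof (induction n)
 case 0
 show ?case by (rule exI[of _ "{}"]) (auto simp: downward_closed_def n_largest_def)
next
 case (Suc n)
 then obtain \<Lambda> where \<Lambda>: "downward_closed \<Lambda>" "n_largest \<kappa> n \<Lambda>" by blast
 have inf: "infinite multi_indices"
 proof
  assume "finite multi_indices"
  moreover have "(%j::nat. (%_. 0)(j := 1::nat)) ` UNIV \<subseteq> multi_indices"
   by (auto simp: multi_indices_def)
  moreover have "inj (%j::nat. (%_. 0)(j := 1::nat))"
   by (rule injI) (metis fun_upd_apply zero_neq_one)
  ultimately show False using finite_subset finite_imageD by blast
 qed
 then obtain \<nu>0 where \<nu>0: "\<nu>0 \<in> multi_indices" "\<nu>0 \<notin> \<Lambda>"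
  using \<Lambda>(2) unfolding n_largest_def by (metis finite_subset subsetI)
 define A where "A = {\<nu>\<in>multi_indices. \<kappa> \<nu>0 <= \<kappa> \<nu>} - \<Lambda>"
 have A: "finite A" "\<nu>0 \<in> A" using fin[OF pos[OF \<nu>0(1)]] \<nu>0 by (auto simp: A_def)
 define m where "m = Max (\<kappa> ` A)"
 \<comment> \<open>the maximisers outside the set chosen so far\<close>
 define M where "M = {\<nu>\<in>A. \<kappa> \<nu> = m}"
 have "m \<in> \<kappa> ` A" unfolding m_def using A by (intro Max_in) auto
 then have M: "M ~= {}" by (auto simp: M_def)
 have mmax: "\<kappa> \<mu> <= m" if "\<mu> \<in> multi_indices - \<Lambda>" for \<mu>
 proof (cases "\<mu> \<in> A")
  case True then show ?thesis using A(1) by (simp add: m_def)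
 next
  case False
  then have "\<kappa> \<mu> < \<kappa> \<nu>0" using that by (auto simp: A_def)
  also have "\<dots> <= m" using A by (simp add: m_def)
  finally show ?thesis by simp
 qed
 let ?sz = "%\<nu>::nat => nat. \<Sum>j | \<nu> j ~= 0. \<nu> j"
 obtain \<nu> where \<nu>: "\<nu> \<in> M" "\<And>\<mu>. \<mu> \<in> M ==> ?sz \<nu> <= ?sz \<mu>"
  using ex_has_least_nat[of "%\<mu>. \<mu> \<in> M" _ ?sz] M by (metis ex_in_conv)
 have \<nu>M: "\<nu> \<in> multi_indices" "\<nu> \<notin> \<Lambda>" "\<kappa> \<nu> = m" using \<nu>(1) by (auto simp: M_def A_def)
 have down: "\<mu> \<in> insert \<nu> \<Lambda>" if \<mu>: "\<mu> \<in> multi_indices" "\<mu> <= \<nu>" for \<mu>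
 proof (rule ccontr)
  assume n: "\<mu> \<notin> insert \<nu> \<Lambda>"
  then have "\<kappa> \<mu> = m" using mmax[of \<mu>] anti[OF \<nu>M(1) \<mu>(2)] \<mu> \<nu>M(3) by force
  moreover have "\<mu> \<in> A" using n \<mu> anti[OF \<nu>M(1) \<mu>(2)] \<nu>(1) by (auto simp: A_def M_def)
  ultimately have "\<mu> \<in> M" by (simp add: M_def)
  then have le: "?sz \<nu> <= ?sz \<mu>" by (rule \<nu>(2))
  have eq: "?sz \<mu> = (\<Sum>j | \<nu> j ~= 0. \<mu> j)"
   using \<mu>(2) by (intro sum.mono_neutral_left multi_indicesD[OF \<nu>M(1)]) (auto simp: le_fun_def, metis gr0I le_zero_eq)
  obtain i where i: "\<mu> i ~= \<nu> i" using n by (auto simp: fun_eq_iff)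
  have "\<mu> i < \<nu> i" using i \<mu>(2) by (metis le_fun_def le_neq_implies_less)
  then have "(\<Sum>j | \<nu> j ~= 0. \<mu> j) < ?sz \<nu>"
   using \<mu>(2) by (intro sum_strict_mono_ex1 multi_indicesD[OF \<nu>M(1)]) (auto simp: le_fun_def intro: exI[of _ i])
  then show False using le eq by simp
 qed
 have "downward_closed (insert \<nu> \<Lambda>)"
  using \<Lambda>(1) down \<nu>M(1) unfolding downward_closed_def by auto
 moreover have "n_largest \<kappa> (Suc n) (insert \<nu> \<Lambda>)"
  using \<Lambda>(2) \<nu>M mmax unfolding n_largest_def by auto
 ultimately show ?case by blast
qed

text \<open>
  Stechkin's argument: each of the \<open>n\<close> chosen terms is at least as large as the term \<open>\<kappa> \<mu>\<close> outside.
\<close>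

lemma n_largest_tail_bound:
 assumes C: "\<And>F. finite F ==> F \<subseteq> multi_indices ==> (\<Sum>\<nu>\<in>F. \<kappa> \<nu> powr q) <= C"
  and q: "0 < (q::real)" and n: "1 <= n" and \<Lambda>: "n_largest \<kappa> n \<Lambda>" and \<mu>: "\<mu> \<in> multi_indices - \<Lambda>"
  and pos: "0 <= \<kappa> \<mu>"
 shows "\<kappa> \<mu> <= C powr (1/q) * real n powr (- (1/q))"
proof -
 have "real n * \<kappa> \<mu> powr q = (\<Sum>\<nu>\<in>\<Lambda>. \<kappa> \<mu> powr q)" using \<Lambda> by (simp add: n_largest_def)
 also have "\<dots> <= (\<Sum>\<nu>\<in>\<Lambda>. \<kappa> \<nu> powr q)"
  using \<Lambda> \<mu> pos q by (intro sum_mono powr_mono2) (auto simp: n_largest_def)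
 also have "\<dots> <= C" using \<Lambda> by (intro C) (auto simp: n_largest_def)
 finally have le: "\<kappa> \<mu> powr q <= C / real n" using n by (simp add: field_simps)
 have "\<kappa> \<mu> = (\<kappa> \<mu> powr q) powr (1/q)" using q pos by (simp add: powr_powr)
 also have "\<dots> <= (C / real n) powr (1/q)" using le q by (intro powr_mono2) auto
 also have "\<dots> = C powr (1/q) * real n powr (- (1/q))"
 proof -
  have "0 <= C" using C[of "{}"] by simp
  then show ?thesis using n by (simp add: powr_divide powr_minus field_simps)
 qed
 finally show ?thesis .
qed

section \<open>Gaussian integration by parts on the line\<close>

abbreviation std_gauss :: "real measure" where
 "std_gauss \<equiv> density lborel std_normal_density"

lemma prob_space_std_gauss: "prob_space std_gauss"
 by (rule prob_space_normal_density) simp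

lemma integrable_std_gauss_iff:
 fixes f :: "real => real"
 assumes "f \<in> borel_measurable borel"
 shows "integrable std_gauss f \<longleftrightarrow> integrable lborel (%t. std_normal_density t * f t)"
 using assms by (subst integrable_density) (auto simp: normal_density_nonneg)

lemma integral_std_gauss:
 fixes f :: "real => real"
 assumes "f \<in> borel_measurable borel"
 shows "integral\<^sup>L std_gauss f = (\<integral>t. std_normal_density t * f t \<partial>lborel)"
 using assms by (subst integral_density) (auto simp: normal_density_nonneg)

text \<open>
  Functions of at most exponential growth are integrable for the Gaussian and kill the boundary terms at infinity.
  The class is closed under products and contains polynomials and the functions \<open>exp (c * \<bar>t\<bar>)\<close> that
  the parametric solution produces.
\<close>

definition exp_growth :: "(real => real) => bool" where
 "exp_growth f \<longleftrightarrow> (\<exists>A B. 0 <= B \<and> (\<forall>t. \<bar>f t\<bar> <= A * exp (B * \<bar>t\<bar>)))"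

lemma exp_growthI: "0 <= B ==> (\<And>t. \<bar>f t\<bar> <= A * exp (B * \<bar>t\<bar>)) ==> exp_growth f"
 unfolding exp_growth_def by blast

lemma exp_growth_const: "exp_growth (%t. c)"
 by (rule exp_growthI[of 0 _ "\<bar>c\<bar>"]) auto

lemma exp_growth_mult:
 assumes "exp_growth f" "exp_growth g" shows "exp_growth (%t. f t * g t)"
proof -
 obtain A B where f: "0 <= B" "\<And>t. \<bar>f t\<bar> <= A * exp (B * \<bar>t\<bar>)" using assms(1) exp_growth_def by blast
 obtain C E where g: "0 <= E" "\<And>t. \<bar>g t\<bar> <= C * exp (E * \<bar>t\<bar>)" using assms(2) exp_growth_def by blast
 show ?thesis
 proof (rule exp_growthI[of "B + E" _ "A * C"])
  fix t
  have "\<bar>f t * g t\<bar> <= (A * exp (B * \<bar>t\<bar>)) * (C * exp (E * \<bar>t\<bar>))"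
   unfolding abs_mult by (rule mult_mono'[OF f(2) g(2)]) auto
  then show "\<bar>f t * g t\<bar> <= A * C * exp ((B + E) * \<bar>t\<bar>)" by (simp add: distrib_right exp_add mult.assoc mult.left_commute)
 qed (use f g in simp)
qed

lemma exp_growth_add:
 assumes "exp_growth f" "exp_growth g" shows "exp_growth (%t. f t + g t)"
proof -
 obtain A B where f: "0 <= B" "\<And>t. \<bar>f t\<bar> <= A * exp (B * \<bar>t\<bar>)" using assms(1) exp_growth_def by blast
 obtain C E where g: "0 <= E" "\<And>t. \<bar>g t\<bar> <= C * exp (E * \<bar>t\<bar>)" using assms(2) exp_growth_def by blast
 have "0 <= A" "0 <= C" using f(2)[of 0] g(2)[of 0] by auto
 show ?thesis
 proof (rule exp_growthI[of "B + E" _ "A + C"])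
  fix t
  have "A * exp (B * \<bar>t\<bar>) <= A * exp ((B + E) * \<bar>t\<bar>)" "C * exp (E * \<bar>t\<bar>) <= C * exp ((B + E) * \<bar>t\<bar>)"
   using f(1) g(1) \<open>0 <= A\<close> \<open>0 <= C\<close> by (auto intro!: mult_left_mono mult_right_mono)
  then show "\<bar>f t + g t\<bar> <= (A + C) * exp ((B + E) * \<bar>t\<bar>)"
   using f(2)[of t] g(2)[of t] abs_triangle_ineq[of "f t" "g t"] by (simp add: distrib_right)
 qed (use f g in simp)
qed

lemma exp_growth_ident: "exp_growth (%t. t)"
proof (rule exp_growthI[of 1 _ 1])
 show "\<bar>t\<bar> <= 1 * exp (1 * \<bar>t\<bar>)" for t :: real using exp_ge_add_one_self[of "\<bar>t\<bar>"] by (simp only: mult_1_left)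
qed simp

lemma exp_growth_poly: "exp_growth (poly p)"
proof (induction p)
 case (pCons a p)
 then show ?case using exp_growth_add[OF exp_growth_const exp_growth_mult[OF exp_growth_ident pCons(2)], of a] by simp
qed (use exp_growth_const[of 0] in simp)

lemma exp_growth_exp: "exp_growth (%t. exp (c * \<bar>t\<bar>))"
 by (rule exp_growthI[of "\<bar>c\<bar>" _ 1]) (auto intro: mult_right_mono)

lemma exp_growth_abs: "exp_growth f ==> exp_growth (%t. \<bar>f t\<bar>)"
 unfolding exp_growth_def by simp

lemma exp_growth_power: "exp_growth f ==> exp_growth (%t. f t ^ n)"
 by (induction n) (auto intro: exp_growth_const exp_growth_mult)

lemma integrable_exp_growth:
 assumes f: "exp_growth f" and [measurable]: "f \<in> borel_measurable borel"
 shows "integrable std_gauss f"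
proof -
 obtain A B where B: "0 <= B" "\<And>t. \<bar>f t\<bar> <= A * exp (B * \<bar>t\<bar>)" using f exp_growth_def by blast
 have A: "0 <= A" using B(2)[of 0] by simp
 have shift: "std_normal_density t * exp (c * t) = exp (c^2 / 2) * normal_density c 1 t" for c t :: real
 proof -
  have "- t\<^sup>2 / 2 + c * t = c\<^sup>2 / 2 + - (t - c)\<^sup>2 / 2" by (simp add: power2_eq_square field_simps)
  then have "exp (- t\<^sup>2 / 2) * exp (c * t) = exp (c^2 / 2) * exp (- (t - c)\<^sup>2 / 2)"
   by (simp only: exp_add[symmetric])
  then show ?thesis by (simp add: normal_density_def field_simps)
 qed
 have ie: "integrable lborel (%t. std_normal_density t * exp (c * t))" for c
  unfolding shift by (intro integrable_mult_right integrable_normal_density) simp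
 have "integrable lborel (%t. std_normal_density t * f t)"
 proof (rule Bochner_Integration.integrable_bound)
  show "integrable lborel (%t. A * (std_normal_density t * exp (B * t) + std_normal_density t * exp ((- B) * t)))"
   by (intro integrable_mult_right Bochner_Integration.integrable_add ie)
  show "(%t. std_normal_density t * f t) \<in> borel_measurable lborel" by measurable
  have "norm (std_normal_density t * f t)
    <= norm (A * (std_normal_density t * exp (B * t) + std_normal_density t * exp ((- B) * t)))" for t
  proof -
   have "exp (B * \<bar>t\<bar>) <= exp (B * t) + exp (- B * t)"
    by (cases "0 <= t") (auto simp: add_increasing add_increasing2)
   then have "\<bar>f t\<bar> <= A * (exp (B * t) + exp (- B * t))"
    by (rule order_trans[OF B(2) mult_left_mono[OF _ A]])
   then have "std_normal_density t * \<bar>f t\<bar> <= std_normal_density t * (A * (exp (B * t) + exp (- B * t)))"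
    by (intro mult_left_mono) auto
   then show ?thesis using A by (simp add: abs_mult algebra_simps)
  qed
  then show "AE t in lborel. norm (std_normal_density t * f t)
    <= norm (A * (std_normal_density t * exp (B * t) + std_normal_density t * exp ((- B) * t)))"
   by (intro AE_I2)
 qed
 then show ?thesis by (simp add: integrable_std_gauss_iff)
qed

lemma tendsto_exp_growth_density:
 assumes f: "exp_growth f"
 shows "((%t. f t * std_normal_density t) \<longlongrightarrow> 0) at_top" "((%t. f t * std_normal_density t) \<longlongrightarrow> 0) at_bot"
proof -
 obtain A B where B: "0 <= B" "\<And>t. \<bar>f t\<bar> <= A * exp (B * \<bar>t\<bar>)" using f exp_growth_def by blast
 have le: "norm (f t * std_normal_density t) <= A * (exp (B * \<bar>t\<bar>) * std_normal_density t)" for t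
  using mult_right_mono[OF B(2)[of t] normal_density_nonneg[of 0 1 t]] by (simp add: abs_mult mult_ac)
 have t: "((%t. exp (B * t) * std_normal_density t) \<longlongrightarrow> 0) at_top"
 proof -
  have "((%t. exp (B * t) * exp (- (t\<^sup>2) / 2)) \<longlongrightarrow> 0) at_top"
  proof (rule Lim_null_comparison)
   show "((%t::real. exp (- t)) \<longlongrightarrow> 0) at_top" by real_asymp
   have "norm (exp (B * t) * exp (- (t\<^sup>2) / 2)) <= exp (- t)" if t: "2 * B + 2 <= t" for t
   proof -
    have "t * (2 * B + 2) <= t * t" using t B(1) by (intro mult_left_mono) auto
    then have "B * t + - (t\<^sup>2) / 2 <= - t" by (simp add: power2_eq_square algebra_simps)
    then have "exp (B * t + - (t\<^sup>2) / 2) <= exp (- t)" by (simp only: exp_le_cancel_iff)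
    then show ?thesis unfolding exp_add by simp
   qed
   then show "\<forall>\<^sub>F t in at_top. norm (exp (B * t) * exp (- (t\<^sup>2) / 2)) <= exp (- t)"
    by (rule eventually_at_top_linorderI)
  qed
  from tendsto_mult[OF this tendsto_const[of "1 / sqrt (2 * pi)"]] show ?thesis
   by (simp add: normal_density_def)
 qed
 have t': "((%t. exp (B * \<bar>t\<bar>) * std_normal_density t) \<longlongrightarrow> 0) at_top"
  by (rule Lim_transform_eventually[OF t eventually_mono[OF eventually_ge_at_top[of 0]]]) simp
 then have "((%t. A * (exp (B * \<bar>t\<bar>) * std_normal_density t)) \<longlongrightarrow> A * 0) at_top"
  by (intro tendsto_mult tendsto_const)
 then have lim: "((%t. A * (exp (B * \<bar>t\<bar>) * std_normal_density t)) \<longlongrightarrow> 0) at_top" by simp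
 show "((%t. f t * std_normal_density t) \<longlongrightarrow> 0) at_top"
  by (rule Lim_null_comparison[OF always_eventually lim]) (use le in blast)
 have "((%t. A * (exp (B * \<bar>- t\<bar>) * std_normal_density (- t))) \<longlongrightarrow> 0) at_top"
  using lim by (simp add: normal_density_def)
 then have lim': "((%t. A * (exp (B * \<bar>t\<bar>) * std_normal_density t)) \<longlongrightarrow> 0) at_bot"
  unfolding filterlim_at_bot_mirror .
 show "((%t. f t * std_normal_density t) \<longlongrightarrow> 0) at_bot"
  by (rule Lim_null_comparison[OF always_eventually lim']) (use le in blast)
qed

text \<open>
  The derivative of the density is \<open>- t\<close> times the density, so moving the derivative from \<open>c\<close> to the rest of the integrand
  replaces the polynomial \<open>p\<close> by \<open>x * p - p'\<close>.
\<close>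

lemma gaussian_integration_by_parts:
 assumes c: "\<And>t. (c has_real_derivative c' t) (at t)" and c': "continuous_on UNIV c'"
  and g: "exp_growth c" "exp_growth c'"
 shows "(\<integral>t. c' t * poly p t \<partial>std_gauss) = (\<integral>t. c t * poly ([:0, 1:] * p - pderiv p) t \<partial>std_gauss)"
proof -
 have cc: "continuous_on UNIV c" using c by (meson DERIV_isCont continuous_at_imp_continuous_on)
 have [measurable]: "c \<in> borel_measurable borel" "c' \<in> borel_measurable borel"
  using cc c' by (auto intro: borel_measurable_continuous_onI)
 have [measurable]: "poly p \<in> borel_measurable borel" for p :: "real poly"
  by (intro borel_measurable_continuous_onI continuous_intros)
 define F where "F t = c t * poly p t * std_normal_density t" for t
 define f where "f t = std_normal_density t * (c' t * poly p t) - std_normal_density t * (c t * poly ([:0, 1:] * p - pderiv p) t)" for t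
 have i1: "integrable lborel (%t. std_normal_density t * (c' t * poly p t))"
  using integrable_exp_growth[OF exp_growth_mult[OF g(2) exp_growth_poly[of p]]] by (simp add: integrable_std_gauss_iff)
 have i2: "integrable lborel (%t. std_normal_density t * (c t * poly ([:0, 1:] * p - pderiv p) t))"
  using integrable_exp_growth[OF exp_growth_mult[OF g(1) exp_growth_poly[of "[:0, 1:] * p - pderiv p"]]]
  by (simp only: integrable_std_gauss_iff[of "%t. c t * poly ([:0, 1:] * p - pderiv p) t"]) measurable
 have fi: "integrable lborel f" unfolding f_def using i1 i2 by (rule Bochner_Integration.integrable_diff)
 have dens: "(std_normal_density has_real_derivative - t * std_normal_density t) (at t)" for t
  unfolding normal_density_def by (auto intro!: derivative_eq_intros simp: field_simps)
 have dF: "(F has_real_derivative f t) (at t)" for t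
  unfolding F_def f_def
  by (auto intro!: derivative_eq_intros c dens simp: algebra_simps)
 have contf: "isCont f t" for t
 proof -
  have "continuous_on UNIV f" unfolding f_def normal_density_def by (intro continuous_intros c' cc) auto
  then show ?thesis by (simp add: continuous_on_eq_continuous_at)
 qed
 have gr: "exp_growth (%t. c t * poly p t)" by (rule exp_growth_mult[OF g(1) exp_growth_poly])
 have "(LBINT t=-\<infinity>..\<infinity>. f t) = 0 - 0"
 proof (rule interval_integral_FTC_integrable[where F = F])
  show "(F has_vector_derivative f t) (at t)" for t
   using dF has_real_derivative_iff_has_vector_derivative by blast
  show "set_integrable lborel (einterval (-\<infinity>) \<infinity>) f" using fi by (simp add: set_integrable_def)
  show "((F \<circ> real_of_ereal) \<longlongrightarrow> 0) (at_right (- \<infinity>))" "((F \<circ> real_of_ereal) \<longlongrightarrow> 0) (at_left \<infinity>)"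
   using tendsto_exp_growth_density[OF gr] unfolding F_def[symmetric] ereal_tendsto_simps1 by (simp_all add: F_def[abs_def])
 qed (use contf in auto)
 then have "integral\<^sup>L lborel f = 0"
  by (simp add: interval_lebesgue_integral_def set_lebesgue_integral_def)
 then have "(\<integral>t. std_normal_density t * (c' t * poly p t) \<partial>lborel) = (\<integral>t. std_normal_density t * (c t * poly ([:0, 1:] * p - pderiv p) t) \<partial>lborel)"
  unfolding f_def using i1 i2 by simp
 then show ?thesis by (subst (1 2) integral_std_gauss) auto
qed

text \<open>
  The operation of the preceding lemma is the recursion of the Hermite polynomials.
\<close>

lemma gaussian_integral_hermite_Suc:
 assumes "\<And>t. (c has_real_derivative c' t) (at t)" "continuous_on UNIV c'" "exp_growth c" "exp_growth c'"
 shows "(\<integral>t. c t * poly (hermite_monic (Suc k)) t \<partial>std_gauss) = (\<integral>t. c' t * poly (hermite_monic k) t \<partial>std_gauss)"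
 using gaussian_integration_by_parts[OF assms, of "hermite_monic k"] by simp

lemma gaussian_integral_poly_hermite_Suc:
 "(\<integral>t. poly p t * poly (hermite_monic (Suc k)) t \<partial>std_gauss) = (\<integral>t. poly (pderiv p) t * poly (hermite_monic k) t \<partial>std_gauss)"
 by (rule gaussian_integral_hermite_Suc) (auto intro: poly_DERIV continuous_intros exp_growth_poly)

text \<open>
  Repeated integration by parts; orthogonality is read off because \<open>k\<close> derivatives annihilate lower degrees.
\<close>

lemma gaussian_integral_poly_hermite:
 "(\<integral>t. poly p t * poly (hermite_monic k) t \<partial>std_gauss) = (\<integral>t. poly ((pderiv ^^ k) p) t \<partial>std_gauss)"
proof (induction k arbitrary: p)
 case (Suc k)
 show ?case unfolding gaussian_integral_poly_hermite_Suc Suc funpow_Suc_right by simp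
qed simp

lemma degree_hermite_monic_le: "degree (hermite_monic k) <= k"
proof (induction k)
 case (Suc k)
 have "degree ([:0, 1:] * hermite_monic k) <= Suc k" using Suc by (simp add: degree_pCons_le le_trans[OF degree_pCons_le])
 moreover have "degree (pderiv (hermite_monic k)) <= Suc k" using Suc by (simp add: degree_pderiv)
 ultimately have "degree ([:0, 1:] * hermite_monic k - pderiv (hermite_monic k)) <= Suc k"
  by (rule degree_diff_le)
 then show ?case by (simp only: hermite_monic.simps)
qed simp

lemma coeff_hermite_monic: "coeff (hermite_monic k) k = 1"
proof (induction k)
 case (Suc k)
 have "coeff (pderiv (hermite_monic k)) (Suc k) = 0"
  using degree_hermite_monic_le[of k] by (intro coeff_eq_0) (simp add: degree_pderiv)
 then show ?case using Suc by simp
qed simp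

lemma pderiv_funpow_zero: "degree (p :: real poly) < k ==> (pderiv ^^ k) p = 0"
proof (induction k arbitrary: p)
 case (Suc k)
 show ?case
 proof (cases "degree p = 0")
  case True
  then have "pderiv p = 0" by (simp add: pderiv_eq_0_iff)
  moreover have "(pderiv ^^ k) 0 = (0 :: real poly)" by (induction k) auto
  ultimately show ?thesis by (simp add: funpow_swap1)
 next
  case False
  then show ?thesis using Suc.prems Suc.IH[of "pderiv p"] by (simp add: funpow_swap1 degree_pderiv)
 qed
qed simp

lemma pderiv_funpow_degree:
 "degree (p :: real poly) <= k ==> (pderiv ^^ k) p = [:fact k * coeff p k:]"
proof (induction k arbitrary: p)
 case 0
 then show ?case by (metis degree_0_id fact_0 funpow_0 le_zero_eq mult_1)
next
 case (Suc k)
 have "degree (pderiv p) <= k" using Suc.prems by (simp add: degree_pderiv)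
 then have "(pderiv ^^ k) (pderiv p) = [:fact k * coeff (pderiv p) k:]" by (rule Suc.IH)
 then show ?case by (simp add: funpow_swap1 coeff_pderiv)
qed

lemma hermite_monic_orthogonal:
 "(\<integral>t. poly (hermite_monic j) t * poly (hermite_monic k) t \<partial>std_gauss) = (if j = k then fact k else 0)"
proof -
 interpret prob_space std_gauss by (rule prob_space_std_gauss)
 have less: "(\<integral>t. poly (hermite_monic j) t * poly (hermite_monic k) t \<partial>std_gauss) = 0" if "j < k" for j k
  unfolding gaussian_integral_poly_hermite
  using pderiv_funpow_zero[of "hermite_monic j" k] degree_hermite_monic_le[of j] that by (simp cong: Bochner_Integration.integral_cong)
 consider "j < k" | "k < j" | "j = k" by linarith
 then show ?thesis
 proof cases
  case 2 then show ?thesis using less[of k j] by (simp add: mult.commute)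
 next
  case 3
  then show ?thesis unfolding gaussian_integral_poly_hermite
   using pderiv_funpow_degree[OF degree_hermite_monic_le[of k]] prob_space
   by (simp add: coeff_hermite_monic cong: Bochner_Integration.integral_cong)
 qed (simp add: less)
qed

lemma hermite_orthonormal: "(\<integral>t. hermite j t * hermite k t \<partial>std_gauss) = (if j = k then 1 else 0)"
proof -
 have "(\<integral>t. hermite j t * hermite k t \<partial>std_gauss)
   = (\<integral>t. poly (hermite_monic j) t * poly (hermite_monic k) t \<partial>std_gauss) / (sqrt (fact j) * sqrt (fact k))"
  unfolding hermite_def by simp
 then show ?thesis by (simp add: hermite_monic_orthogonal)
qed

lemma hermite_0 [simp]: "hermite 0 t = 1" by (simp add: hermite_def)

lemma exp_growth_hermite: "exp_growth (hermite k)"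
 using exp_growth_mult[OF exp_growth_poly[of "hermite_monic k"] exp_growth_const[of "1 / sqrt (fact k)"]]
 by (simp add: hermite_def[abs_def])

lemma borel_measurable_hermite [measurable]: "hermite k \<in> borel_measurable borel"
 unfolding hermite_def by (intro borel_measurable_continuous_onI continuous_intros) auto

text \<open>
  The monic Hermite polynomials have all degrees, so they can be eliminated from the top.
\<close>

lemma poly_in_hermite_span:
 fixes p :: "real poly"
 assumes "degree p <= n" shows "\<exists>a. \<forall>t. poly p t = (\<Sum>k\<le>n. a k * hermite k t)"
 using assms
proof (induction n arbitrary: p)
 case 0
 then obtain c where "p = [:c:]" by (metis degree_eq_zeroE le_zero_eq)
 then show ?case by (intro exI[of _ "%_. c"]) simp
next
 case (Suc n)
 define c where "c = coeff p (Suc n)"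
 define p' where "p' = p - smult c (hermite_monic (Suc n))"
 have "coeff p' i = 0" if "n < i" for i
 proof (cases "i = Suc n")
  case True then show ?thesis using coeff_hermite_monic[of "Suc n"] by (simp only: p'_def c_def coeff_diff coeff_smult)
 next
  case False
  then have "coeff p i = 0" "coeff (hermite_monic (Suc n)) i = 0"
   using that Suc.prems degree_hermite_monic_le[of "Suc n"] by (auto intro!: coeff_eq_0 simp del: hermite_monic.simps)
  then show ?thesis by (simp only: p'_def coeff_diff coeff_smult)
 qed
 then have "degree p' <= n" by (intro degree_le) auto
 then obtain a where a: "\<And>t. poly p' t = (\<Sum>k\<le>n. a k * hermite k t)" using Suc.IH by blast
 have "poly p t = (\<Sum>k\<le>Suc n. (a(Suc n := c * sqrt (fact (Suc n)))) k * hermite k t)" for t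
 proof -
  have "poly p t = poly p' t + c * poly (hermite_monic (Suc n)) t"
   by (simp only: p'_def poly_diff poly_smult)
  also have "c * poly (hermite_monic (Suc n)) t = c * sqrt (fact (Suc n)) * hermite (Suc n) t"
   by (simp only: hermite_def) (simp del: fact_Suc hermite_monic.simps)
  finally show ?thesis by (simp add: a)
 qed
 then show ?case by blast
qed

section \<open>Hermite polynomials of a Gaussian sequence\<close>

interpretation gauss: prob_space std_gauss by (rule prob_space_std_gauss)
interpretation gauss_product: product_prob_space "%_::nat. std_gauss" "UNIV :: nat set" ..

lemma gauss_seq_eq: "gauss_seq = (\<Pi>\<^sub>M j\<in>UNIV. std_gauss)" by (simp add: gauss_seq_def)

lemma prob_space_gauss_seq: "prob_space gauss_seq"
 unfolding gauss_seq_eq by (rule gauss_product.prob_space_axioms[unfolded gauss_product.P.prob_space_axioms]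
   | rule gauss_product.P.prob_space_axioms)+

interpretation gamma: prob_space gauss_seq by (rule prob_space_gauss_seq)

abbreviation H :: "(nat => nat) => (nat => real) => real" where "H \<equiv> hermite_multi"

abbreviation E :: "((nat => real) => real) => real" where "E f \<equiv> integral\<^sup>L gauss_seq f"

abbreviation hermite_sum :: "(nat => nat) set => ((nat => nat) => 'h::real_vector) => (nat => real) => 'h" where
 "hermite_sum \<Gamma> w y \<equiv> \<Sum>\<nu>\<in>\<Gamma>. H \<nu> y *\<^sub>R w \<nu>"

lemma space_gauss_seq [simp]: "space gauss_seq = UNIV"
 unfolding gauss_seq_eq by (simp add: space_PiM)

lemma measurable_coordinate [measurable]: "(%y. y j) \<in> borel_measurable gauss_seq"
proof -
 have "(%y. y j) \<in> measurable gauss_seq std_gauss"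
  unfolding gauss_seq_eq by (rule measurable_component_singleton) simp
 then show ?thesis by simp
qed

lemma measurable_into_gauss_seq:
 assumes "\<And>j. (%x. f x j) \<in> borel_measurable M"
 shows "f \<in> measurable M gauss_seq"
 unfolding gauss_seq_eq
 by (rule measurable_PiM_single') (use assms in auto)

lemma distr_coordinate: "distr gauss_seq borel (%y. y j) = std_gauss"
proof -
 have "distr gauss_seq std_gauss (%y. y j) = std_gauss"
  unfolding gauss_seq_eq by (rule gauss_product.PiM_component) simp
 moreover have "distr gauss_seq borel (%y. y j) = distr gauss_seq std_gauss (%y. y j)"
  by (rule distr_cong) auto
 ultimately show ?thesis by simp
qed

lemma integrable_coordinate:
 fixes f :: "real => real"
 assumes [measurable]: "f \<in> borel_measurable borel"
 shows "integrable gauss_seq (%y. f (y j)) \<longleftrightarrow> integrable std_gauss f"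
 by (subst distr_coordinate[of j, symmetric], subst integrable_distr_eq) auto

lemma integral_coordinate:
 fixes f :: "real => real"
 assumes [measurable]: "f \<in> borel_measurable borel"
 shows "E (%y. f (y j)) = integral\<^sup>L std_gauss f"
 by (subst distr_coordinate[of j, symmetric], subst integral_distr) auto

lemma indep_coordinates: "gamma.indep_vars (%_. borel) (%j y. y j) J"
proof -
 have "gamma.indep_vars (%_. borel) (%j y. y j) (UNIV :: nat set)"
 proof (subst gamma.indep_vars_iff_distr_eq_PiM')
  have "distr gauss_seq (\<Pi>\<^sub>M i\<in>UNIV. borel) (%y. y) = distr gauss_seq gauss_seq (%y. y)"
  proof (rule distr_cong)
   have "sets (\<Pi>\<^sub>M i\<in>(UNIV::nat set). borel :: real measure) = sets (\<Pi>\<^sub>M i\<in>UNIV. std_gauss)"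
    by (rule sets_PiM_cong) simp_all
   then show "sets (\<Pi>\<^sub>M i\<in>(UNIV::nat set). borel :: real measure) = sets gauss_seq"
    by (simp only: gauss_seq_eq)
  qed simp_all
  then show "distr gauss_seq (\<Pi>\<^sub>M i\<in>UNIV. borel) (%x. \<lambda>i\<in>UNIV. x i) = (\<Pi>\<^sub>M i\<in>UNIV. distr gauss_seq borel (%y. y i))"
   by (simp add: distr_coordinate distr_id gauss_seq_eq[symmetric] restrict_UNIV)
 qed auto
 then show ?thesis by (rule gamma.indep_vars_subset) simp
qed

lemma integral_prod_coordinates:
 fixes f :: "nat => real => real"
 assumes J: "finite J" and f: "\<And>j. j \<in> J ==> integrable std_gauss (f j)"
 shows integrable_prod_coordinates: "integrable gauss_seq (%y. \<Prod>j\<in>J. f j (y j))"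
  and "E (%y. (\<Prod>j\<in>J. f j (y j))) = (\<Prod>j\<in>J. integral\<^sup>L std_gauss (f j))"
proof -
 have m: "f j \<in> borel_measurable borel" if "j \<in> J" for j
  using borel_measurable_integrable[OF f[OF that]] by simp
 have ind: "gamma.indep_vars (%_. borel) (%j y. f j (y j)) J"
  by (rule gamma.indep_vars_compose2[OF indep_coordinates]) (use m in auto)
 have int: "integrable gauss_seq (%y. f j (y j))" if "j \<in> J" for j
  using f[OF that] integrable_coordinate[OF m[OF that]] by simp
 show "integrable gauss_seq (%y. \<Prod>j\<in>J. f j (y j))"
  by (rule gamma.indep_vars_integrable[OF J ind int])
 have "E (%y. (\<Prod>j\<in>J. f j (y j))) = (\<Prod>j\<in>J. \<integral>y. f j (y j) \<partial>gauss_seq)"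
  by (rule gamma.indep_vars_lebesgue_integral[OF J ind int])
 also have "\<dots> = (\<Prod>j\<in>J. integral\<^sup>L std_gauss (f j))"
  by (intro prod.cong refl integral_coordinate m)
 finally show "E (%y. (\<Prod>j\<in>J. f j (y j))) = (\<Prod>j\<in>J. integral\<^sup>L std_gauss (f j))" .
qed

lemma measurable_upd_coordinate [measurable]:
 "(%(y, t). y(j := t)) \<in> measurable (gauss_seq \<Otimes>\<^sub>M std_gauss) gauss_seq"
proof (rule measurable_into_gauss_seq)
 fix i
 show "(%x. (case x of (y, t) => y(j := t)) i) \<in> borel_measurable (gauss_seq \<Otimes>\<^sub>M std_gauss)"
 proof (cases "i = j")
  case True
  have "snd \<in> measurable (gauss_seq \<Otimes>\<^sub>M std_gauss) std_gauss" by simp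
  then have "snd \<in> borel_measurable (gauss_seq \<Otimes>\<^sub>M std_gauss)" by simp
  then show ?thesis using True by (simp add: case_prod_beta')
 next
  case False
  have "(%x. fst x i) \<in> borel_measurable (gauss_seq \<Otimes>\<^sub>M std_gauss)" by measurable
  then show ?thesis using False by (simp add: case_prod_beta')
 qed
qed

lemma prod_emb_gauss:
 fixes F :: "nat => real set"
 shows "prod_emb UNIV (%_. std_gauss) K (\<Pi>\<^sub>E j\<in>K. F j) = {y. \<forall>i\<in>K. y i \<in> F i}"
 by (subst prod_emb_PiE) (simp_all add: PiE_UNIV_domain Pi_def set_eq_iff Ball_def)

text \<open>
  Replacing one coordinate by an independent copy leaves the product measure unchanged; it is enough to check this on
  cylinders.  Together with Fubini it lets one-dimensional integration by parts act on a single coordinate of the sequence.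
\<close>

lemma gauss_seq_resample:
 "distr (gauss_seq \<Otimes>\<^sub>M std_gauss) gauss_seq (%(y, t). y(j := t)) = gauss_seq"
proof -
 have "distr (gauss_seq \<Otimes>\<^sub>M std_gauss) gauss_seq (%(y, t). y(j := t)) = (\<Pi>\<^sub>M j\<in>UNIV. std_gauss)"
 proof (rule gauss_product.PiM_eq)
 show "sets (distr (gauss_seq \<Otimes>\<^sub>M std_gauss) gauss_seq (%(y, t). y(j := t))) = sets (\<Pi>\<^sub>M j\<in>UNIV. std_gauss)"
  by (simp only: sets_distr gauss_seq_eq)
 fix J :: "nat set" and F :: "nat => real set"
 assume J: "finite J" "J \<subseteq> UNIV" and F: "\<And>j. j \<in> J ==> F j \<in> sets std_gauss"
 let ?E = "prod_emb UNIV (%_. std_gauss) J (\<Pi>\<^sub>E j\<in>J. F j)"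
 let ?E' = "prod_emb UNIV (%_. std_gauss) (J - {j}) (\<Pi>\<^sub>E j\<in>J-{j}. F j)"
 define A where "A = (if j \<in> J then F j else UNIV)"
 have E: "?E = {y. \<forall>i\<in>J. y i \<in> F i}" and E': "?E' = {y. \<forall>i\<in>J-{j}. y i \<in> F i}"
  by (rule prod_emb_gauss)+
 have sE: "?E \<in> sets gauss_seq" and sE': "?E' \<in> sets gauss_seq"
  unfolding gauss_seq_eq using J F by (auto intro!: sets_PiM_I)
 have sA: "A \<in> sets std_gauss" using F by (auto simp: A_def)
 have "emeasure (distr (gauss_seq \<Otimes>\<^sub>M std_gauss) gauss_seq (%(y, t). y(j := t))) ?E
   = emeasure (gauss_seq \<Otimes>\<^sub>M std_gauss) ((%(y, t). y(j := t)) -` ?E \<inter> space (gauss_seq \<Otimes>\<^sub>M std_gauss))"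
  by (rule emeasure_distr[OF measurable_upd_coordinate sE])
 also have "(%(y, t). y(j := t)) -` ?E \<inter> space (gauss_seq \<Otimes>\<^sub>M std_gauss) = ?E' \<times> A"
  unfolding E E' by (auto simp: space_pair_measure A_def split: if_splits)
 also have "emeasure (gauss_seq \<Otimes>\<^sub>M std_gauss) (?E' \<times> A) = emeasure gauss_seq ?E' * emeasure std_gauss A"
  by (rule gauss.emeasure_pair_measure_Times[OF sE' sA])
 also have "emeasure gauss_seq ?E' = (\<Prod>i\<in>J-{j}. emeasure std_gauss (F i))"
  unfolding gauss_seq_eq using J F by (intro gauss_product.emeasure_PiM_emb) auto
 also have "(\<Prod>i\<in>J-{j}. emeasure std_gauss (F i)) * emeasure std_gauss A = (\<Prod>i\<in>J. emeasure std_gauss (F i))"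
 proof (cases "j \<in> J")
  case True
  then show ?thesis using J(1) by (simp add: A_def prod.remove mult.commute)
 next
  case False
  then show ?thesis using gauss.emeasure_space_1 by (simp add: A_def)
 qed
 finally show "emeasure (distr (gauss_seq \<Otimes>\<^sub>M std_gauss) gauss_seq (%(y, t). y(j := t))) ?E
  = (\<Prod>i\<in>J. emeasure std_gauss (F i))" .
 qed
 then show ?thesis by (simp only: gauss_seq_eq)
qed

interpretation gamma_pair: pair_prob_space gauss_seq std_gauss ..

lemma
 fixes F :: "(nat => real) => real"
 assumes F: "integrable gauss_seq F"
 shows integral_resample: "integral\<^sup>L gauss_seq F = E (%y. (\<integral>t. F (y(j := t)) \<partial>std_gauss))"
  and AE_integrable_resample: "AE y in gauss_seq. integrable std_gauss (%t. F (y(j := t)))"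
proof -
 have i: "integrable (gauss_seq \<Otimes>\<^sub>M std_gauss) (%p. F ((%(y, t). y(j := t)) p))"
  by (rule integrable_distr[OF measurable_upd_coordinate]) (simp add: gauss_seq_resample F)
 have m: "F \<in> borel_measurable gauss_seq" using F by simp
 have "integral\<^sup>L gauss_seq F = integral\<^sup>L (gauss_seq \<Otimes>\<^sub>M std_gauss) (%p. F ((%(y, t). y(j := t)) p))"
  by (subst gauss_seq_resample[of j, symmetric], rule integral_distr[OF measurable_upd_coordinate m])
 also have "\<dots> = E (%y. (\<integral>t. F (y(j := t)) \<partial>std_gauss))"
  using gamma_pair.integral_fst'[OF i] by simp
 finally show "integral\<^sup>L gauss_seq F = E (%y. (\<integral>t. F (y(j := t)) \<partial>std_gauss))" .
 show "AE y in gauss_seq. integrable std_gauss (%t. F (y(j := t)))"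
  using gamma_pair.AE_integrable_fst'[OF i] by simp
qed

text \<open>
  The factors with index 0 are 1, so any finite set containing the support may carry the product.
\<close>

lemma hermite_multi_eq:
 assumes "finite J" "\<And>j. j \<notin> J ==> \<nu> j = 0"
 shows "H \<nu> y = (\<Prod>j\<in>J. hermite (\<nu> j) (y j))"
 unfolding hermite_multi_def by (rule prodinf_finite[OF assms(1)]) (simp add: assms(2))

lemma measurable_hermite_multi [measurable]:
 assumes "\<nu> \<in> multi_indices" shows "H \<nu> \<in> borel_measurable gauss_seq"
proof -
 have "H \<nu> = (%y. \<Prod>j | \<nu> j ~= 0. hermite (\<nu> j) (y j))"
  by (rule ext, rule hermite_multi_eq[OF multi_indicesD[OF assms]]) simp
 then show ?thesis by simp
qed

lemma
 assumes \<mu>: "\<mu> \<in> multi_indices" and \<nu>: "\<nu> \<in> multi_indices"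
 shows integrable_hermite_multi_mult: "integrable gauss_seq (%y. H \<mu> y * H \<nu> y)"
  and hermite_multi_orthonormal:
   "E (%y. H \<mu> y * H \<nu> y) = (if \<mu> = \<nu> then 1 else 0)"
proof -
 define J where "J = {j. \<mu> j ~= 0} \<union> {j. \<nu> j ~= 0}"
 have J: "finite J" using multi_indicesD[OF \<mu>] multi_indicesD[OF \<nu>] unfolding J_def by (rule finite_UnI)
 have eq: "H \<mu> y * H \<nu> y = (\<Prod>j\<in>J. hermite (\<mu> j) (y j) * hermite (\<nu> j) (y j))" for y
  by (subst (1 2) hermite_multi_eq[OF J]) (auto simp: J_def prod.distrib)
 have i: "integrable std_gauss (%t. hermite (\<mu> j) t * hermite (\<nu> j) t)" for j
  by (intro integrable_exp_growth exp_growth_mult exp_growth_hermite) measurable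
 show "integrable gauss_seq (%y. H \<mu> y * H \<nu> y)"
  unfolding eq by (rule integrable_prod_coordinates[OF J i])
 have "E (%y. H \<mu> y * H \<nu> y) = (\<Prod>j\<in>J. if \<mu> j = \<nu> j then 1 else 0)"
  unfolding eq by (subst integral_prod_coordinates[OF J i]) (simp add: hermite_orthonormal)
 also have "\<dots> = (if \<mu> = \<nu> then 1 else 0)"
 proof (cases "\<mu> = \<nu>")
  case False
  then obtain j where "\<mu> j ~= \<nu> j" by blast
  moreover then have "j \<in> J" by (auto simp: J_def)
  ultimately have "(\<Prod>j\<in>J. if \<mu> j = \<nu> j then 1 else (0::real)) = 0"
   using J by (intro prod_zero) auto
  then show ?thesis using False by simp
 qed simp
 finally show "E (%y. H \<mu> y * H \<nu> y) = (if \<mu> = \<nu> then 1 else 0)" .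
qed

lemma integrable_mult_of_squares:
 fixes f g :: "'m => real"
 assumes [measurable]: "f \<in> borel_measurable M" "g \<in> borel_measurable M"
  and i: "integrable M (%x. (f x)^2)" "integrable M (%x. (g x)^2)"
 shows "integrable M (%x. f x * g x)"
proof (rule Bochner_Integration.integrable_bound)
 show "integrable M (%x. (f x)^2 + (g x)^2)" using i by (rule Bochner_Integration.integrable_add)
 have "norm (f x * g x) <= norm ((f x)^2 + (g x)^2)" for x
 proof -
  have "2 * (\<bar>f x\<bar> * \<bar>g x\<bar>) <= (f x)^2 + (g x)^2"
   using sum_squares_bound[of "\<bar>f x\<bar>" "\<bar>g x\<bar>"] by (simp add: mult.assoc)
  moreover have "0 <= \<bar>f x\<bar> * \<bar>g x\<bar>" by simp
  ultimately have "\<bar>f x\<bar> * \<bar>g x\<bar> <= (f x)^2 + (g x)^2" by linarith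
  then show ?thesis by (simp add: abs_mult)
 qed
 then show "AE x in M. norm (f x * g x) <= norm ((f x)^2 + (g x)^2)" by (intro AE_I2)
qed measurable

text \<open>
  Split \<open>w\<close> into positive and negative part and compare the two laws of \<open>Y\<close> with these densities.  The exponential moments
  allow the characteristic functions to be expanded in power series, which have the same coefficients; equal characteristic
  functions give equal laws.
\<close>

lemma moments_determine_null:
 fixes w Y :: "'m => real"
 assumes [measurable]: "w \<in> borel_measurable M" "Y \<in> borel_measurable M"
  and int: "\<And>s. integrable M (%x. w x * exp (s * \<bar>Y x\<bar>))"
  and mom: "\<And>n. (\<integral>x. w x * Y x ^ n \<partial>M) = 0"
  and A: "A \<in> sets borel"
 shows "(\<integral>x. w x * indicator A (Y x) \<partial>M) = 0"
proof -
 note [measurable] = A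
 have iw: "integrable M w" using int[of 0] by simp
 define P N where "P x = max 0 (w x)" and "N x = max 0 (- w x)" for x
 have PN: "w x = P x - N x" "0 <= P x" "0 <= N x" "\<bar>P x\<bar> <= \<bar>w x\<bar>" "\<bar>N x\<bar> <= \<bar>w x\<bar>" for x
  by (auto simp: P_def N_def)
 have [measurable]: "P \<in> borel_measurable M" "N \<in> borel_measurable M" by (simp_all add: P_def[abs_def] N_def[abs_def])
 have iP: "integrable M P" and iN: "integrable M N" using iw by (simp_all add: P_def[abs_def] N_def[abs_def])
 define m where "m = integral\<^sup>L M P"
 have mN: "integral\<^sup>L M N = m"
 proof -
  have "integral\<^sup>L M w = integral\<^sup>L M P - integral\<^sup>L M N"
   unfolding PN(1)[abs_def] by (rule Bochner_Integration.integral_diff[OF iP iN])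
  then show ?thesis using mom[of 0] by (simp add: m_def)
 qed
 show ?thesis
 proof (cases "m = 0")
  case True
  have "AE x in M. P x = 0" "AE x in M. N x = 0"
   using True mN integral_nonneg_eq_0_iff_AE[OF iP] integral_nonneg_eq_0_iff_AE[OF iN] PN by (auto simp: m_def)
  then have "AE x in M. w x * indicator A (Y x) = 0" by eventually_elim (simp add: PN(1))
  then have "(\<integral>x. w x * indicator A (Y x) \<partial>M) = (\<integral>x. 0 \<partial>M)" by (intro integral_cong_AE) auto
  then show ?thesis by simp
 next
  case False
  moreover have "0 <= m" unfolding m_def by (intro integral_nonneg_AE AE_I2 PN)
  ultimately have m: "0 < m" by simp
  have law: "prob_space (density M (%x. ennreal (R x / m)))"
   if "integrable M R" "integral\<^sup>L M R = m" "\<And>x. 0 <= R x" for R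
  proof (rule prob_spaceI)
   have [measurable]: "R \<in> borel_measurable M" using that by simp
   have "emeasure (density M (%x. ennreal (R x / m))) (space M) = (\<integral>\<^sup>+x. ennreal (R x / m) \<partial>M)"
    by (subst emeasure_density) (auto intro!: nn_integral_cong)
   also have "\<dots> = ennreal (\<integral>x. R x / m \<partial>M)" using that m by (intro nn_integral_eq_integral) auto
   also have "(\<integral>x. R x / m \<partial>M) = 1" using that m by simp
   finally show "emeasure (density M (%x. ennreal (R x / m))) (space (density M (%x. ennreal (R x / m)))) = 1" by simp
  qed
  \<comment> \<open>the law of \<open>Y\<close> under the normalised density \<open>R\<close>\<close>
  define L where "L R = distr (density M (%x. ennreal (R x / m))) borel Y" for R
  have rd: "real_distribution (L P)" "real_distribution (L N)"
   unfolding L_def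
   by (auto intro!: prob_space.real_distribution_distr[OF law[OF iP m_def[symmetric] PN(2)]]
     prob_space.real_distribution_distr[OF law[OF iN mN PN(3)]])
  have ch: "char (L R) s = (\<integral>x. (R x / m) *\<^sub>R iexp (s * Y x) \<partial>M)"
   if [measurable]: "R \<in> borel_measurable M" and "\<And>x. 0 <= R x" for R s
   unfolding char_def L_def using that m
   by (subst integral_distr, simp, simp, subst integral_density) auto
  have bound: "norm (iexp r) <= 1" for r by simp
  have ii: "integrable M (%x. (R x / m) *\<^sub>R iexp (s * Y x))"
   if R: "integrable M R" for R s
  proof (rule Bochner_Integration.integrable_bound)
   show "integrable M (%x. R x / m)" using R by simp
   have [measurable]: "R \<in> borel_measurable M" using R by simp
   show "(%x. (R x / m) *\<^sub>R iexp (s * Y x)) \<in> borel_measurable M" by measurable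
  qed simp
  have zero: "(\<integral>x. w x *\<^sub>R iexp (s * Y x) \<partial>M) = 0" for s
  proof -
   define T where "T n x = (\<Sum>k<n. w x *\<^sub>R ((\<i> * complex_of_real (s * Y x)) ^ k /\<^sub>R fact k))" for n x
   have iY: "integrable M (%x. w x * Y x ^ k)" for k
   proof (rule Bochner_Integration.integrable_bound)
    show "integrable M (%x. fact k * (w x * exp (1 * \<bar>Y x\<bar>)))" by (intro integrable_mult_right int)
    have "norm (w x * Y x ^ k) <= norm (fact k * (w x * exp (1 * \<bar>Y x\<bar>)))" for x
    proof -
     have "\<bar>Y x\<bar> ^ k / fact k <= exp \<bar>Y x\<bar>"
     proof -
      have "(\<Sum>i\<in>{k}. \<bar>Y x\<bar> ^ i /\<^sub>R fact i) <= (\<Sum>i. \<bar>Y x\<bar> ^ i /\<^sub>R fact i)"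
       by (intro sum_le_suminf summable_exp_generic) auto
      then show ?thesis by (simp add: exp_def divide_inverse mult.commute)
     qed
     then have "\<bar>Y x\<bar> ^ k <= fact k * exp \<bar>Y x\<bar>" by (simp add: field_simps)
     then have "\<bar>w x\<bar> * \<bar>Y x\<bar> ^ k <= \<bar>w x\<bar> * (fact k * exp \<bar>Y x\<bar>)" by (intro mult_left_mono) auto
     then show ?thesis by (simp add: abs_mult power_abs mult.left_commute)
    qed
    then show "AE x in M. norm (w x * Y x ^ k) <= norm (fact k * (w x * exp (1 * \<bar>Y x\<bar>)))" by (intro AE_I2)
   qed measurable
   have term_eq: "w x *\<^sub>R ((\<i> * complex_of_real (s * Y x)) ^ k /\<^sub>R fact k)
     = ((\<i> * complex_of_real s) ^ k / fact k) * complex_of_real (w x * Y x ^ k)" for k x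
    by (simp add: scaleR_conv_of_real field_simps power_mult_distrib)
   have T0: "integral\<^sup>L M (T n) = 0" for n
   proof -
    have "integrable M (%x. ((\<i> * complex_of_real s) ^ k / fact k) * complex_of_real (w x * Y x ^ k))" for k
     by (intro integrable_mult_right integrable_of_real iY)
    moreover have "(\<integral>x. ((\<i> * complex_of_real s) ^ k / fact k) * complex_of_real (w x * Y x ^ k) \<partial>M) = 0" for k
     by (simp only: integral_mult_right_zero integral_complex_of_real mom of_real_0 mult_zero_right)
    ultimately show ?thesis
     unfolding T_def term_eq by (simp only: Bochner_Integration.integral_sum sum.neutral_const)
   qed
   have "(%n. integral\<^sup>L M (T n)) \<longlonglongrightarrow> (\<integral>x. w x *\<^sub>R iexp (s * Y x) \<partial>M)"
   proof (rule integral_dominated_convergence)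
    show "integrable M (%x. norm (w x * exp (\<bar>s\<bar> * \<bar>Y x\<bar>)))" using int by (rule integrable_norm)
    show "AE x in M. (%n. T n x) \<longlonglongrightarrow> w x *\<^sub>R iexp (s * Y x)"
     unfolding T_def scaleR_right.sum[symmetric]
     using exp_converges[of "\<i> * complex_of_real (s * Y x)" for x]
     by (intro AE_I2 tendsto_scaleR tendsto_const) (simp add: sums_def)
    have "norm (T n x) <= norm (w x * exp (\<bar>s\<bar> * \<bar>Y x\<bar>))" for n x
    proof -
     have "norm (T n x) <= (\<Sum>k<n. \<bar>w x\<bar> * ((\<bar>s\<bar> * \<bar>Y x\<bar>) ^ k /\<^sub>R fact k))"
      unfolding T_def by (rule order_trans[OF norm_sum]) (simp add: norm_power norm_mult abs_mult mult_ac)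
     also have "\<dots> = \<bar>w x\<bar> * (\<Sum>k<n. (\<bar>s\<bar> * \<bar>Y x\<bar>) ^ k /\<^sub>R fact k)" by (simp only: sum_distrib_left)
     also have "\<dots> <= \<bar>w x\<bar> * exp (\<bar>s\<bar> * \<bar>Y x\<bar>)"
      unfolding exp_def by (intro mult_left_mono sum_le_suminf summable_exp_generic) auto
     finally show ?thesis by (simp add: abs_mult)
    qed
    then show "AE x in M. norm (T n x) <= norm (w x * exp (\<bar>s\<bar> * \<bar>Y x\<bar>))" for n by (intro AE_I2)
   qed (unfold T_def, measurable)
   then show ?thesis unfolding T0 using LIMSEQ_unique tendsto_const by blast
  qed
  have "char (L P) = char (L N)"
  proof
   fix s
   have "char (L P) s - char (L N) s = (\<integral>x. (P x / m) *\<^sub>R iexp (s * Y x) - (N x / m) *\<^sub>R iexp (s * Y x) \<partial>M)"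
    unfolding ch[OF \<open>P \<in> borel_measurable M\<close> PN(2)] ch[OF \<open>N \<in> borel_measurable M\<close> PN(3)]
    by (rule Bochner_Integration.integral_diff[symmetric, OF ii[OF iP] ii[OF iN]])
   also have "\<dots> = (\<integral>x. (1 / m) *\<^sub>R (w x *\<^sub>R iexp (s * Y x)) \<partial>M)"
    by (intro Bochner_Integration.integral_cong) (auto simp: PN(1) scaleR_diff_left[symmetric] diff_divide_distrib)
   also have "\<dots> = (1 / m) *\<^sub>R (\<integral>x. w x *\<^sub>R iexp (s * Y x) \<partial>M)" by (rule integral_scaleR_right)
   finally show "char (L P) s = char (L N) s" unfolding zero by simp
  qed
  then have LPN: "L P = L N" by (rule Levy_uniqueness[OF rd])
  have LA: "(\<integral>t. indicator A t \<partial>L R) = (\<integral>x. R x * indicator A (Y x) \<partial>M) / m"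
   if [measurable]: "R \<in> borel_measurable M" and "\<And>x. 0 <= R x" for R :: "'m => real"
   unfolding L_def using that m
   by (subst integral_distr, simp, simp, subst integral_density) auto
  have "(\<integral>x. P x * indicator A (Y x) \<partial>M) / m = (\<integral>x. N x * indicator A (Y x) \<partial>M) / m"
   using LA[OF \<open>P \<in> borel_measurable M\<close> PN(2)] LA[OF \<open>N \<in> borel_measurable M\<close> PN(3)]
   unfolding LPN by simp
  then have "(\<integral>x. P x * indicator A (Y x) \<partial>M) = (\<integral>x. N x * indicator A (Y x) \<partial>M)"
   using m by simp
  moreover have "(\<integral>x. w x * indicator A (Y x) \<partial>M)
    = (\<integral>x. P x * indicator A (Y x) - N x * indicator A (Y x) \<partial>M)" by (simp add: PN(1) left_diff_distrib)
  moreover have "integrable M (%x. P x * indicator A (Y x))" "integrable M (%x. N x * indicator A (Y x))"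
   by (rule Bochner_Integration.integrable_bound[OF iP]; simp add: indicator_def PN)
    (rule Bochner_Integration.integrable_bound[OF iN]; simp add: indicator_def PN)
  ultimately show ?thesis by simp
 qed
qed

section \<open>Completeness of the Hermite polynomials\<close>

lemma integrable_square_hermite_multi:
 "\<nu> \<in> multi_indices ==> integrable gauss_seq (%y. (H \<nu> y)^2)"
 using integrable_hermite_multi_mult[of \<nu> \<nu>] by (simp add: power2_eq_square)

lemma integral_square_hermite_multi:
 "\<nu> \<in> multi_indices ==> E (%y. (H \<nu> y)^2) = 1"
 using hermite_multi_orthonormal[of \<nu> \<nu>] by (simp add: power2_eq_square)

text \<open>
  Monomials in finitely many coordinates are finite combinations of products of Hermite polynomials.
\<close>

lemma hermite_orthogonal_monomial:
 assumes w: "w \<in> borel_measurable gauss_seq" "integrable gauss_seq (%y. (w y)^2)"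
  and orth: "\<And>\<nu>. \<nu> \<in> multi_indices ==> E (%y. w y * H \<nu> y) = 0"
 shows "E (%y. w y * (\<Prod>j<N. y j ^ p j)) = 0"
proof -
 have "\<exists>a. \<forall>t. t ^ n = (\<Sum>k\<le>n. a k * hermite k t)" for n
  using poly_in_hermite_span[of "monom 1 n" n] by (simp add: degree_monom_le poly_monom)
 then obtain a where a: "\<And>n t. t ^ n = (\<Sum>k\<le>n. a n k * hermite k t)" by metis
 define P where "P j = (if j < N then p j else 0)" for j
 have J: "finite {..<N}" "\<And>j. j \<notin> {..<N} ==> P j = 0" by (auto simp: P_def)
 have supp: "\<mu> j = 0" if "\<mu> \<in> {..P}" "j \<notin> {..<N}" for \<mu> j
  using that J(2)[of j] by (auto simp: le_fun_def dest: spec[of _ j])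
 have PM: "P \<in> multi_indices"
  unfolding multi_indices_def mem_Collect_eq by (rule finite_subset[OF _ J(1)]) (auto simp: P_def)
 have eq: "(\<Prod>j<N. y j ^ p j) = (\<Sum>\<mu>\<in>{..P}. (\<Prod>j<N. a (p j) (\<mu> j)) * H \<mu> y)" for y
 proof -
  have "(\<Prod>j<N. y j ^ p j) = (\<Prod>j<N. \<Sum>k\<le>P j. a (p j) k * hermite k (y j))"
   using a by (intro prod.cong) (auto simp: P_def)
  also have "\<dots> = (\<Sum>\<mu>\<in>{..P}. \<Prod>j<N. a (p j) (\<mu> j) * hermite (\<mu> j) (y j))"
   by (rule sum_below_multi_index_prod[symmetric, OF J])
  also have "\<dots> = (\<Sum>\<mu>\<in>{..P}. (\<Prod>j<N. a (p j) (\<mu> j)) * H \<mu> y)"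
  proof (rule sum.cong[OF refl])
   fix \<mu> assume "\<mu> \<in> {..P}"
   then have "H \<mu> y = (\<Prod>j<N. hermite (\<mu> j) (y j))" by (intro hermite_multi_eq[OF J(1)] supp)
   then show "(\<Prod>j<N. a (p j) (\<mu> j) * hermite (\<mu> j) (y j)) = (\<Prod>j<N. a (p j) (\<mu> j)) * H \<mu> y"
    by (simp only: prod.distrib)
  qed
  finally show ?thesis .
 qed
 have PI: "\<mu> \<in> multi_indices" if "\<mu> \<in> {..P}" for \<mu> using multi_indices_le[OF PM] that by simp
 have "E (%y. w y * (\<Prod>j<N. y j ^ p j))
   = E (%y. (\<Sum>\<mu>\<in>{..P}. (\<Prod>j<N. a (p j) (\<mu> j)) * (w y * H \<mu> y)))"
  unfolding eq sum_distrib_left by (simp only: mult.left_commute)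
 also have "\<dots> = (\<Sum>\<mu>\<in>{..P}. \<integral>y. (\<Prod>j<N. a (p j) (\<mu> j)) * (w y * H \<mu> y) \<partial>gauss_seq)"
  by (intro Bochner_Integration.integral_sum integrable_mult_right
    integrable_mult_of_squares[OF w(1) measurable_hermite_multi w(2) integrable_square_hermite_multi] PI)
 also have "\<dots> = 0"
  by (intro sum.neutral ballI) (simp add: orth PI)
 finally show ?thesis .
qed

text \<open>
  Turns the powers of the coordinates into indicators, one coordinate at a time: the function \<open>w\<close> times the remaining factors has
  vanishing moments in the next coordinate, hence vanishes against every indicator of that coordinate.
\<close>

lemma hermite_orthogonal_cylinder:
 assumes w: "w \<in> borel_measurable gauss_seq" "integrable gauss_seq (%y. (w y)^2)"
  and orth: "\<And>\<nu>. \<nu> \<in> multi_indices ==> E (%y. w y * H \<nu> y) = 0"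
  and A: "\<And>j. A j \<in> sets borel"
 shows "E (%y. w y * ((\<Prod>j<m. indicator (A j) (y j)) * (\<Prod>j\<in>{m..<m + k}. y j ^ p j))) = 0"
proof (induction m arbitrary: k p)
 case 0
 have "{0..<0 + k} = {..<k}" by auto
 then show ?case using hermite_orthogonal_monomial[OF w orth, of p k] by simp
next
 case (Suc m)
 note [measurable] = w(1) A
 define v where "v y = w y * ((\<Prod>j<m. indicator (A j) (y j)) * (\<Prod>j\<in>{Suc m..<Suc m + k}. y j ^ p j))" for y
 have [measurable]: "v \<in> borel_measurable gauss_seq" unfolding v_def by measurable
 have "E (%y. v y * indicator (A m) (y m)) = 0"
 proof (rule moments_determine_null)
  show "integrable gauss_seq (%y. v y * exp (s * \<bar>y m\<bar>))" for s
  proof -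
   define G where "G y = (\<Prod>j\<in>{m..<Suc m + k}. (if j = m then exp (s * \<bar>y j\<bar>) else y j ^ p j))" for y
   have G: "G y = exp (s * \<bar>y m\<bar>) * (\<Prod>j\<in>{Suc m..<Suc m + k}. y j ^ p j)" for y
   proof -
    have "{m..<Suc m + k} = insert m {Suc m..<Suc m + k}" by auto
    moreover have "(\<Prod>j\<in>{Suc m..<Suc m + k}. (if j = m then exp (s * \<bar>y j\<bar>) else y j ^ p j))
      = (\<Prod>j\<in>{Suc m..<Suc m + k}. y j ^ p j)" by (rule prod.cong) auto
    ultimately show ?thesis unfolding G_def by (simp only: prod.insert finite_atLeastLessThan) simp
   qed
   have "integrable gauss_seq (%y. \<Prod>j\<in>{m..<Suc m + k}. (if j = m then exp (s * \<bar>y j\<bar>) else y j ^ p j)^2)"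
   proof (rule integrable_prod_coordinates)
    fix j
    show "integrable std_gauss (%t. (if j = m then exp (s * \<bar>t\<bar>) else t ^ p j)^2)"
     by (cases "j = m") (simp_all add: integrable_exp_growth exp_growth_power exp_growth_exp exp_growth_ident)
   qed simp
   then have G2: "integrable gauss_seq (%y. (G y)^2)" unfolding G_def prod_power_distrib .
   have [measurable]: "G \<in> borel_measurable gauss_seq" unfolding G by measurable
   have iwG: "integrable gauss_seq (%y. w y * G y)" by (rule integrable_mult_of_squares[OF w(1) _ w(2) G2]) measurable
   show ?thesis
   proof (rule Bochner_Integration.integrable_bound[OF iwG])
    show "(%y. v y * exp (s * \<bar>y m\<bar>)) \<in> borel_measurable gauss_seq" by measurable
    have "norm (v y * exp (s * \<bar>y m\<bar>)) <= norm (w y * G y)" for y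
    proof -
     have "v y * exp (s * \<bar>y m\<bar>) = (\<Prod>j<m. indicator (A j) (y j)) * (w y * G y)"
      by (simp add: v_def G mult_ac)
     moreover have "\<bar>\<Prod>j<m. indicator (A j) (y j)\<bar> <= (1::real)"
      unfolding abs_prod by (rule prod_le_1) (auto simp: indicator_def)
     ultimately show ?thesis
      using mult_right_mono[of "\<bar>\<Prod>j<m. indicator (A j) (y j)\<bar>" 1 "\<bar>w y * G y\<bar>"] by (simp add: abs_mult)
    qed
    then show "AE y in gauss_seq. norm (v y * exp (s * \<bar>y m\<bar>)) <= norm (w y * G y)" by (intro AE_I2)
   qed
  qed
  show "E (%y. v y * y m ^ n) = 0" for n
  proof -
   have "(\<Prod>j\<in>{m..<m + Suc k}. y j ^ (p(m := n)) j) = y m ^ n * (\<Prod>j\<in>{Suc m..<Suc m + k}. y j ^ p j)" for y :: "nat => real"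
   proof -
    have "{m..<m + Suc k} = insert m {Suc m..<Suc m + k}" by auto
    moreover have "(\<Prod>j\<in>{Suc m..<Suc m + k}. y j ^ (p(m := n)) j) = (\<Prod>j\<in>{Suc m..<Suc m + k}. y j ^ p j)"
     by (rule prod.cong) auto
    ultimately show ?thesis by (simp only:) (subst prod.insert_if, simp_all)
   qed
   then have "v y * y m ^ n = w y * ((\<Prod>j<m. indicator (A j) (y j)) * (\<Prod>j\<in>{m..<m + Suc k}. y j ^ (p(m := n)) j))" for y
    unfolding v_def by (simp only: mult_ac)
   then show ?thesis using Suc[of "p(m := n)" "Suc k"] by (simp only:)
  qed
  show "A m \<in> sets borel" by (rule A)
 qed measurable
 then show ?case by (simp add: v_def mult_ac)
qed

text \<open>
  A function orthogonal to all Hermite polynomials integrates to zero over all cylinders.  These generate the sigma algebra and are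
  stable under intersection, so the positive and the negative part are densities of the same measure.
\<close>

theorem hermite_total:
 assumes w: "w \<in> borel_measurable gauss_seq" "integrable gauss_seq (%y. (w y)^2)"
  and orth: "\<And>\<nu>. \<nu> \<in> multi_indices ==> E (%y. w y * H \<nu> y) = 0"
 shows "AE y in gauss_seq. w y = 0"
proof -
 note [measurable] = w(1)
 have iw: "integrable gauss_seq w"
  using integrable_mult_of_squares[OF w(1) _ w(2), of "%_. 1"] by simp
 define P N where "P y = max 0 (w y)" and "N y = max 0 (- w y)" for y
 have PN: "w y = P y - N y" "0 <= P y" "0 <= N y" for y by (auto simp: P_def N_def)
 have iP: "integrable gauss_seq P" and iN: "integrable gauss_seq N" using iw by (simp_all add: P_def[abs_def] N_def[abs_def])
 note [measurable] = borel_measurable_integrable[OF iP] borel_measurable_integrable[OF iN]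
 have em: "emeasure (density gauss_seq (%x. ennreal (R x))) A = ennreal (E (%x. R x * indicator A x))"
  if R: "integrable gauss_seq R" "\<And>x. 0 <= R x" and A: "A \<in> sets gauss_seq" for R A
 proof -
  note [measurable] = borel_measurable_integrable[OF R(1)] A
  have "emeasure (density gauss_seq (%x. ennreal (R x))) A = (\<integral>\<^sup>+x. ennreal (R x * indicator A x) \<partial>gauss_seq)"
   by (subst emeasure_density) (auto intro!: nn_integral_cong simp: indicator_def)
  also have "\<dots> = ennreal (E (%x. R x * indicator A x))"
   using R A by (intro nn_integral_eq_integral integrable_real_mult_indicator) (auto simp: indicator_def)
  finally show ?thesis .
 qed
 have dP: "E (%x. P x * indicator A x) - E (%x. N x * indicator A x)
   = E (%x. w x * indicator A x)" if "A \<in> sets gauss_seq" for A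
  by (subst Bochner_Integration.integral_diff[symmetric])
   (auto intro!: integrable_real_mult_indicator iP iN that simp: PN(1) left_diff_distrib)
 have dens_eq: "density gauss_seq (%x. ennreal (P x)) = density gauss_seq (%x. ennreal (N x))"
 proof (rule measure_eqI_PiM_infinite[where I = UNIV and M = "%_. std_gauss"])
  show "sets (density gauss_seq (%x. ennreal (P x))) = sets (\<Pi>\<^sub>M j\<in>UNIV. std_gauss)"
   "sets (density gauss_seq (%x. ennreal (N x))) = sets (\<Pi>\<^sub>M j\<in>UNIV. std_gauss)"
   by (simp_all only: sets_density gauss_seq_eq)
  show "finite_measure (density gauss_seq (%x. ennreal (P x)))"
   by (rule finite_measureI) (simp add: em[OF iP PN(2) sets.top, simplified])
  fix F :: "nat => real set" and J :: "nat set"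
  assume J: "finite J" and F: "\<And>i. i \<in> J ==> F i \<in> sets std_gauss"
  let ?E = "prod_emb UNIV (%_. std_gauss) J (Pi\<^sub>E J F)"
  have E: "?E \<in> sets gauss_seq" unfolding gauss_seq_eq using J F by (intro sets_PiM_I) auto
  obtain m where m: "J \<subseteq> {..<m}" using finite_nat_iff_bounded J by blast
  define A where "A j = (if j \<in> J then F j else UNIV)" for j
  have "E (%y. w y * ((\<Prod>j<m. indicator (A j) (y j)) * (\<Prod>j\<in>{m..<m + 0}. y j ^ 0))) = 0"
   by (rule hermite_orthogonal_cylinder[OF w orth]) (use F in \<open>auto simp: A_def\<close>)
  moreover have "(\<Prod>j<m. indicator (A j) (y j)) = (indicator ?E y :: real)" for y
  proof -
   have "(\<forall>j<m. y j \<in> A j) \<longleftrightarrow> y \<in> ?E" unfolding prod_emb_gauss using m by (auto simp: A_def)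
   then show ?thesis by (auto simp: indicator_def prod_zero_iff)
  qed
  ultimately have "E (%y. w y * indicator ?E y) = 0" by simp
  then have "E (%x. P x * indicator ?E x) = E (%x. N x * indicator ?E x)" using dP[OF E] by simp
  then show "emeasure (density gauss_seq (%x. ennreal (P x))) ?E = emeasure (density gauss_seq (%x. ennreal (N x))) ?E"
   by (simp only: em[OF iP PN(2) E] em[OF iN PN(3) E])
 qed
 show ?thesis
 proof (rule gamma.density_zero[OF iw])
  fix A assume A: "A \<in> sets gauss_seq"
  have "ennreal (E (%x. P x * indicator A x)) = ennreal (E (%x. N x * indicator A x))"
   by (simp only: em[OF iP PN(2) A, symmetric] em[OF iN PN(3) A, symmetric] dens_eq)
  moreover have "0 <= E (%x. P x * indicator A x)" "0 <= E (%x. N x * indicator A x)"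
   by (auto intro!: integral_nonneg_AE mult_nonneg_nonneg PN)
  ultimately have "E (%x. P x * indicator A x) = E (%x. N x * indicator A x)" by simp
  then show "set_lebesgue_integral gauss_seq A w = 0"
   using dP[OF A] by (simp add: set_lebesgue_integral_def mult.commute)
 qed
qed

text \<open>
  Pythagoras for a finite combination with arbitrary coefficients.
\<close>

lemma hermite_distance:
 assumes f: "f \<in> borel_measurable gauss_seq" "integrable gauss_seq (%y. (f y)^2)"
  and \<Gamma>: "finite \<Gamma>" "\<Gamma> \<subseteq> multi_indices"
 defines "h \<equiv> %\<nu>. \<integral>y. f y * H \<nu> y \<partial>gauss_seq"
 shows "integrable gauss_seq (%y. (f y - (\<Sum>\<nu>\<in>\<Gamma>. a \<nu> * H \<nu> y))^2)"
  and "E (%y. (f y - (\<Sum>\<nu>\<in>\<Gamma>. a \<nu> * H \<nu> y))^2)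
   = E (%y. (f y)^2) - 2 * (\<Sum>\<nu>\<in>\<Gamma>. a \<nu> * h \<nu>) + (\<Sum>\<nu>\<in>\<Gamma>. (a \<nu>)^2)"
proof -
 have M: "\<nu> \<in> multi_indices" if "\<nu> \<in> \<Gamma>" for \<nu> using that \<Gamma> by blast
 have expand: "(f y - (\<Sum>\<nu>\<in>\<Gamma>. a \<nu> * H \<nu> y))^2 = (f y)^2 - 2 * (\<Sum>\<nu>\<in>\<Gamma>. a \<nu> * (f y * H \<nu> y))
   + (\<Sum>\<nu>\<in>\<Gamma>. \<Sum>\<mu>\<in>\<Gamma>. (a \<nu> * a \<mu>) * (H \<nu> y * H \<mu> y))" for y
  by (simp add: power2_diff power2_eq_square[of "sum _ _"] sum_product sum_distrib_left mult_ac)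
 have i: "integrable gauss_seq (%y. f y * H \<nu> y)" if "\<nu> \<in> \<Gamma>" for \<nu>
  by (rule integrable_mult_of_squares[OF f(1) measurable_hermite_multi f(2) integrable_square_hermite_multi]) (use M that in auto)
 have i1: "integrable gauss_seq (%y. \<Sum>\<nu>\<in>\<Gamma>. a \<nu> * (f y * H \<nu> y))"
  by (intro Bochner_Integration.integrable_sum integrable_mult_right i)
 have i2: "integrable gauss_seq (%y. \<Sum>\<nu>\<in>\<Gamma>. \<Sum>\<mu>\<in>\<Gamma>. (a \<nu> * a \<mu>) * (H \<nu> y * H \<mu> y))"
  by (intro Bochner_Integration.integrable_sum integrable_mult_right integrable_hermite_multi_mult M)
 show "integrable gauss_seq (%y. (f y - (\<Sum>\<nu>\<in>\<Gamma>. a \<nu> * H \<nu> y))^2)"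
  unfolding expand
  by (intro Bochner_Integration.integrable_add Bochner_Integration.integrable_diff integrable_mult_right f(2) i1 i2)
 have s1: "E (%y. (\<Sum>\<nu>\<in>\<Gamma>. a \<nu> * (f y * H \<nu> y))) = (\<Sum>\<nu>\<in>\<Gamma>. a \<nu> * h \<nu>)"
  by (subst Bochner_Integration.integral_sum) (auto intro!: integrable_mult_right i simp: h_def)
 have s2: "E (%y. (\<Sum>\<nu>\<in>\<Gamma>. \<Sum>\<mu>\<in>\<Gamma>. (a \<nu> * a \<mu>) * (H \<nu> y * H \<mu> y))) = (\<Sum>\<nu>\<in>\<Gamma>. (a \<nu>)^2)"
 proof -
  have "E (%y. (\<Sum>\<nu>\<in>\<Gamma>. \<Sum>\<mu>\<in>\<Gamma>. (a \<nu> * a \<mu>) * (H \<nu> y * H \<mu> y)))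
    = (\<Sum>\<nu>\<in>\<Gamma>. \<Sum>\<mu>\<in>\<Gamma>. \<integral>y. (a \<nu> * a \<mu>) * (H \<nu> y * H \<mu> y) \<partial>gauss_seq)"
   by (subst Bochner_Integration.integral_sum
     , (intro Bochner_Integration.integrable_sum integrable_mult_right integrable_hermite_multi_mult M; assumption)
     , intro sum.cong refl Bochner_Integration.integral_sum integrable_mult_right integrable_hermite_multi_mult M; assumption)
  also have "\<dots> = (\<Sum>\<nu>\<in>\<Gamma>. \<Sum>\<mu>\<in>\<Gamma>. if \<nu> = \<mu> then a \<nu> * a \<mu> else 0)"
   by (intro sum.cong refl) (simp add: hermite_multi_orthonormal M)
  also have "\<dots> = (\<Sum>\<nu>\<in>\<Gamma>. (a \<nu>)^2)" using \<Gamma>(1) by (simp add: power2_eq_square)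
  finally show ?thesis .
 qed
 show "E (%y. (f y - (\<Sum>\<nu>\<in>\<Gamma>. a \<nu> * H \<nu> y))^2)
   = E (%y. (f y)^2) - 2 * (\<Sum>\<nu>\<in>\<Gamma>. a \<nu> * h \<nu>) + (\<Sum>\<nu>\<in>\<Gamma>. (a \<nu>)^2)"
  unfolding expand s1[symmetric] s2[symmetric]
  by (simp add: i1 i2 f(2))
qed

text \<open>
  The partial Hermite sums converge in mean square to some limit, since their coefficients are square summable; the difference
  to that limit is orthogonal to all Hermite polynomials, hence null.  Exhausting the square sum of the coefficients by a sequence of
  finite sets avoids enumerating the multi-indices.
\<close>

lemma hermite_dense:
 assumes f: "f \<in> borel_measurable gauss_seq" "integrable gauss_seq (%y. (f y)^2)" and \<epsilon>: "0 < (\<epsilon>::real)"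
 shows "\<exists>\<Gamma> a. finite \<Gamma> \<and> \<Gamma> \<subseteq> multi_indices \<and>
  E (%y. (f y - (\<Sum>\<nu>\<in>\<Gamma>. a \<nu> * H \<nu> y))^2) < \<epsilon>"
proof -
 note [measurable] = f(1)
 define h where "h \<nu> = E (%y. f y * H \<nu> y)" for \<nu>
 define S where "S \<Gamma> y = (\<Sum>\<nu>\<in>\<Gamma>. h \<nu> * H \<nu> y)" for \<Gamma> y
 define \<F> where "\<F> = {\<Gamma>. finite \<Gamma> \<and> \<Gamma> \<subseteq> multi_indices}"
 define e where "e \<Gamma> = (\<Sum>\<nu>\<in>\<Gamma>. (h \<nu>)^2)" for \<Gamma>
 have dist: "E (%y. (f y - S \<Gamma> y)^2) = E (%y. (f y)^2) - e \<Gamma>" if "\<Gamma> \<in> \<F>" for \<Gamma>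
  using hermite_distance(2)[OF f, of \<Gamma> h] that unfolding S_def \<F>_def e_def h_def[symmetric]
  by (simp add: power2_eq_square)
 have bessel: "e \<Gamma> <= E (%y. (f y)^2)" if "\<Gamma> \<in> \<F>" for \<Gamma>
 proof -
  have "0 <= E (%y. (f y - S \<Gamma> y)^2)" by (intro integral_nonneg_AE) simp
  then show ?thesis using dist[OF that] by simp
 qed
 define s where "s = Sup (e ` \<F>)"
 \<comment> \<open>the square sum of all coefficients is finite by Bessel's inequality\<close>
 have bdd: "bdd_above (e ` \<F>)" using bessel by (auto intro!: bdd_aboveI2)
 have les: "e \<Gamma> <= s" if "\<Gamma> \<in> \<F>" for \<Gamma> unfolding s_def using that bdd by (auto intro: cSup_upper)
 have ne: "e ` \<F> ~= {}" by (auto simp: \<F>_def)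
 have "\<exists>\<Gamma>\<in>\<F>. s - (1/4)^k < e \<Gamma>" for k :: nat
 proof -
  have "s - (1/4)^k < Sup (e ` \<F>)" by (simp add: s_def)
  then show ?thesis using less_cSupD[OF ne] by auto
 qed
 then obtain \<Gamma>0 where \<Gamma>0: "\<And>k::nat. \<Gamma>0 k \<in> \<F>" "\<And>k. s - (1/4)^k < e (\<Gamma>0 k)" by metis
 define \<Gamma> where "\<Gamma> k = (\<Union>i\<le>k. \<Gamma>0 i)" for k
 have \<Gamma>F: "\<Gamma> k \<in> \<F>" for k using \<Gamma>0(1) by (auto simp: \<Gamma>_def \<F>_def)
 have \<Gamma>mono: "\<Gamma> k \<subseteq> \<Gamma> l" if "k <= l" for k l using that by (force simp: \<Gamma>_def)
 have emono: "e A <= e B" if "A \<subseteq> B" "B \<in> \<F>" for A B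
  using that unfolding e_def \<F>_def by (intro sum_mono2) auto
 have \<Gamma>s: "s - (1/4)^k < e (\<Gamma> k)" for k
 proof -
  have "\<Gamma>0 k \<subseteq> \<Gamma> k" by (auto simp: \<Gamma>_def)
  from emono[OF this \<Gamma>F] show ?thesis using \<Gamma>0(2)[of k] by linarith
 qed
 have diff: "e (B - \<Gamma> k) <= (1/4)^k" if "\<Gamma> k \<subseteq> B" "B \<in> \<F>" for B k
 proof -
  have "e (B - \<Gamma> k) = e B - e (\<Gamma> k)" using that unfolding e_def \<F>_def by (subst sum_diff) auto
  then show ?thesis using les[OF that(2)] \<Gamma>s[of k] by linarith
 qed
 have [measurable]: "S \<Delta> \<in> borel_measurable gauss_seq" if "\<Delta> \<in> \<F>" for \<Delta>
  unfolding S_def using that by (intro borel_measurable_sum borel_measurable_times borel_measurable_const measurable_hermite_multi) (auto simp: \<F>_def)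
 have [measurable]: "S (\<Gamma> k) \<in> borel_measurable gauss_seq" for k using \<Gamma>F by simp
 have zero2: "integrable gauss_seq (%y. (0::real)^2)" by simp
 have Snorm: "integrable gauss_seq (%y. (S \<Delta> y)^2)" "E (%y. (S \<Delta> y)^2) = e \<Delta>" if "\<Delta> \<in> \<F>" for \<Delta>
  using hermite_distance[OF borel_measurable_const zero2, of \<Delta> h] that
  unfolding S_def[symmetric] \<F>_def e_def by simp_all
 have nn: "(\<integral>\<^sup>+y. ennreal ((norm (S (\<Gamma> l) y - S (\<Gamma> k) y))^2) \<partial>gauss_seq) <= ennreal ((1/4)^k)" if "k <= l" for k l
 proof -
  have "S (\<Gamma> l) y - S (\<Gamma> k) y = S (\<Gamma> l - \<Gamma> k) y" for y
   using \<Gamma>F[of l] \<Gamma>mono[OF that] unfolding S_def \<F>_def by (subst sum_diff) auto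
  moreover have D: "\<Gamma> l - \<Gamma> k \<in> \<F>" using \<Gamma>F[of l] by (auto simp: \<F>_def)
  ultimately have "(\<integral>\<^sup>+y. ennreal ((norm (S (\<Gamma> l) y - S (\<Gamma> k) y))^2) \<partial>gauss_seq) = ennreal (e (\<Gamma> l - \<Gamma> k))"
   using Snorm[OF D] by (simp add: nn_integral_eq_integral)
  then show ?thesis using diff[OF \<Gamma>mono[OF that] \<Gamma>F] by (simp add: ennreal_leI)
 qed
 obtain G where G [measurable]: "G \<in> borel_measurable gauss_seq"
  and Gd: "\<And>k. (\<integral>\<^sup>+y. ennreal ((norm (G y - S (\<Gamma> k) y))^2) \<partial>gauss_seq) <= ennreal ((1/4)^k)"
  using rapid_L2_limit[of "%k. S (\<Gamma> k)" gauss_seq, OF _ nn] by (metis \<open>\<And>k. S (\<Gamma> k) \<in> borel_measurable gauss_seq\<close>)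
 have Gk: "integrable gauss_seq (%y. (G y - S (\<Gamma> k) y)^2)" "E (%y. (G y - S (\<Gamma> k) y)^2) <= (1/4)^k" for k
 proof -
  show i: "integrable gauss_seq (%y. (G y - S (\<Gamma> k) y)^2)"
   by (rule integrableI_nonneg) (use le_less_trans[OF Gd[of k] ennreal_less_top] in \<open>auto simp: top.not_eq_extremum\<close>)
  have "ennreal (E (%y. (G y - S (\<Gamma> k) y)^2)) <= ennreal ((1/4)^k)"
   using Gd[of k] nn_integral_eq_integral[OF i] by simp
  then show "E (%y. (G y - S (\<Gamma> k) y)^2) <= (1/4)^k" by simp
 qed
 define w where "w y = f y - G y" for y
 have [measurable]: "w \<in> borel_measurable gauss_seq" by (simp add: w_def[abs_def])
 have sq_diff: "integrable gauss_seq (%y. (a y - b y)^2)"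
  if [measurable]: "a \<in> borel_measurable gauss_seq" "b \<in> borel_measurable gauss_seq"
   and "integrable gauss_seq (%y. (a y)^2)" "integrable gauss_seq (%y. (b y)^2)" for a b :: "(nat => real) => real"
 proof -
  have "integrable gauss_seq (%y. (a y)^2 + (b y)^2 - 2 * (a y * b y))"
   using that integrable_mult_of_squares[OF that] by auto
  then show ?thesis by (simp add: power2_diff mult.assoc)
 qed
 have fS: "integrable gauss_seq (%y. (f y - S (\<Gamma> k) y)^2)" for k
  by (rule sq_diff[OF f(1) _ f(2) Snorm(1)[OF \<Gamma>F]]) simp
 have w2: "integrable gauss_seq (%y. (w y)^2)"
  using sq_diff[OF _ _ fS[of 0] Gk(1)[of 0]] by (simp add: w_def)
 have orth: "E (%y. w y * H \<nu> y) = 0" if \<nu>: "\<nu> \<in> multi_indices" for \<nu>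
 proof -
  note [measurable] = measurable_hermite_multi[OF \<nu>]
  have le: "\<bar>\<integral>y. w y * H \<nu> y \<partial>gauss_seq\<bar> <= 2 * (1/2)^k" for k
  proof -
   have i1: "integrable gauss_seq (%y. (f y - S (\<Gamma> k) y) * H \<nu> y)"
    by (rule integrable_mult_of_squares[OF _ _ fS integrable_square_hermite_multi[OF \<nu>]]) auto
   have i2: "integrable gauss_seq (%y. (G y - S (\<Gamma> k) y) * H \<nu> y)"
    by (rule integrable_mult_of_squares[OF _ _ Gk(1) integrable_square_hermite_multi[OF \<nu>]]) auto
   have "E (%y. w y * H \<nu> y) = E (%y. (f y - S (\<Gamma> k) y) * H \<nu> y)
     - E (%y. (G y - S (\<Gamma> k) y) * H \<nu> y)"
    unfolding Bochner_Integration.integral_diff[OF i1 i2, symmetric] by (simp add: w_def left_diff_distrib)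
   moreover have "\<bar>\<integral>y. (f y - S (\<Gamma> k) y) * H \<nu> y \<partial>gauss_seq\<bar> <= (1/2)^k"
   proof -
    have if1: "integrable gauss_seq (%y. f y * H \<nu> y)"
     by (rule integrable_mult_of_squares[OF f(1) _ f(2) integrable_square_hermite_multi[OF \<nu>]]) simp
    have if2: "integrable gauss_seq (%y. h \<mu> * (H \<mu> y * H \<nu> y))" if "\<mu> \<in> \<Gamma> k" for \<mu>
     using \<Gamma>F[of k] that \<nu> by (intro integrable_mult_right integrable_hermite_multi_mult) (auto simp: \<F>_def)
    have "E (%y. (f y - S (\<Gamma> k) y) * H \<nu> y)
      = E (%y. f y * H \<nu> y - (\<Sum>\<mu>\<in>\<Gamma> k. h \<mu> * (H \<mu> y * H \<nu> y)))"
     by (simp only: S_def left_diff_distrib sum_distrib_right mult.assoc)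
    also have "\<dots> = h \<nu> - (\<Sum>\<mu>\<in>\<Gamma> k. \<integral>y. h \<mu> * (H \<mu> y * H \<nu> y) \<partial>gauss_seq)"
     by (subst Bochner_Integration.integral_diff[OF if1 Bochner_Integration.integrable_sum[OF if2]], assumption)
      (simp only: h_def[symmetric] Bochner_Integration.integral_sum[OF if2])
    also have "(\<Sum>\<mu>\<in>\<Gamma> k. \<integral>y. h \<mu> * (H \<mu> y * H \<nu> y) \<partial>gauss_seq) = (\<Sum>\<mu>\<in>\<Gamma> k. if \<mu> = \<nu> then h \<nu> else 0)"
     using \<Gamma>F[of k] \<nu> by (intro sum.cong refl) (auto simp: \<F>_def hermite_multi_orthonormal)
    also have "\<dots> = (if \<nu> \<in> \<Gamma> k then h \<nu> else 0)" using \<Gamma>F[of k] by (simp add: \<F>_def)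
    finally have eq: "E (%y. (f y - S (\<Gamma> k) y) * H \<nu> y) = (if \<nu> \<in> \<Gamma> k then 0 else h \<nu>)" by simp
    have "(h \<nu>)^2 <= ((1/2)^k)^2" if n: "\<nu> \<notin> \<Gamma> k"
    proof -
     have "e (insert \<nu> (\<Gamma> k) - \<Gamma> k) <= (1/4)^k" using \<Gamma>F[of k] \<nu> by (intro diff) (auto simp: \<F>_def)
     moreover have "insert \<nu> (\<Gamma> k) - \<Gamma> k = {\<nu>}" using n by auto
     ultimately show ?thesis by (simp add: e_def power2_eq_square flip: power_mult_distrib)
    qed
    then have "\<bar>h \<nu>\<bar> <= (1/2)^k" if "\<nu> \<notin> \<Gamma> k" using that abs_le_square_iff[of "h \<nu>" "(1/2)^k"] by simp
    then show ?thesis unfolding eq by simp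
   qed
   moreover have "\<bar>\<integral>y. (G y - S (\<Gamma> k) y) * H \<nu> y \<partial>gauss_seq\<bar> <= (1/2)^k"
   proof -
    have "\<bar>\<integral>y. (G y - S (\<Gamma> k) y) * H \<nu> y \<partial>gauss_seq\<bar>
      <= E (%y. \<bar>(G y - S (\<Gamma> k) y) * H \<nu> y\<bar>)" by (rule integral_abs_bound)
    also have "\<dots> <= E (%y. 2^k / 2 * (G y - S (\<Gamma> k) y)^2 + (1/2)^k / 2 * (H \<nu> y)^2)"
    proof (rule integral_mono)
     show "integrable gauss_seq (%y. \<bar>(G y - S (\<Gamma> k) y) * H \<nu> y\<bar>)" using i2 by (rule integrable_abs)
     show "integrable gauss_seq (%y. 2^k / 2 * (G y - S (\<Gamma> k) y)^2 + (1/2)^k / 2 * (H \<nu> y)^2)"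
      by (intro Bochner_Integration.integrable_add integrable_mult_right Gk integrable_square_hermite_multi \<nu>)
     have am: "\<bar>a * b\<bar> <= 2^k / 2 * a^2 + (1/2)^k / 2 * b^2" for a b :: real
     proof -
      have "0 <= (2^k * \<bar>a\<bar> - \<bar>b\<bar>)^2" by simp
      then have "2 * 2^k * (\<bar>a\<bar> * \<bar>b\<bar>) <= 2^k * 2^k * a^2 + b^2"
       by (simp add: power2_diff power_mult_distrib power2_eq_square[of "2^k"] mult_ac)
      then show ?thesis by (simp add: abs_mult field_simps power_one_over)
     qed
     show "\<bar>(G y - S (\<Gamma> k) y) * H \<nu> y\<bar> <= 2^k / 2 * (G y - S (\<Gamma> k) y)^2 + (1/2)^k / 2 * (H \<nu> y)^2" for y
      by (rule am)
    qed
    also have "\<dots> = 2^k / 2 * E (%y. (G y - S (\<Gamma> k) y)^2) + (1/2)^k / 2"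
     using Gk(1)[of k] integrable_square_hermite_multi[OF \<nu>] integral_square_hermite_multi[OF \<nu>] by simp
    also have "\<dots> <= 2^k / 2 * (1/4)^k + (1/2)^k / 2"
     using Gk(2)[of k] by (intro add_mono mult_left_mono) auto
    also have "\<dots> = (1/2)^k"
    proof -
     have "(2::real)^k * (1/4)^k = (1/2)^k" by (simp flip: power_mult_distrib)
     then show ?thesis by simp
    qed
    finally show ?thesis .
   qed
   ultimately show ?thesis by linarith
  qed
  have lim: "(%k. 2 * (1/2::real)^k) \<longlonglongrightarrow> 2 * 0"
   by (intro tendsto_mult tendsto_const LIMSEQ_realpow_zero) auto
  have "\<bar>\<integral>y. w y * H \<nu> y \<partial>gauss_seq\<bar> <= 2 * 0"
   by (rule LIMSEQ_le_const[OF lim]) (use le in blast)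
  then show ?thesis by simp
 qed
 have w0: "AE y in gauss_seq. w y = 0" by (rule hermite_total[OF _ w2 orth]) simp
 obtain k where k: "(1/4::real)^k < \<epsilon>" using real_arch_pow_inv[OF \<epsilon>, of "1/4"] by auto
 have "E (%y. (f y - S (\<Gamma> k) y)^2) = E (%y. (G y - S (\<Gamma> k) y)^2)"
 proof (rule integral_cong_AE)
  show "AE y in gauss_seq. (f y - S (\<Gamma> k) y)^2 = (G y - S (\<Gamma> k) y)^2"
   using w0 by eventually_elim (simp add: w_def)
 qed measurable
 also have "\<dots> < \<epsilon>" using Gk(2)[of k] k by linarith
 finally show ?thesis using \<Gamma>F[of k] unfolding \<F>_def S_def by blast
qed

section \<open>Smooth bumps and the fundamental lemma of the calculus of variations\<close>

abbreviation partial :: "('a::euclidean_space => real) => 'a => 'a => real" where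
 "partial \<phi> i \<equiv> (%x. frechet_derivative \<phi> (at x) i)"

lemma Ck_SucD: "Ck (Suc m) \<phi> ==> Ck m \<phi>"
proof (induction m arbitrary: \<phi>)
 case 0
 then show ?case by (auto intro!: differentiable_imp_continuous_on simp: differentiable_on_def intro: differentiable_at_withinI)
next
 case (Suc m)
 then show ?case by simp
qed

lemma Ck_const: "Ck m (%x. c)"
 by (induction m arbitrary: c) auto

lemma partial_add:
 assumes "\<And>x. \<phi> differentiable (at x)" "\<And>x. \<psi> differentiable (at x)"
 shows "partial (%x. \<phi> x + \<psi> x) i = (%x. partial \<phi> i x + partial \<psi> i x)"
proof
 fix x
 have "((%x. \<phi> x + \<psi> x) has_derivative (%h. frechet_derivative \<phi> (at x) h + frechet_derivative \<psi> (at x) h)) (at x)"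
  using assms by (intro has_derivative_add) (simp_all add: frechet_derivative_works)
 from frechet_derivative_at[OF this] show "partial (%x. \<phi> x + \<psi> x) i x = partial \<phi> i x + partial \<psi> i x"
  by (rule fun_cong[symmetric])
qed

lemma partial_mult:
 fixes \<phi> \<psi> :: "'a::euclidean_space => real"
 assumes "\<And>x. \<phi> differentiable (at x)" "\<And>x. \<psi> differentiable (at x)"
 shows "partial (%x. \<phi> x * \<psi> x) i = (%x. \<phi> x * partial \<psi> i x + partial \<phi> i x * \<psi> x)"
proof
 fix x
 have "((%x. \<phi> x * \<psi> x) has_derivative (%h. \<phi> x * frechet_derivative \<psi> (at x) h + frechet_derivative \<phi> (at x) h * \<psi> x)) (at x)"
  using assms by (intro has_derivative_mult) (simp_all add: frechet_derivative_works)
 from frechet_derivative_at[OF this] show "partial (%x. \<phi> x * \<psi> x) i x = \<phi> x * partial \<psi> i x + partial \<phi> i x * \<psi> x"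
  by (rule fun_cong[symmetric])
qed

lemma Ck_add: "Ck m \<phi> ==> Ck m \<psi> ==> Ck m (%x. \<phi> x + \<psi> x)"
proof (induction m arbitrary: \<phi> \<psi>)
 case 0 then show ?case by (auto intro: continuous_intros)
next
 case (Suc m)
 have d: "\<And>x. \<phi> differentiable (at x)" "\<And>x. \<psi> differentiable (at x)" using Suc.prems by auto
 show ?case unfolding Ck.simps partial_add[OF d] using Suc d by (auto intro: differentiable_add)
qed

lemma Ck_mult: "Ck m \<phi> ==> Ck m \<psi> ==> Ck m (%x. \<phi> x * \<psi> x)"
proof (induction m arbitrary: \<phi> \<psi>)
 case 0 then show ?case by (auto intro: continuous_intros)
next
 case (Suc m)
 have d: "\<And>x. \<phi> differentiable (at x)" "\<And>x. \<psi> differentiable (at x)" using Suc.prems by auto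
 have "Ck m (%x. \<phi> x * partial \<psi> i x + partial \<phi> i x * \<psi> x)" if "i \<in> Basis" for i
  using Suc.prems that Ck_SucD[OF Suc.prems(1)] Ck_SucD[OF Suc.prems(2)] by (intro Ck_add Suc.IH) auto
 then show ?case unfolding Ck.simps partial_mult[OF d] using d by (auto intro: differentiable_mult)
qed

lemma Ck_inner: "Ck m (%x. x \<bullet> i)"
proof (cases m)
 case (Suc n)
 have d: "((%x. x \<bullet> i) has_derivative (%h. h \<bullet> i)) (at x)" for x
  by (auto intro!: derivative_eq_intros)
 have "partial (%x. x \<bullet> i) k = (%x. k \<bullet> i)" for k
  by (rule ext) (simp add: frechet_derivative_at[OF d, symmetric])
 then show ?thesis using Suc d by (auto simp: Ck_const differentiable_def)
qed (auto intro: continuous_intros)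

text \<open>
  Iterated partial derivatives of a composition need only the chain rule when \<open>h\<close> lists all derivatives of the outer function.
\<close>

lemma Ck_compose:
 assumes h: "\<And>n t. (h n has_real_derivative h (Suc n) t) (at t)"
 shows "Ck m \<phi> ==> Ck m (%x. h n (\<phi> x))"
proof (induction m arbitrary: n)
 case 0
 have "continuous_on UNIV (h n)" using h by (meson DERIV_isCont continuous_at_imp_continuous_on)
 then show ?case using 0 by (auto intro: continuous_on_compose2)
next
 case (Suc m)
 have d: "((%x. h n (\<phi> x)) has_derivative (%k. h (Suc n) (\<phi> x) * frechet_derivative \<phi> (at x) k)) (at x)" for x
 proof -
  have "(\<phi> has_derivative frechet_derivative \<phi> (at x)) (at x)"
   using Suc.prems by (simp add: frechet_derivative_works)
  moreover have "(h n has_derivative (%t. h (Suc n) (\<phi> x) * t)) (at (\<phi> x))"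
   using h[of n "\<phi> x"] by (simp add: has_field_derivative_def)
  ultimately show ?thesis using has_derivative_compose by fastforce
 qed
 have "partial (%x. h n (\<phi> x)) i = (%x. h (Suc n) (\<phi> x) * partial \<phi> i x)" for i
  by (rule ext) (simp add: frechet_derivative_at[OF d, symmetric])
 moreover have "Ck m (%x. h (Suc n) (\<phi> x) * partial \<phi> i x)" if "i \<in> Basis" for i
  using Suc that Ck_SucD by (intro Ck_mult) auto
 ultimately show ?case using d by (auto simp: differentiable_def)
qed

lemma Ck_prod: "finite I ==> (\<And>i. i \<in> I ==> Ck m (f i)) ==> Ck m (%x. \<Prod>i\<in>I. f i x)"
 by (induction I rule: finite_induct) (auto intro: Ck_const Ck_mult)

text \<open>
  The \<open>n\<close>-th derivative of \<open>exp (- 1 / t)\<close> on the positive half-line is a polynomial in \<open>1 / t\<close> times that exponential.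
\<close>

primrec flat_poly :: "nat => real poly" where
 "flat_poly 0 = 1"
| "flat_poly (Suc n) = [:0, 0, 1:] * (flat_poly n - pderiv (flat_poly n))"

text \<open>
  The sequence of derivatives of the standard smooth function that is flat at 0.
\<close>

definition flat :: "nat => real => real" where
 "flat n t = (if 0 < t then poly (flat_poly n) (1 / t) * exp (- (1 / t)) else 0)"

lemma poly_times_exp_tendsto_0: "((%s. poly p s * exp (- s)) \<longlongrightarrow> 0) at_top" for p :: "real poly"
proof -
 have "((%s. \<Sum>i\<le>degree p. coeff p i * (s ^ i / exp s)) \<longlongrightarrow> (\<Sum>i\<le>degree p. coeff p i * 0)) at_top"
  by (intro tendsto_sum tendsto_mult tendsto_const tendsto_power_div_exp_0)
 moreover have "(\<Sum>i\<le>degree p. coeff p i * (s ^ i / exp s)) = poly p s * exp (- s)" for s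
  by (simp add: poly_altdef sum_distrib_right exp_minus divide_inverse mult.assoc)
 ultimately show ?thesis by simp
qed

lemma has_derivative_flat: "(flat n has_real_derivative flat (Suc n) t) (at t)"
proof -
 consider "t < 0" | "0 < t" | "t = 0" by linarith
 then show ?thesis
 proof cases
  case 1
  have "((%t. 0) has_real_derivative flat (Suc n) t) (at t)" using 1 by (simp add: flat_def)
  moreover have "\<forall>\<^sub>F s in nhds t. flat n s = 0"
   using eventually_nhds_in_open[of "{..<0}" t] 1 by (auto simp: flat_def elim!: eventually_mono)
  ultimately show ?thesis by (subst DERIV_cong_ev[OF refl _ refl])
 next
  case 2
  have "((%t. poly (flat_poly n) (1 / t) * exp (- (1 / t))) has_real_derivative flat (Suc n) t) (at t)"
   using 2 by (auto intro!: derivative_eq_intros poly_DERIV[THEN DERIV_chain2] simp: flat_def field_simps power2_eq_square)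
  moreover have "\<forall>\<^sub>F s in nhds t. flat n s = poly (flat_poly n) (1 / s) * exp (- (1 / s))"
   using eventually_nhds_in_open[of "{0<..}" t] 2 by (auto simp: flat_def elim!: eventually_mono)
  ultimately show ?thesis by (subst DERIV_cong_ev[OF refl _ refl])
 next
  case 3
  have "((%t. poly (pCons 0 (flat_poly n)) (inverse t) * exp (- inverse t)) \<longlongrightarrow> 0) (at_right 0)"
   by (rule filterlim_compose[OF poly_times_exp_tendsto_0 filterlim_inverse_at_top_right])
  then have r: "((%t. flat n t / t) \<longlongrightarrow> 0) (at_right 0)"
   by (rule Lim_transform_eventually)
    (auto simp: eventually_at_filter flat_def divide_inverse intro!: always_eventually)
  have l: "((%t. flat n t / t) \<longlongrightarrow> 0) (at_left 0)"
   by (rule Lim_transform_eventually[OF tendsto_const]) (auto simp: eventually_at_filter flat_def)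
  have "((%t. flat n t / t) \<longlongrightarrow> 0) (at 0)" using filterlim_split_at[OF l r] .
  then show ?thesis using 3 by (simp add: DERIV_def flat_def)
 qed
qed

lemma flat_0_eq: "flat 0 t = (if 0 < t then exp (- (1 / t)) else 0)" by (simp add: flat_def)

text \<open>
  On the open box every factor tends to 1 as \<open>n\<close> grows, outside it some factor vanishes.  The last factor settles the
  empty boxes: if \<open>b \<bullet> i < a \<bullet> i\<close>, the product of the differences is positive between the two.
\<close>

definition box_bump :: "'a::euclidean_space => 'a => nat => 'a => real" where
 "box_bump a b n x = (\<Prod>i\<in>Basis. flat 0 (real (Suc n) * ((x \<bullet> i - a \<bullet> i) * (b \<bullet> i - x \<bullet> i))) *
  (if a \<bullet> i < b \<bullet> i then 1 else 0))"

lemma box_bump_nonzero_iff: "box_bump a b n x ~= 0 \<longleftrightarrow> x \<in> box a b"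
proof -
 have "0 < (x \<bullet> i - a \<bullet> i) * (b \<bullet> i - x \<bullet> i) \<and> a \<bullet> i < b \<bullet> i \<longleftrightarrow> a \<bullet> i < x \<bullet> i \<and> x \<bullet> i < b \<bullet> i" for i
  by (auto simp: zero_less_mult_iff)
 then show ?thesis
  unfolding box_bump_def by (auto simp: prod_zero_iff flat_0_eq mem_box zero_less_mult_iff)
qed

lemma box_bump_range: "0 <= box_bump a b n x" "box_bump a b n x <= 1"
 unfolding box_bump_def
 by (auto intro!: prod_nonneg prod_le_1 simp: flat_0_eq)

lemma Ck_box_bump: "Ck m (box_bump a b n)"
proof -
 have c: "Ck m (%x. flat 0 (real (Suc n) * ((x \<bullet> i - a \<bullet> i) * (b \<bullet> i - x \<bullet> i))))" for i
 proof -
  have "Ck m (%x. real (Suc n) * ((x \<bullet> i + - (a \<bullet> i)) * (b \<bullet> i + (- 1) * (x \<bullet> i))))"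
   by (intro Ck_mult Ck_add Ck_const Ck_inner)
  from Ck_compose[of flat, OF has_derivative_flat this, of 0] show ?thesis by simp
 qed
 have "Ck m (%x. \<Prod>i\<in>Basis. flat 0 (real (Suc n) * ((x \<bullet> i - a \<bullet> i) * (b \<bullet> i - x \<bullet> i))) * (if a \<bullet> i < b \<bullet> i then 1 else 0))"
  by (intro Ck_prod Ck_mult c Ck_const) simp
 then show ?thesis by (simp only: box_bump_def[abs_def])
qed

lemma box_bump_tendsto: "(%n. box_bump a b n x) \<longlonglongrightarrow> indicator (box a b) x"
proof (cases "x \<in> box a b")
 case True
 have "(%n. flat 0 (real (Suc n) * t)) \<longlonglongrightarrow> 1" if "0 < t" for t
 proof -
  have "(%n. exp (- (1 / (real (Suc n) * t)))) \<longlonglongrightarrow> 1" using that by real_asymp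
  then show ?thesis using that by (simp add: flat_0_eq)
 qed
 then have "(%n. \<Prod>i\<in>Basis. flat 0 (real (Suc n) * ((x \<bullet> i - a \<bullet> i) * (b \<bullet> i - x \<bullet> i))) *
  (if a \<bullet> i < b \<bullet> i then 1 else 0)) \<longlonglongrightarrow> (\<Prod>i\<in>(Basis::'a set). 1 * 1)"
  using True by (intro tendsto_prod tendsto_mult) (auto simp: mem_box intro: less_trans)
 then show ?thesis using True by (simp add: box_bump_def)
next
 case False
 then have "box_bump a b n x = 0" for n using box_bump_nonzero_iff[of a b n x] by blast
 then show ?thesis using False by simp
qed

lemma box_bump_test_fun: "cbox a b \<subseteq> D ==> box_bump a b n \<in> test_fun D"
proof -
 assume D: "cbox a b \<subseteq> D"
 have "closure {x. box_bump a b n x ~= 0} \<subseteq> cbox a b"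
  unfolding box_bump_nonzero_iff by (rule closure_minimal) (auto simp: box_subset_cbox[THEN subsetD])
 moreover from this have "compact (closure {x. box_bump a b n x ~= 0})"
  using compact_Int_closed[OF compact_cbox closed_closure, of a b "{x. box_bump a b n x ~= 0}"]
  by (simp only: Int_absorb1)
 ultimately show ?thesis unfolding test_fun_def using D Ck_box_bump by blast
qed

text \<open>
  Boxes are stable under intersection and generate the Borel sets, so the positive and the negative part are densities of
  the same measure.
\<close>

lemma integral_box_zero_imp_AE_zero:
 fixes w :: "'a::euclidean_space => real"
 assumes w: "integrable lborel w" and zero: "\<And>c d. (\<integral>x. w x * indicator (box c d) x \<partial>lborel) = 0"
 shows "AE x in lborel. w x = 0"
proof (rule sigma_finite_measure.density_zero[OF _ w])
 show "sigma_finite_measure (lborel :: 'a measure)" by (rule sigma_finite_lborel)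
 have [measurable]: "w \<in> borel_measurable borel" using w by auto
 define P N where "P x = max 0 (w x)" and "N x = max 0 (- w x)" for x
 have PN: "w x = P x - N x" "0 <= P x" "0 <= N x" for x by (auto simp: P_def N_def)
 have iP: "integrable lborel P" and iN: "integrable lborel N" using w by (simp_all add: P_def[abs_def] N_def[abs_def])
 have [measurable]: "P \<in> borel_measurable borel" "N \<in> borel_measurable borel" by (simp_all add: P_def[abs_def] N_def[abs_def])
 have em: "emeasure (density lborel (%x. ennreal (R x))) A = ennreal (\<integral>x. R x * indicator A x \<partial>lborel)"
  if "integrable lborel R" "\<And>x. 0 <= R x" and [measurable]: "A \<in> sets borel" for R A
 proof -
  have [measurable]: "R \<in> borel_measurable borel" using that by auto
  have "emeasure (density lborel (%x. ennreal (R x))) A = (\<integral>\<^sup>+x. ennreal (R x * indicator A x) \<partial>lborel)"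
   by (subst emeasure_density) (auto intro!: nn_integral_cong simp: indicator_def)
  also have "\<dots> = ennreal (\<integral>x. R x * indicator A x \<partial>lborel)"
   using that by (intro nn_integral_eq_integral integrable_real_mult_indicator) (auto simp: indicator_def)
  finally show ?thesis .
 qed
 have dP: "(\<integral>x. P x * indicator A x \<partial>lborel) - (\<integral>x. N x * indicator A x \<partial>lborel) = (\<integral>x. w x * indicator A x \<partial>lborel)"
  if [measurable]: "A \<in> sets borel" for A
  by (subst Bochner_Integration.integral_diff[symmetric])
   (auto intro!: integrable_real_mult_indicator iP iN simp: PN(1) left_diff_distrib)
 have dens_eq: "density lborel (%x. ennreal (P x)) = density lborel (%x. ennreal (N x))"
 proof (rule measure_eqI_generator_eq[where E = "range (%(a, b). box a b)" and \<Omega> = UNIV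
    and A = "%i. box (- (real i *\<^sub>R One)) (real i *\<^sub>R One)"])
  show "Int_stable (range (%(a, b). box a b :: 'a set))"
  proof (rule Int_stableI)
   fix X Y :: "'a set"
   assume "X \<in> range (%(a, b). box a b)" "Y \<in> range (%(a, b). box a b)"
   then obtain a b c d where XY: "X = box a b" "Y = box c d" by auto
   obtain p q where "box a b \<inter> box c d = box p q" using box_Int_box by blast
   then have "X \<inter> Y = (%(a, b). box a b) (p, q)" by (simp add: XY)
   then show "X \<inter> Y \<in> range (%(a, b). box a b)" by (rule range_eqI)
  qed
  show "emeasure (density lborel (%x. ennreal (P x))) X = emeasure (density lborel (%x. ennreal (N x))) X"
   if Xr: "X \<in> range (%(a, b). box a b)" for X
  proof -
   obtain p where "X = (case p of (a, b) => box a b)" using Xr by (rule imageE)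
   then obtain c d where X: "X = box c d" by (cases p) simp
   then show ?thesis using dP[of X] zero[of c d] by (simp add: em iP iN PN)
  qed
  show "sets (density lborel (%x. ennreal (P x))) = sigma_sets UNIV (range (%(a, b). box a b))"
   "sets (density lborel (%x. ennreal (N x))) = sigma_sets UNIV (range (%(a, b). box a b))"
   by (simp_all add: borel_eq_box)
  show "(\<Union>i. box (- (real i *\<^sub>R One)) (real i *\<^sub>R One)) = (UNIV :: 'a set)" by (rule UN_box_eq_UNIV)
  show "emeasure (density lborel (%x. ennreal (P x))) (box (- (real i *\<^sub>R One)) (real i *\<^sub>R One)) ~= \<infinity>" for i
   by (subst em[OF iP]) (auto simp: PN)
 qed auto
 have eq: "(\<integral>x. P x * indicator A x \<partial>lborel) = (\<integral>x. N x * indicator A x \<partial>lborel)" if A: "A \<in> sets borel" for A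
 proof -
  have "ennreal (\<integral>x. P x * indicator A x \<partial>lborel) = ennreal (\<integral>x. N x * indicator A x \<partial>lborel)"
   by (simp only: em[OF iP PN(2) A, symmetric] em[OF iN PN(3) A, symmetric] dens_eq)
  moreover have "0 <= (\<integral>x. P x * indicator A x \<partial>lborel)" "0 <= (\<integral>x. N x * indicator A x \<partial>lborel)"
   by (auto intro!: integral_nonneg_AE mult_nonneg_nonneg PN)
  ultimately show ?thesis by simp
 qed
 show "set_lebesgue_integral lborel A w = 0" if A: "A \<in> sets lborel" for A
  using dP[of A] eq[of A] A by (simp add: set_lebesgue_integral_def mult.commute)
qed

text \<open>
  Bumps approximate indicators of boxes boundedly and pointwise, and an open set is a countable union of boxes.
\<close>

lemma fundamental_lemma_calculus_of_variations:
 fixes w :: "'a::euclidean_space => real"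
 assumes D: "open D" and w: "integrable lebesgue w"
  and zero: "\<And>\<phi>. \<phi> \<in> test_fun D ==> (\<integral>x. w x * \<phi> x \<partial>lebesgue) = 0"
 shows "AE x in lebesgue. x \<in> D \<longrightarrow> w x = 0"
proof -
 have wm: "w \<in> borel_measurable (completion lborel)" using w by auto
 obtain g where g: "g \<in> borel_measurable lborel" "AE x in lborel. w x = g x"
  using completion_ex_borel_measurable_real[OF wm] by blast
 note [measurable] = g(1)
 have gc: "AE x in lebesgue. w x = g x" using g(2) by (rule AE_completion)
 have gi: "integrable lborel g"
 proof -
  have "integrable lebesgue g" by (rule integrable_cong_AE_imp[OF w]) (use g gc in \<open>auto elim: eventually_mono intro: measurable_completion\<close>)
  then show ?thesis using g(1) by (simp add: integrable_completion)
 qed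
 have boxz: "(\<integral>x. g x * indicator (box a b) x \<partial>lborel) = 0" if ab: "cbox a b \<subseteq> D" for a b
 proof -
  have "(%n. \<integral>x. w x * box_bump a b n x \<partial>lebesgue) \<longlonglongrightarrow> (\<integral>x. w x * indicator (box a b) x \<partial>lebesgue)"
  proof (rule integral_dominated_convergence)
   show "integrable lebesgue (%x. norm (w x))" using w by (rule integrable_norm)
   show "AE x in lebesgue. (%n. w x * box_bump a b n x) \<longlonglongrightarrow> w x * indicator (box a b) x"
    by (intro AE_I2 tendsto_mult tendsto_const box_bump_tendsto)
   have "\<bar>w x\<bar> * box_bump a b n x <= \<bar>w x\<bar> * 1" for x n using box_bump_range by (intro mult_left_mono) auto
   then show "AE x in lebesgue. norm (w x * box_bump a b n x) <= norm (w x)" for n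
    by (intro AE_I2) (simp add: abs_mult abs_of_nonneg[OF box_bump_range(1)])
   have "continuous_on UNIV (box_bump a b n)" for n using Ck_box_bump[of 0] by simp
   then have "box_bump a b n \<in> borel_measurable borel" for n by (rule borel_measurable_continuous_onI)
   then have "box_bump a b n \<in> borel_measurable lebesgue" for n by (intro measurable_completion) simp
   then show "(%x. w x * box_bump a b n x) \<in> borel_measurable lebesgue" for n using wm by (intro borel_measurable_times) auto
   have "box a b \<in> sets lebesgue" by simp
   then show "(%x. w x * indicator (box a b) x) \<in> borel_measurable lebesgue" using wm
    by (intro borel_measurable_times borel_measurable_indicator) auto
  qed
  then have "(\<integral>x. w x * indicator (box a b) x \<partial>lebesgue) = 0"
   using zero[OF box_bump_test_fun[OF ab]] LIMSEQ_unique[OF _ tendsto_const] by simp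
  moreover have "(\<integral>x. w x * indicator (box a b) x \<partial>lebesgue) = (\<integral>x. g x * indicator (box a b) x \<partial>lebesgue)"
  proof (rule integral_cong_AE)
   show "(%x. w x * indicator (box a b) x) \<in> borel_measurable lebesgue"
    using wm by (intro borel_measurable_times borel_measurable_indicator) auto
   show "(%x. g x * indicator (box a b) x) \<in> borel_measurable lebesgue"
    using g(1) by (intro borel_measurable_times borel_measurable_indicator measurable_completion) auto
   show "AE x in lebesgue. w x * indicator (box a b) x = g x * indicator (box a b) x"
    using gc by eventually_elim simp
  qed
  moreover have "(\<integral>x. g x * indicator (box a b) x \<partial>lebesgue) = (\<integral>x. g x * indicator (box a b) x \<partial>lborel)"
   by (rule integral_completion) measurable
  ultimately show ?thesis by simp
 qed
 have loc: "AE x in lborel. x \<in> box a b \<longrightarrow> g x = 0" if ab: "cbox a b \<subseteq> D" for a b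
 proof -
  have "AE x in lborel. g x * indicator (box a b) x = 0"
  proof (rule integral_box_zero_imp_AE_zero)
   show "integrable lborel (%x. g x * indicator (box a b) x)" by (intro integrable_real_mult_indicator gi) simp
   fix c d :: 'a
   obtain a' b' where ab': "box a b \<inter> box c d = box a' b'" using box_Int_box by blast
   show "(\<integral>x. g x * indicator (box a b) x * indicator (box c d) x \<partial>lborel) = 0"
   proof (cases "box a' b' = {}")
    case True
    have "(%x. g x * indicator (box a b) x * indicator (box c d) x) = (%x. 0)"
     using ab' True by (auto simp: indicator_def fun_eq_iff)
    then show ?thesis by (simp only: integral_zero)
   next
    case False
    then have "cbox a' b' = closure (box a' b')" by simp
    also have "\<dots> \<subseteq> closure (box a b)" using ab' by (intro closure_mono) auto
    also have "\<dots> \<subseteq> cbox a b" by (rule closure_minimal) (auto simp: box_subset_cbox[THEN subsetD])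
    finally have "cbox a' b' \<subseteq> D" using ab by blast
    have "(%x. g x * indicator (box a b) x * indicator (box c d) x) = (%x. g x * indicator (box a' b') x)"
     unfolding ab'[symmetric] by (auto simp: indicator_def fun_eq_iff)
    then show ?thesis by (simp only: boxz[OF \<open>cbox a' b' \<subseteq> D\<close>])
   qed
  qed
  then show ?thesis by eventually_elim (auto simp: indicator_def)
 qed
 have "\<exists>\<E>. countable \<E> \<and> (\<forall>X\<in>\<E>. \<exists>a b. X = box a b \<and> cbox a b \<subseteq> D) \<and> \<Union>\<E> = D"
 proof -
  define \<F> where "\<F> = {box a b | a b. cbox a b \<subseteq> D}"
  have "\<exists>X\<in>\<F>. x \<in> X" if "x \<in> D" for x
  proof -
   obtain e where e: "0 < e" "cball x e \<subseteq> D" using D \<open>x \<in> D\<close> open_contains_cball by blast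
   obtain a b where ab: "x \<in> box a b" "box a b \<subseteq> ball x e" using rational_boxes[OF e(1)] by blast
   have "cbox a b = closure (box a b)" using ab(1) by (intro closure_box[symmetric]) auto
   also have "\<dots> \<subseteq> cball x e" using ab(2) by (intro closure_minimal) auto
   finally show ?thesis using ab(1) e(2) unfolding \<F>_def by blast
  qed
  moreover have "X \<subseteq> D" if "X \<in> \<F>" for X
   using that box_subset_cbox unfolding \<F>_def by blast
  ultimately have U: "\<Union>\<F> = D" by blast
  have op: "\<And>S. S \<in> \<F> ==> open S" unfolding \<F>_def by auto
  obtain \<E> where E: "\<E> \<subseteq> \<F>" "countable \<E>" "\<Union>\<E> = \<Union>\<F>"
   using Lindelof[of \<F>, OF op] by blast
  have "\<forall>X\<in>\<E>. \<exists>a b. X = box a b \<and> cbox a b \<subseteq> D" using E(1) unfolding \<F>_def by blast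
  then show ?thesis using E(2,3) U by (intro exI[of _ \<E>] conjI) simp_all
 qed
 then obtain \<E> where \<E>: "countable \<E>" "\<forall>X\<in>\<E>. \<exists>a b. X = box a b \<and> cbox a b \<subseteq> D" "\<Union>\<E> = D" by metis
 have "\<forall>X\<in>\<E>. AE x in lborel. x \<in> X \<longrightarrow> g x = 0"
 proof
  fix X assume "X \<in> \<E>"
  then obtain a b where "X = box a b" "cbox a b \<subseteq> D" using \<E>(2) by blast
  then show "AE x in lborel. x \<in> X \<longrightarrow> g x = 0" using loc by simp
 qed
 then have "AE x in lborel. \<forall>X\<in>\<E>. x \<in> X \<longrightarrow> g x = 0"
  by (simp only: AE_ball_countable[OF \<E>(1)])
 then have "AE x in lborel. x \<in> D \<longrightarrow> g x = 0"
  by (rule eventually_mono) (use \<E>(3) in blast)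
 then have "AE x in lebesgue. x \<in> D \<longrightarrow> g x = 0" by (rule AE_completion)
 then show ?thesis using gc by eventually_elim simp
qed

section \<open>The energy space as a closed space of gradients\<close>

lemma smooth_partial:
 assumes "\<And>m. Ck m \<phi>"
 shows "\<phi> differentiable (at x)" "continuous_on UNIV \<phi>" "i \<in> Basis ==> continuous_on UNIV (partial \<phi> i)"
  "(\<phi> has_derivative frechet_derivative \<phi> (at x)) (at x)"
 using assms[of 0] assms[of "Suc 0"] by (auto simp: frechet_derivative_works)

text \<open>
  The integrals of the difference quotients in the direction \<open>i\<close> vanish by translation invariance, and they converge to the
  integral of the derivative.
\<close>

lemma integral_partial_zero:
 fixes g :: "'a::euclidean_space => real"
 assumes d: "\<And>x. (g has_derivative g' x) (at x)" and i: "i \<in> Basis"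
  and c: "continuous_on UNIV (%x. g' x i)"
  and b: "bounded {x. g x ~= 0}"
 shows "(\<integral>x. g' x i \<partial>lborel) = 0"
proof -
 obtain R where R: "\<And>x. g x ~= 0 ==> norm x <= R" using b unfolding bounded_iff by auto
 have cg: "continuous_on UNIV g" using d by (meson continuous_at_imp_continuous_on has_derivative_continuous)
 have cb: "compact (cball 0 (R + 1) :: 'a set)" by simp
 have "bounded ((%x. g' x i) ` cball 0 (R + 1))"
  by (rule compact_imp_bounded[OF compact_continuous_image[OF continuous_on_subset[OF c subset_UNIV] cb]])
 then obtain M where "\<forall>z\<in>(%x. g' x i) ` cball 0 (R + 1). norm z <= M" unfolding bounded_iff by blast
 then have M: "\<bar>g' x i\<bar> <= M" if "x \<in> cball 0 (R + 1)" for x using that by (metis imageI real_norm_def)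
 define q where "q n x = real (Suc n) * (g (x + (1 / real (Suc n)) *\<^sub>R i) - g x)" for n x
 have [measurable]: "g \<in> borel_measurable borel" by (rule borel_measurable_continuous_onI[OF cg])
 have ig: "integrable lborel g"
 proof -
  have "integrable lborel (%x. indicator (cball 0 R) x *\<^sub>R g x)"
   by (rule borel_integrable_compact) (auto intro: continuous_on_subset[OF cg])
  moreover have "(%x. indicator (cball 0 R) x *\<^sub>R g x) = g" using R by (auto simp: indicator_def fun_eq_iff)
  ultimately show ?thesis by (simp only:)
 qed
 have shift: "(\<integral>x. g (x + v) \<partial>lborel) = (\<integral>x. g x \<partial>lborel)" "integrable lborel (%x. g (x + v))" for v
 proof -
  have "integral\<^sup>L (distr lborel borel ((+) v)) g = (\<integral>x. g (v + x) \<partial>lborel)" by (rule integral_distr) auto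
  then show "(\<integral>x. g (x + v) \<partial>lborel) = (\<integral>x. g x \<partial>lborel)" by (simp add: lborel_distr_plus add.commute)
  have "integrable (distr lborel borel ((+) v)) g = integrable lborel (%x. g (v + x))" by (rule integrable_distr_eq) auto
  then show "integrable lborel (%x. g (x + v))" using ig by (simp add: lborel_distr_plus add.commute)
 qed
 have line: "((%t. g (x + t *\<^sub>R i)) has_real_derivative g' (x + t *\<^sub>R i) i) (at t)" for x t
 proof -
  have "((%t. x + t *\<^sub>R i) has_derivative (%h. h *\<^sub>R i)) (at t)" by (auto intro!: derivative_eq_intros)
  from has_derivative_compose[OF this d]
  have "((%t. g (x + t *\<^sub>R i)) has_derivative (%h. g' (x + t *\<^sub>R i) (h *\<^sub>R i))) (at t)" .
  moreover have "g' y (h *\<^sub>R i) = g' y i * h" for y h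
   using linear_scale[OF has_derivative_linear[OF d[of y]], of h i] by simp
  ultimately show ?thesis by (simp add: has_field_derivative_def)
 qed
 have ql: "(%n. q n x) \<longlonglongrightarrow> g' x i" for x
 proof -
  have "((%t. (g (x + t *\<^sub>R i) - g x) / t) \<longlongrightarrow> g' x i) (at 0)"
   using line[of x 0] by (simp add: DERIV_def)
  moreover have "filterlim (%n. 1 / real (Suc n)) (at 0) sequentially"
   using LIMSEQ_inverse_real_of_nat by (simp add: filterlim_at divide_inverse)
  ultimately have "(%n. (g (x + (1 / real (Suc n)) *\<^sub>R i) - g x) / (1 / real (Suc n))) \<longlonglongrightarrow> g' x i"
   by (rule filterlim_compose)
  then show ?thesis by (simp add: q_def mult.commute)
 qed
 have qb: "\<bar>q n x\<bar> <= M * indicator (cball 0 (R + 1)) x" for n x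
 proof (cases "x \<in> cball 0 (R + 1)")
  case False
  let ?h = "1 / real (Suc n)"
  have "norm (x + ?h *\<^sub>R i) \<ge> norm x - norm (?h *\<^sub>R i)" by (rule norm_diff_ineq)
  moreover have "norm (?h *\<^sub>R i) <= 1" using i by simp
  moreover have "norm x > R + 1" using False by simp
  ultimately have "norm (x + ?h *\<^sub>R i) > R" "norm x > R" by linarith+
  then have "g (x + ?h *\<^sub>R i) = 0" "g x = 0" using R by (meson not_le)+
  then show ?thesis using False by (simp add: q_def)
 next
  case True
  let ?h = "1 / real (Suc n)"
  have h: "0 < ?h" "?h <= 1" by auto
  obtain t where t: "0 < t" "t < ?h" "g (x + ?h *\<^sub>R i) - g (x + 0 *\<^sub>R i) = (?h - 0) * g' (x + t *\<^sub>R i) i"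
   using MVT2[of 0 ?h "%t. g (x + t *\<^sub>R i)" "%t. g' (x + t *\<^sub>R i) i"] h line by blast
  have qe: "q n x = g' (x + t *\<^sub>R i) i" using t(3) by (simp add: q_def)
  show ?thesis
  proof (cases "x + t *\<^sub>R i \<in> cball 0 (R + 1)")
   case True2: True
   then show ?thesis using True M qe by simp
  next
   case False
   then have far: "norm (x + t *\<^sub>R i) > R + 1" by simp
   have "\<forall>\<^sub>F s in nhds t. g (x + s *\<^sub>R i) = 0"
   proof -
    have "open {s. norm (x + s *\<^sub>R i) > R}" by (intro open_Collect_less continuous_intros)
    then have "\<forall>\<^sub>F s in nhds t. s \<in> {s. norm (x + s *\<^sub>R i) > R}"
     using far by (intro eventually_nhds_in_open) auto
    then show ?thesis by (rule eventually_mono) (use R in force)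
   qed
   then have "((%s. g (x + s *\<^sub>R i)) has_real_derivative 0) (at t)"
    by (subst DERIV_cong_ev[OF refl _ refl]) auto
   then have "g' (x + t *\<^sub>R i) i = 0" using line DERIV_unique by blast
   moreover have "0 <= M" using M[OF \<open>x \<in> cball 0 (R + 1)\<close>] by linarith
   ultimately show ?thesis using qe by simp
  qed
 qed
 have "(%n. integral\<^sup>L lborel (q n)) \<longlonglongrightarrow> (\<integral>x. g' x i \<partial>lborel)"
 proof (rule integral_dominated_convergence)
  show "integrable lborel (%x::'a. M * indicator (cball 0 (R + 1)) x :: real)"
   by (intro integrable_mult_right integrable_real_indicator) (use emeasure_bounded_finite[OF bounded_cball, of "0 :: 'a" "R + 1"] in simp_all)
  show "AE x in lborel. (%n. q n x) \<longlonglongrightarrow> g' x i" using ql by simp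
  show "AE x in lborel. norm (q n x) <= M * indicator (cball 0 (R + 1)) x" for n using qb by simp
  show "(%x. g' x i) \<in> borel_measurable lborel" using borel_measurable_continuous_onI[OF c] by simp
  show "q n \<in> borel_measurable lborel" for n unfolding q_def by measurable
 qed
 moreover have "integral\<^sup>L lborel (q n) = 0" for n
  unfolding q_def using shift[of "(1 / real (Suc n)) *\<^sub>R i"] ig by simp
 ultimately show ?thesis using LIMSEQ_unique[OF _ tendsto_const] by simp
qed

text \<open>
  Only the restriction of a function to the domain matters; the extension by zero fixes a representative on the whole space.
\<close>

definition zero_ext :: "'a::euclidean_space set => ('a => 'b::euclidean_space) => 'a => 'b" where
 "zero_ext D v x = indicator D x *\<^sub>R v x"

definition l2_on :: "'a::euclidean_space set => ('a => 'b::euclidean_space) => ('a, 'b) l2" where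
 "l2_on D v = l2_class (zero_ext D v)"

definition test_grad :: "('a::euclidean_space => real) => 'a => 'a" where
 "test_grad \<phi> x = (\<Sum>i\<in>Basis. partial \<phi> i x *\<^sub>R i)"

locale bounded_open =
 fixes D :: "'a::euclidean_space set"
 assumes D_open: "open D" and D_bounded: "bounded D" and D_nonempty: "D ~= {}"
begin

lemma D_sets: "D \<in> sets lebesgue" using D_open by (simp add: borel_open)

lemma square_int_zero_ext_iff: "square_int (zero_ext D v) \<longleftrightarrow> v \<in> L2_fun D"
proof -
 have eq: "(norm (zero_ext D v x))^2 = indicator D x *\<^sub>R (norm (v x))^2" for x
  by (simp add: zero_ext_def indicator_def)
 have "zero_ext D v \<in> borel_measurable lebesgue \<longleftrightarrow> v \<in> borel_measurable (lebesgue_on D)"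
  unfolding zero_ext_def[abs_def] using D_sets by (subst borel_measurable_restrict_space_iff) auto
 moreover have "integrable lebesgue (%x. (norm (zero_ext D v x))^2) \<longleftrightarrow> integrable (lebesgue_on D) (%x. (norm (v x))^2)"
  unfolding eq using D_sets by (subst integrable_restrict_space) (auto simp: set_integrable_def)
 ultimately show ?thesis by (simp add: square_int_def L2_fun_def)
qed

lemma integral_on_D:
 fixes g :: "'a => real"
 shows "(\<integral>x. g x \<partial>lebesgue_on D) = (\<integral>x. indicator D x * g x \<partial>lebesgue)"
 using D_sets by (subst integral_restrict_space) (auto simp: set_lebesgue_integral_def)

lemma inner_l2_on:
 assumes "v \<in> L2_fun D" "w \<in> L2_fun D"
 shows "l2_on D v \<bullet> l2_on D w = (\<integral>x. v x \<bullet> w x \<partial>lebesgue_on D)"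
proof -
 have "zero_ext D v x \<bullet> zero_ext D w x = indicator D x * (v x \<bullet> w x)" for x by (simp add: zero_ext_def indicator_def)
 then show ?thesis
  using inner_l2_class[of "zero_ext D v" "zero_ext D w"] assms
  by (simp add: l2_on_def square_int_zero_ext_iff integral_on_D)
qed

lemma norm_l2_on: "v \<in> L2_fun D ==> (norm (l2_on D v))^2 = (\<integral>x. (norm (v x))^2 \<partial>lebesgue_on D)"
 by (simp add: power2_norm_eq_inner inner_l2_on)

lemma AE_on_D: "(AE x in lebesgue_on D. P x) \<longleftrightarrow> (AE x in lebesgue. x \<in> D \<longrightarrow> P x)"
 using D_sets by (subst AE_restrict_space_iff) auto

lemma l2_on_eq_iff:
 assumes "v \<in> L2_fun D" "w \<in> L2_fun D"
 shows "l2_on D v = l2_on D w \<longleftrightarrow> (AE x in lebesgue_on D. v x = w x)"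
proof -
 have "l2_on D v = l2_on D w \<longleftrightarrow> (AE x in lebesgue. zero_ext D v x = zero_ext D w x)"
  unfolding l2_on_def using assms by (intro l2_class_eq_iff) (simp_all add: square_int_zero_ext_iff)
 also have "\<dots> \<longleftrightarrow> (AE x in lebesgue. x \<in> D \<longrightarrow> v x = w x)"
  by (intro AE_cong) (auto simp: zero_ext_def indicator_def)
 finally show ?thesis by (simp add: AE_on_D)
qed

lemma L2_fun_add: "v \<in> L2_fun D ==> w \<in> L2_fun D ==> (%x. v x + w x) \<in> L2_fun D"
 and l2_on_add: "v \<in> L2_fun D ==> w \<in> L2_fun D ==> l2_on D (%x. v x + w x) = l2_on D v + l2_on D w"
proof -
 have e: "zero_ext D (%x. v x + w x) = (%x. zero_ext D v x + zero_ext D w x)"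
  by (auto simp: zero_ext_def scaleR_add_right)
 assume "v \<in> L2_fun D" "w \<in> L2_fun D"
 then have s: "square_int (zero_ext D v)" "square_int (zero_ext D w)" by (simp_all add: square_int_zero_ext_iff)
 show "(%x. v x + w x) \<in> L2_fun D"
  using square_int_add[OF s] by (simp add: square_int_zero_ext_iff[symmetric] e)
 show "l2_on D (%x. v x + w x) = l2_on D v + l2_on D w" by (simp add: l2_on_def e l2_class_add[OF s])
qed

lemma L2_fun_scale: "v \<in> L2_fun D ==> (%x. c *\<^sub>R v x) \<in> L2_fun D"
 and l2_on_scale: "v \<in> L2_fun D ==> l2_on D (%x. c *\<^sub>R v x) = c *\<^sub>R l2_on D v"
proof -
 have e: "zero_ext D (%x. c *\<^sub>R v x) = (%x. c *\<^sub>R zero_ext D v x)"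
  by (auto simp: zero_ext_def)
 assume "v \<in> L2_fun D"
 then have s: "square_int (zero_ext D v)" by (simp add: square_int_zero_ext_iff)
 show "(%x. c *\<^sub>R v x) \<in> L2_fun D"
  using square_int_scaleR[OF s] by (simp add: square_int_zero_ext_iff[symmetric] e)
 show "l2_on D (%x. c *\<^sub>R v x) = c *\<^sub>R l2_on D v" by (simp add: l2_on_def e l2_class_scaleR[OF s])
qed

lemma bounded_L2_fun:
 fixes v :: "'a => 'b::euclidean_space"
 assumes c: "continuous_on UNIV v" shows "v \<in> L2_fun D"
proof -
 have [measurable]: "v \<in> borel_measurable borel" by (rule borel_measurable_continuous_onI[OF c])
 have "compact (closure D)" using D_bounded by simp
 then have "bounded (v ` closure D)"
  by (rule compact_imp_bounded[OF compact_continuous_image[OF continuous_on_subset[OF c subset_UNIV]]])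
 then obtain B where "\<forall>z\<in>v ` closure D. norm z <= B" unfolding bounded_iff by blast
 then have B: "norm (v x) <= B" if "x \<in> closure D" for x using that by blast
 have fin: "emeasure lebesgue D < \<infinity>"
  using D_bounded D_open emeasure_bounded_finite[of D] by (simp add: main_part_sets)
 have m: "zero_ext D v \<in> borel_measurable lebesgue"
 proof -
  have "zero_ext D v \<in> borel_measurable borel" unfolding zero_ext_def[abs_def]
   by (intro borel_measurable_scaleR borel_measurable_indicator borel_open D_open) fact
  then show ?thesis by (intro measurable_completion) simp
 qed
 have "square_int (zero_ext D v)" unfolding square_int_def
 proof (rule conjI[OF m], rule Bochner_Integration.integrable_bound)
  show "integrable lebesgue (%x. B^2 * indicator D x :: real)"
   by (intro integrable_mult_right integrable_real_indicator D_sets fin)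
  show "(%x. (norm (zero_ext D v x))^2) \<in> borel_measurable lebesgue"
   by (rule borel_measurable_power[OF measurable_compose[OF m borel_measurable_norm]])
  have "(norm (zero_ext D v x))^2 <= B^2 * indicator D x" for x
   using power_mono[OF B[of x] norm_ge_zero, of 2] closure_subset[of D] by (auto simp: zero_ext_def indicator_def)
  then show "AE x in lebesgue. norm ((norm (zero_ext D v x))^2) <= norm (B^2 * indicator D x :: real)"
   by (intro AE_I2) simp
 qed
 then show ?thesis by (simp add: square_int_zero_ext_iff)
qed

lemma test_funD:
 assumes "\<phi> \<in> test_fun D"
 shows "\<And>m. Ck m \<phi>" "x \<notin> D ==> \<phi> x = 0" "bounded {x. \<phi> x ~= 0}" "\<And>i x. x \<notin> D ==> partial \<phi> i x = 0"
proof -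
 show C: "\<And>m. Ck m \<phi>" using assms by (simp add: test_fun_def)
 show "x \<notin> D ==> \<phi> x = 0" using assms closure_subset[of "{x. \<phi> x ~= 0}"] by (auto simp: test_fun_def)
 show "bounded {x. \<phi> x ~= 0}"
  using assms compact_imp_bounded bounded_subset closure_subset unfolding test_fun_def by blast
 fix i x assume x: "x \<notin> D"
 define S where "S = - closure {x. \<phi> x ~= 0}"
 have S: "open S" "x \<in> S" using assms x by (auto simp: S_def test_fun_def)
 have "((%x. 0) has_derivative (%h. 0)) (at x)" by simp
 then have "(\<phi> has_derivative (%h. 0)) (at x)"
  by (rule has_derivative_transform_within_open[OF _ S]) (use closure_subset[of "{x. \<phi> x ~= 0}"] in \<open>auto simp: S_def\<close>)
 then show "partial \<phi> i x = 0" by (simp add: frechet_derivative_at[symmetric])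
qed

lemma test_fun_add:
 assumes "\<phi> \<in> test_fun D" "\<psi> \<in> test_fun D" shows "(%x. \<phi> x + \<psi> x) \<in> test_fun D"
proof -
 have "{x. \<phi> x + \<psi> x ~= 0} \<subseteq> {x. \<phi> x ~= 0} \<union> {x. \<psi> x ~= 0}" by auto
 then have sub: "closure {x. \<phi> x + \<psi> x ~= 0} \<subseteq> closure {x. \<phi> x ~= 0} \<union> closure {x. \<psi> x ~= 0}"
  unfolding closure_Un[symmetric] by (rule closure_mono)
 have "compact (closure {x. \<phi> x ~= 0} \<union> closure {x. \<psi> x ~= 0})"
  using assms by (intro compact_Un) (simp_all add: test_fun_def)
 then have "compact (closure {x. \<phi> x + \<psi> x ~= 0})"
  using compact_Int_closed[OF _ closed_closure[of "{x. \<phi> x + \<psi> x ~= 0}"]] sub by (metis Int_absorb1)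
 then show ?thesis using assms sub Ck_add unfolding test_fun_def by blast
qed

lemma test_fun_scale:
 assumes "\<phi> \<in> test_fun D" shows "(%x. c * \<phi> x) \<in> test_fun D"
proof -
 have sub: "closure {x. c * \<phi> x ~= 0} \<subseteq> closure {x. \<phi> x ~= 0}" by (rule closure_mono) auto
 have "compact (closure {x. \<phi> x ~= 0})" using assms by (simp add: test_fun_def)
 then have "compact (closure {x. c * \<phi> x ~= 0})"
  using compact_Int_closed[OF _ closed_closure[of "{x. c * \<phi> x ~= 0}"]] sub by (metis Int_absorb1)
 then show ?thesis using assms sub Ck_mult[OF Ck_const] unfolding test_fun_def by blast
qed

lemma test_fun_zero: "(%x. 0) \<in> test_fun D"
 by (simp add: test_fun_def Ck_const)

lemma test_grad_inner: "i \<in> Basis ==> test_grad \<phi> x \<bullet> i = partial \<phi> i x"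
 by (simp add: test_grad_def inner_sum_left inner_Basis if_distrib cong: if_cong)

lemma test_fun_L2:
 assumes "\<phi> \<in> test_fun D"
 shows "\<phi> \<in> L2_fun D" "test_grad \<phi> \<in> L2_fun D" "i \<in> Basis ==> partial \<phi> i \<in> L2_fun D"
  "(%x. \<phi> x *\<^sub>R i) \<in> L2_fun D"
proof -
 note C = smooth_partial[OF test_funD(1)[OF assms]]
 show "\<phi> \<in> L2_fun D" "i \<in> Basis ==> partial \<phi> i \<in> L2_fun D" "(%x. \<phi> x *\<^sub>R i) \<in> L2_fun D"
  using C by (auto intro!: bounded_L2_fun continuous_intros)
 show "test_grad \<phi> \<in> L2_fun D" unfolding test_grad_def[abs_def]
  by (intro bounded_L2_fun continuous_intros C(3))
qed

lemma test_grad_add: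
 assumes "\<phi> \<in> test_fun D" "\<psi> \<in> test_fun D"
 shows "test_grad (%x. \<phi> x + \<psi> x) = (%x. test_grad \<phi> x + test_grad \<psi> x)"
proof -
 have "frechet_derivative (%x. \<phi> x + \<psi> x) (at x) i = partial \<phi> i x + partial \<psi> i x" for x i
  by (rule fun_cong[OF partial_add[OF smooth_partial(1)[OF test_funD(1)[OF assms(1)]] smooth_partial(1)[OF test_funD(1)[OF assms(2)]]]])
 then show ?thesis unfolding test_grad_def[abs_def] by (simp only: scaleR_add_left sum.distrib)
qed

lemma test_grad_scale:
 assumes "\<phi> \<in> test_fun D"
 shows "test_grad (%x. c * \<phi> x) = (%x. c *\<^sub>R test_grad \<phi> x)"
proof -
 have "frechet_derivative (%x. c * \<phi> x) (at x) i = c * partial \<phi> i x" for x i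
  using fun_cong[OF partial_mult[of "%x. c" \<phi> i, OF _ smooth_partial(1)[OF test_funD(1)[OF assms]]], of x] by simp
 then show ?thesis unfolding test_grad_def[abs_def] by (simp only: scaleR_sum_right scaleR_scaleR)
qed

lemma integral_on_D_lborel:
 fixes g :: "'a => real"
 assumes "continuous_on UNIV g" "\<And>x. x \<notin> D ==> g x = 0"
 shows "(\<integral>x. g x \<partial>lebesgue_on D) = (\<integral>x. g x \<partial>lborel)"
proof -
 have "(%x. indicator D x * g x) = g" using assms(2) by (auto simp: indicator_def fun_eq_iff)
 moreover have "g \<in> borel_measurable lborel" using borel_measurable_continuous_onI[OF assms(1)] by simp
 ultimately show ?thesis by (simp only: integral_on_D integral_completion)
qed

lemma test_has_weak_gradient:
 assumes \<phi>: "\<phi> \<in> test_fun D"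
 shows "has_weak_gradient D \<phi> (test_grad \<phi>)"
 unfolding has_weak_gradient_def
proof (intro conjI ballI test_fun_L2[OF \<phi>])
 fix \<psi> and i :: 'a assume \<psi>: "\<psi> \<in> test_fun D" and i: "i \<in> Basis"
 note C = smooth_partial[OF test_funD(1)[OF \<phi>]] and C' = smooth_partial[OF test_funD(1)[OF \<psi>]]
 have "(\<integral>x. (%h. \<phi> x * frechet_derivative \<psi> (at x) h + frechet_derivative \<phi> (at x) h * \<psi> x) i \<partial>lborel) = 0"
 proof (rule integral_partial_zero[OF has_derivative_mult[OF C(4) C'(4)] i])
  show "continuous_on UNIV (%x. \<phi> x * partial \<psi> i x + partial \<phi> i x * \<psi> x)"
   using i by (intro continuous_intros C C')
  show "bounded {x. \<phi> x * \<psi> x ~= 0}" by (rule bounded_subset[OF test_funD(3)[OF \<phi>]]) auto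
 qed
 then have z: "(\<integral>x. \<phi> x * partial \<psi> i x + partial \<phi> i x * \<psi> x \<partial>lebesgue_on D) = 0"
  using i by (subst integral_on_D_lborel) (auto intro!: continuous_intros C C' simp: test_funD(2)[OF \<phi>] test_funD(2)[OF \<psi>])
 have int: "integrable (lebesgue_on D) (%x. v x * w x)" if "v \<in> L2_fun D" "w \<in> L2_fun D" for v w :: "'a => real"
  using that integrable_mult_of_squares[of v "lebesgue_on D" w] by (simp add: L2_fun_def)
 have "(\<integral>x. \<phi> x * partial \<psi> i x \<partial>lebesgue_on D) + (\<integral>x. partial \<phi> i x * \<psi> x \<partial>lebesgue_on D) = 0"
  using z by (subst (asm) Bochner_Integration.integral_add)
   (auto intro!: int test_fun_L2[OF \<phi>] test_fun_L2[OF \<psi>] i)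
 then show "(\<integral>x. \<phi> x * frechet_derivative \<psi> (at x) i \<partial>lebesgue_on D) = - (\<integral>x. (test_grad \<phi> x \<bullet> i) * \<psi> x \<partial>lebesgue_on D)"
  using i by (simp add: test_grad_inner)
qed

lemma weak_gradient_inner:
 assumes "v \<in> L2_fun D" "w \<in> L2_fun D"
 shows "has_weak_gradient D v w \<longleftrightarrow> (\<forall>\<phi>\<in>test_fun D. \<forall>i\<in>Basis.
  l2_on D v \<bullet> l2_on D (partial \<phi> i) = - (l2_on D w \<bullet> l2_on D (%x. \<phi> x *\<^sub>R i)))"
 unfolding has_weak_gradient_def using assms
 by (simp add: inner_l2_on test_fun_L2 mult.commute cong: ball_cong)

text \<open>
  Testing against \<open>\<phi> x *\<^sub>R i\<close> reduces this to the fundamental lemma for each component of the difference.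
\<close>

lemma weak_gradient_unique:
 assumes "has_weak_gradient D v w" "has_weak_gradient D v w'"
 shows "l2_on D w = l2_on D w'"
proof -
 have L: "v \<in> L2_fun D" "w \<in> L2_fun D" "w' \<in> L2_fun D" using assms by (auto simp: has_weak_gradient_def)
 define d where "d x = w x - w' x" for x
 have d: "d \<in> L2_fun D" "l2_on D d = l2_on D w - l2_on D w'"
  using L2_fun_add[OF L(2) L2_fun_scale[OF L(3), of "-1"]] l2_on_add[OF L(2) L2_fun_scale[OF L(3), of "-1"]]
   l2_on_scale[OF L(3), of "-1"] by (simp_all add: d_def[abs_def])
 have comp: "AE x in lebesgue. x \<in> D \<longrightarrow> zero_ext D d x \<bullet> i = 0" if i: "i \<in> Basis" for i
 proof (rule fundamental_lemma_calculus_of_variations[OF D_open])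
  have sd: "square_int (zero_ext D d)" using d square_int_zero_ext_iff by blast
  have cst: "(%x. i) \<in> L2_fun D" by (rule bounded_L2_fun) simp
  have "zero_ext D d x \<bullet> i = zero_ext D d x \<bullet> zero_ext D (%x. i) x" for x by (simp add: zero_ext_def indicator_def)
  then show "integrable lebesgue (%x. zero_ext D d x \<bullet> i)"
   using integrable_inner_square_int[OF sd, of "zero_ext D (%x. i)"] cst by (simp add: square_int_zero_ext_iff)
  fix \<phi> assume \<phi>: "\<phi> \<in> test_fun D"
  have "l2_on D d \<bullet> l2_on D (%x. \<phi> x *\<^sub>R i) = 0"
   using assms \<phi> i weak_gradient_inner[OF L(1,2)] weak_gradient_inner[OF L(1,3)] by (simp add: d inner_diff_left)
  then have "(\<integral>x. indicator D x * (d x \<bullet> (\<phi> x *\<^sub>R i)) \<partial>lebesgue) = 0"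
   by (simp only: inner_l2_on[OF d(1) test_fun_L2(4)[OF \<phi>]] integral_on_D)
  moreover have "indicator D x * (d x \<bullet> (\<phi> x *\<^sub>R i)) = (zero_ext D d x \<bullet> i) * \<phi> x" for x by (simp add: zero_ext_def)
  ultimately show "(\<integral>x. (zero_ext D d x \<bullet> i) * \<phi> x \<partial>lebesgue) = 0" by (simp only:)
 qed
 have "AE x in lebesgue. \<forall>i\<in>Basis. x \<in> D \<longrightarrow> zero_ext D d x \<bullet> i = 0"
  using comp by (intro AE_finite_allI) auto
 then have "AE x in lebesgue. x \<in> D \<longrightarrow> w x = w' x"
  by eventually_elim (auto simp: zero_ext_def d_def euclidean_eq_iff[where 'a='a] inner_diff_left)
 then show ?thesis using L by (simp add: l2_on_eq_iff AE_on_D)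
qed

text \<open>
  The class of the weak gradient, a vector of the ambient Hilbert space; by uniqueness the choice made by \<open>wgrad\<close> is immaterial.
\<close>

definition G :: "('a => real) => ('a, 'a) l2" where "G v = l2_on D (wgrad D v)"

lemma wgrad_has_weak_gradient: "v \<in> H1 D ==> has_weak_gradient D v (wgrad D v)"
 unfolding H1_def wgrad_def mem_Collect_eq some_eq_ex .

lemma G_eq: "has_weak_gradient D v w ==> G v = l2_on D w"
 unfolding G_def using weak_gradient_unique[OF wgrad_has_weak_gradient] by (auto simp: H1_def)

lemma H1_L2: "v \<in> H1 D ==> v \<in> L2_fun D" "v \<in> H1 D ==> wgrad D v \<in> L2_fun D"
 using wgrad_has_weak_gradient by (auto simp: has_weak_gradient_def)

lemma V_norm_eq: "v \<in> H1 D ==> V_norm D v = norm (G v)"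
 using norm_l2_on[OF H1_L2(2), of v] by (simp add: V_norm_def G_def) (metis norm_ge_zero real_sqrt_unique)

lemma H1_norm_eq: "v \<in> H1 D ==> H1_norm D v = norm (l2_on D v, G v)"
 using norm_l2_on[OF H1_L2(1), of v] norm_l2_on[OF H1_L2(2), of v]
 by (simp add: H1_norm_def G_def norm_Pair)

lemma weak_gradient_add:
 assumes "has_weak_gradient D v w" "has_weak_gradient D v' w'"
 shows "has_weak_gradient D (%x. v x + v' x) (%x. w x + w' x)"
proof -
 have L: "v \<in> L2_fun D" "w \<in> L2_fun D" "v' \<in> L2_fun D" "w' \<in> L2_fun D" using assms by (auto simp: has_weak_gradient_def)
 show ?thesis using assms L
  by (simp add: weak_gradient_inner L2_fun_add l2_on_add inner_add_left)
qed

lemma weak_gradient_scale: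
 assumes "has_weak_gradient D v w"
 shows "has_weak_gradient D (%x. c * v x) (%x. c *\<^sub>R w x)"
proof -
 have L: "v \<in> L2_fun D" "w \<in> L2_fun D" using assms by (auto simp: has_weak_gradient_def)
 show ?thesis using assms L L2_fun_scale[OF L(1), of c] l2_on_scale[OF L(1), of c]
  by (simp add: weak_gradient_inner L2_fun_scale l2_on_scale)
qed

lemma H1_add: "v \<in> H1 D ==> w \<in> H1 D ==> (%x. v x + w x) \<in> H1 D"
 and G_add: "v \<in> H1 D ==> w \<in> H1 D ==> G (%x. v x + w x) = G v + G w"
proof -
 assume "v \<in> H1 D" "w \<in> H1 D"
 note g = weak_gradient_add[OF this[THEN wgrad_has_weak_gradient]] and L = this[THEN H1_L2(2)]
 show "(%x. v x + w x) \<in> H1 D" using g by (auto simp: H1_def)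
 show "G (%x. v x + w x) = G v + G w" using G_eq[OF g] L by (simp add: G_def l2_on_add)
qed

lemma H1_scale: "v \<in> H1 D ==> (%x. c * v x) \<in> H1 D"
 and G_scale: "v \<in> H1 D ==> G (%x. c * v x) = c *\<^sub>R G v"
proof -
 assume "v \<in> H1 D"
 note g = weak_gradient_scale[OF this[THEN wgrad_has_weak_gradient], of c] and L = this[THEN H1_L2(2)]
 show "(%x. c * v x) \<in> H1 D" using g by (auto simp: H1_def)
 show "G (%x. c * v x) = c *\<^sub>R G v" using G_eq[OF g] L by (simp add: G_def l2_on_scale)
qed

text \<open>
  The gradient, as an operator on test functions, identified with its graph.  The closure of this graph is the graph of the gradient
  on \<open>H10 D\<close>, which makes completeness arguments purely topological.
\<close>

definition test_graph :: "(('a, real) l2 \<times> ('a, 'a) l2) set" where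
 "test_graph = (%\<phi>. (l2_on D \<phi>, l2_on D (test_grad \<phi>))) ` test_fun D"

definition graph :: "(('a, real) l2 \<times> ('a, 'a) l2) set" where "graph = closure test_graph"

lemma test_H1: "\<phi> \<in> test_fun D ==> \<phi> \<in> H1 D" and G_test: "\<phi> \<in> test_fun D ==> G \<phi> = l2_on D (test_grad \<phi>)"
 using test_has_weak_gradient G_eq by (auto simp: H1_def)

lemma subspace_test_graph: "subspace test_graph"
proof (rule subspaceI)
 have "l2_on D (%x. 0 :: real) = 0" "l2_on D (%x. 0 :: 'a) = 0"
  using l2_on_scale[OF bounded_L2_fun[of "%x. 0 :: real"], of 0]
   l2_on_scale[OF bounded_L2_fun[of "%x. 0 :: 'a"], of 0] by simp_all
 moreover have "test_grad (%x. 0 :: real) = (%x. 0 :: 'a)" by (simp add: test_grad_def[abs_def])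
 ultimately show "0 \<in> test_graph" unfolding test_graph_def using test_fun_zero
  by (intro image_eqI[of _ _ "%x. 0"]) (simp_all add: zero_prod_def)
 fix p q assume "p \<in> test_graph" "q \<in> test_graph"
 then obtain \<phi> \<psi> where \<phi>: "\<phi> \<in> test_fun D" "p = (l2_on D \<phi>, l2_on D (test_grad \<phi>))"
  and \<psi>: "\<psi> \<in> test_fun D" "q = (l2_on D \<psi>, l2_on D (test_grad \<psi>))" by (auto simp: test_graph_def)
 show "p + q \<in> test_graph" unfolding test_graph_def
  by (rule image_eqI[OF _ test_fun_add[OF \<phi>(1) \<psi>(1)]])
   (simp add: \<phi>(2) \<psi>(2) test_grad_add[OF \<phi>(1) \<psi>(1)] l2_on_add test_fun_L2[OF \<phi>(1)] test_fun_L2[OF \<psi>(1)])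
next
 fix c p assume "p \<in> test_graph"
 then obtain \<phi> where \<phi>: "\<phi> \<in> test_fun D" "p = (l2_on D \<phi>, l2_on D (test_grad \<phi>))" by (auto simp: test_graph_def)
 show "c *\<^sub>R p \<in> test_graph" unfolding test_graph_def
  by (rule image_eqI[OF _ test_fun_scale[OF \<phi>(1), of c]])
   (use l2_on_scale[OF test_fun_L2(1)[OF \<phi>(1)], of c] in \<open>simp add: \<phi>(2) test_grad_scale[OF \<phi>(1)] l2_on_scale test_fun_L2[OF \<phi>(1)]\<close>)
qed

lemma subspace_graph: "subspace graph"
 unfolding graph_def
proof (rule subspaceI)
 show "0 \<in> closure test_graph"
  using subspace_0[OF subspace_test_graph] closure_subset by blast
 fix p q assume "p \<in> closure test_graph" "q \<in> closure test_graph"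
 then obtain P Q where "\<And>n. P n \<in> test_graph" "P \<longlonglongrightarrow> p" "\<And>n. Q n \<in> test_graph" "Q \<longlonglongrightarrow> q"
  unfolding closure_sequential by blast
 then have "(%n. P n + Q n) \<longlonglongrightarrow> p + q" "\<And>n. P n + Q n \<in> test_graph"
  using subspace_add[OF subspace_test_graph] by (auto intro: tendsto_add)
 then show "p + q \<in> closure test_graph"
  unfolding closure_sequential by (intro exI[of _ "%n. P n + Q n"]) simp
next
 fix c p assume "p \<in> closure test_graph"
 then obtain P where "\<And>n. P n \<in> test_graph" "P \<longlonglongrightarrow> p"
  unfolding closure_sequential by blast
 then have "(%n. c *\<^sub>R P n) \<longlonglongrightarrow> c *\<^sub>R p" "\<And>n. c *\<^sub>R P n \<in> test_graph"
  using subspace_scale[OF subspace_test_graph] by (auto intro: tendsto_scaleR tendsto_const)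
 then show "c *\<^sub>R p \<in> closure test_graph"
  unfolding closure_sequential by (intro exI[of _ "%n. c *\<^sub>R P n"]) simp
qed

text \<open>
  The norm of \<open>H1\<close> is the graph norm.
\<close>

lemma H1_norm_diff_test:
 assumes v: "v \<in> H1 D" and \<phi>: "\<phi> \<in> test_fun D"
 shows "H1_norm D (%x. v x - \<phi> x) = norm ((l2_on D v, G v) - (l2_on D \<phi>, l2_on D (test_grad \<phi>)))"
proof -
 have m: "(%x. - 1 * \<phi> x) \<in> H1 D" by (rule H1_scale[OF test_H1[OF \<phi>]])
 have "H1_norm D (%x. v x + - 1 * \<phi> x) = norm (l2_on D (%x. v x + - 1 * \<phi> x), G (%x. v x + - 1 * \<phi> x))"
  by (rule H1_norm_eq[OF H1_add[OF v m]])
 moreover have "l2_on D (%x. v x + - 1 * \<phi> x) = l2_on D v - l2_on D \<phi>"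
  using l2_on_add[OF H1_L2(1)[OF v] H1_L2(1)[OF m]] l2_on_scale[OF test_fun_L2(1)[OF \<phi>], of "-1"] by simp
 moreover have "G (%x. v x + - 1 * \<phi> x) = G v - l2_on D (test_grad \<phi>)"
  using G_add[OF v m] G_scale[OF test_H1[OF \<phi>], of "-1"] G_test[OF \<phi>] by simp
 ultimately show ?thesis by simp
qed

text \<open>
  Convergence of test functions in the norm of \<open>H1\<close> is convergence of the pairs of classes.
\<close>

lemma H10_iff_graph: "v \<in> H10 D \<longleftrightarrow> v \<in> H1 D \<and> (l2_on D v, G v) \<in> graph"
proof -
 let ?p = "%\<phi>. (l2_on D \<phi>, l2_on D (test_grad \<phi>))"
 have lim: "(%n. H1_norm D (%x. v x - \<phi> n x)) \<longlonglongrightarrow> 0 \<longleftrightarrow> (%n. ?p (\<phi> n)) \<longlonglongrightarrow> (l2_on D v, G v)"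
  if "v \<in> H1 D" "\<forall>n. \<phi> n \<in> test_fun D" for \<phi>
  unfolding H1_norm_diff_test[OF that(1) that(2)[rule_format]]
  by (subst norm_minus_commute) (simp only: tendsto_norm_zero_iff LIM_zero_iff)
 show ?thesis
 proof
  assume v: "v \<in> H10 D"
  then obtain \<phi> where H1: "v \<in> H1 D" and \<phi>: "\<forall>n. \<phi> n \<in> test_fun D"
   and l: "(%n. H1_norm D (%x. v x - \<phi> n x)) \<longlonglongrightarrow> 0" by (auto simp: H10_def)
  have "?p (\<phi> n) \<in> test_graph" for n using \<phi> by (auto simp: test_graph_def)
  then show "v \<in> H1 D \<and> (l2_on D v, G v) \<in> graph"
   unfolding graph_def closure_sequential using H1 l[unfolded lim[OF H1 \<phi>]] by (intro conjI exI[of _ "%n. ?p (\<phi> n)"]) auto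
 next
  assume v: "v \<in> H1 D \<and> (l2_on D v, G v) \<in> graph"
  then obtain P where P: "\<And>n. P n \<in> test_graph" "P \<longlonglongrightarrow> (l2_on D v, G v)" unfolding graph_def closure_sequential by blast
  have "\<exists>\<phi>. \<phi> \<in> test_fun D \<and> P n = ?p \<phi>" for n using P(1)[of n] by (auto simp: test_graph_def)
  then obtain \<phi> where \<phi>: "\<And>n. \<phi> n \<in> test_fun D" "\<And>n. P n = ?p (\<phi> n)" by metis
  have "P = (%n. ?p (\<phi> n))" using \<phi>(2) by (rule ext)
  then have "(%n. H1_norm D (%x. v x - \<phi> n x)) \<longlonglongrightarrow> 0" using P(2) lim[of \<phi>] \<phi>(1) v by simp
  then show "v \<in> H10 D" unfolding H10_def using v \<phi>(1) by blast
 qed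
qed

text \<open>
  A limit of pairs vanishes outside the domain because cutting off is continuous, and the weak gradient relation passes to the
  limit because both of its sides are inner products.
\<close>

lemma graph_H10:
 assumes pg: "(p, g) \<in> graph"
 shows "\<exists>v\<in>H10 D. l2_on D v = p \<and> G v = g"
proof -
 have zt: "zero_ext D (zero_ext D f) = zero_ext D f" for f :: "'a => 'c::euclidean_space"
  by (auto simp: zero_ext_def indicator_def)
 have mI: "multiplier (indicator D :: 'a => real)"
  by (rule multiplierI[of _ 1]) (use D_sets in \<open>auto simp: indicator_def\<close>)
 have cut: "mult_op (indicator D) (l2_on D f) = l2_on D f" if "f \<in> L2_fun D" for f :: "'a => 'c::euclidean_space"
 proof -
  have s: "square_int (zero_ext D f)" using that by (simp add: square_int_zero_ext_iff)
  have "AE x in lebesgue. l2_fun (mult_op (indicator D) (l2_on D f)) x = zero_ext D f x"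
   using l2_fun_mult_op[OF mI, of "l2_on D f"] l2_fun_l2_class[OF s] unfolding l2_on_def
   by eventually_elim (simp add: zero_ext_def indicator_def)
  then have "l2_class (l2_fun (mult_op (indicator D) (l2_on D f))) = l2_class (zero_ext D f)"
   by (subst l2_class_eq_iff[OF square_int_l2_fun s])
  then show ?thesis by (simp add: l2_on_def)
 qed
 obtain P where P: "\<And>n. P n \<in> test_graph" "P \<longlonglongrightarrow> (p, g)" using pg unfolding graph_def closure_sequential by blast
 have "\<exists>\<phi>. \<phi> \<in> test_fun D \<and> P n = (l2_on D \<phi>, l2_on D (test_grad \<phi>))" for n using P(1)[of n] by (auto simp: test_graph_def)
 then obtain \<phi> where \<phi>: "\<And>n. \<phi> n \<in> test_fun D" "\<And>n. P n = (l2_on D (\<phi> n), l2_on D (test_grad (\<phi> n)))" by metis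
 have lp: "(%n. l2_on D (\<phi> n)) \<longlonglongrightarrow> p" and lg: "(%n. l2_on D (test_grad (\<phi> n))) \<longlonglongrightarrow> g"
  using tendsto_fst[OF P(2)] tendsto_snd[OF P(2)] by (simp_all add: \<phi>(2))
 have cp: "mult_op (indicator D) p = p"
 proof (rule LIMSEQ_unique[OF _ lp])
  show "(%n. l2_on D (\<phi> n)) \<longlonglongrightarrow> mult_op (indicator D) p"
   using blinfun.tendsto[OF tendsto_const[of "mult_op (indicator D)"] lp]
   by (simp only: cut[OF test_fun_L2(1)[OF \<phi>(1)]])
 qed
 have cg: "mult_op (indicator D) g = g"
 proof (rule LIMSEQ_unique[OF _ lg])
  show "(%n. l2_on D (test_grad (\<phi> n))) \<longlonglongrightarrow> mult_op (indicator D) g"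
   using blinfun.tendsto[OF tendsto_const[of "mult_op (indicator D)"] lg]
   by (simp only: cut[OF test_fun_L2(2)[OF \<phi>(1)]])
 qed
 have rep: "l2_fun h \<in> L2_fun D \<and> l2_on D (l2_fun h) = h" if "mult_op (indicator D) h = h" for h :: "('a, 'c::euclidean_space) l2"
 proof -
  have z: "zero_ext D (l2_fun h) = (%x. indicator D x *\<^sub>R l2_fun h x)" by (simp add: zero_ext_def[abs_def])
  then have "square_int (zero_ext D (l2_fun h))" using square_int_multiplier[OF mI square_int_l2_fun] by simp
  moreover have "l2_class (zero_ext D (l2_fun h)) = h" using that mult_op_apply[OF mI, of h] z by simp
  ultimately show ?thesis by (simp add: square_int_zero_ext_iff l2_on_def)
 qed
 have R: "l2_fun p \<in> L2_fun D" "l2_on D (l2_fun p) = p" "l2_fun g \<in> L2_fun D" "l2_on D (l2_fun g) = g"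
  using rep[OF cp] rep[OF cg] by auto
 have w: "has_weak_gradient D (l2_fun p) (l2_fun g)"
  unfolding weak_gradient_inner[OF R(1,3)] R(2,4)
 proof (intro ballI)
  fix \<psi> and i :: 'a assume \<psi>: "\<psi> \<in> test_fun D" "i \<in> Basis"
  have "l2_on D (\<phi> n) \<bullet> l2_on D (partial \<psi> i) = - (l2_on D (test_grad (\<phi> n)) \<bullet> l2_on D (%x. \<psi> x *\<^sub>R i))" for n
   using test_has_weak_gradient[OF \<phi>(1)[of n]] weak_gradient_inner[OF test_fun_L2(1,2)[OF \<phi>(1)[of n]]] \<psi> by blast
  moreover have "(%n. l2_on D (\<phi> n) \<bullet> l2_on D (partial \<psi> i)) \<longlonglongrightarrow> p \<bullet> l2_on D (partial \<psi> i)"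
   by (intro tendsto_inner lp tendsto_const)
  moreover have "(%n. - (l2_on D (test_grad (\<phi> n)) \<bullet> l2_on D (%x. \<psi> x *\<^sub>R i))) \<longlonglongrightarrow> - (g \<bullet> l2_on D (%x. \<psi> x *\<^sub>R i))"
   by (intro tendsto_minus tendsto_inner lg tendsto_const)
  ultimately show "p \<bullet> l2_on D (partial \<psi> i) = - (g \<bullet> l2_on D (%x. \<psi> x *\<^sub>R i))"
   using LIMSEQ_unique by simp
 qed
 have H1: "l2_fun p \<in> H1 D" and Gp: "G (l2_fun p) = g" using w G_eq[OF w] R(4) by (auto simp: H1_def)
 have "l2_fun p \<in> H10 D" unfolding H10_iff_graph using H1 pg R(2) Gp by simp
 then show ?thesis using R(2) Gp by blast
qed

text \<open>
  The integral of \<open>\<partial>\<^sub>i (x\<^sub>i * \<phi>\<^sup>2) = \<phi>\<^sup>2 + 2 * x\<^sub>i * \<phi> * \<partial>\<^sub>i \<phi>\<close> vanishes, and \<open>x\<^sub>i\<close> is bounded on the domain.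
  The estimate passes to the closure of the graph.
\<close>

lemma poincare: "\<exists>C>0. \<forall>p g. (p, g) \<in> graph \<longrightarrow> norm p <= C * norm g"
proof -
 obtain R where R: "\<And>x. x \<in> D ==> norm x <= R" "0 < R" using D_bounded bounded_pos by metis
 obtain i :: 'a where i: "i \<in> Basis" using nonempty_Basis by blast
 have test: "norm (l2_on D \<phi>) <= 2 * R * norm (l2_on D (test_grad \<phi>))" if \<phi>: "\<phi> \<in> test_fun D" for \<phi>
 proof -
  note C = smooth_partial[OF test_funD(1)[OF \<phi>]] and L = test_fun_L2[OF \<phi>]
  \<comment> \<open>the function whose partial derivative in direction \<open>i\<close> has vanishing integral\<close>
  have der: "((%x. (x \<bullet> i) * (\<phi> x * \<phi> x)) has_derivative (%h. (x \<bullet> i) * (\<phi> x * frechet_derivative \<phi> (at x) h + frechet_derivative \<phi> (at x) h * \<phi> x) + (h \<bullet> i) * (\<phi> x * \<phi> x))) (at x)" for x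
   by (intro has_derivative_mult C(4)) (auto intro!: derivative_eq_intros)
  have "(\<integral>x. (x \<bullet> i) * (\<phi> x * partial \<phi> i x + partial \<phi> i x * \<phi> x) + (i \<bullet> i) * (\<phi> x * \<phi> x) \<partial>lborel) = 0"
  proof (rule integral_partial_zero[OF der i])
   show "continuous_on UNIV (%x. (x \<bullet> i) * (\<phi> x * partial \<phi> i x + partial \<phi> i x * \<phi> x) + (i \<bullet> i) * (\<phi> x * \<phi> x))"
    using i by (intro continuous_intros C)
   show "bounded {x. (x \<bullet> i) * (\<phi> x * \<phi> x) ~= 0}" by (rule bounded_subset[OF test_funD(3)[OF \<phi>]]) auto
  qed
  moreover have "(x \<bullet> i) * (\<phi> x * partial \<phi> i x + partial \<phi> i x * \<phi> x) + (i \<bullet> i) * (\<phi> x * \<phi> x) = 2 * (x \<bullet> i) * \<phi> x * partial \<phi> i x + (\<phi> x)^2" for x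
   using i by (simp add: inner_Basis algebra_simps power2_eq_square)
  ultimately have z0: "(\<integral>x. 2 * (x \<bullet> i) * \<phi> x * partial \<phi> i x + (\<phi> x)^2 \<partial>lborel) = 0" by (simp only:)
  have "(\<integral>x. 2 * (x \<bullet> i) * \<phi> x * partial \<phi> i x + (\<phi> x)^2 \<partial>lebesgue_on D)
    = (\<integral>x. 2 * (x \<bullet> i) * \<phi> x * partial \<phi> i x + (\<phi> x)^2 \<partial>lborel)"
  proof (rule integral_on_D_lborel)
   show "continuous_on UNIV (%x. 2 * (x \<bullet> i) * \<phi> x * partial \<phi> i x + (\<phi> x)^2)"
    using i by (intro continuous_intros C)
  qed (simp add: test_funD(2)[OF \<phi>])
  then have z: "(\<integral>x. 2 * (x \<bullet> i) * \<phi> x * partial \<phi> i x + (\<phi> x)^2 \<partial>lebesgue_on D) = 0"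
   using z0 by (simp only:)
  have Lx: "(%x. (x \<bullet> i) * \<phi> x) \<in> L2_fun D" by (intro bounded_L2_fun continuous_intros C)
  have int: "integrable (lebesgue_on D) (%x. v x * w x)" if "v \<in> L2_fun D" "w \<in> L2_fun D" for v w :: "'a => real"
   using that integrable_mult_of_squares[of v "lebesgue_on D" w] by (simp add: L2_fun_def)
  have i2: "integrable (lebesgue_on D) (%x. (\<phi> x)^2)" using int[OF L(1) L(1)] by (simp add: power2_eq_square)
  have i3: "integrable (lebesgue_on D) (%x. 2 * (x \<bullet> i) * \<phi> x * partial \<phi> i x)"
   using integrable_mult_right[OF int[OF Lx L(3)[OF i]], of 2] by (simp add: mult.assoc)
  have i4: "integrable (lebesgue_on D) (%x. (partial \<phi> i x)^2)" using int[OF L(3)[OF i] L(3)[OF i]] by (simp add: power2_eq_square)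
  have i5: "integrable (lebesgue_on D) (%x. (norm (test_grad \<phi> x))^2)" using L(2) by (simp add: L2_fun_def)
  have "(\<integral>x. (\<phi> x)^2 \<partial>lebesgue_on D) = (\<integral>x. - (2 * (x \<bullet> i) * \<phi> x * partial \<phi> i x) \<partial>lebesgue_on D)"
   using z i2 i3 by simp
  also have "\<dots> <= (\<integral>x. (\<phi> x)^2 / 2 + 2 * R^2 * (norm (test_grad \<phi> x))^2 \<partial>lebesgue_on D)"
  proof (rule integral_mono)
   show "integrable (lebesgue_on D) (%x. - (2 * (x \<bullet> i) * \<phi> x * partial \<phi> i x))" using i3 by simp
   show "integrable (lebesgue_on D) (%x. (\<phi> x)^2 / 2 + 2 * R^2 * (norm (test_grad \<phi> x))^2)" using i2 i5 by simp
   fix x assume "x \<in> space (lebesgue_on D)"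
   then have x: "x \<in> D" by (simp add: space_restrict_space)
   have xi: "\<bar>x \<bullet> i\<bar> <= R" using Basis_le_norm[OF i, of x] R(1)[OF x] by linarith
   have pi: "\<bar>partial \<phi> i x\<bar> <= norm (test_grad \<phi> x)" using Basis_le_norm[OF i, of "test_grad \<phi> x"] test_grad_inner[OF i] by simp
   have "\<bar>(x \<bullet> i) * partial \<phi> i x\<bar> <= R * norm (test_grad \<phi> x)"
    unfolding abs_mult by (rule mult_mono[OF xi pi]) (use R in auto)
   then have "((x \<bullet> i) * partial \<phi> i x)^2 <= (R * norm (test_grad \<phi> x))^2"
    using abs_le_square_iff[of "(x \<bullet> i) * partial \<phi> i x" "R * norm (test_grad \<phi> x)"] R(2) by simp
   moreover have "0 <= (\<phi> x + 2 * ((x \<bullet> i) * partial \<phi> i x))^2" by simp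
   ultimately show "- (2 * (x \<bullet> i) * \<phi> x * partial \<phi> i x) <= (\<phi> x)^2 / 2 + 2 * R^2 * (norm (test_grad \<phi> x))^2"
    by (simp add: power2_sum power_mult_distrib algebra_simps)
  qed
  also have "\<dots> = (\<integral>x. (\<phi> x)^2 \<partial>lebesgue_on D) / 2 + 2 * R^2 * (\<integral>x. (norm (test_grad \<phi> x))^2 \<partial>lebesgue_on D)"
   using i2 i5 by simp
  finally have "(norm (l2_on D \<phi>))^2 <= (2 * R * norm (l2_on D (test_grad \<phi>)))^2"
   using norm_l2_on[OF L(1)] norm_l2_on[OF L(2)] by (simp add: power_mult_distrib)
  then show ?thesis by (rule power2_le_imp_le) (use R in auto)
 qed
 have "graph \<subseteq> {pg. norm (fst pg) <= 2 * R * norm (snd pg)}"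
  unfolding graph_def
 proof (rule closure_minimal)
  show "test_graph \<subseteq> {pg. norm (fst pg) <= 2 * R * norm (snd pg)}" using test by (auto simp: test_graph_def)
  show "closed {pg :: ('a, real) l2 \<times> ('a, 'a) l2. norm (fst pg) <= 2 * R * norm (snd pg)}"
   by (intro closed_Collect_le continuous_intros)
 qed
 then show ?thesis using R(2) by (intro exI[of _ "2 * R"]) auto
qed

definition energy_space :: "('a, 'a) l2 set" where "energy_space = snd ` graph"

lemma energy_space_eq: "energy_space = G ` H10 D"
 unfolding energy_space_def using H10_iff_graph graph_H10 by (force simp: image_iff)

text \<open>
  By Poincare's inequality convergence of the gradients forces convergence of the functions, so the projection
  of the closed graph is closed.
\<close>

lemma energy_space_closed_subspace: "closed_subspace energy_space"
proof
 show "subspace energy_space" unfolding energy_space_def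
  by (rule linear_subspace_image[OF linear_snd subspace_graph])
 obtain C where C: "0 < C" "\<And>p g. (p, g) \<in> graph ==> norm p <= C * norm g" using poincare by blast
 show "closed energy_space" unfolding closed_sequential_limits
 proof (intro allI impI, elim conjE)
  fix g l assume g: "\<forall>n. g n \<in> energy_space" and lim: "g \<longlonglongrightarrow> l"
  have "\<exists>p. (p, g n) \<in> graph" for n using g[rule_format, of n] by (auto simp: energy_space_def)
  then obtain p where p: "\<And>n. (p n, g n) \<in> graph" by metis
  have le: "norm (p m - p n) <= C * norm (g m - g n)" for m n
   using C(2)[of "p m - p n" "g m - g n"] subspace_diff[OF subspace_graph p p, of m n] by simp
  have "Cauchy p"
  proof (rule metric_CauchyI)
   fix e :: real assume e: "0 < e"
   have "Cauchy g" using lim by (rule LIMSEQ_imp_Cauchy)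
   then obtain N where N: "\<And>m n. m \<ge> N ==> n \<ge> N ==> dist (g m) (g n) < e / C"
    using metric_CauchyD[of g "e / C"] e C(1) by auto
   have "dist (p m) (p n) < e" if "m \<ge> N" "n \<ge> N" for m n
   proof -
    have "C * norm (g m - g n) < e" using N[OF that] C(1) by (simp add: dist_norm field_simps)
    then show ?thesis using le[of m n] by (simp add: dist_norm)
   qed
   then show "\<exists>M. \<forall>m\<ge>M. \<forall>n\<ge>M. dist (p m) (p n) < e" by blast
  qed
  then obtain q where "p \<longlonglongrightarrow> q" using Cauchy_convergent_iff convergent_def by blast
  then have "(%n. (p n, g n)) \<longlonglongrightarrow> (q, l)" using lim by (rule tendsto_Pair)
  moreover have "closed graph" unfolding graph_def by simp
  ultimately have "(q, l) \<in> graph" using p closed_sequentially[of graph "%n. (p n, g n)"] by simp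
  then show "l \<in> energy_space" unfolding energy_space_def by (rule image_eqI[rotated]) simp
 qed
qed

sublocale V: closed_subspace energy_space by (rule energy_space_closed_subspace)

lemma H10_H1: "v \<in> H10 D ==> v \<in> H1 D" by (simp add: H10_def)

lemma H10_add: assumes "v \<in> H10 D" "w \<in> H10 D" shows "(%x. v x + w x) \<in> H10 D"
proof -
 have v: "v \<in> H1 D" "(l2_on D v, G v) \<in> graph" and w: "w \<in> H1 D" "(l2_on D w, G w) \<in> graph"
  using assms by (auto simp: H10_iff_graph)
 show ?thesis unfolding H10_iff_graph
  using H1_add[OF v(1) w(1)] subspace_add[OF subspace_graph v(2) w(2)]
  by (simp add: G_add[OF v(1) w(1)] l2_on_add[OF H1_L2(1)[OF v(1)] H1_L2(1)[OF w(1)]])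
qed

lemma H10_scale: assumes "v \<in> H10 D" shows "(%x. c * v x) \<in> H10 D"
proof -
 have v: "v \<in> H1 D" "(l2_on D v, G v) \<in> graph" using assms by (auto simp: H10_iff_graph)
 show ?thesis unfolding H10_iff_graph
  using H1_scale[OF v(1), of c] subspace_scale[OF subspace_graph v(2), of c] l2_on_scale[OF H1_L2(1)[OF v(1)], of c]
  by (simp add: G_scale[OF v(1)])
qed

text \<open>
  Riesz representation of the right-hand side.  By Poincare's inequality a gradient determines its potential, on which the
  functional depends continuously.
\<close>

lemma load_functional:
 assumes f: "f \<in> L2_fun D"
 shows "\<exists>F\<in>energy_space. \<forall>w\<in>H10 D. F \<bullet> G w = (\<integral>x. f x * w x \<partial>lebesgue_on D)"
proof -
 obtain C where C: "0 < C" "\<And>p g. (p, g) \<in> graph ==> norm p <= C * norm g" using poincare by blast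
 have "\<exists>p. (p, g) \<in> graph" if "g \<in> energy_space" for g using that by (auto simp: energy_space_def)
 then obtain pot where pot: "\<And>g. g \<in> energy_space ==> (pot g, g) \<in> graph" by metis
 have uniq: "p = q" if "(p, g) \<in> graph" "(q, g) \<in> graph" for p q g
  using C(2)[of "p - q" 0] subspace_diff[OF subspace_graph that] by simp
 have "\<exists>w\<in>energy_space. \<forall>v\<in>energy_space. id_blinfun w \<bullet> v = l2_on D f \<bullet> pot v"
 proof (rule coercive_form_represents[OF V.V_subspace V.V_closed, of 1])
  show "id_blinfun v \<bullet> w = id_blinfun w \<bullet> v" for v w :: "('a, 'a) l2" by (simp add: inner_commute)
  show "1 * (norm v)^2 <= id_blinfun v \<bullet> v" for v :: "('a, 'a) l2" by (simp add: power2_norm_eq_inner)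
  show "l2_on D f \<bullet> pot (v + w) = l2_on D f \<bullet> pot v + l2_on D f \<bullet> pot w" if "v \<in> energy_space" "w \<in> energy_space" for v w
  proof -
   have "pot (v + w) = pot v + pot w"
    by (rule uniq[OF pot[OF subspace_add[OF V.V_subspace that]]]) (use subspace_add[OF subspace_graph pot[OF that(1)] pot[OF that(2)]] in simp)
   then show ?thesis by (simp add: inner_add_right)
  qed
  show "l2_on D f \<bullet> pot (t *\<^sub>R v) = t * (l2_on D f \<bullet> pot v)" if "v \<in> energy_space" for t v
  proof -
   have "pot (t *\<^sub>R v) = t *\<^sub>R pot v"
    by (rule uniq[OF pot[OF subspace_scale[OF V.V_subspace that]]]) (use subspace_scale[OF subspace_graph pot[OF that]] in simp)
   then show ?thesis by simp
  qed
  show "\<bar>l2_on D f \<bullet> pot v\<bar> <= (norm (l2_on D f) * C) * norm v" if "v \<in> energy_space" for v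
  proof -
   have "\<bar>l2_on D f \<bullet> pot v\<bar> <= norm (l2_on D f) * norm (pot v)" by (rule Cauchy_Schwarz_ineq2)
   also have "\<dots> <= norm (l2_on D f) * (C * norm v)" by (intro mult_left_mono C(2) pot that) simp
   finally show ?thesis by (simp add: mult.assoc)
  qed
 qed simp
 then obtain F where F: "F \<in> energy_space" "\<And>v. v \<in> energy_space ==> F \<bullet> v = l2_on D f \<bullet> pot v" by auto
 have "F \<bullet> G w = (\<integral>x. f x * w x \<partial>lebesgue_on D)" if w: "w \<in> H10 D" for w
 proof -
  have Gw: "G w \<in> energy_space" using w by (auto simp: energy_space_eq)
  have "pot (G w) = l2_on D w" by (rule uniq[OF pot[OF Gw] H10_iff_graph[THEN iffD1, THEN conjunct2, OF w]])
  then show ?thesis using F(2)[OF Gw] inner_l2_on[OF f H1_L2(1)[OF H10_H1[OF w]]] by simp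
 qed
 then show ?thesis using F(1) by blast
qed

text \<open>
  Integrals over the domain become inner products of gradient classes, because gradients are extended by zero.
\<close>

lemma weak_solution_iff:
 assumes a: "multiplier a'" "AE x in lebesgue_on D. a x = a' x" and v: "v \<in> H10 D"
  and F: "\<And>w. w \<in> H10 D ==> F \<bullet> G w = (\<integral>x. f x * w x \<partial>lebesgue_on D)"
 shows "weak_solution D a f v \<longleftrightarrow> (\<forall>g\<in>energy_space. mult_op a' (G v) \<bullet> g = F \<bullet> g)"
proof -
 have "(\<integral>x. a x * (wgrad D v x \<bullet> wgrad D w x) \<partial>lebesgue_on D) = mult_op a' (G v) \<bullet> G w" if w: "w \<in> H10 D" for w
 proof -
  have Lv: "wgrad D v \<in> L2_fun D" and Lw: "wgrad D w \<in> L2_fun D" using v w H10_H1 H1_L2 by blast+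
  have sv: "square_int (zero_ext D (wgrad D v))" and sw: "square_int (zero_ext D (wgrad D w))"
   using Lv Lw by (simp_all add: square_int_zero_ext_iff)
  have mp: "(%x. a' x * (l2_fun (G v) x \<bullet> l2_fun (G w) x)) \<in> borel_measurable lebesgue"
   using integrable_mult_inner[OF a(1)] by (rule borel_measurable_integrable)
  have ae: "AE x in lebesgue. a' x * (l2_fun (G v) x \<bullet> l2_fun (G w) x) = indicator D x * (a x * (wgrad D v x \<bullet> wgrad D w x))"
   using l2_fun_l2_class[OF sv] l2_fun_l2_class[OF sw] a(2) unfolding AE_on_D G_def l2_on_def
   by eventually_elim (auto simp: zero_ext_def indicator_def)
  have "mult_op a' (G v) \<bullet> G w = (\<integral>x. a' x * (l2_fun (G v) x \<bullet> l2_fun (G w) x) \<partial>lebesgue)" by (rule mult_op_inner[OF a(1)])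
  also have "\<dots> = (\<integral>x. indicator D x * (a x * (wgrad D v x \<bullet> wgrad D w x)) \<partial>lebesgue)"
  proof (rule integral_cong_AE[OF mp _ ae])
   show "(%x. indicator D x * (a x * (wgrad D v x \<bullet> wgrad D w x))) \<in> borel_measurable lebesgue"
    by (rule borel_measurable_AE[OF mp ae])
  qed
  finally show ?thesis by (simp add: integral_on_D)
 qed
 then show ?thesis unfolding weak_solution_def energy_space_eq using v F by auto
qed

end

section \<open>Taylor coefficients of the parametric solution\<close>

lemma abs_exp_diff_le:
 fixes s t :: real
 assumes "\<bar>s\<bar> <= M" "\<bar>t\<bar> <= M" shows "\<bar>exp s - exp t\<bar> <= exp M * \<bar>s - t\<bar>"
proof -
 have *: "\<bar>exp s - exp t\<bar> <= exp M * \<bar>s - t\<bar>" if "s < t" "\<bar>s\<bar> <= M" "\<bar>t\<bar> <= M" for s t :: real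
 proof -
  obtain z where z: "s < z" "z < t" "exp t - exp s = (t - s) * exp z"
   using MVT2[OF \<open>s < t\<close>, of exp exp] DERIV_exp by blast
  have "exp z <= exp M" using z that by simp
  then have "(t - s) * exp z <= (t - s) * exp M" using that by (intro mult_left_mono) auto
  moreover have "0 <= (t - s) * exp z" using that by simp
  ultimately show ?thesis using z(3) that by (simp add: abs_if mult.commute split: if_splits)
 qed
 consider "s < t" | "t < s" | "s = t" by linarith
 then show ?thesis
 proof cases
  case 2
  then show ?thesis using *[OF 2 assms(2,1)] by (simp add: abs_minus_commute)
 qed (use * assms in auto)
qed

text \<open>
  The quadratic remainder makes the difference quotients of the coefficient converge uniformly in \<open>x\<close>.
\<close>

lemma abs_exp_taylor_le: "\<bar>exp u - 1 - u\<bar> <= exp \<bar>u\<bar> * u^2" for u :: real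
proof (cases "u = 0")
 case False
 have "\<exists>z. \<bar>z\<bar> <= \<bar>u\<bar> \<and> exp u - 1 = u * exp z"
 proof (cases "0 < u")
  case True
  then obtain z where "0 < z" "z < u" "exp u - exp 0 = (u - 0) * exp z"
   using MVT2[of 0 u exp exp] DERIV_exp by blast
  then show ?thesis by (intro exI[of _ z]) auto
 next
  case n: False
  then have "u < 0" using False by simp
  then obtain z where "u < z" "z < 0" "exp 0 - exp u = (0 - u) * exp z"
   using MVT2[of u 0 exp exp] DERIV_exp by blast
  then show ?thesis by (intro exI[of _ z]) auto
 qed
 then obtain z where z: "\<bar>z\<bar> <= \<bar>u\<bar>" "exp u - 1 = u * exp z" by blast
 have "\<bar>exp z - exp 0\<bar> <= exp \<bar>u\<bar> * \<bar>z - 0\<bar>" using z by (intro abs_exp_diff_le) auto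
 also have "\<dots> <= exp \<bar>u\<bar> * \<bar>u\<bar>" using z by (intro mult_left_mono) auto
 finally have "\<bar>u\<bar> * \<bar>exp z - 1\<bar> <= \<bar>u\<bar> * (exp \<bar>u\<bar> * \<bar>u\<bar>)" by (intro mult_left_mono) auto
 moreover have "exp u - 1 - u = u * (exp z - 1)" using z(2) by (simp add: algebra_simps)
 moreover have "\<bar>u\<bar> * (exp \<bar>u\<bar> * \<bar>u\<bar>) = exp \<bar>u\<bar> * u^2" by (simp add: power2_eq_square mult_ac)
 ultimately show ?thesis by (simp only: abs_mult)
qed simp

abbreviation sub_index :: "(nat => nat) => (nat => nat) => nat => nat" where
 "sub_index \<mu> m \<equiv> (%i. \<mu> i - m i)"

abbreviation zero_index :: "nat => nat" where "zero_index \<equiv> (%_. 0)"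

abbreviation below :: "(nat => nat) => (nat => nat) set" where
 "below \<mu> \<equiv> {m. m <= \<mu> \<and> m ~= zero_index}"

abbreviation incr :: "nat => (nat => nat) => nat => nat" where
 "incr j \<mu> \<equiv> \<mu>(j := Suc (\<mu> j))"

definition index_size :: "(nat => nat) => nat" where "index_size \<mu> = (\<Sum>j | \<mu> j ~= 0. \<mu> j)"

lemma index_size_eq:
 assumes "finite J" "\<And>j. j \<notin> J ==> \<mu> j = 0" shows "index_size \<mu> = (\<Sum>j\<in>J. \<mu> j)"
 unfolding index_size_def
proof (rule sum.mono_neutral_left[OF assms(1)])
 show "{j. \<mu> j ~= 0} \<subseteq> J" by (rule subsetI, rule ccontr) (simp add: assms(2))
qed simp

lemma index_size_sub:
 assumes \<mu>: "\<mu> \<in> multi_indices" and m: "m <= \<mu>" "m ~= zero_index"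
 shows "index_size (sub_index \<mu> m) < index_size \<mu>"
proof -
 let ?J = "{j. \<mu> j ~= 0}"
 have J: "finite ?J" by (rule multi_indicesD[OF \<mu>])
 have "index_size (sub_index \<mu> m) = (\<Sum>j\<in>?J. \<mu> j - m j)" by (rule index_size_eq[OF J]) simp
 also have "\<dots> < (\<Sum>j\<in>?J. \<mu> j)"
 proof (rule sum_strict_mono_ex1[OF J])
  obtain i where "m i ~= 0" using m(2) by auto
  then show "\<exists>i\<in>?J. \<mu> i - m i < \<mu> i" using m(1) by (intro bexI[of _ i]) (auto simp: le_fun_def dest: spec[of _ i])
 qed simp
 finally show ?thesis by (simp add: index_size_def)
qed

text \<open>
  The scaled sums are bounded at every point, not just almost everywhere, so that all coefficients are honest bounded functions.
\<close>

locale affine_exponent =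
 fixes \<psi> :: "nat => 'a::euclidean_space => real" and \<sigma> :: "nat => real" and K :: real
 assumes \<psi>_meas: "\<And>j. \<psi> j \<in> borel_measurable lebesgue"
  and \<sigma>_pos: "\<And>j. 0 < \<sigma> j"
  and \<psi>_summable: "\<And>x. summable (%j. \<sigma> j * \<bar>\<psi> j x\<bar>)"
  and \<psi>_sum: "\<And>x. (\<Sum>j. \<sigma> j * \<bar>\<psi> j x\<bar>) <= K"
begin

lemma K_nonneg: "0 <= K"
proof -
 have "0 <= (\<Sum>j. \<sigma> j * \<bar>\<psi> j x\<bar>)" for x
  using \<sigma>_pos by (intro suminf_nonneg \<psi>_summable mult_nonneg_nonneg) (auto intro: less_imp_le)
 then show ?thesis using \<psi>_sum order_trans by blast
qed

text \<open>
  The parameter may be unbounded as a sequence; only its size relative to \<open>\<sigma>\<close> enters.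
\<close>

definition bounded_by :: "real => (nat => real) => bool" where
 "bounded_by B y \<longleftrightarrow> (\<forall>j. \<bar>y j\<bar> <= B * \<sigma> j)"

definition exponent :: "(nat => real) => 'a => real" where "exponent y x = (\<Sum>j. y j * \<psi> j x)"

lemma bounded_by_nonneg: "bounded_by B y ==> 0 <= B"
 using \<sigma>_pos[of 0] unfolding bounded_by_def by (metis abs_ge_zero order_trans zero_le_mult_iff not_le)

lemma
 assumes y: "bounded_by B y"
 shows exponent_summable: "summable (%j. y j * \<psi> j x)" and exponent_le: "\<bar>exponent y x\<bar> <= B * K"
proof -
 have le: "norm (y j * \<psi> j x) <= B * (\<sigma> j * \<bar>\<psi> j x\<bar>)" for j
  using mult_right_mono[OF y[unfolded bounded_by_def, rule_format, of j] abs_ge_zero[of "\<psi> j x"]]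
  by (simp add: abs_mult mult.assoc)
 have s: "summable (%j. B * (\<sigma> j * \<bar>\<psi> j x\<bar>))" by (rule summable_mult[OF \<psi>_summable])
 show "summable (%j. y j * \<psi> j x)" by (rule summable_comparison_test'[OF s le])
 have "norm (exponent y x) <= (\<Sum>j. B * (\<sigma> j * \<bar>\<psi> j x\<bar>))"
  unfolding exponent_def by (rule norm_suminf_le[OF le s])
 also have "\<dots> = B * (\<Sum>j. \<sigma> j * \<bar>\<psi> j x\<bar>)" by (rule suminf_mult[OF \<psi>_summable])
 also have "\<dots> <= B * K" by (rule mult_left_mono[OF \<psi>_sum bounded_by_nonneg[OF y]])
 finally show "\<bar>exponent y x\<bar> <= B * K" by simp
qed

lemma exponent_diff_le:
 assumes "bounded_by B y" "bounded_by B z" "bounded_by \<delta> (%j. z j - y j)"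
 shows "\<bar>exponent z x - exponent y x\<bar> <= \<delta> * K"
proof -
 have "exponent z x - exponent y x = exponent (%j. z j - y j) x"
  unfolding exponent_def using suminf_diff[OF exponent_summable[OF assms(2)] exponent_summable[OF assms(1)], of x]
  by (simp add: left_diff_distrib)
 then show ?thesis using exponent_le[OF assms(3)] by simp
qed

lemma exponent_measurable: "exponent y \<in> borel_measurable lebesgue"
 unfolding exponent_def by (intro borel_measurable_suminf borel_measurable_times borel_measurable_const \<psi>_meas)

lemma bounded_by_upd: "bounded_by B y ==> \<bar>t\<bar> <= C * \<sigma> j ==> B <= C ==> bounded_by C (y(j := t))"
 unfolding bounded_by_def using \<sigma>_pos
 by (auto intro: order_trans mult_right_mono less_imp_le)

lemma exponent_upd:
 assumes "bounded_by B y"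
 shows "exponent (y(j := t)) x = exponent (y(j := 0)) x + t * \<psi> j x"
proof -
 have C: "\<bar>t\<bar> <= max B (\<bar>t\<bar> / \<sigma> j) * \<sigma> j"
  using \<sigma>_pos[of j] mult_right_mono[of "\<bar>t\<bar> / \<sigma> j" "max B (\<bar>t\<bar> / \<sigma> j)" "\<sigma> j"] by simp
 have 1: "bounded_by (max B (\<bar>t\<bar> / \<sigma> j)) (y(j := t))" by (rule bounded_by_upd[OF assms C]) simp
 have 0: "bounded_by B (y(j := 0))"
  by (rule bounded_by_upd[OF assms]) (use \<sigma>_pos[of j] bounded_by_nonneg[OF assms] in auto)
 have "exponent (y(j := t)) x - exponent (y(j := 0)) x = (\<Sum>i. (y(j := t)) i * \<psi> i x - (y(j := 0)) i * \<psi> i x)"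
  unfolding exponent_def by (rule suminf_diff[OF exponent_summable[OF 1] exponent_summable[OF 0]])
 also have "\<dots> = (\<Sum>i. if i = j then t * \<psi> j x else 0)" by (rule arg_cong[of _ _ suminf]) auto
 also have "\<dots> = t * \<psi> j x" using suminf_finite[of "{j}" "%i. if i = j then t * \<psi> j x else 0"] by simp
 finally show ?thesis by simp
qed

text \<open>
  The coefficient \<open>\<psi> ^ m / m!\<close> of the Taylor expansion of the exponential in the parameters.
\<close>

definition power_weight :: "(nat => nat) => 'a => real" where
 "power_weight m x = (\<Prod>j | m j ~= 0. \<psi> j x ^ m j / fact (m j))"

definition scale :: "(nat => nat) => real" where "scale m = (\<Prod>j | m j ~= 0. \<sigma> j ^ m j)"

lemma power_weight_eq:
 assumes "finite J" "\<And>j. j \<notin> J ==> m j = 0"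
 shows "power_weight m x = (\<Prod>j\<in>J. \<psi> j x ^ m j / fact (m j))"
 unfolding power_weight_def
proof (rule prod.mono_neutral_left[OF assms(1)])
 show "{j. m j ~= 0} \<subseteq> J" by (rule subsetI, rule ccontr) (simp add: assms(2))
qed simp

lemma scale_eq:
 assumes "finite J" "\<And>j. j \<notin> J ==> m j = 0" shows "scale m = (\<Prod>j\<in>J. \<sigma> j ^ m j)"
 unfolding scale_def
proof (rule prod.mono_neutral_left[OF assms(1)])
 show "{j. m j ~= 0} \<subseteq> J" by (rule subsetI, rule ccontr) (simp add: assms(2))
qed simp

lemma scale_pos: "0 < scale m"
 unfolding scale_def using \<sigma>_pos by (intro prod_pos) simp

lemma scale_zero [simp]: "scale zero_index = 1" by (simp add: scale_def)

lemma scale_add: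
 assumes \<mu>: "\<mu> \<in> multi_indices" and m: "m <= \<mu>" shows "scale \<mu> = scale m * scale (sub_index \<mu> m)"
proof -
 note J = multi_indicesD[OF \<mu>]
 have z: "m j = 0" if "j \<notin> {j. \<mu> j ~= 0}" for j using that m by (auto simp: le_fun_def dest: spec[of _ j])
 have "scale \<mu> = (\<Prod>j | \<mu> j ~= 0. \<sigma> j ^ m j * \<sigma> j ^ (\<mu> j - m j))"
  unfolding scale_def using m by (intro prod.cong refl) (simp add: le_fun_def flip: power_add)
 also have "\<dots> = scale m * scale (sub_index \<mu> m)"
  by (subst scale_eq[OF J z], assumption, subst scale_eq[OF J, of "sub_index \<mu> m"]) (auto simp: prod.distrib)
 finally show ?thesis .
qed

lemma scaled_psi_le: "\<sigma> j * \<bar>\<psi> j x\<bar> <= K"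
proof -
 have "(\<Sum>i\<in>{j}. \<sigma> i * \<bar>\<psi> i x\<bar>) <= (\<Sum>i. \<sigma> i * \<bar>\<psi> i x\<bar>)"
  by (intro sum_le_suminf \<psi>_summable) (auto intro!: mult_nonneg_nonneg less_imp_le[OF \<sigma>_pos])
 then show ?thesis using \<psi>_sum[of x] by simp
qed

text \<open>
 Summed over a box of multi-indices, the scaled Taylor weights of the exponential stay below
 \<open>exp K\<close>: the sum factorises into truncated exponential series.
\<close>

lemma sum_scaled_power_weight_le:
 assumes N: "N \<in> multi_indices"
 shows "(\<Sum>m\<in>{..N}. scale m * \<bar>power_weight m x\<bar>) <= exp K"
proof -
 note J = multi_indicesD[OF N]
 have z: "m j = 0" if "m \<in> {..N}" "j \<notin> {j. N j ~= 0}" for m j using that by (auto simp: le_fun_def dest: spec[of _ j])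
 have "(\<Sum>m\<in>{..N}. scale m * \<bar>power_weight m x\<bar>) = (\<Sum>m\<in>{..N}. \<Prod>j | N j ~= 0. (\<sigma> j * \<bar>\<psi> j x\<bar>) ^ m j / fact (m j))"
 proof (rule sum.cong[OF refl])
  fix m assume m: "m \<in> {..N}"
  have "scale m * \<bar>power_weight m x\<bar> = (\<Prod>j | N j ~= 0. \<sigma> j ^ m j) * \<bar>\<Prod>j | N j ~= 0. \<psi> j x ^ m j / fact (m j)\<bar>"
   using scale_eq[OF J z[OF m]] power_weight_eq[OF J z[OF m]] by simp
  also have "\<dots> = (\<Prod>j | N j ~= 0. (\<sigma> j * \<bar>\<psi> j x\<bar>) ^ m j / fact (m j))"
   by (simp add: abs_prod power_abs power_mult_distrib flip: prod.distrib)
  finally show "scale m * \<bar>power_weight m x\<bar> = (\<Prod>j | N j ~= 0. (\<sigma> j * \<bar>\<psi> j x\<bar>) ^ m j / fact (m j))" .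
 qed
 also have "\<dots> = (\<Prod>j | N j ~= 0. \<Sum>l\<le>N j. (\<sigma> j * \<bar>\<psi> j x\<bar>) ^ l / fact l)"
  by (rule sum_below_multi_index_prod[OF J]) simp
 also have "\<dots> <= (\<Prod>j | N j ~= 0. exp (\<sigma> j * \<bar>\<psi> j x\<bar>))"
 proof (rule prod_mono, rule conjI)
  fix j
  have nn: "0 <= \<sigma> j * \<bar>\<psi> j x\<bar>" using \<sigma>_pos[of j] by simp
  then show "0 <= (\<Sum>l\<le>N j. (\<sigma> j * \<bar>\<psi> j x\<bar>) ^ l / fact l)" by (intro sum_nonneg) simp
  have "(\<Sum>l\<le>N j. (\<sigma> j * \<bar>\<psi> j x\<bar>) ^ l /\<^sub>R fact l) <= exp (\<sigma> j * \<bar>\<psi> j x\<bar>)"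
   unfolding exp_def using nn by (intro sum_le_suminf summable_exp_generic) auto
  then show "(\<Sum>l\<le>N j. (\<sigma> j * \<bar>\<psi> j x\<bar>) ^ l / fact l) <= exp (\<sigma> j * \<bar>\<psi> j x\<bar>)"
   by (simp add: divide_inverse mult.commute)
 qed
 also have "\<dots> = exp (\<Sum>j | N j ~= 0. \<sigma> j * \<bar>\<psi> j x\<bar>)" by (rule exp_sum[OF J, symmetric])
 also have "\<dots> <= exp K"
 proof -
  have "(\<Sum>j | N j ~= 0. \<sigma> j * \<bar>\<psi> j x\<bar>) <= (\<Sum>j. \<sigma> j * \<bar>\<psi> j x\<bar>)"
   by (intro sum_le_suminf \<psi>_summable J) (auto intro!: mult_nonneg_nonneg less_imp_le[OF \<sigma>_pos])
  then show ?thesis using \<psi>_sum[of x] by simp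
 qed
 finally show ?thesis .
qed

lemma power_weight_le:
 assumes "m \<in> multi_indices" shows "\<bar>power_weight m x\<bar> <= exp K / scale m"
proof -
 have "scale m * \<bar>power_weight m x\<bar> <= (\<Sum>m'\<in>{..m}. scale m' * \<bar>power_weight m' x\<bar>)"
  by (rule member_le_sum[of m "{..m}" "%m. scale m * \<bar>power_weight m x\<bar>"])
   (auto intro!: finite_multi_indices_below[OF assms] mult_nonneg_nonneg less_imp_le[OF scale_pos])
 then have "scale m * \<bar>power_weight m x\<bar> <= exp K" using sum_scaled_power_weight_le[OF assms, of x] by linarith
 then show ?thesis using scale_pos[of m] by (simp add: pos_le_divide_eq mult.commute)
qed

lemma power_weight_measurable: "power_weight m \<in> borel_measurable lebesgue"
 unfolding power_weight_def
 by (intro borel_measurable_prod borel_measurable_divide borel_measurable_power borel_measurable_const \<psi>_meas)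

lemma power_weight_incr:
 assumes m: "m \<in> multi_indices"
 shows "real (Suc (m j)) * power_weight (incr j m) x = \<psi> j x * power_weight m x"
proof -
 let ?J = "insert j {i. m i ~= 0}"
 have J: "finite ?J" using multi_indicesD[OF m] by simp
 have "power_weight (incr j m) x = (\<Prod>i\<in>?J. \<psi> i x ^ incr j m i / fact (incr j m i))"
  by (rule power_weight_eq[OF J]) auto
 also have "\<dots> = \<psi> j x ^ Suc (m j) / fact (Suc (m j)) * (\<Prod>i\<in>?J - {j}. \<psi> i x ^ m i / fact (m i))"
  by (subst prod.remove[OF J, of j]) (auto intro!: prod.cong arg_cong2[of _ _ _ _ "(*)"])
 finally have 1: "power_weight (incr j m) x = \<psi> j x ^ Suc (m j) / fact (Suc (m j)) * (\<Prod>i\<in>?J - {j}. \<psi> i x ^ m i / fact (m i))" .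
 have "power_weight m x = (\<Prod>i\<in>?J. \<psi> i x ^ m i / fact (m i))"
  by (rule power_weight_eq[OF J]) auto
 also have "\<dots> = \<psi> j x ^ m j / fact (m j) * (\<Prod>i\<in>?J - {j}. \<psi> i x ^ m i / fact (m i))"
  by (subst prod.remove[OF J, of j]) auto
 finally have 2: "power_weight m x = \<psi> j x ^ m j / fact (m j) * (\<Prod>i\<in>?J - {j}. \<psi> i x ^ m i / fact (m i))" .
 show ?thesis unfolding 1 2 by (simp add: field_simps del: of_nat_Suc)
qed

text \<open>
  The Taylor coefficient of order \<open>m\<close> of the diffusion coefficient at \<open>y\<close>, acting by multiplication.
\<close>

definition coeff_op :: "(nat => real) => (nat => nat) => ('a, 'b::euclidean_space) l2 \<Rightarrow>\<^sub>L ('a, 'b) l2" where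
 "coeff_op y m = mult_op (%x. exp (exponent y x) * power_weight m x)"

lemma coeff_weight_measurable: "(%x. exp (exponent y x) * power_weight m x) \<in> borel_measurable lebesgue"
 by (intro borel_measurable_times power_weight_measurable measurable_compose[OF exponent_measurable borel_measurable_exp])

lemma coeff_multiplier:
 assumes "bounded_by B y" "m \<in> multi_indices"
 shows "multiplier (%x. exp (exponent y x) * power_weight m x)"
proof (rule multiplierI[OF coeff_weight_measurable])
 fix x
 have "exp (exponent y x) <= exp (B * K)" using exponent_le[OF assms(1), of x] by (simp add: abs_le_iff)
 then show "\<bar>exp (exponent y x) * power_weight m x\<bar> <= exp (B * K) * (exp K / scale m)"
  unfolding abs_mult by (intro mult_mono power_weight_le assms(2)) auto
qed

lemma coeff_op_diff_le:
 assumes y: "bounded_by B y" and z: "bounded_by B z" and d: "bounded_by \<delta> (%j. z j - y j)"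
  and m: "m \<in> multi_indices"
 shows "norm (coeff_op z m - coeff_op y m :: ('a, 'b::euclidean_space) l2 \<Rightarrow>\<^sub>L _) <= exp (B * K) * (\<delta> * K) * (exp K / scale m)"
proof -
 let ?c = "%y x. exp (exponent y x) * power_weight m x"
 note M = coeff_multiplier[OF z m] coeff_multiplier[OF y m]
 have eq: "coeff_op z m - coeff_op y m = (mult_op (%x. 1 * ?c z x + (- 1) * ?c y x) :: ('a, 'b) l2 \<Rightarrow>\<^sub>L _)"
  unfolding mult_op_lin[OF M] coeff_op_def by simp
 show ?thesis unfolding eq
 proof (rule norm_mult_op_le[OF multiplier_lin[OF M]])
  fix x
  have "\<bar>exp (exponent z x) - exp (exponent y x)\<bar> <= exp (B * K) * \<bar>exponent z x - exponent y x\<bar>"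
   by (rule abs_exp_diff_le[OF exponent_le[OF z] exponent_le[OF y]])
  also have "\<dots> <= exp (B * K) * (\<delta> * K)" by (intro mult_left_mono exponent_diff_le[OF y z d]) simp
  finally have 1: "\<bar>exp (exponent z x) - exp (exponent y x)\<bar> <= exp (B * K) * (\<delta> * K)" .
  have "1 * ?c z x + (- 1) * ?c y x = (exp (exponent z x) - exp (exponent y x)) * power_weight m x"
   by (simp add: left_diff_distrib)
  then show "\<bar>1 * ?c z x + (- 1) * ?c y x\<bar> <= exp (B * K) * (\<delta> * K) * (exp K / scale m)"
   using mult_mono[OF 1 power_weight_le[OF m, of x]] order_trans[OF abs_ge_zero 1] by (simp only: abs_mult abs_ge_zero)
 qed
qed

lemma tendsto_coeff_op:
 assumes y: "bounded_by B y" and z: "\<forall>\<^sub>F s in F. bounded_by B (z s)"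
  and d: "\<forall>\<^sub>F s in F. bounded_by (\<delta> s) (%j. z s j - y j)" and \<delta>: "(\<delta> \<longlongrightarrow> 0) F" and m: "m \<in> multi_indices"
 shows "((%s. coeff_op (z s) m :: ('a, 'b::euclidean_space) l2 \<Rightarrow>\<^sub>L _) \<longlongrightarrow> coeff_op y m) F"
proof -
 have "((%s. exp (B * K) * (\<delta> s * K) * (exp K / scale m)) \<longlongrightarrow> exp (B * K) * (0 * K) * (exp K / scale m)) F"
  by (intro tendsto_mult tendsto_const \<delta>)
 then have l: "((%s. exp (B * K) * (\<delta> s * K) * (exp K / scale m)) \<longlongrightarrow> 0) F" by simp
 have "\<forall>\<^sub>F s in F. norm (coeff_op (z s) m - coeff_op y m :: ('a, 'b) l2 \<Rightarrow>\<^sub>L _) <= exp (B * K) * (\<delta> s * K) * (exp K / scale m)"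
  using z d by eventually_elim (rule coeff_op_diff_le[OF y _ _ m])
 then have "((%s. coeff_op (z s) m - coeff_op y m :: ('a, 'b) l2 \<Rightarrow>\<^sub>L _) \<longlongrightarrow> 0) F" using l by (rule Lim_null_comparison)
 then show ?thesis by (simp only: LIM_zero_iff)
qed

lemma coeff_op_sym: "coeff_op y m p \<bullet> q = coeff_op y m q \<bullet> p"
 unfolding coeff_op_def by (rule mult_op_sym)

lemma power_weight_zero [simp]: "power_weight zero_index x = 1" by (simp add: power_weight_def)

lemma zero_index_multi [simp]: "zero_index \<in> multi_indices" by (simp add: multi_indices_def)

lemma coeff_op_zero_ge:
 assumes y: "bounded_by B y"
 shows "exp (- (B * K)) * (norm p)^2 <= coeff_op y zero_index p \<bullet> p"
proof -
 have M: "multiplier (%x. exp (exponent y x) * power_weight zero_index x)" by (rule coeff_multiplier[OF y]) simp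
 have "exp (- (B * K)) * (norm p)^2 = (\<integral>x. exp (- (B * K)) * (norm (l2_fun p x))^2 \<partial>lebesgue)"
  using norm_l2_class[OF square_int_l2_fun, of p] by simp
 also have "\<dots> <= (\<integral>x. (exp (exponent y x) * power_weight zero_index x) * (l2_fun p x \<bullet> l2_fun p x) \<partial>lebesgue)"
 proof (rule integral_mono)
  show "integrable lebesgue (%x. exp (- (B * K)) * (norm (l2_fun p x))^2)"
   by (rule integrable_mult_right) (use square_int_l2_fun[of p] in \<open>simp only: square_int_def\<close>)
  show "integrable lebesgue (%x. (exp (exponent y x) * power_weight zero_index x) * (l2_fun p x \<bullet> l2_fun p x))"
   by (rule integrable_mult_inner[OF M])
  fix x
  have "exp (- (B * K)) <= exp (exponent y x)" using exponent_le[OF y, of x] by (simp add: abs_le_iff)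
  then show "exp (- (B * K)) * (norm (l2_fun p x))^2 <= (exp (exponent y x) * power_weight zero_index x) * (l2_fun p x \<bullet> l2_fun p x)"
   by (simp only: power_weight_zero mult_1_right power2_norm_eq_inner) (rule mult_right_mono, simp_all)
 qed
 also have "\<dots> = coeff_op y zero_index p \<bullet> p" unfolding coeff_op_def by (rule mult_op_inner[OF M, symmetric])
 finally show ?thesis .
qed

lemma coercive_coeff_op: "bounded_by B y ==> coercive_on V (exp (- (B * K))) (coeff_op y zero_index)"
 unfolding coercive_on_def using coeff_op_zero_ge coeff_op_sym by auto

lemma coeff_op_has_derivative:
 assumes y: "bounded_by B y" and m: "m \<in> multi_indices"
 shows "((%t. coeff_op (y(j := t)) m :: ('a, 'b::euclidean_space) l2 \<Rightarrow>\<^sub>L _) has_vector_derivative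
  real (Suc (m j)) *\<^sub>R coeff_op (y(j := t)) (incr j m)) (at t)"
proof -
 define C where "C = max B ((\<bar>t\<bar> + 1) / \<sigma> j)"
 have C: "(\<bar>t\<bar> + 1) <= C * \<sigma> j"
  using \<sigma>_pos[of j] mult_right_mono[of "(\<bar>t\<bar> + 1) / \<sigma> j" C "\<sigma> j"] by (simp add: C_def)
 have bd: "bounded_by C (y(j := s))" if "\<bar>s - t\<bar> < 1" for s
  by (rule bounded_by_upd[OF y]) (use that C in \<open>auto simp: C_def\<close>)
 have bt: "bounded_by C (y(j := t))" by (rule bd) simp
 have im: "incr j m \<in> multi_indices" by (rule multi_indices_upd[OF m])
 define L where "L = exp (C * K) * (exp (K / \<sigma> j) * (K / \<sigma> j)^2) * (exp K / scale m)"
 have \<psi>le: "\<bar>\<psi> j x\<bar> <= K / \<sigma> j" for x using scaled_psi_le[of j x] \<sigma>_pos[of j] by (simp add: pos_le_divide_eq mult.commute)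
 have est: "norm ((1 / (s - t)) *\<^sub>R (coeff_op (y(j := s)) m - coeff_op (y(j := t)) m)
   - real (Suc (m j)) *\<^sub>R coeff_op (y(j := t)) (incr j m) :: ('a, 'b) l2 \<Rightarrow>\<^sub>L _) <= \<bar>s - t\<bar> * L"
  if s: "s ~= t" "\<bar>s - t\<bar> < 1" for s
 proof -
  let ?c = "%s x. exp (exponent (y(j := s)) x) * power_weight m x"
  let ?d = "%x. exp (exponent (y(j := t)) x) * power_weight (incr j m) x"
  note M = coeff_multiplier[OF bd[OF s(2)] m] coeff_multiplier[OF bt m] coeff_multiplier[OF bt im]
  note M1 = multiplier_lin[OF M(1,2), of "1/(s-t)" "- 1/(s-t)"]
  have eq: "(1 / (s - t)) *\<^sub>R (coeff_op (y(j := s)) m - coeff_op (y(j := t)) m) - real (Suc (m j)) *\<^sub>R coeff_op (y(j := t)) (incr j m)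
   = (mult_op (%x. 1 * (1/(s-t) * ?c s x + (- 1/(s-t)) * ?c t x) + (- real (Suc (m j))) * ?d x) :: ('a, 'b) l2 \<Rightarrow>\<^sub>L _)"
   unfolding mult_op_lin[OF M1 M(3)] mult_op_lin[OF M(1,2)] coeff_op_def
   by (simp add: scaleR_diff_right del: of_nat_Suc)
  show ?thesis unfolding eq
  proof (rule norm_mult_op_le[OF multiplier_lin[OF M1 M(3)]])
   fix x
   define u where "u = (s - t) * \<psi> j x"
   have e: "exponent (y(j := s)) x = exponent (y(j := t)) x + u"
    unfolding exponent_upd[OF y, of j s] exponent_upd[OF y, of j t] u_def by (simp add: algebra_simps)
   have "1 * (1/(s-t) * ?c s x + (- 1/(s-t)) * ?c t x) + (- real (Suc (m j))) * ?d x
     = exp (exponent (y(j := t)) x) * ((exp u - 1) / (s - t) * power_weight m x - real (Suc (m j)) * power_weight (incr j m) x)"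
   proof -
    have alg: "1 * (1 / h * (E * U * w) + (- 1 / h) * (E * w)) + (- n) * (E * w') = E * ((U - 1) / h * w - n * w')" for h E U w n w' :: real
     by (simp add: algebra_simps diff_divide_distrib)
    show ?thesis unfolding e exp_add by (rule alg)
   qed
   also have "\<dots> = exp (exponent (y(j := t)) x) * ((exp u - 1 - u) / (s - t) * power_weight m x)"
    unfolding power_weight_incr[OF m] using s(1) by (simp add: u_def field_simps)
   finally have E: "1 * (1/(s-t) * ?c s x + (- 1/(s-t)) * ?c t x) + (- real (Suc (m j))) * ?d x
     = exp (exponent (y(j := t)) x) * ((exp u - 1 - u) / (s - t)) * power_weight m x" by (simp only: mult.assoc)
   have u: "\<bar>u\<bar> <= \<bar>s - t\<bar> * (K / \<sigma> j)" unfolding u_def abs_mult by (intro mult_left_mono \<psi>le) simp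
   have Kn: "0 <= K / \<sigma> j" using K_nonneg \<sigma>_pos[of j] by simp
   have "\<bar>s - t\<bar> * (K / \<sigma> j) <= 1 * (K / \<sigma> j)" using s(2) Kn by (intro mult_right_mono) auto
   then have u1: "\<bar>u\<bar> <= K / \<sigma> j" using u by simp
   have u2: "u^2 <= (\<bar>s - t\<bar> * (K / \<sigma> j))^2" using power_mono[OF u abs_ge_zero, of 2] by simp
   have "\<bar>exp u - 1 - u\<bar> <= exp \<bar>u\<bar> * u^2" by (rule abs_exp_taylor_le)
   also have "\<dots> <= exp (K / \<sigma> j) * (\<bar>s - t\<bar> * (K / \<sigma> j))^2" using u1 u2 by (intro mult_mono) auto
   finally have "\<bar>exp u - 1 - u\<bar> / \<bar>s - t\<bar> <= exp (K / \<sigma> j) * (\<bar>s - t\<bar> * (K / \<sigma> j))^2 / \<bar>s - t\<bar>"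
    by (rule divide_right_mono) simp
   also have "\<dots> = \<bar>s - t\<bar> * (exp (K / \<sigma> j) * (K / \<sigma> j)^2)"
    using s(1) by (simp add: power_mult_distrib power2_eq_square)
   finally have q: "\<bar>(exp u - 1 - u) / (s - t)\<bar> <= \<bar>s - t\<bar> * (exp (K / \<sigma> j) * (K / \<sigma> j)^2)" by (simp only: abs_divide)
   have ex: "\<bar>exp (exponent (y(j := t)) x)\<bar> <= exp (C * K)" using exponent_le[OF bt, of x] by (simp add: abs_le_iff)
   have "\<bar>exp (exponent (y(j := t)) x) * ((exp u - 1 - u) / (s - t)) * power_weight m x\<bar>
     <= exp (C * K) * (\<bar>s - t\<bar> * (exp (K / \<sigma> j) * (K / \<sigma> j)^2)) * (exp K / scale m)"
    unfolding abs_mult[of "_ * _"] abs_mult[of "exp _"]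
    by (intro mult_mono ex q power_weight_le[OF m] mult_nonneg_nonneg) auto
   then show "\<bar>1 * (1/(s-t) * ?c s x + (- 1/(s-t)) * ?c t x) + (- real (Suc (m j))) * ?d x\<bar> <= \<bar>s - t\<bar> * L"
    unfolding E L_def by (simp only: mult_ac)
  qed
 qed
 show ?thesis unfolding has_vector_derivative_iff_quotient
 proof (rule LIM_zero_cancel, rule Lim_null_comparison)
  show "((%s. \<bar>s - t\<bar> * L) \<longlongrightarrow> 0) (at t)"
  proof -
   have "((%s. \<bar>s - t\<bar> * L) \<longlongrightarrow> \<bar>t - t\<bar> * L) (at t)" by (intro tendsto_intros)
   then show ?thesis by simp
  qed
  show "\<forall>\<^sub>F s in at t. norm ((1 / (s - t)) *\<^sub>R (coeff_op (y(j := s)) m - coeff_op (y(j := t)) m)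
   - real (Suc (m j)) *\<^sub>R coeff_op (y(j := t)) (incr j m) :: ('a, 'b) l2 \<Rightarrow>\<^sub>L _) <= \<bar>s - t\<bar> * L"
   unfolding eventually_at by (rule exI[of _ 1]) (use est in \<open>auto simp: dist_real_def\<close>)
 qed
qed

end

locale parametric_problem = affine_exponent \<psi> \<sigma> K + closed_subspace V
 for \<psi> :: "nat => 'a::euclidean_space => real" and \<sigma> K and V :: "('a, 'b::euclidean_space) l2 set" +
 fixes load :: "('a, 'b) l2"
 assumes load_in: "load \<in> V" and K_less: "K < ln 2"
begin

text \<open>
  The recursion is the differentiated equation solved for its leading term: the coefficients of lower order form the load.
  Defining the coefficients by recursion and verifying afterwards that they are the derivatives avoids any discussion of
  higher differentiability.
\<close>

function taylor :: "(nat => real) => (nat => nat) => ('a, 'b) l2" where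
 "taylor y \<mu> = (if \<mu> \<in> multi_indices then
  form_solution V (coeff_op y zero_index)
   ((if \<mu> = zero_index then load else 0)
    - (\<Sum>m\<in>(below \<mu>). coeff_op y m (taylor y (sub_index \<mu> m))))
  else 0)"
 by pat_completeness auto
termination
 by (relation "inv_image less_than (%(y, \<mu>). index_size \<mu>)") (auto intro: index_size_sub)

declare taylor.simps [simp del]

lemma sub_multi: "\<mu> \<in> multi_indices ==> sub_index \<mu> m \<in> multi_indices"
 by (erule multi_indices_le) (simp add: le_fun_def)

lemma finite_lower: "\<mu> \<in> multi_indices ==> finite (below \<mu>)"
 by (rule finite_subset[OF _ finite_multi_indices_below]) auto

lemma lower_multi: "\<mu> \<in> multi_indices ==> m <= \<mu> ==> m \<in> multi_indices" by (rule multi_indices_le)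

lemma lower_split: "\<mu> \<in> multi_indices ==> (\<Sum>m\<in>{..\<mu>}. f m) = f zero_index + (\<Sum>m\<in>(below \<mu>). f m :: 'c::comm_monoid_add)"
proof -
 assume \<mu>: "\<mu> \<in> multi_indices"
 have "{..\<mu>} = insert zero_index (below \<mu>)" by (auto simp: le_fun_def)
 then show ?thesis using finite_lower[OF \<mu>] by simp
qed

lemma taylor_in: "bounded_by B y ==> \<mu> \<in> multi_indices ==> taylor y \<mu> \<in> V"
 by (subst taylor.simps) (simp add: form_solution(1)[OF coercive_coeff_op])

lemma taylor_equation:
 assumes y: "bounded_by B y" and \<mu>: "\<mu> \<in> multi_indices" and v: "v \<in> V"
 shows "(\<Sum>m\<in>{..\<mu>}. coeff_op y m (taylor y (sub_index \<mu> m)) \<bullet> v) = (if \<mu> = zero_index then load \<bullet> v else 0)"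
proof -
 have "coeff_op y zero_index (taylor y \<mu>) \<bullet> v = ((if \<mu> = zero_index then load else 0)
    - (\<Sum>m\<in>(below \<mu>). coeff_op y m (taylor y (sub_index \<mu> m)))) \<bullet> v"
  by (subst taylor.simps) (simp only: \<mu> if_True form_solution(2)[OF coercive_coeff_op[OF y] v])
 then have "coeff_op y zero_index (taylor y \<mu>) \<bullet> v + (\<Sum>m\<in>(below \<mu>). coeff_op y m (taylor y (sub_index \<mu> m)) \<bullet> v)
   = (if \<mu> = zero_index then load else 0) \<bullet> v"
  by (simp only: inner_diff_left inner_sum_left diff_add_cancel)
 then show ?thesis unfolding lower_split[OF \<mu>] by simp
qed

text \<open>
  Induction along the recursion.  Used for the measurability of the coefficients, by approximating the parameter.
\<close>

lemma tendsto_taylor: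
 assumes y: "bounded_by B y" and z: "\<forall>\<^sub>F s in F. bounded_by B (z s)"
  and d: "\<forall>\<^sub>F s in F. bounded_by (\<delta> s) (%j. z s j - y j)" and \<delta>: "(\<delta> \<longlongrightarrow> 0) F"
 shows "\<mu> \<in> multi_indices ==> ((%s. taylor (z s) \<mu>) \<longlongrightarrow> taylor y \<mu>) F"
proof (induction "index_size \<mu>" arbitrary: \<mu> rule: less_induct)
 case less
 note \<mu> = less.prems
 have "((%s. form_solution V (coeff_op (z s) zero_index) ((if \<mu> = zero_index then load else 0)
    - (\<Sum>m\<in>(below \<mu>). coeff_op (z s) m (taylor (z s) (sub_index \<mu> m)))))
  \<longlongrightarrow> form_solution V (coeff_op y zero_index) ((if \<mu> = zero_index then load else 0)
    - (\<Sum>m\<in>(below \<mu>). coeff_op y m (taylor y (sub_index \<mu> m))))) F"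
 proof (rule tendsto_form_solution[OF coercive_coeff_op[OF y]])
  show "\<forall>\<^sub>F s in F. coercive_on V (exp (- (B * K))) (coeff_op (z s) zero_index)"
   using z by eventually_elim (rule coercive_coeff_op)
  show "((%s. coeff_op (z s) zero_index) \<longlongrightarrow> (coeff_op y zero_index :: ('a, 'b) l2 \<Rightarrow>\<^sub>L _)) F"
   by (rule tendsto_coeff_op[OF y z d \<delta>]) simp
  show "((%s. (if \<mu> = zero_index then load else 0)
    - (\<Sum>m\<in>(below \<mu>). coeff_op (z s) m (taylor (z s) (sub_index \<mu> m))))
   \<longlongrightarrow> (if \<mu> = zero_index then load else 0)
    - (\<Sum>m\<in>(below \<mu>). coeff_op y m (taylor y (sub_index \<mu> m)))) F"
  proof (intro tendsto_diff tendsto_const tendsto_sum blinfun.tendsto)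
   fix m assume m: "m \<in> (below \<mu>)"
   show "((%s. coeff_op (z s) m) \<longlongrightarrow> (coeff_op y m :: ('a, 'b) l2 \<Rightarrow>\<^sub>L _)) F"
    using m lower_multi[OF \<mu>] by (intro tendsto_coeff_op[OF y z d \<delta>]) auto
   show "((%s. taylor (z s) (sub_index \<mu> m)) \<longlongrightarrow> taylor y (sub_index \<mu> m)) F"
    using m index_size_sub[OF \<mu>] by (intro less.hyps sub_multi \<mu>) auto
  qed
 qed simp
 moreover have "taylor w \<mu> = form_solution V (coeff_op w zero_index) ((if \<mu> = zero_index then load else 0)
    - (\<Sum>m\<in>(below \<mu>). coeff_op w m (taylor w (sub_index \<mu> m))))" for w
  by (subst taylor.simps) (simp only: \<mu> if_True)
 ultimately show ?case by (simp only:)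
qed

text \<open>
  Induction along the recursion with the product rule.  Collecting the terms that contain a given operator, its own index contributes
  \<open>m j\<close> from the derivative of the operator and the remaining \<open>\<mu> j + 1 - m j\<close> from the derivative of the coefficient;
  they add up to \<open>\<mu> j + 1\<close>.
\<close>

lemma taylor_has_derivative:
 "\<mu> \<in> multi_indices ==> bounded_by B y ==>
  ((%t. taylor (y(j := t)) \<mu>) has_vector_derivative real (Suc (\<mu> j)) *\<^sub>R taylor (y(j := t)) (incr j \<mu>)) (at t)"
proof (induction "index_size \<mu>" arbitrary: \<mu> rule: less_induct)
 case less
 note \<mu> = less.prems(1) and y = less.prems(2)
 define C where "C = max B ((\<bar>t\<bar> + 1) / \<sigma> j)"
 have C: "(\<bar>t\<bar> + 1) <= C * \<sigma> j"
  using \<sigma>_pos[of j] mult_right_mono[of "(\<bar>t\<bar> + 1) / \<sigma> j" C "\<sigma> j"] by (simp add: C_def)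
 have bd: "bounded_by C (y(j := s))" if "dist s t < 1" for s
  by (rule bounded_by_upd[OF y]) (use that C in \<open>auto simp: C_def dist_real_def\<close>)
 have bt: "bounded_by C (y(j := t))" by (rule bd) simp
 let ?A = "coeff_op (y(j := t)) :: _ => ('a, 'b) l2 \<Rightarrow>\<^sub>L _" and ?T = "taylor (y(j := t))"
 let ?L = "(below \<mu>)" and ?mu' = "incr j \<mu>"
 have \<mu>': "?mu' \<in> multi_indices" by (rule multi_indices_upd[OF \<mu>])
 define rhs where "rhs s = (if \<mu> = zero_index then load else 0)
    - (\<Sum>m\<in>?L. coeff_op (y(j := s)) m (taylor (y(j := s)) (sub_index \<mu> m)))" for s
 define rhs' where "rhs' = 0 - (\<Sum>m\<in>?L. real (Suc (m j)) *\<^sub>R ?A (incr j m) (?T (sub_index \<mu> m))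
   + real (Suc (\<mu> j - m j)) *\<^sub>R ?A m (?T (sub_index ?mu' m)))"
 have sol: "taylor (y(j := s)) \<mu> = form_solution V (coeff_op (y(j := s)) zero_index) (rhs s)" for s
  unfolding rhs_def by (subst taylor.simps) (simp only: \<mu> if_True)
 have rd: "(rhs has_vector_derivative rhs') (at t)"
  unfolding rhs_def rhs'_def
 proof (intro has_vector_derivative_diff has_vector_derivative_const has_vector_derivative_sum)
  fix m assume m: "m \<in> ?L"
  have mm: "m \<in> multi_indices" using m lower_multi[OF \<mu>] by simp
  have inc: "incr j (sub_index \<mu> m) = sub_index ?mu' m" using m by (auto simp: fun_eq_iff le_fun_def Suc_diff_le)
  have dT: "((%s. taylor (y(j := s)) (sub_index \<mu> m)) has_vector_derivative
    real (Suc (\<mu> j - m j)) *\<^sub>R ?T (sub_index ?mu' m)) (at t)"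
   using less.hyps[of "sub_index \<mu> m"] index_size_sub[OF \<mu>] m sub_multi[OF \<mu>] y inc by simp
  have dA: "((%s. coeff_op (y(j := s)) m :: ('a, 'b) l2 \<Rightarrow>\<^sub>L _) has_vector_derivative real (Suc (m j)) *\<^sub>R ?A (incr j m)) (at t)"
   by (rule coeff_op_has_derivative[OF y mm])
  have "((%s. coeff_op (y(j := s)) m (taylor (y(j := s)) (sub_index \<mu> m))) has_vector_derivative
    ?A m (real (Suc (\<mu> j - m j)) *\<^sub>R ?T (sub_index ?mu' m)) + (real (Suc (m j)) *\<^sub>R ?A (incr j m)) (?T (sub_index \<mu> m))) (at t)"
   by (rule bounded_bilinear.has_vector_derivative[OF bounded_bilinear_blinfun_apply dA dT])
  then show "((%s. coeff_op (y(j := s)) m (taylor (y(j := s)) (sub_index \<mu> m))) has_vector_derivative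
    real (Suc (m j)) *\<^sub>R ?A (incr j m) (?T (sub_index \<mu> m)) + real (Suc (\<mu> j - m j)) *\<^sub>R ?A m (?T (sub_index ?mu' m))) (at t)"
   by (simp only: blinfun.scaleR_right blinfun.scaleR_left add.commute)
 qed
 have dA0: "((%s. coeff_op (y(j := s)) zero_index :: ('a, 'b) l2 \<Rightarrow>\<^sub>L _) has_vector_derivative ?A (incr j zero_index)) (at t)"
  using coeff_op_has_derivative[OF y zero_index_multi, of j t] by simp
 have der: "((%s. taylor (y(j := s)) \<mu>) has_vector_derivative
   form_solution V (?A zero_index) (rhs' - ?A (incr j zero_index) (?T \<mu>))) (at t)"
  unfolding sol by (rule has_vector_derivative_form_solution[OF coercive_coeff_op[OF bd] dA0 rd])
 have key: "rhs' - ?A (incr j zero_index) (?T \<mu>)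
   = real (Suc (\<mu> j)) *\<^sub>R (0 - (\<Sum>m\<in>{m. m <= ?mu' \<and> m ~= zero_index}. ?A m (?T (sub_index ?mu' m))))"
 proof -
  let ?X = "%m. ?A m (?T (sub_index ?mu' m))"
  have fin': "finite {m. m <= ?mu' \<and> m ~= zero_index}" by (rule finite_lower[OF \<mu>'])
  \<comment> \<open>terms in which the derivative hits the operator\<close>
  have S1: "(\<Sum>m\<in>{..\<mu>}. real (Suc (m j)) *\<^sub>R ?A (incr j m) (?T (sub_index \<mu> m)))
    = (\<Sum>m\<in>{m. m <= ?mu' \<and> m ~= zero_index}. real (m j) *\<^sub>R ?X m)"
  proof -
   have "(\<Sum>m\<in>{..\<mu>}. real (Suc (m j)) *\<^sub>R ?A (incr j m) (?T (sub_index \<mu> m)))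
     = (\<Sum>m\<in>{m. m <= ?mu' \<and> m j ~= 0}. real (m j) *\<^sub>R ?X m)"
   proof (rule sum.reindex_bij_witness[where j = "incr j" and i = "%m. m(j := m j - 1)"])
    fix m assume m: "m \<in> {..\<mu>}"
    show "(incr j m)(j := incr j m j - 1) = m" by simp
    show "incr j m \<in> {m. m <= ?mu' \<and> m j ~= 0}" using m by (auto simp: le_fun_def)
    have "sub_index ?mu' (incr j m) = sub_index \<mu> m" by auto
    then show "real (incr j m j) *\<^sub>R ?X (incr j m) = real (Suc (m j)) *\<^sub>R ?A (incr j m) (?T (sub_index \<mu> m))" by simp
   next
    fix m assume m: "m \<in> {m. m <= ?mu' \<and> m j ~= 0}"
    show "incr j (m(j := m j - 1)) = m" using m by auto
    have "\<forall>i. m i <= ?mu' i" using m by (simp add: le_fun_def)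
    then have "(m(j := m j - 1)) i <= \<mu> i" for i by (cases "i = j") (auto dest: spec[of _ i])
    then show "m(j := m j - 1) \<in> {..\<mu>}" by (simp only: atMost_iff le_fun_def) blast
   qed
   also have "\<dots> = (\<Sum>m\<in>{m. m <= ?mu' \<and> m ~= zero_index}. real (m j) *\<^sub>R ?X m)"
    by (rule sum.mono_neutral_left[OF fin']) auto
   finally show ?thesis .
  qed
  \<comment> \<open>terms in which the derivative hits a Taylor coefficient\<close>
  have S2: "(\<Sum>m\<in>?L. real (Suc (\<mu> j - m j)) *\<^sub>R ?X m)
    = (\<Sum>m\<in>{m. m <= ?mu' \<and> m ~= zero_index}. (real (Suc (\<mu> j)) - real (m j)) *\<^sub>R ?X m)"
  proof -
   have "(\<Sum>m\<in>?L. real (Suc (\<mu> j - m j)) *\<^sub>R ?X m) = (\<Sum>m\<in>?L. (real (Suc (\<mu> j)) - real (m j)) *\<^sub>R ?X m)"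
   proof (rule sum.cong[OF refl])
    fix m assume "m \<in> ?L"
    then have "m j <= \<mu> j" by (simp add: le_fun_def)
    then have "real (Suc (\<mu> j - m j)) = real (Suc (\<mu> j)) - real (m j)" by (simp add: of_nat_diff)
    then show "real (Suc (\<mu> j - m j)) *\<^sub>R ?X m = (real (Suc (\<mu> j)) - real (m j)) *\<^sub>R ?X m" by (simp only:)
   qed
   also have "\<dots> = (\<Sum>m\<in>{m. m <= ?mu' \<and> m ~= zero_index}. (real (Suc (\<mu> j)) - real (m j)) *\<^sub>R ?X m)"
   proof (rule sum.mono_neutral_left[OF fin'])
    show "?L \<subseteq> {m. m <= ?mu' \<and> m ~= zero_index}"
     by (auto simp: le_fun_def le_SucI)
    show "\<forall>m\<in>{m. m <= ?mu' \<and> m ~= zero_index} - ?L. (real (Suc (\<mu> j)) - real (m j)) *\<^sub>R ?X m = 0"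
    proof
     fix m assume m: "m \<in> {m. m <= ?mu' \<and> m ~= zero_index} - ?L"
     then have le: "m i <= ?mu' i" for i by (simp add: le_fun_def)
     obtain i where i: "\<not> m i <= \<mu> i" using m by (auto simp: le_fun_def)
     have "i = j" using le[of i] i by (cases "i = j") auto
     then have "m j = Suc (\<mu> j)" using le[of j] i by simp
     then show "(real (Suc (\<mu> j)) - real (m j)) *\<^sub>R ?X m = 0" by simp
    qed
   qed
   finally show ?thesis .
  qed
  have "rhs' - ?A (incr j zero_index) (?T \<mu>) = - ((\<Sum>m\<in>{..\<mu>}. real (Suc (m j)) *\<^sub>R ?A (incr j m) (?T (sub_index \<mu> m)))
    + (\<Sum>m\<in>?L. real (Suc (\<mu> j - m j)) *\<^sub>R ?X m))"
   unfolding rhs'_def lower_split[OF \<mu>] sum.distrib by simp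
  also have "\<dots> = - (\<Sum>m\<in>{m. m <= ?mu' \<and> m ~= zero_index}. real (Suc (\<mu> j)) *\<^sub>R ?X m)"
   unfolding S1 S2 sum.distrib[symmetric] scaleR_add_left[symmetric] by (simp del: of_nat_Suc)
  finally show ?thesis by (simp only: scaleR_sum_right scaleR_minus_right diff_0)
 qed
 have "?mu' ~= zero_index" by (auto simp: fun_eq_iff)
 then have "?T ?mu' = form_solution V (?A zero_index) (0 - (\<Sum>m\<in>{m. m <= ?mu' \<and> m ~= zero_index}. ?A m (?T (sub_index ?mu' m))))"
  by (subst taylor.simps) (simp only: \<mu>' if_True if_False)
 then have "form_solution V (?A zero_index) (rhs' - ?A (incr j zero_index) (?T \<mu>)) = real (Suc (\<mu> j)) *\<^sub>R ?T ?mu'"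
  unfolding key using bounded_linear_form_solution[OF coercive_coeff_op[OF bt]] by (simp only: linear_simps)
 then show ?case using der by (simp only:)
qed

text \<open>
  The energy of \<open>p\<close> for the absolute value of the coefficient of order \<open>m\<close>.
\<close>

definition weight_energy :: "(nat => real) => (nat => nat) => ('a, 'b) l2 => real" where
 "weight_energy y m p = (\<integral>x. (exp (exponent y x) * \<bar>power_weight m x\<bar>) * (l2_fun p x \<bullet> l2_fun p x) \<partial>lebesgue)"

lemma abs_multiplier: "multiplier c ==> multiplier (%x. \<bar>c x\<bar>)"
 unfolding multiplier_def by (auto intro: borel_measurable_abs)

lemma weight_energy_integrable:
 assumes "bounded_by B y" "m \<in> multi_indices"
 shows "integrable lebesgue (%x. (exp (exponent y x) * \<bar>power_weight m x\<bar>) * (l2_fun p x \<bullet> l2_fun p x))"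
 using integrable_mult_inner[OF abs_multiplier[OF coeff_multiplier[OF assms]], of p p] by (simp add: abs_mult)

lemma weight_energy_nonneg: "0 <= weight_energy y m p"
 unfolding weight_energy_def by (intro integral_nonneg_AE) simp

text \<open>
  Young's inequality under the integral.
\<close>

lemma coeff_op_inner_le:
 assumes "bounded_by B y" "m \<in> multi_indices"
 shows "\<bar>coeff_op y m p \<bullet> q\<bar> <= (weight_energy y m p + weight_energy y m q) / 2"
proof -
 note M = coeff_multiplier[OF assms] and W = weight_energy_integrable[OF assms]
 let ?c = "%x. exp (exponent y x) * power_weight m x"
 have "\<bar>coeff_op y m p \<bullet> q\<bar> = \<bar>\<integral>x. ?c x * (l2_fun p x \<bullet> l2_fun q x) \<partial>lebesgue\<bar>"
  unfolding coeff_op_def mult_op_inner[OF M] ..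
 also have "\<dots> <= (\<integral>x. \<bar>?c x * (l2_fun p x \<bullet> l2_fun q x)\<bar> \<partial>lebesgue)" by (rule integral_abs_bound)
 also have "\<dots> <= (\<integral>x. ((exp (exponent y x) * \<bar>power_weight m x\<bar>) * (l2_fun p x \<bullet> l2_fun p x)
   + (exp (exponent y x) * \<bar>power_weight m x\<bar>) * (l2_fun q x \<bullet> l2_fun q x)) / 2 \<partial>lebesgue)"
 proof (rule integral_mono)
  show "integrable lebesgue (%x. \<bar>?c x * (l2_fun p x \<bullet> l2_fun q x)\<bar>)"
   by (rule integrable_abs[OF integrable_mult_inner[OF M]])
  show "integrable lebesgue (%x. ((exp (exponent y x) * \<bar>power_weight m x\<bar>) * (l2_fun p x \<bullet> l2_fun p x)
   + (exp (exponent y x) * \<bar>power_weight m x\<bar>) * (l2_fun q x \<bullet> l2_fun q x)) / 2)"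
   by (intro integrable_divide Bochner_Integration.integrable_add W)
  fix x
  have "\<bar>l2_fun p x \<bullet> l2_fun q x\<bar> <= (l2_fun p x \<bullet> l2_fun p x + l2_fun q x \<bullet> l2_fun q x) / 2"
  proof -
   have "\<bar>l2_fun p x \<bullet> l2_fun q x\<bar> <= norm (l2_fun p x) * norm (l2_fun q x)" by (rule Cauchy_Schwarz_ineq2)
   moreover have "2 * (norm (l2_fun p x) * norm (l2_fun q x)) <= (norm (l2_fun p x))^2 + (norm (l2_fun q x))^2"
    using sum_squares_bound[of "norm (l2_fun p x)" "norm (l2_fun q x)"] by (simp only: mult.assoc)
   moreover have "s <= (P + Q) / 2" if "s <= n" "2 * n <= P + Q" for s n P Q :: real using that by simp
   ultimately show ?thesis unfolding power2_norm_eq_inner by blast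
  qed
  then have "\<bar>?c x\<bar> * \<bar>l2_fun p x \<bullet> l2_fun q x\<bar> <= \<bar>?c x\<bar> * ((l2_fun p x \<bullet> l2_fun p x + l2_fun q x \<bullet> l2_fun q x) / 2)"
   by (intro mult_left_mono) auto
  then show "\<bar>?c x * (l2_fun p x \<bullet> l2_fun q x)\<bar> <= ((exp (exponent y x) * \<bar>power_weight m x\<bar>) * (l2_fun p x \<bullet> l2_fun p x)
   + (exp (exponent y x) * \<bar>power_weight m x\<bar>) * (l2_fun q x \<bullet> l2_fun q x)) / 2"
   by (simp add: abs_mult distrib_left)
 qed
 also have "\<dots> = (weight_energy y m p + weight_energy y m q) / 2"
  unfolding weight_energy_def by (simp add: W)
 finally show ?thesis .
qed

text \<open>
  The zeroth term is removed from the exponential bound on the scaled weights, pointwise in \<open>x\<close>.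
\<close>

lemma sum_weight_energy_le:
 assumes y: "bounded_by B y" and N: "N \<in> multi_indices"
 shows "(\<Sum>m\<in>{m. m <= N \<and> m ~= zero_index}. scale m * weight_energy y m p) <= (exp K - 1) * (coeff_op y zero_index p \<bullet> p)"
proof -
 let ?L = "{m. m <= N \<and> m ~= zero_index}"
 note W = weight_energy_integrable[OF y lower_multi[OF N]]
 have M0: "multiplier (%x. exp (exponent y x) * power_weight zero_index x)" by (rule coeff_multiplier[OF y]) simp
 have "(\<Sum>m\<in>?L. scale m * weight_energy y m p)
   = (\<integral>x. (\<Sum>m\<in>?L. scale m * ((exp (exponent y x) * \<bar>power_weight m x\<bar>) * (l2_fun p x \<bullet> l2_fun p x))) \<partial>lebesgue)"
  unfolding weight_energy_def using W by (subst Bochner_Integration.integral_sum) auto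
 also have "\<dots> <= (\<integral>x. (exp K - 1) * ((exp (exponent y x) * power_weight zero_index x) * (l2_fun p x \<bullet> l2_fun p x)) \<partial>lebesgue)"
 proof (rule integral_mono)
  show "integrable lebesgue (%x. \<Sum>m\<in>?L. scale m * ((exp (exponent y x) * \<bar>power_weight m x\<bar>) * (l2_fun p x \<bullet> l2_fun p x)))"
   using W by (intro Bochner_Integration.integrable_sum integrable_mult_right) auto
  show "integrable lebesgue (%x. (exp K - 1) * ((exp (exponent y x) * power_weight zero_index x) * (l2_fun p x \<bullet> l2_fun p x)))"
   by (rule integrable_mult_right[OF integrable_mult_inner[OF M0]])
  fix x
  have "(\<Sum>m\<in>?L. scale m * \<bar>power_weight m x\<bar>) <= exp K - 1"
   using sum_scaled_power_weight_le[OF N, of x] unfolding lower_split[OF N] by simp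
  then have "(\<Sum>m\<in>?L. scale m * \<bar>power_weight m x\<bar>) * (exp (exponent y x) * (l2_fun p x \<bullet> l2_fun p x))
    <= (exp K - 1) * (exp (exponent y x) * (l2_fun p x \<bullet> l2_fun p x))"
   by (intro mult_right_mono) auto
  then show "(\<Sum>m\<in>?L. scale m * ((exp (exponent y x) * \<bar>power_weight m x\<bar>) * (l2_fun p x \<bullet> l2_fun p x)))
    <= (exp K - 1) * ((exp (exponent y x) * power_weight zero_index x) * (l2_fun p x \<bullet> l2_fun p x))"
   by (simp only: sum_distrib_right power_weight_zero mult_1_right mult.assoc mult.left_commute[of "exp (exponent y x)"])
 qed
 also have "\<dots> = (exp K - 1) * (coeff_op y zero_index p \<bullet> p)"
  unfolding coeff_op_def mult_op_inner[OF M0] by simp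
 finally show ?thesis .
qed

text \<open>
  Test the equation of order \<open>\<mu>\<close> with \<open>(scale \<mu>)\<^sup>2 *\<^sub>R taylor y \<mu>\<close> and sum over the box.  After Young's inequality each of
  the two halves of the off-diagonal terms is bounded by \<open>(exp K - 1) / 2\<close> times the total energy: one directly, the other after
  the substitution of \<open>\<mu> - m\<close> for \<open>\<mu>\<close>, which leads into the same box.
\<close>

lemma taylor_energy_bound:
 assumes y: "bounded_by B y" and N: "N \<in> multi_indices"
 shows "(2 - exp K) * (\<Sum>\<mu>\<in>{..N}. (scale \<mu>)^2 * (coeff_op y zero_index (taylor y \<mu>) \<bullet> taylor y \<mu>)) <= load \<bullet> taylor y zero_index"
proof -
 define \<tau> where "\<tau> \<mu> = scale \<mu> *\<^sub>R taylor y \<mu>" for \<mu>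
 let ?A = "coeff_op y :: _ => ('a, 'b) l2 \<Rightarrow>\<^sub>L _" and ?W = "weight_energy y"
 let ?L = "%\<mu>. (below \<mu>)"
 define E where "E = (\<Sum>\<mu>\<in>{..N}. ?A zero_index (\<tau> \<mu>) \<bullet> \<tau> \<mu>)"
 have E: "E = (\<Sum>\<mu>\<in>{..N}. (scale \<mu>)^2 * (?A zero_index (taylor y \<mu>) \<bullet> taylor y \<mu>))"
  unfolding E_def \<tau>_def by (simp add: blinfun.scaleR_right power2_eq_square mult.assoc)
 have finN: "finite {..N}" by (rule finite_multi_indices_below[OF N])
 have each: "?A zero_index (\<tau> \<mu>) \<bullet> \<tau> \<mu> <= (if \<mu> = zero_index then load \<bullet> taylor y zero_index else 0)
   + (\<Sum>m\<in>?L \<mu>. scale m * (?W m (\<tau> (sub_index \<mu> m)) + ?W m (\<tau> \<mu>)) / 2)" if "\<mu> \<in> {..N}" for \<mu>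
 proof -
  have \<mu>: "\<mu> \<in> multi_indices" using lower_multi[OF N] that by simp
  have "(\<Sum>m\<in>{..\<mu>}. ?A m (taylor y (sub_index \<mu> m)) \<bullet> taylor y \<mu>) = (if \<mu> = zero_index then load \<bullet> taylor y \<mu> else 0)"
   by (rule taylor_equation[OF y \<mu> taylor_in[OF y \<mu>]])
  then have "(scale \<mu> * scale \<mu>) * (?A zero_index (taylor y \<mu>) \<bullet> taylor y \<mu>)
    = (scale \<mu> * scale \<mu>) * (if \<mu> = zero_index then load \<bullet> taylor y \<mu> else 0)
    - (\<Sum>m\<in>?L \<mu>. (scale \<mu> * scale \<mu>) * (?A m (taylor y (sub_index \<mu> m)) \<bullet> taylor y \<mu>))"
   unfolding lower_split[OF \<mu>] sum_distrib_left[symmetric] right_diff_distrib[symmetric] by simp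
  moreover have "(\<Sum>m\<in>?L \<mu>. (scale \<mu> * scale \<mu>) * (?A m (taylor y (sub_index \<mu> m)) \<bullet> taylor y \<mu>))
    = (\<Sum>m\<in>?L \<mu>. scale m * (?A m (\<tau> (sub_index \<mu> m)) \<bullet> \<tau> \<mu>))"
  proof (rule sum.cong[OF refl])
   fix m assume that: "m \<in> ?L \<mu>"
   have "scale \<mu> = scale m * scale (sub_index \<mu> m)" using scale_add[OF \<mu>] that by simp
   then have "scale \<mu> * scale \<mu> = scale m * (scale (sub_index \<mu> m) * scale \<mu>)" by (simp only: mult.assoc)
   then show "(scale \<mu> * scale \<mu>) * (?A m (taylor y (sub_index \<mu> m)) \<bullet> taylor y \<mu>) = scale m * (?A m (\<tau> (sub_index \<mu> m)) \<bullet> \<tau> \<mu>)"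
    by (simp only: \<tau>_def blinfun.scaleR_right inner_scaleR_left inner_scaleR_right mult_ac)
  qed
  moreover have "(scale \<mu> * scale \<mu>) * (if \<mu> = zero_index then load \<bullet> taylor y \<mu> else 0) = (if \<mu> = zero_index then load \<bullet> taylor y zero_index else 0)"
   by simp
  ultimately have "?A zero_index (\<tau> \<mu>) \<bullet> \<tau> \<mu> = (if \<mu> = zero_index then load \<bullet> taylor y zero_index else 0)
    - (\<Sum>m\<in>?L \<mu>. scale m * (?A m (\<tau> (sub_index \<mu> m)) \<bullet> \<tau> \<mu>))"
   by (simp only: \<tau>_def blinfun.scaleR_right inner_scaleR_left inner_scaleR_right mult.assoc)
  moreover have "- (\<Sum>m\<in>?L \<mu>. scale m * (?A m (\<tau> (sub_index \<mu> m)) \<bullet> \<tau> \<mu>)) <= (\<Sum>m\<in>?L \<mu>. scale m * (?W m (\<tau> (sub_index \<mu> m)) + ?W m (\<tau> \<mu>)) / 2)"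
   unfolding sum_negf[symmetric]
  proof (rule sum_mono)
   fix m assume m: "m \<in> ?L \<mu>"
   have "- (?A m (\<tau> (sub_index \<mu> m)) \<bullet> \<tau> \<mu>) <= (?W m (\<tau> (sub_index \<mu> m)) + ?W m (\<tau> \<mu>)) / 2"
    using coeff_op_inner_le[OF y lower_multi[OF \<mu>], of m "\<tau> (sub_index \<mu> m)" "\<tau> \<mu>"] m by (simp add: abs_le_iff)
   then have "scale m * - (?A m (\<tau> (sub_index \<mu> m)) \<bullet> \<tau> \<mu>) <= scale m * ((?W m (\<tau> (sub_index \<mu> m)) + ?W m (\<tau> \<mu>)) / 2)"
    by (rule mult_left_mono) (rule less_imp_le[OF scale_pos])
   then show "- (scale m * (?A m (\<tau> (sub_index \<mu> m)) \<bullet> \<tau> \<mu>)) <= scale m * (?W m (\<tau> (sub_index \<mu> m)) + ?W m (\<tau> \<mu>)) / 2"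
    by simp
  qed
  ultimately show ?thesis by linarith
 qed
 have "E <= (\<Sum>\<mu>\<in>{..N}. (if \<mu> = zero_index then load \<bullet> taylor y zero_index else 0)
   + (\<Sum>m\<in>?L \<mu>. scale m * (?W m (\<tau> (sub_index \<mu> m)) + ?W m (\<tau> \<mu>)) / 2))"
  unfolding E_def by (rule sum_mono[OF each])
 also have "\<dots> = load \<bullet> taylor y zero_index + ((\<Sum>\<mu>\<in>{..N}. \<Sum>m\<in>?L \<mu>. scale m * ?W m (\<tau> (sub_index \<mu> m)))
   + (\<Sum>\<mu>\<in>{..N}. \<Sum>m\<in>?L \<mu>. scale m * ?W m (\<tau> \<mu>))) / 2"
 proof -
  have "zero_index \<in> {..N}" by (simp add: le_fun_def)
  then have "(\<Sum>\<mu>\<in>{..N}. if \<mu> = zero_index then load \<bullet> taylor y zero_index else 0) = load \<bullet> taylor y zero_index"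
   using finN by simp
  moreover have "(\<Sum>\<mu>\<in>{..N}. \<Sum>m\<in>?L \<mu>. scale m * (?W m (\<tau> (sub_index \<mu> m)) + ?W m (\<tau> \<mu>)) / 2)
   = ((\<Sum>\<mu>\<in>{..N}. \<Sum>m\<in>?L \<mu>. scale m * ?W m (\<tau> (sub_index \<mu> m))) + (\<Sum>\<mu>\<in>{..N}. \<Sum>m\<in>?L \<mu>. scale m * ?W m (\<tau> \<mu>))) / 2"
   by (simp only: distrib_left add_divide_distrib sum.distrib sum_divide_distrib[symmetric])
  ultimately show ?thesis by (simp only: sum.distrib)
 qed
 also have "(\<Sum>\<mu>\<in>{..N}. \<Sum>m\<in>?L \<mu>. scale m * ?W m (\<tau> \<mu>)) <= (exp K - 1) * E"
 proof -
  have "(\<Sum>m\<in>?L \<mu>. scale m * ?W m (\<tau> \<mu>)) <= (exp K - 1) * (?A zero_index (\<tau> \<mu>) \<bullet> \<tau> \<mu>)" if "\<mu> \<in> {..N}" for \<mu>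
   using that lower_multi[OF N] by (intro sum_weight_energy_le[OF y]) simp
  then show ?thesis unfolding E_def sum_distrib_left by (rule sum_mono)
 qed
 also have "(\<Sum>\<mu>\<in>{..N}. \<Sum>m\<in>?L \<mu>. scale m * ?W m (\<tau> (sub_index \<mu> m))) <= (exp K - 1) * E"
 proof -
  \<comment> \<open>substitute \<open>\<mu> - m\<close> for \<open>\<mu>\<close>; the pairs so obtained lie in the product of two full boxes\<close>
  have finL: "finite (?L N)" by (rule finite_lower[OF N])
  have "(\<Sum>\<mu>\<in>{..N}. \<Sum>m\<in>?L \<mu>. scale m * ?W m (\<tau> (sub_index \<mu> m)))
    = (\<Sum>p\<in>Sigma {..N} ?L. scale (snd p) * ?W (snd p) (\<tau> (sub_index (fst p) (snd p))))"
   by (subst sum.Sigma) (use finN finite_lower lower_multi[OF N] in \<open>auto simp: case_prod_beta\<close>)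
  also have "\<dots> = (\<Sum>p\<in>(%p. (sub_index (fst p) (snd p), snd p)) ` Sigma {..N} ?L. scale (snd p) * ?W (snd p) (\<tau> (fst p)))"
  proof (subst sum.reindex)
   show "inj_on (%p. (sub_index (fst p) (snd p), snd p)) (Sigma {..N} ?L)"
   proof (rule inj_onI)
    fix p q assume pq: "p \<in> Sigma {..N} ?L" "q \<in> Sigma {..N} ?L"
     and eq: "(sub_index (fst p) (snd p), snd p) = (sub_index (fst q) (snd q), snd q)"
    have "fst p i = fst q i" for i
    proof -
     have "fst p i - snd p i = fst q i - snd q i" "snd p i = snd q i" using eq by (auto dest: fun_cong[of _ _ i])
     moreover have "snd p i <= fst p i" "snd q i <= fst q i" using pq by (auto simp: le_fun_def)
     ultimately show ?thesis by linarith
    qed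
    then show "p = q" using eq by (simp add: prod_eq_iff fun_eq_iff)
   qed
  qed simp
  also have "\<dots> <= (\<Sum>p\<in>{..N} \<times> ?L N. scale (snd p) * ?W (snd p) (\<tau> (fst p)))"
  proof (rule sum_mono2)
   show "finite ({..N} \<times> ?L N)" using finN finL by simp
   show "(%p. (sub_index (fst p) (snd p), snd p)) ` Sigma {..N} ?L \<subseteq> {..N} \<times> ?L N"
    by (auto simp: le_fun_def intro: order_trans) (meson diff_le_self order_trans)+
   show "0 <= scale (snd p) * ?W (snd p) (\<tau> (fst p))" for p
    by (intro mult_nonneg_nonneg less_imp_le[OF scale_pos] weight_energy_nonneg)
  qed
  also have "\<dots> = (\<Sum>\<mu>\<in>{..N}. \<Sum>m\<in>?L N. scale m * ?W m (\<tau> \<mu>))"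
   by (simp add: sum.cartesian_product case_prod_beta)
  also have "\<dots> <= (\<Sum>\<mu>\<in>{..N}. (exp K - 1) * (?A zero_index (\<tau> \<mu>) \<bullet> \<tau> \<mu>))"
   by (rule sum_mono[OF sum_weight_energy_le[OF y N]])
  finally show ?thesis by (simp only: E_def sum_distrib_left)
 qed
 finally have "E <= load \<bullet> taylor y zero_index + (exp K - 1) * E" by (simp add: mult.commute)
 then show ?thesis unfolding E[symmetric] by (simp add: algebra_simps)
qed

lemma taylor_zero: "taylor y zero_index = form_solution V (coeff_op y zero_index) load"
proof -
 have "{m. m <= zero_index \<and> m ~= zero_index} = {}" by (auto simp: le_fun_def)
 then show ?thesis by (subst taylor.simps) (simp only: zero_index_multi if_True sum.empty diff_zero refl)
qed

text \<open>
  Coercivity with the constant \<open>exp (- B * K)\<close> is used twice, for the energies and for the size of the solution itself.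
\<close>

lemma taylor_norm_bound:
 assumes y: "bounded_by B y" and N: "N \<in> multi_indices"
 shows "(\<Sum>\<mu>\<in>{..N}. (scale \<mu>)^2 * (norm (taylor y \<mu>))^2) <= exp (2 * (B * K)) * ((norm load)^2 / (2 - exp K))"
proof -
 let ?A = "coeff_op y zero_index :: ('a, 'b) l2 \<Rightarrow>\<^sub>L _"
 have K2: "0 < 2 - exp K"
 proof -
  have "exp K < exp (ln 2)" unfolding exp_less_cancel_iff by (rule K_less)
  then show ?thesis by simp
 qed
 have "norm (taylor y zero_index) <= norm load / exp (- (B * K))"
  using norm_form_solution_le[OF coercive_coeff_op[OF y], of load] by (simp add: taylor_zero)
 then have n0: "norm (taylor y zero_index) <= exp (B * K) * norm load" by (simp add: exp_minus field_simps)
 have "load \<bullet> taylor y zero_index <= norm load * norm (taylor y zero_index)" by (rule norm_cauchy_schwarz)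
 also have "\<dots> <= norm load * (exp (B * K) * norm load)" by (intro mult_left_mono n0) simp
 finally have F: "load \<bullet> taylor y zero_index <= exp (B * K) * (norm load)^2" by (simp add: power2_eq_square mult_ac)
 have "exp (- (B * K)) * (\<Sum>\<mu>\<in>{..N}. (scale \<mu>)^2 * (norm (taylor y \<mu>))^2)
   <= (\<Sum>\<mu>\<in>{..N}. (scale \<mu>)^2 * (?A (taylor y \<mu>) \<bullet> taylor y \<mu>))"
  unfolding sum_distrib_left
 proof (rule sum_mono)
  fix \<mu>
  have "(scale \<mu>)^2 * (exp (- (B * K)) * (norm (taylor y \<mu>))^2) <= (scale \<mu>)^2 * (?A (taylor y \<mu>) \<bullet> taylor y \<mu>)"
   by (intro mult_left_mono coeff_op_zero_ge[OF y]) simp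
  then show "exp (- (B * K)) * ((scale \<mu>)^2 * (norm (taylor y \<mu>))^2) <= (scale \<mu>)^2 * (?A (taylor y \<mu>) \<bullet> taylor y \<mu>)"
   by (simp only: mult.left_commute)
 qed
 then have "(2 - exp K) * (exp (- (B * K)) * (\<Sum>\<mu>\<in>{..N}. (scale \<mu>)^2 * (norm (taylor y \<mu>))^2)) <= load \<bullet> taylor y zero_index"
  using mult_left_mono[OF _ less_imp_le[OF K2]] taylor_energy_bound[OF y N] order_trans by blast
 also note F
 finally have "(2 - exp K) * (exp (- (B * K)) * (\<Sum>\<mu>\<in>{..N}. (scale \<mu>)^2 * (norm (taylor y \<mu>))^2)) <= exp (B * K) * (norm load)^2" .
 then have "exp (- (B * K)) * (\<Sum>\<mu>\<in>{..N}. (scale \<mu>)^2 * (norm (taylor y \<mu>))^2) <= exp (B * K) * (norm load)^2 / (2 - exp K)"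
  using K2 by (simp add: pos_le_divide_eq mult.commute)
 then have "exp (B * K) * (exp (- (B * K)) * (\<Sum>\<mu>\<in>{..N}. (scale \<mu>)^2 * (norm (taylor y \<mu>))^2)) <= exp (B * K) * (exp (B * K) * (norm load)^2 / (2 - exp K))"
  by (rule mult_left_mono) simp
 then show ?thesis by (simp add: mult.assoc[symmetric] flip: exp_add)
qed

end

section \<open>Hermite expansions of Hilbert space valued random vectors\<close>

context closed_subspace
begin

definition simple_vector :: "((nat => real) => 'h) => bool" where
 "simple_vector s \<longleftrightarrow> simple_function gauss_seq s \<and> range s \<subseteq> V"

text \<open>
  Strong measurability, with convergence everywhere: the sigma algebra of the Gaussian sequence is not complete, and norms and
  inner products of such vectors are then genuinely measurable.
\<close>

definition random_vector :: "((nat => real) => 'h) => bool" where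
 "random_vector F \<longleftrightarrow> (\<exists>s. (\<forall>i. simple_vector (s i)) \<and> (\<forall>y. (%i. s i y) \<longlonglongrightarrow> F y))"

lemma random_vectorI: "(\<And>i. simple_vector (s i)) ==> (\<And>y. (%i. s i y) \<longlonglongrightarrow> F y) ==> random_vector F"
 unfolding random_vector_def by blast

lemma random_vectorE:
 assumes "random_vector F"
 obtains s where "\<And>i. simple_vector (s i)" "\<And>y. (%i. s i y) \<longlonglongrightarrow> F y"
 using assms unfolding random_vector_def by blast

lemma simple_vectorD: "simple_vector s ==> simple_function gauss_seq s" "simple_vector s ==> s y \<in> V"
 "simple_vector s ==> finite (range s)"
 unfolding simple_vector_def by (auto dest: simple_functionD(1))

lemma random_vector_simple: "simple_vector s ==> random_vector s"
 by (rule random_vectorI[of "%_. s"]) auto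

lemma random_vector_const: "v \<in> V ==> random_vector (%_. v)"
 by (rule random_vector_simple) (auto simp: simple_vector_def)

lemma random_vector_measurable:
 fixes g :: "'h => real"
 assumes F: "random_vector F" and g: "continuous_on UNIV g"
 shows "(%y. g (F y)) \<in> borel_measurable gauss_seq"
proof -
 obtain s where s: "\<And>i. simple_vector (s i)" "\<And>y. (%i. s i y) \<longlonglongrightarrow> F y" by (rule random_vectorE[OF F]) blast
 show ?thesis
 proof (rule borel_measurable_LIMSEQ_real)
  show "(%i. g (s i y)) \<longlonglongrightarrow> g (F y)" for y
   using continuous_on_tendsto_compose[OF g s(2)] by simp
  show "(%y. g (s i y)) \<in> borel_measurable gauss_seq" for i
   by (rule borel_measurable_simple_function[OF simple_function_compose1[OF simple_vectorD(1)[OF s(1)]]])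
 qed
qed

lemma random_vector_norm: "random_vector F ==> (%y. norm (F y)) \<in> borel_measurable gauss_seq"
 by (erule random_vector_measurable) (rule continuous_on_norm[OF continuous_on_id])

lemma random_vector_inner: "random_vector F ==> (%y. F y \<bullet> v) \<in> borel_measurable gauss_seq"
 by (erule random_vector_measurable) (intro continuous_intros)

lemma random_vector_combine:
 assumes F: "random_vector F" "random_vector F'"
  and h: "\<And>v w. v \<in> V ==> w \<in> V ==> h v w \<in> V" "continuous_on UNIV (%p. h (fst p) (snd p))"
 shows "random_vector (%y. h (F y) (F' y))"
proof -
 obtain s where s: "\<And>i. simple_vector (s i)" "\<And>y. (%i. s i y) \<longlonglongrightarrow> F y" by (rule random_vectorE[OF F(1)]) blast
 obtain s' where s': "\<And>i. simple_vector (s' i)" "\<And>y. (%i. s' i y) \<longlonglongrightarrow> F' y" by (rule random_vectorE[OF F(2)]) blast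
 show ?thesis
 proof (rule random_vectorI)
  show "simple_vector (%y. h (s i y) (s' i y))" for i
   unfolding simple_vector_def
   using simple_function_compose2[OF simple_vectorD(1)[OF s(1)] simple_vectorD(1)[OF s'(1)]]
    h(1)[OF simple_vectorD(2)[OF s(1)] simple_vectorD(2)[OF s'(1)]] by auto
  have "((%i. (s i y, s' i y)) \<longlonglongrightarrow> (F y, F' y))" for y by (intro tendsto_Pair s s')
  then show "(%i. h (s i y) (s' i y)) \<longlonglongrightarrow> h (F y) (F' y)" for y
   using continuous_on_tendsto_compose[OF h(2)] by fastforce
 qed
qed

lemma random_vector_add: "random_vector F ==> random_vector F' ==> random_vector (%y. F y + F' y)"
 by (erule (1) random_vector_combine) (auto intro: subspace_add[OF V_subspace] intro!: continuous_intros)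

lemma random_vector_diff: "random_vector F ==> random_vector F' ==> random_vector (%y. F y - F' y)"
 by (erule (1) random_vector_combine) (auto intro: subspace_diff[OF V_subspace] intro!: continuous_intros)

lemma random_vector_scale:
 fixes g :: "(nat => real) => real"
 assumes F: "random_vector F" and g: "g \<in> borel_measurable gauss_seq"
 shows "random_vector (%y. g y *\<^sub>R F y)"
proof -
 obtain s where s: "\<And>i. simple_vector (s i)" "\<And>y. (%i. s i y) \<longlonglongrightarrow> F y" by (rule random_vectorE[OF F]) blast
 obtain a where a: "\<And>i. simple_function gauss_seq (a i)" "\<And>y. (%i. a i y) \<longlonglongrightarrow> g y"
  using borel_measurable_implies_sequence_metric[OF g, of 0] by auto
 show ?thesis
 proof (rule random_vectorI)
  show "simple_vector (%y. a i y *\<^sub>R s i y)" for i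
   unfolding simple_vector_def
   using simple_function_compose2[OF a(1) simple_vectorD(1)[OF s(1)]]
    subspace_scale[OF V_subspace simple_vectorD(2)[OF s(1)]] by auto
  show "(%i. a i y *\<^sub>R s i y) \<longlonglongrightarrow> g y *\<^sub>R F y" for y by (intro tendsto_scaleR s a)
 qed
qed

lemma random_vector_sum:
 assumes "finite \<Gamma>" "\<And>\<nu>. \<nu> \<in> \<Gamma> ==> random_vector (F \<nu>)"
 shows "random_vector (%y. \<Sum>\<nu>\<in>\<Gamma>. F \<nu> y)"
 using assms
proof (induction rule: finite_induct)
 case empty
 show ?case using random_vector_const[OF subspace_0[OF V_subspace]] by simp
next
 case (insert \<nu> \<Gamma>)
 show ?case unfolding sum.insert[OF insert.hyps] by (intro random_vector_add insert) auto
qed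

lemma random_vector_expansion:
 assumes "finite \<Gamma>" "\<Gamma> \<subseteq> multi_indices" "\<And>\<nu>. \<nu> \<in> \<Gamma> ==> w \<nu> \<in> V"
 shows "random_vector (%y. \<Sum>\<nu>\<in>\<Gamma>. H \<nu> y *\<^sub>R w \<nu>)"
 using assms by (intro random_vector_sum random_vector_scale random_vector_const measurable_hermite_multi) auto

text \<open>
  Where an approximation is more than twice as large as its limit it is replaced by 0, which gives a majorant for dominated convergence.
\<close>

lemma random_vector_dominated:
 assumes F: "random_vector F"
 obtains s where "\<And>i. simple_vector (s i)" "\<And>y. (%i. s i y) \<longlonglongrightarrow> F y" "\<And>i y. norm (s i y) <= 2 * norm (F y)"
proof -
 obtain s where s: "\<And>i. simple_vector (s i)" "\<And>y. (%i. s i y) \<longlonglongrightarrow> F y" by (rule random_vectorE[OF F]) blast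
 define A where "A i = {y. norm (s i y) <= 2 * norm (F y)}" for i
 define s' where "s' i y = (if y \<in> A i then s i y else 0)" for i y
 have A: "A i \<in> sets gauss_seq" for i
 proof -
  have [measurable]: "(%y. norm (s i y)) \<in> borel_measurable gauss_seq" "(%y. norm (F y)) \<in> borel_measurable gauss_seq"
   by (intro random_vector_norm random_vector_simple s F)+
  have "{y\<in>space gauss_seq. norm (s i y) <= 2 * norm (F y)} \<in> sets gauss_seq" by measurable
  then show ?thesis by (simp add: A_def)
 qed
 show thesis
 proof (rule that)
  show "simple_vector (s' i)" for i
  proof -
   have "simple_function gauss_seq (%y. (%a v. if a = (1::real) then v else 0) (indicator (A i) y) (s i y))"
    by (rule simple_function_compose2[OF simple_function_indicator[OF A] simple_vectorD(1)[OF s(1)]])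
   then have "simple_function gauss_seq (s' i)"
    by (rule back_subst[of "simple_function gauss_seq"]) (auto simp: s'_def fun_eq_iff indicator_def)
   then show ?thesis
    unfolding simple_vector_def by (auto simp: s'_def intro: simple_vectorD(2)[OF s(1)] subspace_0[OF V_subspace])
  qed
  show "norm (s' i y) <= 2 * norm (F y)" for i y by (auto simp: s'_def A_def)
  show "(%i. s' i y) \<longlonglongrightarrow> F y" for y
  proof (cases "F y = 0")
   case True
   then have "s' i y = 0" for i by (auto simp: s'_def A_def)
   then show ?thesis using True by simp
  next
   case False
   have "\<forall>\<^sub>F i in sequentially. norm (s i y) < 2 * norm (F y)"
    by (rule order_tendstoD(2)[OF tendsto_norm[OF s(2)]]) (use False in simp)
   then have "\<forall>\<^sub>F i in sequentially. s i y = s' i y" by eventually_elim (simp add: s'_def A_def)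
   then show ?thesis by (rule Lim_transform_eventually[OF s(2)])
  qed
 qed
qed

definition L2_vector :: "((nat => real) => 'h) => bool" where
 "L2_vector F \<longleftrightarrow> random_vector F \<and> integrable gauss_seq (%y. (norm (F y))^2)"

lemma L2_vectorD: "L2_vector F ==> random_vector F" "L2_vector F ==> integrable gauss_seq (%y. (norm (F y))^2)"
 by (auto simp: L2_vector_def)

lemma integrable_norm_hermite:
 assumes F: "L2_vector F" and \<nu>: "\<nu> \<in> multi_indices"
 shows "integrable gauss_seq (%y. norm (F y) * \<bar>H \<nu> y\<bar>)"
proof (rule integrable_mult_of_squares)
 show "(%y. norm (F y)) \<in> borel_measurable gauss_seq" by (rule random_vector_norm[OF L2_vectorD(1)[OF F]])
 show "(%y. \<bar>H \<nu> y\<bar>) \<in> borel_measurable gauss_seq" using measurable_hermite_multi[OF \<nu>] by simp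
qed (use L2_vectorD(2)[OF F] integrable_square_hermite_multi[OF \<nu>] in simp_all)

lemma integrable_inner_hermite:
 assumes F: "L2_vector F" and \<nu>: "\<nu> \<in> multi_indices"
 shows "integrable gauss_seq (%y. (F y \<bullet> v) * H \<nu> y)"
proof (rule Bochner_Integration.integrable_bound)
 show "integrable gauss_seq (%y. norm v * (norm (F y) * \<bar>H \<nu> y\<bar>))"
  by (rule integrable_mult_right[OF integrable_norm_hermite[OF F \<nu>]])
 show "(%y. (F y \<bullet> v) * H \<nu> y) \<in> borel_measurable gauss_seq"
  by (intro borel_measurable_times random_vector_inner measurable_hermite_multi \<nu> L2_vectorD(1)[OF F])
 have "\<bar>(F y \<bullet> v) * H \<nu> y\<bar> <= (norm (F y) * norm v) * \<bar>H \<nu> y\<bar>" for y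
  unfolding abs_mult by (rule mult_right_mono[OF Cauchy_Schwarz_ineq2]) simp
 then show "AE y in gauss_seq. norm ((F y \<bullet> v) * H \<nu> y) <= norm (norm v * (norm (F y) * \<bar>H \<nu> y\<bar>))"
  by (simp add: mult_ac)
qed

text \<open>
  The coefficient is characterised weakly, by its inner products with the elements of \<open>V\<close>; the Riesz theorem provides it.
\<close>

definition hcoef :: "((nat => real) => 'h) => (nat => nat) => 'h" where
 "hcoef F \<nu> = (SOME w. w \<in> V \<and> (\<forall>v\<in>V. w \<bullet> v = E (%y. (F y \<bullet> v) * H \<nu> y)))"

lemma
 assumes F: "L2_vector F" and \<nu>: "\<nu> \<in> multi_indices"
 shows hcoef_in: "hcoef F \<nu> \<in> V"
  and hcoef_inner: "v \<in> V ==> hcoef F \<nu> \<bullet> v = E (%y. (F y \<bullet> v) * H \<nu> y)"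
proof -
 note i = integrable_inner_hermite[OF F \<nu>]
 let ?L = "%v. \<integral>y. (F y \<bullet> v) * H \<nu> y \<partial>gauss_seq"
 have "\<exists>w\<in>V. \<forall>v\<in>V. id_blinfun w \<bullet> v = ?L v"
 proof (rule coercive_form_represents[OF V_subspace V_closed, of 1])
  show "?L (v + w) = ?L v + ?L w" for v w
   unfolding inner_add_right distrib_right by (rule Bochner_Integration.integral_add[OF i i])
  show "?L (t *\<^sub>R v) = t * ?L v" for t v
   by (simp add: mult.assoc)
  show "\<bar>?L v\<bar> <= E (%y. norm (F y) * \<bar>H \<nu> y\<bar>) * norm v" for v
  proof -
   have "\<bar>?L v\<bar> <= E (%y. \<bar>(F y \<bullet> v) * H \<nu> y\<bar>)" by (rule integral_abs_bound)
   also have "\<dots> <= E (%y. (norm (F y) * \<bar>H \<nu> y\<bar>) * norm v)"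
   proof (rule integral_mono)
    show "\<bar>(F y \<bullet> v) * H \<nu> y\<bar> <= (norm (F y) * \<bar>H \<nu> y\<bar>) * norm v" for y
     using mult_right_mono[OF Cauchy_Schwarz_ineq2[of "F y" v], of "\<bar>H \<nu> y\<bar>"] by (simp add: abs_mult mult_ac)
   qed (intro integrable_abs i integrable_mult_left integrable_norm_hermite[OF F \<nu>])+
   finally show ?thesis by simp
  qed
 qed (auto simp: power2_norm_eq_inner inner_commute)
 then have "\<exists>w. w \<in> V \<and> (\<forall>v\<in>V. w \<bullet> v = ?L v)" by auto
 from someI_ex[OF this] show "hcoef F \<nu> \<in> V" "v \<in> V ==> hcoef F \<nu> \<bullet> v = ?L v" unfolding hcoef_def by blast+
qed

lemma hcoef_eqI:
 assumes F: "L2_vector F" and \<nu>: "\<nu> \<in> multi_indices" and w: "w \<in> V"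
  and eq: "\<And>v. v \<in> V ==> w \<bullet> v = E (%y. (F y \<bullet> v) * H \<nu> y)"
 shows "hcoef F \<nu> = w"
proof -
 have d: "hcoef F \<nu> - w \<in> V" by (rule subspace_diff[OF V_subspace hcoef_in[OF F \<nu>] w])
 have "(hcoef F \<nu> - w) \<bullet> (hcoef F \<nu> - w) = 0"
  using hcoef_inner[OF F \<nu> d] eq[OF d] by (simp only: inner_diff_left)
 then show ?thesis by simp
qed

text \<open>
  Pythagoras for vector valued coefficients.  It yields Bessel's inequality, and shows that any approximation by Hermite sums
  certifies Parseval's identity.
\<close>

lemma
 assumes F: "L2_vector F" and \<Gamma>: "finite \<Gamma>" "\<Gamma> \<subseteq> multi_indices" and w: "\<And>\<nu>. \<nu> \<in> \<Gamma> ==> w \<nu> \<in> V"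
 shows integrable_expansion_error: "integrable gauss_seq (%y. (norm (F y - (hermite_sum \<Gamma> w y)))^2)"
  and expansion_error: "E (%y. (norm (F y - (hermite_sum \<Gamma> w y)))^2)
   = E (%y. (norm (F y))^2) - (\<Sum>\<nu>\<in>\<Gamma>. (norm (hcoef F \<nu>))^2) + (\<Sum>\<nu>\<in>\<Gamma>. (norm (hcoef F \<nu> - w \<nu>))^2)"
proof -
 have M: "\<nu> \<in> multi_indices" if "\<nu> \<in> \<Gamma>" for \<nu> using that \<Gamma> by blast
 have expand: "(norm (F y - (hermite_sum \<Gamma> w y)))^2
   = (norm (F y))^2 - 2 * (\<Sum>\<nu>\<in>\<Gamma>. (F y \<bullet> w \<nu>) * H \<nu> y)
   + (\<Sum>\<nu>\<in>\<Gamma>. \<Sum>\<mu>\<in>\<Gamma>. (w \<nu> \<bullet> w \<mu>) * (H \<nu> y * H \<mu> y))" for y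
 proof -
  have "(norm (p - q))^2 = (norm p)^2 - 2 * (p \<bullet> q) + q \<bullet> q" for p q :: 'h
   by (simp add: power2_norm_eq_inner inner_diff_left inner_diff_right inner_commute)
  moreover have "F y \<bullet> (hermite_sum \<Gamma> w y) = (\<Sum>\<nu>\<in>\<Gamma>. (F y \<bullet> w \<nu>) * H \<nu> y)"
   by (simp add: inner_sum_right mult.commute)
  moreover have "(hermite_sum \<Gamma> w y) \<bullet> (hermite_sum \<Gamma> w y)
   = (\<Sum>\<nu>\<in>\<Gamma>. \<Sum>\<mu>\<in>\<Gamma>. (w \<nu> \<bullet> w \<mu>) * (H \<nu> y * H \<mu> y))"
   by (subst inner_sum_left, intro sum.cong refl, subst inner_sum_right, intro sum.cong refl) (simp add: mult_ac)
  ultimately show ?thesis by (simp only:)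
 qed
 have i1: "integrable gauss_seq (%y. \<Sum>\<nu>\<in>\<Gamma>. (F y \<bullet> w \<nu>) * H \<nu> y)"
  by (intro Bochner_Integration.integrable_sum integrable_inner_hermite F M)
 have i2: "integrable gauss_seq (%y. \<Sum>\<nu>\<in>\<Gamma>. \<Sum>\<mu>\<in>\<Gamma>. (w \<nu> \<bullet> w \<mu>) * (H \<nu> y * H \<mu> y))"
  by (intro Bochner_Integration.integrable_sum integrable_mult_right integrable_hermite_multi_mult M)
 show "integrable gauss_seq (%y. (norm (F y - (hermite_sum \<Gamma> w y)))^2)"
  unfolding expand
  by (intro Bochner_Integration.integrable_add Bochner_Integration.integrable_diff integrable_mult_right L2_vectorD(2)[OF F] i1 i2)
 have s1: "E (%y. (\<Sum>\<nu>\<in>\<Gamma>. (F y \<bullet> w \<nu>) * H \<nu> y)) = (\<Sum>\<nu>\<in>\<Gamma>. hcoef F \<nu> \<bullet> w \<nu>)"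
  by (subst Bochner_Integration.integral_sum) (auto intro!: integrable_inner_hermite F M sum.cong hcoef_inner[symmetric] w)
 have s2: "E (%y. (\<Sum>\<nu>\<in>\<Gamma>. \<Sum>\<mu>\<in>\<Gamma>. (w \<nu> \<bullet> w \<mu>) * (H \<nu> y * H \<mu> y))) = (\<Sum>\<nu>\<in>\<Gamma>. (norm (w \<nu>))^2)"
 proof -
  have "E (%y. (\<Sum>\<nu>\<in>\<Gamma>. \<Sum>\<mu>\<in>\<Gamma>. (w \<nu> \<bullet> w \<mu>) * (H \<nu> y * H \<mu> y)))
    = (\<Sum>\<nu>\<in>\<Gamma>. \<Sum>\<mu>\<in>\<Gamma>. \<integral>y. (w \<nu> \<bullet> w \<mu>) * (H \<nu> y * H \<mu> y) \<partial>gauss_seq)"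
   by (subst Bochner_Integration.integral_sum
     , (intro Bochner_Integration.integrable_sum integrable_mult_right integrable_hermite_multi_mult M; assumption)
     , intro sum.cong refl Bochner_Integration.integral_sum integrable_mult_right integrable_hermite_multi_mult M; assumption)
  also have "\<dots> = (\<Sum>\<nu>\<in>\<Gamma>. \<Sum>\<mu>\<in>\<Gamma>. if \<nu> = \<mu> then w \<nu> \<bullet> w \<mu> else 0)"
   by (intro sum.cong refl) (simp add: hermite_multi_orthonormal M)
  also have "\<dots> = (\<Sum>\<nu>\<in>\<Gamma>. (norm (w \<nu>))^2)" using \<Gamma>(1) by (simp add: power2_norm_eq_inner)
  finally show ?thesis .
 qed
 have "E (%y. (norm (F y - (hermite_sum \<Gamma> w y)))^2)
   = E (%y. (norm (F y))^2) - 2 * (\<Sum>\<nu>\<in>\<Gamma>. hcoef F \<nu> \<bullet> w \<nu>) + (\<Sum>\<nu>\<in>\<Gamma>. (norm (w \<nu>))^2)"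
  unfolding expand s1[symmetric] s2[symmetric] by (simp add: i1 i2 L2_vectorD(2)[OF F])
 moreover have "(\<Sum>\<nu>\<in>\<Gamma>. (norm (hcoef F \<nu> - w \<nu>))^2)
   = (\<Sum>\<nu>\<in>\<Gamma>. (norm (hcoef F \<nu>))^2) - 2 * (\<Sum>\<nu>\<in>\<Gamma>. hcoef F \<nu> \<bullet> w \<nu>) + (\<Sum>\<nu>\<in>\<Gamma>. (norm (w \<nu>))^2)"
 proof -
  have "(norm (p - q))^2 = (norm p)^2 - 2 * (p \<bullet> q) + (norm q)^2" for p q :: 'h
   by (simp add: power2_norm_eq_inner inner_diff_left inner_diff_right inner_commute)
  then show ?thesis by (simp only: sum.distrib sum_subtractf sum_distrib_left)
 qed
 ultimately show "E (%y. (norm (F y - (hermite_sum \<Gamma> w y)))^2)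
   = E (%y. (norm (F y))^2) - (\<Sum>\<nu>\<in>\<Gamma>. (norm (hcoef F \<nu>))^2) + (\<Sum>\<nu>\<in>\<Gamma>. (norm (hcoef F \<nu> - w \<nu>))^2)"
  by linarith
qed

lemma bessel:
 assumes F: "L2_vector F" and \<Gamma>: "finite \<Gamma>" "\<Gamma> \<subseteq> multi_indices"
 shows "(\<Sum>\<nu>\<in>\<Gamma>. (norm (hcoef F \<nu>))^2) <= E (%y. (norm (F y))^2)"
proof -
 have "0 <= E (%y. (norm (F y - (hermite_sum \<Gamma> (hcoef F) y)))^2)"
  by (intro integral_nonneg_AE) simp
 also have "\<dots> = E (%y. (norm (F y))^2) - (\<Sum>\<nu>\<in>\<Gamma>. (norm (hcoef F \<nu>))^2)"
  using expansion_error[OF F \<Gamma>, of "hcoef F"] hcoef_in[OF F] \<Gamma>(2) by (simp add: subset_iff)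
 finally show ?thesis by simp
qed

text \<open>
  The indicators of the level sets are approximated by scalar Hermite sums.
\<close>

lemma simple_vector_expansion_dense:
 assumes S: "simple_vector S" and \<epsilon>: "0 < (\<epsilon>::real)"
 shows "\<exists>\<Gamma> w. finite \<Gamma> \<and> \<Gamma> \<subseteq> multi_indices \<and> (\<forall>\<nu>. w \<nu> \<in> V) \<and>
  E (%y. (norm (S y - (hermite_sum \<Gamma> w y)))^2) <= \<epsilon>"
proof -
 define R where "R = range S"
 have R: "finite R" "\<And>a. a \<in> R ==> a \<in> V" using simple_vectorD[OF S] by (auto simp: R_def)
 define I where "I a = (indicator {y. S y = a} :: (nat => real) => real)" for a
 have sets: "{y. S y = a} \<in> sets gauss_seq" for a
 proof -
  have "S -` {a} \<inter> space gauss_seq \<in> sets gauss_seq" by (rule simple_functionD(2)[OF simple_vectorD(1)[OF S]])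
  then show ?thesis by (simp add: vimage_def)
 qed
 have I: "I a \<in> borel_measurable gauss_seq" "integrable gauss_seq (%y. (I a y)^2)" for a
 proof -
  show m: "I a \<in> borel_measurable gauss_seq" unfolding I_def using sets by (rule borel_measurable_indicator)
  show "integrable gauss_seq (%y. (I a y)^2)"
   by (rule gamma.integrable_const_bound[of _ 1]) (use borel_measurable_power[OF m] in \<open>auto simp: I_def indicator_def\<close>)
 qed
 define q where "q = real (card R) * (\<Sum>a\<in>R. (norm a)^2)"
 have q: "0 <= q" unfolding q_def by (intro mult_nonneg_nonneg sum_nonneg) auto
 \<comment> \<open>accuracy for one indicator; the sum over the level sets costs the factor \<open>q\<close>\<close>
 define \<eta> where "\<eta> = \<epsilon> / (q + 1)"
 have \<eta>: "0 < \<eta>" using q \<epsilon> by (simp add: \<eta>_def)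
 have "\<forall>a. \<exists>p. finite (fst p) \<and> fst p \<subseteq> multi_indices \<and>
  E (%y. (I a y - (\<Sum>\<nu>\<in>fst p. snd p \<nu> * H \<nu> y))^2) < \<eta>"
  using hermite_dense[OF I \<eta>] by simp
 from choice[OF this] obtain p where p: "\<forall>a. finite (fst (p a)) \<and> fst (p a) \<subseteq> multi_indices \<and>
  E (%y. (I a y - (\<Sum>\<nu>\<in>fst (p a). snd (p a) \<nu> * H \<nu> y))^2) < \<eta>" ..
 define G where "G a = fst (p a)" for a
 define c where "c a = snd (p a)" for a
 have Gc: "finite (G a)" "G a \<subseteq> multi_indices"
  "E (%y. (I a y - (\<Sum>\<nu>\<in>G a. c a \<nu> * H \<nu> y))^2) < \<eta>" for a
  using p by (simp_all add: G_def c_def)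
 define \<Gamma> where "\<Gamma> = (\<Union>a\<in>R. G a)"
 define w where "w \<nu> = (\<Sum>a\<in>R. (if \<nu> \<in> G a then c a \<nu> else 0) *\<^sub>R a)" for \<nu>
 have \<Gamma>: "finite \<Gamma>" "\<Gamma> \<subseteq> multi_indices" using R(1) Gc by (auto simp: \<Gamma>_def)
 define P where "P a y = (\<Sum>\<nu>\<in>G a. c a \<nu> * H \<nu> y)" for a y
 have eq: "S y - (hermite_sum \<Gamma> w y) = (\<Sum>a\<in>R. (I a y - P a y) *\<^sub>R a)" for y
 proof -
  have "(\<Sum>a\<in>R. I a y *\<^sub>R a) = (\<Sum>a\<in>R. if a = S y then a else 0)" by (intro sum.cong) (auto simp: I_def)
  then have 1: "(\<Sum>a\<in>R. I a y *\<^sub>R a) = S y" using R(1) by (simp add: R_def)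
  have "(hermite_sum \<Gamma> w y) = (\<Sum>\<nu>\<in>\<Gamma>. \<Sum>a\<in>R. ((if \<nu> \<in> G a then c a \<nu> else 0) * H \<nu> y) *\<^sub>R a)"
   unfolding w_def scaleR_sum_right by (simp add: mult.commute)
  also have "\<dots> = (\<Sum>a\<in>R. (\<Sum>\<nu>\<in>\<Gamma>. (if \<nu> \<in> G a then c a \<nu> else 0) * H \<nu> y) *\<^sub>R a)"
   unfolding scaleR_sum_left by (rule sum.swap)
  also have "\<dots> = (\<Sum>a\<in>R. P a y *\<^sub>R a)"
  proof (rule sum.cong[OF refl])
   fix a assume "a \<in> R"
   then have "(\<Sum>\<nu>\<in>\<Gamma>. (if \<nu> \<in> G a then c a \<nu> else 0) * H \<nu> y) = P a y"
    unfolding P_def by (intro sum.mono_neutral_cong_right \<Gamma>(1)) (auto simp: \<Gamma>_def)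
   then show "(\<Sum>\<nu>\<in>\<Gamma>. (if \<nu> \<in> G a then c a \<nu> else 0) * H \<nu> y) *\<^sub>R a = P a y *\<^sub>R a" by (simp only:)
  qed
  finally show ?thesis using 1 by (simp add: scaleR_left_diff_distrib sum_subtractf)
 qed
 have i: "integrable gauss_seq (%y. (I a y - P a y)^2)" for a
  unfolding P_def by (rule hermite_distance(1)[OF I Gc(1,2)])
 have le: "(norm (S y - (hermite_sum \<Gamma> w y)))^2 <= real (card R) * (\<Sum>a\<in>R. (norm a)^2 * (I a y - P a y)^2)" for y
 proof -
  have "norm (\<Sum>a\<in>R. (I a y - P a y) *\<^sub>R a) <= (\<Sum>a\<in>R. \<bar>I a y - P a y\<bar> * norm a)"
   by (rule order_trans[OF norm_sum]) simp
  then have "(norm (\<Sum>a\<in>R. (I a y - P a y) *\<^sub>R a))^2 <= (\<Sum>a\<in>R. \<bar>I a y - P a y\<bar> * norm a)^2" by (rule power_mono) simp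
  also have "\<dots> <= (\<Sum>a\<in>R. (\<bar>I a y - P a y\<bar> * norm a)^2) * card R" by (rule sum_squared_le_sum_of_squares)
  finally show ?thesis unfolding eq by (simp add: power_mult_distrib mult_ac)
 qed
 have "E (%y. (norm (S y - (hermite_sum \<Gamma> w y)))^2)
   <= E (%y. real (card R) * (\<Sum>a\<in>R. (norm a)^2 * (I a y - P a y)^2))"
  by (rule integral_mono'[OF _ le])
   (auto intro!: integrable_mult_right Bochner_Integration.integrable_sum i mult_nonneg_nonneg sum_nonneg)
 also have "\<dots> = real (card R) * (\<Sum>a\<in>R. (norm a)^2 * E (%y. (I a y - P a y)^2))"
  using i by (subst integral_mult_right_zero, subst Bochner_Integration.integral_sum) auto
 also have "\<dots> <= real (card R) * (\<Sum>a\<in>R. (norm a)^2 * \<eta>)"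
  using less_imp_le[OF Gc(3)] by (intro mult_left_mono sum_mono) (auto simp: P_def)
 also have "\<dots> = q * \<eta>" by (simp add: q_def sum_distrib_right mult.assoc)
 also have "\<dots> <= \<epsilon>" using q \<epsilon> by (simp add: \<eta>_def field_simps)
 finally have "E (%y. (norm (S y - (hermite_sum \<Gamma> w y)))^2) <= \<epsilon>" .
 moreover have "w \<nu> \<in> V" for \<nu>
  unfolding w_def using R(2) by (intro subspace_sum[OF V_subspace] subspace_scale[OF V_subspace])
 ultimately show ?thesis using \<Gamma> by blast
qed

lemma simple_vector_L2: assumes "simple_vector s" shows "L2_vector s"
proof -
 have rv: "random_vector s" by (rule random_vector_simple[OF assms])
 have "finite (range s)" by (rule simple_vectorD(3)[OF assms])
 then obtain B where B: "\<And>y. norm (s y) <= B"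
  using finite_imp_bounded[of "range s"] by (auto simp: bounded_iff)
 have "integrable gauss_seq (%y. (norm (s y))^2)"
  by (rule gamma.integrable_const_bound[of _ "B^2"]) (use random_vector_norm[OF rv] B in \<open>auto intro!: power_mono\<close>)
 then show ?thesis using rv by (simp add: L2_vector_def)
qed

lemma simple_vector_dense:
 assumes F: "L2_vector F" and \<epsilon>: "0 < (\<epsilon>::real)"
 shows "\<exists>S. simple_vector S \<and> integrable gauss_seq (%y. (norm (F y - S y))^2) \<and> E (%y. (norm (F y - S y))^2) < \<epsilon>"
proof -
 obtain s where s: "\<And>i. simple_vector (s i)" "\<And>y. (%i. s i y) \<longlonglongrightarrow> F y" "\<And>i y. norm (s i y) <= 2 * norm (F y)"
  by (rule random_vector_dominated[OF L2_vectorD(1)[OF F]]) blast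
 have m: "(%y. (norm (F y - s i y))^2) \<in> borel_measurable gauss_seq" for i
  by (intro borel_measurable_power random_vector_norm random_vector_diff L2_vectorD(1)[OF F] random_vector_simple s)
 have dom: "AE y in gauss_seq. norm ((norm (F y - s i y))^2) <= 9 * (norm (F y))^2" for i
 proof (rule AE_I2)
  fix y
  have "norm (F y - s i y) <= 3 * norm (F y)" using norm_triangle_ineq4[of "F y" "s i y"] s(3)[of i y] by linarith
  then have "(norm (F y - s i y))^2 <= (3 * norm (F y))^2" by (rule power_mono) simp
  then show "norm ((norm (F y - s i y))^2) <= 9 * (norm (F y))^2" by (simp add: power_mult_distrib)
 qed
 have lim: "AE y in gauss_seq. (%i. (norm (F y - s i y))^2) \<longlonglongrightarrow> 0"
 proof (rule AE_I2)
  fix y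
  have "(%i. (norm (F y - s i y))^2) \<longlonglongrightarrow> (norm (F y - F y))^2" by (intro tendsto_intros s)
  then show "(%i. (norm (F y - s i y))^2) \<longlonglongrightarrow> 0" by simp
 qed
 have i9: "integrable gauss_seq (%y. 9 * (norm (F y))^2)" by (rule integrable_mult_right[OF L2_vectorD(2)[OF F]])
 have "(%i. \<integral>y. (norm (F y - s i y))^2 \<partial>gauss_seq) \<longlonglongrightarrow> E (%y. 0)"
  by (rule integral_dominated_convergence[OF _ m i9 lim dom]) simp
 then have "\<forall>\<^sub>F i in sequentially. E (%y. (norm (F y - s i y))^2) < \<epsilon>"
  using order_tendstoD(2)[of _ 0 sequentially \<epsilon>] \<epsilon> by simp
 then obtain i where "E (%y. (norm (F y - s i y))^2) < \<epsilon>" using eventually_happens by force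
 moreover have "integrable gauss_seq (%y. (norm (F y - s i y))^2)"
  by (rule Bochner_Integration.integrable_bound[OF i9 m]) (use dom[of i] in simp)
 ultimately show ?thesis using s(1) by blast
qed

lemma expansion_dense:
 assumes F: "L2_vector F" and \<epsilon>: "0 < (\<epsilon>::real)"
 shows "\<exists>\<Gamma> w. finite \<Gamma> \<and> \<Gamma> \<subseteq> multi_indices \<and> (\<forall>\<nu>. w \<nu> \<in> V) \<and>
  E (%y. (norm (F y - (hermite_sum \<Gamma> w y)))^2) < \<epsilon>"
proof -
 have "0 < \<epsilon> / 4" using \<epsilon> by simp
 then obtain S where S: "simple_vector S" "integrable gauss_seq (%y. (norm (F y - S y))^2)"
  "E (%y. (norm (F y - S y))^2) < \<epsilon> / 4"
  using simple_vector_dense[OF F] by blast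
 obtain \<Gamma> w where \<Gamma>: "finite \<Gamma>" "\<Gamma> \<subseteq> multi_indices" "\<forall>\<nu>. w \<nu> \<in> V"
  and e: "E (%y. (norm (S y - (hermite_sum \<Gamma> w y)))^2) <= \<epsilon> / 4"
  using simple_vector_expansion_dense[OF S(1) \<open>0 < \<epsilon> / 4\<close>] by blast
 let ?P = "%y. \<Sum>\<nu>\<in>\<Gamma>. H \<nu> y *\<^sub>R w \<nu>"
 have i: "integrable gauss_seq (%y. (norm (S y - ?P y))^2)"
  using \<Gamma>(3) by (intro integrable_expansion_error simple_vector_L2 S \<Gamma>) auto
 have "(norm (F y - ?P y))^2 <= 2 * (norm (F y - S y))^2 + 2 * (norm (S y - ?P y))^2" for y
 proof -
  have "norm (F y - ?P y) <= norm (F y - S y) + norm (S y - ?P y)"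
   using norm_triangle_ineq[of "F y - S y" "S y - ?P y"] by simp
  then have "(norm (F y - ?P y))^2 <= (norm (F y - S y) + norm (S y - ?P y))^2" by (rule power_mono) simp
  moreover have "0 <= (norm (F y - S y) - norm (S y - ?P y))^2" by simp
  ultimately show ?thesis by (simp add: power2_sum power2_diff)
 qed
 then have "E (%y. (norm (F y - ?P y))^2) <= E (%y. 2 * (norm (F y - S y))^2 + 2 * (norm (S y - ?P y))^2)"
  by (intro integral_mono') (auto intro!: Bochner_Integration.integrable_add integrable_mult_right S i)
 also have "\<dots> = 2 * E (%y. (norm (F y - S y))^2) + 2 * E (%y. (norm (S y - ?P y))^2)"
  using S(2) i by simp
 also have "\<dots> < \<epsilon>" using S(3) e by linarith
 finally show ?thesis using \<Gamma> by blast
qed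

text \<open>
  Parseval's identity: the error of the truncation exceeds the coefficients outside \<open>\<Lambda>\<close> by no more than the error of an
  arbitrarily good approximation.
\<close>

lemma truncation_error_le:
 assumes F: "L2_vector F" and \<Lambda>: "finite \<Lambda>" "\<Lambda> \<subseteq> multi_indices"
  and B: "\<And>\<Gamma>. finite \<Gamma> ==> \<Gamma> \<subseteq> multi_indices - \<Lambda> ==> (\<Sum>\<nu>\<in>\<Gamma>. (norm (hcoef F \<nu>))^2) <= B"
 shows "E (%y. (norm (F y - (hermite_sum \<Lambda> (hcoef F) y)))^2) <= B"
proof (rule field_le_epsilon)
 fix e :: real assume e: "0 < e"
 from expansion_dense[OF F e] obtain \<Gamma> w where \<Gamma>: "finite \<Gamma>" "\<Gamma> \<subseteq> multi_indices" "\<forall>\<nu>. w \<nu> \<in> V"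
  and less: "E (%y. (norm (F y - (hermite_sum \<Gamma> w y)))^2) < e"
  by blast
 let ?N = "%\<Gamma>. \<Sum>\<nu>\<in>\<Gamma>. (norm (hcoef F \<nu>))^2" and ?E = "\<integral>y. (norm (F y))^2 \<partial>gauss_seq"
 have "?E - ?N \<Gamma> + (\<Sum>\<nu>\<in>\<Gamma>. (norm (hcoef F \<nu> - w \<nu>))^2) < e"
  using less unfolding expansion_error[OF F \<Gamma>(1,2) \<Gamma>(3)[rule_format]] .
 moreover have "0 <= (\<Sum>\<nu>\<in>\<Gamma>. (norm (hcoef F \<nu> - w \<nu>))^2)" by (intro sum_nonneg) simp
 moreover have "?N \<Gamma> <= ?N (\<Gamma> \<union> \<Lambda>)" using \<Gamma>(1) \<Lambda>(1) by (intro sum_mono2) auto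
 moreover have "?N (\<Gamma> \<union> \<Lambda>) = ?N \<Lambda> + ?N (\<Gamma> - \<Lambda>)"
  using sum.union_disjoint[OF \<Lambda>(1), of "\<Gamma> - \<Lambda>" "%\<nu>. (norm (hcoef F \<nu>))^2"] \<Gamma>(1) by (simp add: Un_commute)
 moreover have "?N (\<Gamma> - \<Lambda>) <= B"
 proof (rule B)
  show "\<Gamma> - \<Lambda> \<subseteq> multi_indices - \<Lambda>" using \<Gamma>(2) by (rule Diff_mono) simp
 qed (simp add: \<Gamma>(1))
 moreover have "E (%y. (norm (F y - (hermite_sum \<Lambda> (hcoef F) y)))^2) = ?E - ?N \<Lambda>"
  using expansion_error[OF F \<Lambda> hcoef_in[OF F subsetD[OF \<Lambda>(2)]]] by simp
 ultimately show "E (%y. (norm (F y - (hermite_sum \<Lambda> (hcoef F) y)))^2) <= B + e"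
  by linarith
qed

end

section \<open>Hermite coefficients of the Taylor coefficients\<close>

lemma multi_index_induct [consumes 1, case_names zero incr]:
 assumes "\<mu> \<in> multi_indices" "P zero_index"
  and step: "\<And>\<mu> j. \<mu> \<in> multi_indices ==> P \<mu> ==> P (incr j \<mu>)"
 shows "P \<mu>"
 using assms(1)
proof (induction "index_size \<mu>" arbitrary: \<mu> rule: less_induct)
 case less
 show ?case
 proof (cases "\<mu> = zero_index")
  case False
  then obtain j where j: "\<mu> j ~= 0" by auto
  let ?e = "(%_. 0)(j := Suc 0) :: nat => nat"
  have "index_size (sub_index \<mu> ?e) < index_size \<mu>"
   by (rule index_size_sub[OF less.prems]) (use j in \<open>auto simp: le_fun_def fun_eq_iff\<close>)
  moreover have m: "sub_index \<mu> ?e \<in> multi_indices"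
   by (rule multi_indices_le[OF less.prems]) (simp add: le_fun_def)
  ultimately have "P (incr j (sub_index \<mu> ?e))" by (intro step less.hyps) auto
  moreover have "incr j (sub_index \<mu> ?e) = \<mu>" using j by auto
  ultimately show ?thesis by simp
 qed (use assms(2) in simp)
qed

text \<open>
  The additional summability makes almost all Gaussian sequences small relative to \<open>\<sigma>\<close>.
\<close>

locale gaussian_problem = parametric_problem \<psi> \<sigma> K V load
 for \<psi> :: "nat => 'a::euclidean_space => real" and \<sigma> K and V :: "('a, 'b::euclidean_space) l2 set" and load +
 fixes p :: nat
 assumes p_pos: "1 <= p" and \<sigma>_summable: "summable (%j. inverse (\<sigma> j) ^ p)"
begin

lemma inverse_\<sigma>_bounded: "\<exists>\<tau>>0. \<forall>j. inverse (\<sigma> j) <= \<tau>"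
proof (intro exI conjI allI)
 let ?S = "\<Sum>j. inverse (\<sigma> j) ^ p"
 have nn: "0 <= inverse (\<sigma> j)" for j using \<sigma>_pos[of j] by simp
 have S: "0 <= ?S" using nn by (intro suminf_nonneg \<sigma>_summable) simp
 then show "0 < 1 + ?S" by simp
 fix j
 have "(\<Sum>i\<in>{j}. inverse (\<sigma> i) ^ p) <= ?S" by (rule sum_le_suminf[OF \<sigma>_summable]) (auto intro: zero_le_power nn)
 then have le: "inverse (\<sigma> j) ^ p <= ?S" by simp
 show "inverse (\<sigma> j) <= 1 + ?S"
 proof (cases "inverse (\<sigma> j) <= 1")
  case False
  then have "inverse (\<sigma> j) <= inverse (\<sigma> j) ^ p" using p_pos by (intro self_le_power) auto
  then show ?thesis using le by linarith
 qed (use S in linarith)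
qed

definition ratio :: "(nat => real) => nat => real" where "ratio y j = \<bar>y j\<bar> / \<sigma> j"

lemma ratio_nonneg: "0 <= ratio y j" using \<sigma>_pos[of j] by (simp add: ratio_def)

lemma ratio_le_iff: "ratio y j <= B \<longleftrightarrow> \<bar>y j\<bar> <= B * \<sigma> j"
 using \<sigma>_pos[of j] by (simp add: ratio_def pos_divide_le_eq)

lemma measurable_ratio [measurable]: "(%y. ratio y j) \<in> borel_measurable gauss_seq"
 unfolding ratio_def by measurable

text \<open>
  On these sequences the ratios \<open>\<bar>y j\<bar> / \<sigma> j\<close> tend to 0.  The set has full measure and, unlike the set where the ratios
  are merely bounded by a given constant, is invariant under a change of one coordinate.
\<close>

definition good :: "(nat => real) set" where "good = {y. summable (%j. ratio y j ^ p)}"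

text \<open>
  With \<open>B\<close> the supremum of the ratios this is a majorant for \<open>exp (t * B)\<close> that splits into terms of single coordinates: if
  \<open>B > 1\<close>, the supremum is attained, and the factor \<open>ratio y j ^ p\<close> only enlarges its term.  That factor makes the expectations of the
  terms summable over \<open>j\<close>.
\<close>

definition weight :: "real => (nat => real) => ennreal" where
 "weight t y = ennreal (exp t) + (\<Sum>j. ennreal (ratio y j ^ p * exp (t * ratio y j)))"

lemma measurable_weight [measurable]: "weight t \<in> borel_measurable gauss_seq"
 unfolding weight_def by measurable

lemma good_iff: "y \<in> good \<longleftrightarrow> weight 0 y ~= \<infinity>"
proof -
 have "(\<Sum>j. ennreal (ratio y j ^ p)) ~= top \<longleftrightarrow> summable (%j. ratio y j ^ p)"
 proof
  show "summable (%j. ratio y j ^ p)" if "(\<Sum>j. ennreal (ratio y j ^ p)) ~= top"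
   by (rule summable_suminf_not_top[OF zero_le_power[OF ratio_nonneg] that])
  show "(\<Sum>j. ennreal (ratio y j ^ p)) ~= top" if "summable (%j. ratio y j ^ p)"
   by (rule ennreal_suminf_neq_top[OF that zero_le_power[OF ratio_nonneg]])
 qed
 then show ?thesis by (simp add: good_def weight_def)
qed

lemma sets_good: "good \<in> sets gauss_seq"
proof -
 have "{y\<in>space gauss_seq. weight 0 y ~= \<infinity>} \<in> sets gauss_seq" by measurable
 moreover have "good = {y\<in>space gauss_seq. weight 0 y ~= \<infinity>}" by (auto simp: good_iff)
 ultimately show ?thesis by (simp only:)
qed

text \<open>
  One-dimensional Gaussian moments, uniformly in \<open>j\<close> because the inverses of \<open>\<sigma>\<close> are bounded.
\<close>

lemma weight_finite:
 assumes t: "0 <= t"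
 shows "(\<integral>\<^sup>+y. weight t y \<partial>gauss_seq) < \<infinity>"
proof -
 obtain \<tau> where \<tau>: "0 < \<tau>" "\<And>j. inverse (\<sigma> j) <= \<tau>" using inverse_\<sigma>_bounded by blast
 let ?g = "%s. \<bar>s\<bar> ^ p * exp (t * \<tau> * \<bar>s\<bar>)"
 have gm: "?g \<in> borel_measurable borel" by measurable
 have gi: "integrable std_gauss ?g"
  by (rule integrable_exp_growth[OF _ gm]) (intro exp_growth_mult exp_growth_power exp_growth_abs exp_growth_ident exp_growth_exp)
 define M where "M = integral\<^sup>L std_gauss ?g"
 have M: "0 <= M" unfolding M_def by (intro integral_nonneg_AE) simp
 have each: "(\<integral>\<^sup>+y. ennreal (ratio y j ^ p * exp (t * ratio y j)) \<partial>gauss_seq) <= ennreal (inverse (\<sigma> j) ^ p * M)" for j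
 proof -
  have nn: "0 <= inverse (\<sigma> j)" using \<sigma>_pos[of j] by simp
  have "ratio y j ^ p * exp (t * ratio y j) <= inverse (\<sigma> j) ^ p * ?g (y j)" for y
  proof -
   have r: "ratio y j = inverse (\<sigma> j) * \<bar>y j\<bar>" by (simp add: ratio_def field_simps)
   have "t * ratio y j <= t * (\<tau> * \<bar>y j\<bar>)"
    unfolding r by (intro mult_left_mono mult_right_mono \<tau> t) simp
   then have "exp (t * ratio y j) <= exp (t * \<tau> * \<bar>y j\<bar>)" by (simp add: mult.assoc)
   then have "ratio y j ^ p * exp (t * ratio y j) <= ratio y j ^ p * exp (t * \<tau> * \<bar>y j\<bar>)"
    by (intro mult_left_mono zero_le_power ratio_nonneg)
   then show ?thesis by (simp add: r power_mult_distrib mult.assoc)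
  qed
  then have "(\<integral>\<^sup>+y. ennreal (ratio y j ^ p * exp (t * ratio y j)) \<partial>gauss_seq)
    <= (\<integral>\<^sup>+y. ennreal (inverse (\<sigma> j) ^ p * ?g (y j)) \<partial>gauss_seq)"
   by (intro nn_integral_mono ennreal_leI)
  also have "\<dots> = ennreal (E (%y. inverse (\<sigma> j) ^ p * ?g (y j)))"
   using integrable_coordinate[OF gm, of j] gi nn by (intro nn_integral_eq_integral integrable_mult_right) auto
  also have "E (%y. inverse (\<sigma> j) ^ p * ?g (y j)) = inverse (\<sigma> j) ^ p * M"
   unfolding M_def using integral_coordinate[OF gm, of j] by simp
  finally show ?thesis .
 qed
 have "(\<integral>\<^sup>+y. weight t y \<partial>gauss_seq) = (\<integral>\<^sup>+y. ennreal (exp t) \<partial>gauss_seq)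
   + (\<integral>\<^sup>+y. (\<Sum>j. ennreal (ratio y j ^ p * exp (t * ratio y j))) \<partial>gauss_seq)"
  unfolding weight_def by (rule nn_integral_add) measurable
 also have "(\<integral>\<^sup>+y. (\<Sum>j. ennreal (ratio y j ^ p * exp (t * ratio y j))) \<partial>gauss_seq)
   = (\<Sum>j. \<integral>\<^sup>+y. ennreal (ratio y j ^ p * exp (t * ratio y j)) \<partial>gauss_seq)"
  by (rule nn_integral_suminf) measurable
 also have "(\<integral>\<^sup>+y. ennreal (exp t) \<partial>gauss_seq) = ennreal (exp t)" using gamma.emeasure_space_1 by simp
 also have "(\<Sum>j. \<integral>\<^sup>+y. ennreal (ratio y j ^ p * exp (t * ratio y j)) \<partial>gauss_seq) <= (\<Sum>j. ennreal (inverse (\<sigma> j) ^ p * M))"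
  by (intro suminf_le each) auto
 also have "\<dots> = ennreal (\<Sum>j. inverse (\<sigma> j) ^ p * M)"
 proof (rule suminf_ennreal2)
  show "0 <= inverse (\<sigma> j) ^ p * M" for j using \<sigma>_pos[of j] M by simp
 qed (rule summable_mult2[OF \<sigma>_summable])
 finally show ?thesis by (simp add: order_le_less_trans)
qed

lemma AE_good: "AE y in gauss_seq. y \<in> good"
 unfolding good_iff using weight_finite[of 0] by (intro nn_integral_PInf_AE) auto

lemma ratio_tendsto: assumes "y \<in> good" shows "ratio y \<longlonglongrightarrow> 0"
proof -
 have "(%j. ratio y j ^ p) \<longlonglongrightarrow> 0" using assms by (intro summable_LIMSEQ_zero) (simp add: good_def)
 then have "(%j. root p (ratio y j ^ p)) \<longlonglongrightarrow> root p 0" by (rule tendsto_real_root)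
 moreover have "root p (ratio y j ^ p) = ratio y j" for j
  using p_pos ratio_nonneg by (intro real_root_power_cancel) auto
 ultimately show ?thesis by simp
qed

lemma good_upd: assumes "y \<in> good" shows "y(j := t) \<in> good"
proof -
 have "\<forall>\<^sub>F i in sequentially. ratio (y(j := t)) i ^ p = ratio y i ^ p"
  using eventually_gt_at_top[of j] by eventually_elim (simp add: ratio_def)
 then show ?thesis using assms unfolding good_def mem_Collect_eq by (simp only: summable_cong)
qed

lemma good_bounded:
 assumes y: "y \<in> good" and t: "0 <= t"
 shows "\<exists>B. bounded_by B y \<and> ennreal (exp (t * B)) <= weight t y"
proof (cases "\<forall>j. ratio y j <= 1")
 case True
 then have "bounded_by 1 y" by (simp add: bounded_by_def ratio_le_iff)
 moreover have "ennreal (exp (t * 1)) <= weight t y" by (simp add: weight_def add_increasing2)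
 ultimately show ?thesis by blast
next
 case False
 define A where "A = {j. 1 < ratio y j}"
 have "\<forall>\<^sub>F j in sequentially. ratio y j < 1" by (rule order_tendstoD(2)[OF ratio_tendsto[OF y]]) simp
 then obtain n where n: "\<And>j. n <= j ==> ratio y j < 1" by (auto simp: eventually_sequentially)
 have "A \<subseteq> {..n}"
 proof
  fix j assume "j \<in> A" then show "j \<in> {..n}" using n[of j] by (cases "n <= j") (auto simp: A_def)
 qed
 then have A: "finite A" "A ~= {}" using False by (auto simp: A_def not_le intro: finite_subset)
 \<comment> \<open>only finitely many ratios exceed 1, so the largest one is attained\<close>
 define B where "B = Max (ratio y ` A)"
 have "B \<in> ratio y ` A" unfolding B_def using A by (intro Max_in) auto
 then obtain j where j: "j \<in> A" "B = ratio y j" by blast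
 have B1: "1 < B" using j by (simp add: A_def)
 have "ratio y i <= B" for i
 proof (cases "i \<in> A")
  case True
  then show ?thesis unfolding B_def using A(1) by (intro Max_ge) auto
 next
  case False
  then show ?thesis using B1 by (simp add: A_def)
 qed
 then have bd: "bounded_by B y" by (simp add: bounded_by_def ratio_le_iff)
 have "1 <= B ^ p" using B1 by (intro one_le_power) simp
 then have "1 * exp (t * B) <= B ^ p * exp (t * B)" by (rule mult_right_mono) simp
 then have "ennreal (exp (t * B)) <= ennreal (ratio y j ^ p * exp (t * ratio y j))" unfolding j(2) by (intro ennreal_leI) simp
 also have "\<dots> = (\<Sum>i\<in>{j}. ennreal (ratio y i ^ p * exp (t * ratio y i)))" by simp
 also have "\<dots> <= (\<Sum>i. ennreal (ratio y i ^ p * exp (t * ratio y i)))" by (rule sum_le_suminf) auto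
 also have "\<dots> <= weight t y" by (simp add: weight_def add_increasing)
 finally show ?thesis using bd by blast
qed

text \<open>
  Off a null set these are the Taylor coefficients; the value 0 on the null set makes them measurable.
\<close>

definition T :: "(nat => nat) => (nat => real) => ('a, 'b) l2" where
 "T \<mu> y = (if y \<in> good then taylor y \<mu> else 0)"

definition energy_const :: real where "energy_const = (norm load)^2 / (2 - exp K)"

lemma energy_const_nonneg: "0 <= energy_const"
proof -
 have "exp K < exp (ln 2)" unfolding exp_less_cancel_iff by (rule K_less)
 then show ?thesis by (simp add: energy_const_def)
qed

lemma norm_taylor_le:
 assumes y: "bounded_by B y" and \<mu>: "\<mu> \<in> multi_indices"
 shows "norm (taylor y \<mu>) <= exp (B * K) * (sqrt energy_const / scale \<mu>)"
proof -
 have "(scale \<mu>)^2 * (norm (taylor y \<mu>))^2 <= (\<Sum>\<mu>\<in>{..\<mu>}. (scale \<mu>)^2 * (norm (taylor y \<mu>))^2)"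
  by (rule member_le_sum[of \<mu> "{..\<mu>}" "%\<mu>. (scale \<mu>)^2 * (norm (taylor y \<mu>))^2"])
   (auto intro: finite_multi_indices_below[OF \<mu>])
 also have "\<dots> <= exp (2 * (B * K)) * energy_const" unfolding energy_const_def by (rule taylor_norm_bound[OF y \<mu>])
 also have "\<dots> = (exp (B * K) * sqrt energy_const)^2"
  using energy_const_nonneg by (simp add: power_mult_distrib exp_double)
 finally have "(scale \<mu> * norm (taylor y \<mu>))^2 <= (exp (B * K) * sqrt energy_const)^2" by (simp only: power_mult_distrib)
 then have "scale \<mu> * norm (taylor y \<mu>) <= exp (B * K) * sqrt energy_const"
  by (rule power2_le_imp_le) (simp add: energy_const_nonneg)
 then show ?thesis using scale_pos[of \<mu>] by (simp add: pos_le_divide_eq mult.commute)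
qed

lemma simple_function_truncated_coordinates:
 assumes "simple_function borel \<phi>"
 shows "simple_function gauss_seq (%y j. if j < n then \<phi> (y j) else (0::real))"
proof (induction n)
 case (Suc n)
 have "simple_function gauss_seq (%y. \<phi> (y n))"
  by (rule simple_function_comp[OF measurable_coordinate assms])
 from simple_function_compose2[OF Suc this, of "%z a. z(n := a)"]
 show ?case by (rule back_subst[of "simple_function gauss_seq"]) (auto simp: fun_eq_iff)
qed simp

lemma bounded_by_finite: "(\<And>j. n <= j ==> z j = 0) ==> \<exists>B. bounded_by B z"
proof -
 assume z: "\<And>j. n <= j ==> z j = 0"
 have "\<bar>z j\<bar> <= (\<Sum>i<n. ratio z i) * \<sigma> j" for j
 proof (cases "j < n")
  case True
  then have "ratio z j <= (\<Sum>i<n. ratio z i)" by (intro member_le_sum ratio_nonneg) auto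
  then show ?thesis by (simp add: ratio_le_iff)
 next
  case False
  have "0 <= (\<Sum>i<n. ratio z i)" by (intro sum_nonneg ratio_nonneg)
  then show ?thesis using z[of j] False \<sigma>_pos[of j] by simp
 qed
 then show ?thesis unfolding bounded_by_def by blast
qed

text \<open>
  The parameter is approximated by sequences with finitely many nonzero coordinates that take finitely many values.  The relative
  distance of these to \<open>y\<close> tends to 0 uniformly in the coordinates: for late coordinates because the ratios of \<open>y\<close> are
  small, for the finitely many others by convergence.
\<close>

lemma random_vector_T:
 assumes \<mu>: "\<mu> \<in> multi_indices"
 shows "random_vector (T \<mu>)"
proof -
 have "(%t. t) \<in> borel_measurable (borel :: real measure)" by simp
 from borel_measurable_implies_sequence_metric[OF this, of 0]
 obtain \<phi> where \<phi>: "\<And>i. simple_function borel (\<phi> i)" "\<And>t::real. (%i. \<phi> i t) \<longlonglongrightarrow> t" "\<And>i t. \<bar>\<phi> i t\<bar> <= 2 * \<bar>t\<bar>"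
  by (auto simp: dist_real_def)
 \<comment> \<open>simple functions of the first \<open>i\<close> coordinates, at most twice as large as these\<close>
 define z where "z i y j = (if j < i then \<phi> i (y j) else 0)" for i j :: nat and y :: "nat => real"
 have sz: "simple_function gauss_seq (z i)" for i
  using simple_function_truncated_coordinates[OF \<phi>(1), of i i] unfolding z_def[abs_def] .
 have zin: "taylor (z i y) \<mu> \<in> V" for i y
  using bounded_by_finite[of i "z i y"] taylor_in[OF _ \<mu>] by (auto simp: z_def)
 show ?thesis
 proof (rule random_vectorI)
  show "simple_vector (%y. if y \<in> good then taylor (z i y) \<mu> else 0)" for i
  proof -
   have "simple_function gauss_seq (%y. (%a v. if a = (1::real) then v else 0) (indicator good y) (taylor (z i y) \<mu>))"
    by (rule simple_function_compose2[OF simple_function_indicator[OF sets_good] simple_function_compose1[OF sz]])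
   then have "simple_function gauss_seq (%y. if y \<in> good then taylor (z i y) \<mu> else 0)"
    by (rule back_subst[of "simple_function gauss_seq"]) (auto simp: fun_eq_iff indicator_def)
   then show ?thesis unfolding simple_vector_def by (auto intro: zin subspace_0[OF V_subspace])
  qed
  show "(%i. if y \<in> good then taylor (z i y) \<mu> else 0) \<longlonglongrightarrow> T \<mu> y" for y
  proof (cases "y \<in> good")
   case True
   obtain B where B: "bounded_by B y" using good_bounded[OF True, of 0] by auto
   have B0: "0 <= B" by (rule bounded_by_nonneg[OF B])
   have r: "ratio y j <= B" for j using B by (simp add: ratio_le_iff bounded_by_def)
   define d where "d i j = ratio (%j. z i y j - y j) j" for i j
   have z2: "\<bar>z i y j\<bar> <= 2 * \<bar>y j\<bar>" for i j using \<phi>(3)[of i "y j"] by (simp add: z_def)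
   have d3: "d i j <= 3 * ratio y j" for i j
   proof -
    have "\<bar>z i y j - y j\<bar> <= 3 * \<bar>y j\<bar>" using z2[of i j] by linarith
    then have "\<bar>z i y j - y j\<bar> / \<sigma> j <= 3 * \<bar>y j\<bar> / \<sigma> j" by (rule divide_right_mono) (rule less_imp_le[OF \<sigma>_pos])
    then show ?thesis by (simp add: d_def ratio_def)
   qed
   have d3B: "d i j <= 3 * B" for i j using d3[of i j] r[of j] by linarith
   have bdd: "bdd_above (range (d i))" for i by (rule bdd_aboveI2[OF d3B])
   define \<delta> where "\<delta> i = (SUP j. d i j)" for i
   have d\<delta>: "d i j <= \<delta> i" for i j unfolding \<delta>_def by (rule cSUP_upper[OF _ bdd]) simp
   have \<delta>0: "\<delta> \<longlonglongrightarrow> 0"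
   proof (rule tendstoI)
    fix e :: real assume e: "0 < e"
    have "\<forall>\<^sub>F j in sequentially. ratio y j < e / 6" by (rule order_tendstoD(2)[OF ratio_tendsto[OF True]]) (use e in simp)
    then obtain n where n: "\<And>j. n <= j ==> ratio y j < e / 6" by (auto simp: eventually_sequentially)
    have "\<forall>\<^sub>F i in sequentially. d i j < e / 2" for j
    proof -
     have "(%i. \<bar>\<phi> i (y j) - y j\<bar> / \<sigma> j) \<longlonglongrightarrow> \<bar>y j - y j\<bar> / \<sigma> j"
      using \<sigma>_pos[of j] by (intro tendsto_intros \<phi>(2)) simp
     then have "\<forall>\<^sub>F i in sequentially. \<bar>\<phi> i (y j) - y j\<bar> / \<sigma> j < e / 2" using e by (intro order_tendstoD(2)) auto
     then show ?thesis using eventually_gt_at_top[of j] by eventually_elim (simp add: d_def ratio_def z_def)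
    qed
    then have "\<forall>\<^sub>F i in sequentially. \<forall>j\<in>{..<n}. d i j < e / 2" by (intro eventually_ball_finite) auto
    then show "\<forall>\<^sub>F i in sequentially. dist (\<delta> i) 0 < e"
    proof eventually_elim
     case (elim i)
     have "d i j <= e / 2" for j
     proof (cases "j < n")
      case False
      then show ?thesis using d3[of i j] n[of j] by simp
     qed (use elim in \<open>auto intro: less_imp_le\<close>)
     then have "\<delta> i <= e / 2" unfolding \<delta>_def by (intro cSUP_least) auto
     moreover have "0 <= \<delta> i" using d\<delta>[of i 0] ratio_nonneg[of "%j. z i y j - y j" 0] by (simp add: d_def)
     ultimately show ?case using e by simp
    qed
   qed
   have "(%i. taylor (z i y) \<mu>) \<longlonglongrightarrow> taylor y \<mu>"
   proof (rule tendsto_taylor[where B = "2 * B" and \<delta> = \<delta>, OF _ _ _ \<delta>0 \<mu>])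
    have "\<bar>y j\<bar> <= B * \<sigma> j" for j using B by (simp add: bounded_by_def)
    moreover have "0 <= B * \<sigma> j" for j using B0 \<sigma>_pos[of j] by simp
    ultimately have "\<bar>y j\<bar> <= 2 * (B * \<sigma> j) \<and> 2 * \<bar>y j\<bar> <= 2 * (B * \<sigma> j)" for j
     by (metis add_increasing mult_2 mult_left_mono zero_le_numeral)
    then have y2: "\<bar>y j\<bar> <= 2 * B * \<sigma> j" "2 * \<bar>y j\<bar> <= 2 * B * \<sigma> j" for j
     by (simp_all only: mult.assoc)
    show "bounded_by (2 * B) y" using y2(1) by (simp add: bounded_by_def)
    show "\<forall>\<^sub>F i in sequentially. bounded_by (2 * B) (z i y)"
     using order_trans[OF z2 y2(2)] by (simp add: bounded_by_def)
    show "\<forall>\<^sub>F i in sequentially. bounded_by (\<delta> i) (%j. z i y j - y j)"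
     using d\<delta> by (simp add: bounded_by_def d_def ratio_le_iff)
   qed
   then show ?thesis using True by (simp add: T_def)
  qed (simp add: T_def)
 qed
qed

lemma sum_T_le_weight:
 assumes N: "N \<in> multi_indices"
 shows "ennreal (\<Sum>\<mu>\<in>{..N}. (scale \<mu>)^2 * (norm (T \<mu> y))^2) <= ennreal energy_const * weight (2 * K) y"
proof (cases "y \<in> good")
 case True
 have K2: "0 <= 2 * K" using K_nonneg by simp
 obtain B where B: "bounded_by B y" "ennreal (exp (2 * K * B)) <= weight (2 * K) y" using good_bounded[OF True K2] by blast
 have "(\<Sum>\<mu>\<in>{..N}. (scale \<mu>)^2 * (norm (T \<mu> y))^2) <= energy_const * exp (2 * K * B)"
  using taylor_norm_bound[OF B(1) N] True by (simp add: T_def energy_const_def mult_ac)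
 then have "ennreal (\<Sum>\<mu>\<in>{..N}. (scale \<mu>)^2 * (norm (T \<mu> y))^2) <= ennreal energy_const * ennreal (exp (2 * K * B))"
  using energy_const_nonneg by (simp add: ennreal_leI flip: ennreal_mult)
 also have "\<dots> <= ennreal energy_const * weight (2 * K) y" by (intro mult_left_mono B) simp
 finally show ?thesis .
qed (simp add: T_def)

lemma L2_T: assumes \<mu>: "\<mu> \<in> multi_indices" shows "L2_vector (T \<mu>)"
proof -
 note rv = random_vector_T[OF \<mu>]
 have "integrable gauss_seq (%y. (scale \<mu>)^2 * (norm (T \<mu> y))^2)"
 proof (rule integrableI_nonneg)
  show "(%y. (scale \<mu>)^2 * (norm (T \<mu> y))^2) \<in> borel_measurable gauss_seq"
   using random_vector_norm[OF rv] by simp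
  have "(\<integral>\<^sup>+y. ennreal ((scale \<mu>)^2 * (norm (T \<mu> y))^2) \<partial>gauss_seq) <= (\<integral>\<^sup>+y. ennreal energy_const * weight (2 * K) y \<partial>gauss_seq)"
  proof (rule nn_integral_mono)
   fix y
   have "(scale \<mu>)^2 * (norm (T \<mu> y))^2 <= (\<Sum>\<mu>\<in>{..\<mu>}. (scale \<mu>)^2 * (norm (T \<mu> y))^2)"
    by (rule member_le_sum[of \<mu> "{..\<mu>}" "%\<mu>. (scale \<mu>)^2 * (norm (T \<mu> y))^2"])
     (auto intro: finite_multi_indices_below[OF \<mu>])
   from order_trans[OF ennreal_leI[OF this] sum_T_le_weight[OF \<mu>]]
   show "ennreal ((scale \<mu>)^2 * (norm (T \<mu> y))^2) <= ennreal energy_const * weight (2 * K) y" .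
  qed
  also have "\<dots> = ennreal energy_const * (\<integral>\<^sup>+y. weight (2 * K) y \<partial>gauss_seq)" by (rule nn_integral_cmult) measurable
  also have "\<dots> < \<infinity>" using weight_finite[of "2 * K"] K_nonneg by (simp add: ennreal_mult_less_top)
  finally show "(\<integral>\<^sup>+y. ennreal ((scale \<mu>)^2 * (norm (T \<mu> y))^2) \<partial>gauss_seq) < \<infinity>" .
 qed simp
 then show ?thesis using rv scale_pos[of \<mu>] by (simp add: L2_vector_def)
qed

text \<open>
  The pointwise energy bound integrated against the majorant of the exponential factor.
\<close>

lemma sum_T_energy_bounded:
 "\<exists>C. \<forall>N\<in>multi_indices. (\<Sum>\<mu>\<in>{..N}. (scale \<mu>)^2 * E (%y. (norm (T \<mu> y))^2)) <= C"
proof (intro exI ballI)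
 fix N assume N: "N \<in> multi_indices"
 let ?I = "ennreal energy_const * (\<integral>\<^sup>+y. weight (2 * K) y \<partial>gauss_seq)"
 have i: "integrable gauss_seq (%y. (scale \<mu>)^2 * (norm (T \<mu> y))^2)" if "\<mu> \<in> {..N}" for \<mu>
  using that lower_multi[OF N] by (intro integrable_mult_right L2_vectorD(2)[OF L2_T]) simp
 have "ennreal (E (%y. (\<Sum>\<mu>\<in>{..N}. (scale \<mu>)^2 * (norm (T \<mu> y))^2)))
   = (\<integral>\<^sup>+y. ennreal (\<Sum>\<mu>\<in>{..N}. (scale \<mu>)^2 * (norm (T \<mu> y))^2) \<partial>gauss_seq)"
  by (rule nn_integral_eq_integral[symmetric]) (auto intro!: Bochner_Integration.integrable_sum i sum_nonneg simp del: integrable_mult_right_iff)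
 also have "\<dots> <= (\<integral>\<^sup>+y. ennreal energy_const * weight (2 * K) y \<partial>gauss_seq)" by (rule nn_integral_mono[OF sum_T_le_weight[OF N]])
 also have "\<dots> = ?I" by (rule nn_integral_cmult) measurable
 finally have le: "ennreal (E (%y. (\<Sum>\<mu>\<in>{..N}. (scale \<mu>)^2 * (norm (T \<mu> y))^2))) <= ?I" .
 have fin: "?I < top" using weight_finite[of "2 * K"] K_nonneg by (simp add: ennreal_mult_less_top)
 have "(\<Sum>\<mu>\<in>{..N}. (scale \<mu>)^2 * E (%y. (norm (T \<mu> y))^2)) = E (%y. (\<Sum>\<mu>\<in>{..N}. (scale \<mu>)^2 * (norm (T \<mu> y))^2))"
  using i by (subst Bochner_Integration.integral_sum) auto
 also have "\<dots> <= enn2real ?I"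
  using enn2real_mono[OF le fin] by (subst (asm) enn2real_ennreal) (auto intro!: integral_nonneg_AE sum_nonneg)
 finally show "(\<Sum>\<mu>\<in>{..N}. (scale \<mu>)^2 * E (%y. (norm (T \<mu> y))^2)) <= enn2real ?I" .
qed

lemma exp_growth_taylor:
 assumes y: "bounded_by B y" and \<mu>: "\<mu> \<in> multi_indices"
 shows "exp_growth (%t. taylor (y(j := t)) \<mu> \<bullet> v)"
proof (rule exp_growthI)
 show "0 <= K / \<sigma> j" using K_nonneg \<sigma>_pos[of j] by simp
 fix t
 let ?B = "B + \<bar>t\<bar> / \<sigma> j"
 have q: "0 <= \<bar>t\<bar> / \<sigma> j" using \<sigma>_pos[of j] by simp
 have "bounded_by ?B (y(j := t))"
  by (rule bounded_by_upd[OF y]) (use q bounded_by_nonneg[OF y] \<sigma>_pos[of j] in \<open>auto simp: distrib_right\<close>)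
 then have "norm (taylor (y(j := t)) \<mu>) <= exp (?B * K) * (sqrt energy_const / scale \<mu>)" by (rule norm_taylor_le[OF _ \<mu>])
 then have "norm (taylor (y(j := t)) \<mu>) * norm v <= exp (?B * K) * (sqrt energy_const / scale \<mu>) * norm v"
  by (rule mult_right_mono) simp
 moreover have "exp (?B * K) = exp (B * K) * exp (K / \<sigma> j * \<bar>t\<bar>)" by (simp add: algebra_simps flip: exp_add)
 moreover have "\<bar>taylor (y(j := t)) \<mu> \<bullet> v\<bar> <= norm (taylor (y(j := t)) \<mu>) * norm v" by (rule Cauchy_Schwarz_ineq2)
 ultimately show "\<bar>taylor (y(j := t)) \<mu> \<bullet> v\<bar> <= (exp (B * K) * (sqrt energy_const / scale \<mu>) * norm v) * exp (K / \<sigma> j * \<bar>t\<bar>)"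
  by (simp only: mult_ac)
qed

text \<open>
  Along one coordinate the coefficient of order \<open>incr j \<mu>\<close> is the derivative of that of order \<open>\<mu>\<close>, up to a factor; the
  square root comes from the normalisation of the Hermite polynomials.
\<close>

lemma coordinate_integration_by_parts:
 assumes y: "y \<in> good" and \<mu>: "\<mu> \<in> multi_indices"
 shows "(\<integral>t. (T \<mu> (y(j := t)) \<bullet> v) * hermite (Suc k) t \<partial>std_gauss)
  = (real (Suc (\<mu> j)) / sqrt (real (Suc k))) * (\<integral>t. (T (incr j \<mu>) (y(j := t)) \<bullet> v) * hermite k t \<partial>std_gauss)"
proof -
 obtain B where B: "bounded_by B y" using good_bounded[OF y, of 0] by auto
 let ?n = "real (Suc (\<mu> j))"
 define c where "c t = taylor (y(j := t)) \<mu> \<bullet> v" for t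
 \<comment> \<open>up to the factor \<open>Suc (\<mu> j)\<close>, the derivative of \<open>c\<close>\<close>
 define c' where "c' t = taylor (y(j := t)) (incr j \<mu>) \<bullet> v" for t
 have \<mu>': "incr j \<mu> \<in> multi_indices" by (rule multi_indices_upd[OF \<mu>])
 have dv: "((%t. f t \<bullet> v) has_real_derivative f' \<bullet> v) (at t)" if "(f has_vector_derivative f') (at t)" for f f' t
  using bounded_linear.has_vector_derivative[OF bounded_linear_inner_left that]
  by (simp add: has_real_derivative_iff_has_vector_derivative)
 have d: "(c has_real_derivative ?n * c' t) (at t)" for t
  using dv[OF taylor_has_derivative[OF \<mu> B, of j t]] unfolding c_def c'_def by (simp only: inner_scaleR_left)
 have "isCont c' t" for t
  using dv[OF taylor_has_derivative[OF \<mu>' B, of j t]] unfolding c'_def by (rule DERIV_isCont)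
 then have cont: "continuous_on UNIV (%t. ?n * c' t)"
  by (intro continuous_on_mult continuous_on_const continuous_at_imp_continuous_on) simp
 have eg: "exp_growth c" "exp_growth (%t. ?n * c' t)"
  unfolding c_def c'_def by (intro exp_growth_mult exp_growth_const exp_growth_taylor[OF B] \<mu> \<mu>')+
 have T: "T \<mu> (y(j := t)) \<bullet> v = c t" "T (incr j \<mu>) (y(j := t)) \<bullet> v = c' t" for t
  using good_upd[OF y] by (simp_all add: T_def c_def c'_def)
 have sq: "sqrt (fact (Suc k)) = sqrt (real (Suc k)) * sqrt (fact k)" by (simp only: fact_Suc of_nat_mult real_sqrt_mult)
 have "(\<integral>t. c t * hermite (Suc k) t \<partial>std_gauss) = (\<integral>t. c t * poly (hermite_monic (Suc k)) t \<partial>std_gauss) / sqrt (fact (Suc k))"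
  unfolding hermite_def by (simp del: hermite_monic.simps fact_Suc)
 also have "\<dots> = (\<integral>t. ?n * c' t * poly (hermite_monic k) t \<partial>std_gauss) / sqrt (fact (Suc k))"
  by (simp only: gaussian_integral_hermite_Suc[OF d cont eg])
 also have "\<dots> = (?n / sqrt (real (Suc k))) * ((\<integral>t. c' t * poly (hermite_monic k) t \<partial>std_gauss) / sqrt (fact k))"
  unfolding sq by (simp add: mult.assoc del: of_nat_Suc)
 also have "(\<integral>t. c' t * poly (hermite_monic k) t \<partial>std_gauss) / sqrt (fact k) = (\<integral>t. c' t * hermite k t \<partial>std_gauss)"
  unfolding hermite_def by simp
 finally show ?thesis unfolding T .
qed

text \<open>
  Resample the coordinate \<open>j\<close> and integrate by parts in it.
\<close>

lemma hcoef_T_incr: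
 assumes \<mu>: "\<mu> \<in> multi_indices" and \<nu>: "\<nu> \<in> multi_indices"
 shows "hcoef (T \<mu>) (incr j \<nu>) = (real (Suc (\<mu> j)) / sqrt (real (Suc (\<nu> j)))) *\<^sub>R hcoef (T (incr j \<mu>)) \<nu>"
proof (rule hcoef_eqI[OF L2_T[OF \<mu>] multi_indices_upd[OF \<nu>]])
 let ?c = "real (Suc (\<mu> j)) / sqrt (real (Suc (\<nu> j)))"
 note \<mu>' = multi_indices_upd[OF \<mu>, of j "Suc (\<mu> j)"] and \<nu>' = multi_indices_upd[OF \<nu>, of j "Suc (\<nu> j)"]
 show "?c *\<^sub>R hcoef (T (incr j \<mu>)) \<nu> \<in> V"
  by (intro subspace_scale[OF V_subspace] hcoef_in L2_T \<mu>' \<nu>)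
 fix v assume v: "v \<in> V"
 let ?J = "insert j {i. \<nu> i ~= 0}"
 have J: "finite ?J" using multi_indicesD[OF \<nu>] by simp
 \<comment> \<open>the factors that do not involve the coordinate \<open>j\<close>\<close>
 define g where "g y = (\<Prod>i\<in>?J - {j}. hermite (\<nu> i) (y i))" for y
 have H: "H \<nu> (y(j := t)) = hermite (\<nu> j) t * g y" for y t
 proof -
  have "H \<nu> (y(j := t)) = (\<Prod>i\<in>?J. hermite (\<nu> i) ((y(j := t)) i))" by (rule hermite_multi_eq[OF J]) auto
  then show ?thesis unfolding g_def by (subst (asm) prod.remove[OF J, of j]) auto
 qed
 have H': "H (incr j \<nu>) (y(j := t)) = hermite (Suc (\<nu> j)) t * g y" for y t
 proof -
  have "H (incr j \<nu>) (y(j := t)) = (\<Prod>i\<in>?J. hermite ((incr j \<nu>) i) ((y(j := t)) i))"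
   by (rule hermite_multi_eq[OF J]) auto
  then show ?thesis unfolding g_def by (subst (asm) prod.remove[OF J, of j]) auto
 qed
 have "E (%y. (T \<mu> y \<bullet> v) * H (incr j \<nu>) y)
   = E (%y. (\<integral>t. (T \<mu> (y(j := t)) \<bullet> v) * H (incr j \<nu>) (y(j := t)) \<partial>std_gauss))"
  by (rule integral_resample[OF integrable_inner_hermite[OF L2_T[OF \<mu>] \<nu>']])
 also have "\<dots> = E (%y. ?c * (\<integral>t. (T (incr j \<mu>) (y(j := t)) \<bullet> v) * H \<nu> (y(j := t)) \<partial>std_gauss))"
 proof (rule integral_cong_AE)
  have m: "(%y. \<integral>t. F (y(j := t)) \<partial>std_gauss) \<in> borel_measurable gauss_seq" if "F \<in> borel_measurable gauss_seq" for F :: "_ => real"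
   using measurable_compose[OF measurable_upd_coordinate that, of j]
   by (intro gauss.borel_measurable_lebesgue_integral) (simp add: case_prod_beta')
  show "(%y. \<integral>t. (T \<mu> (y(j := t)) \<bullet> v) * H (incr j \<nu>) (y(j := t)) \<partial>std_gauss) \<in> borel_measurable gauss_seq"
   by (rule m) (rule borel_measurable_integrable[OF integrable_inner_hermite[OF L2_T[OF \<mu>] \<nu>']])
  show "(%y. ?c * (\<integral>t. (T (incr j \<mu>) (y(j := t)) \<bullet> v) * H \<nu> (y(j := t)) \<partial>std_gauss)) \<in> borel_measurable gauss_seq"
   by (rule borel_measurable_times[OF borel_measurable_const m])
    (rule borel_measurable_integrable[OF integrable_inner_hermite[OF L2_T[OF \<mu>'] \<nu>]])
  show "AE y in gauss_seq. (\<integral>t. (T \<mu> (y(j := t)) \<bullet> v) * H (incr j \<nu>) (y(j := t)) \<partial>std_gauss)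
   = ?c * (\<integral>t. (T (incr j \<mu>) (y(j := t)) \<bullet> v) * H \<nu> (y(j := t)) \<partial>std_gauss)"
   using AE_good
  proof eventually_elim
   case (elim y)
   have "(\<integral>t. (T \<mu> (y(j := t)) \<bullet> v) * H (incr j \<nu>) (y(j := t)) \<partial>std_gauss)
     = (\<integral>t. (T \<mu> (y(j := t)) \<bullet> v) * hermite (Suc (\<nu> j)) t \<partial>std_gauss) * g y"
    unfolding H' by (simp only: mult.assoc[symmetric] integral_mult_left_zero)
   also have "\<dots> = ?c * ((\<integral>t. (T (incr j \<mu>) (y(j := t)) \<bullet> v) * hermite (\<nu> j) t \<partial>std_gauss) * g y)"
    unfolding coordinate_integration_by_parts[OF elim \<mu>] by (simp only: mult.assoc)
   also have "(\<integral>t. (T (incr j \<mu>) (y(j := t)) \<bullet> v) * hermite (\<nu> j) t \<partial>std_gauss) * g y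
     = (\<integral>t. (T (incr j \<mu>) (y(j := t)) \<bullet> v) * H \<nu> (y(j := t)) \<partial>std_gauss)"
    unfolding H by (simp only: mult.assoc[symmetric] integral_mult_left_zero)
   finally show ?case .
  qed
 qed
 also have "\<dots> = ?c * E (%y. (\<integral>t. (T (incr j \<mu>) (y(j := t)) \<bullet> v) * H \<nu> (y(j := t)) \<partial>std_gauss))"
  by (rule integral_mult_right_zero)
 also have "E (%y. (\<integral>t. (T (incr j \<mu>) (y(j := t)) \<bullet> v) * H \<nu> (y(j := t)) \<partial>std_gauss))
   = E (%y. (T (incr j \<mu>) y \<bullet> v) * H \<nu> y)"
  by (rule integral_resample[OF integrable_inner_hermite[OF L2_T[OF \<mu>'] \<nu>], symmetric])
 also have "\<dots> = hcoef (T (incr j \<mu>)) \<nu> \<bullet> v" by (rule hcoef_inner[OF L2_T[OF \<mu>'] \<nu> v, symmetric])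
 finally show "(?c *\<^sub>R hcoef (T (incr j \<mu>)) \<nu>) \<bullet> v = E (%y. (T \<mu> y \<bullet> v) * H (incr j \<nu>) y)"
  by (simp only: inner_scaleR_left)
qed

text \<open>
  Iteration of the preceding lemma, with the factors collected into binomial coefficients.
\<close>

lemma hcoef_T_binomial:
 assumes \<nu>: "\<nu> \<in> multi_indices" and J: "finite J" "\<And>j. j \<notin> J ==> \<nu> j = 0"
 shows "\<mu> \<in> multi_indices ==> \<mu> <= \<nu> ==> (\<Prod>j\<in>J. real (\<nu> j choose \<mu> j)) * (norm (hcoef (T zero_index) \<nu>))^2
  = (\<Prod>j\<in>J. fact (\<mu> j)) * (norm (hcoef (T \<mu>) (sub_index \<nu> \<mu>)))^2"
proof (induction \<mu> rule: multi_index_induct)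
 case zero
 show ?case by simp
next
 case (incr \<mu> j)
 have le: "\<mu> <= \<nu>" by (rule order_trans[OF _ incr.prems]) (simp add: le_fun_def)
 have lt: "Suc (\<mu> j) <= \<nu> j" using le_funD[OF incr.prems, of j] by simp
 then have jJ: "j \<in> J" using J(2)[of j] by (cases "j \<in> J") auto
 let ?m = "sub_index \<nu> (incr j \<mu>)" and ?R = "J - {j}"
 have m: "?m \<in> multi_indices" by (rule sub_multi[OF \<nu>])
 have inc: "incr j ?m = sub_index \<nu> \<mu>" using lt by (auto simp: fun_eq_iff)
 define n where "n = \<nu> j - Suc (\<mu> j)"
 have n: "\<nu> j = Suc (\<mu> j) + n" using lt by (simp add: n_def)
 have h: "hcoef (T \<mu>) (sub_index \<nu> \<mu>) = (real (Suc (\<mu> j)) / sqrt (real (Suc n))) *\<^sub>R hcoef (T (incr j \<mu>)) ?m"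
  using hcoef_T_incr[OF incr.hyps m, of j] unfolding inc by (simp add: n_def del: of_nat_Suc)
 have IH: "(\<Prod>i\<in>J. real (\<nu> i choose \<mu> i)) * (norm (hcoef (T zero_index) \<nu>))^2
   = (\<Prod>i\<in>J. fact (\<mu> i)) * ((real (Suc (\<mu> j)))^2 / real (Suc n) * (norm (hcoef (T (incr j \<mu>)) ?m))^2)"
  using incr.IH[OF le] unfolding h by (simp add: power_mult_distrib power_divide del: of_nat_Suc)
 have bin: "real (\<nu> j choose Suc (\<mu> j)) * real (Suc (\<mu> j)) = real (\<nu> j choose \<mu> j) * real (Suc n)"
 proof -
  have "Suc (\<mu> j) * (\<nu> j choose Suc (\<mu> j)) = (\<nu> j - \<mu> j) * (\<nu> j choose \<mu> j)" 
   using binomial_absorption[of "\<mu> j" "\<nu> j"] binomial_absorb_comp[of "\<nu> j" "\<mu> j"] by simp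
  then show ?thesis by (simp only: n flip: of_nat_mult) (simp add: mult.commute)
 qed
 have P1: "(\<Prod>i\<in>J. real (\<nu> i choose \<mu> i)) = real (\<nu> j choose \<mu> j) * (\<Prod>i\<in>?R. real (\<nu> i choose \<mu> i))"
  and P2: "(\<Prod>i\<in>J. real (\<nu> i choose incr j \<mu> i)) = real (\<nu> j choose Suc (\<mu> j)) * (\<Prod>i\<in>?R. real (\<nu> i choose \<mu> i))"
  and P3: "(\<Prod>i\<in>J. fact (\<mu> i) :: real) = fact (\<mu> j) * (\<Prod>i\<in>?R. fact (\<mu> i))"
  and P4: "(\<Prod>i\<in>J. fact (incr j \<mu> i) :: real) = fact (Suc (\<mu> j)) * (\<Prod>i\<in>?R. fact (\<mu> i))"
  by (subst prod.remove[OF J(1) jJ]; auto intro!: prod.cong)+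
 define X where "X = (norm (hcoef (T zero_index) \<nu>))^2"
 define Y where "Y = (norm (hcoef (T (incr j \<mu>)) ?m))^2"
 have alg: "c' * P * X = (s * f) * Q * Y"
  if "c * P * X = f * Q * (s^2 / k * Y)" "c' * s = c * k" "s > 0" "k > 0" for c c' P Q X Y f s k :: real
 proof -
  have "(c' * P * X) * s = (c' * s) * P * X" by (simp only: mult_ac)
  also have "\<dots> = k * (c * P * X)" unfolding that(2) by (simp only: mult_ac)
  also have "\<dots> = (s * f) * Q * Y * s" unfolding that(1) using that(4) by (simp add: power2_eq_square mult_ac)
  finally show ?thesis using that(3) by simp
 qed
 have "real (\<nu> j choose Suc (\<mu> j)) * (\<Prod>i\<in>?R. real (\<nu> i choose \<mu> i)) * X
   = (real (Suc (\<mu> j)) * fact (\<mu> j)) * (\<Prod>i\<in>?R. fact (\<mu> i)) * Y"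
  by (rule alg[OF _ bin]) (use IH in \<open>simp_all only: P1 P3 X_def Y_def of_nat_0_less_iff zero_less_Suc\<close>)
 then show ?case unfolding P2 P4 X_def[symmetric] Y_def[symmetric] by (simp only: fact_Suc of_nat_mult)
qed

text \<open>
  Multiply out the weight, exchange the sums and apply Bessel's inequality to each Taylor coefficient; the shift by \<open>\<mu>\<close> is
  injective.  The factorials are absorbed by the powers of \<open>sqrt r\<close> in \<open>\<sigma>\<close>, since the entries of \<open>\<mu>\<close> are at most \<open>r\<close>.
\<close>

lemma weighted_hermite_sum_bounded:
 assumes b: "\<And>j. 0 < b j" "\<And>j. \<sigma> j = sqrt (real r) * inverse (b j)"
 shows "\<exists>C. \<forall>\<Gamma>. finite \<Gamma> \<longrightarrow> \<Gamma> \<subseteq> multi_indices \<longrightarrow>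
  (\<Sum>\<nu>\<in>\<Gamma>. inverse ((kappa r b \<nu>)^2) * (norm (hcoef (T zero_index) \<nu>))^2) <= C"
proof -
 obtain C where C: "\<And>N. N \<in> multi_indices ==> (\<Sum>\<mu>\<in>{..N}. (scale \<mu>)^2 * E (%y. (norm (T \<mu> y))^2)) <= C"
  using sum_T_energy_bounded by blast
 have "(\<Sum>\<nu>\<in>\<Gamma>. inverse ((kappa r b \<nu>)^2) * (norm (hcoef (T zero_index) \<nu>))^2) <= C"
  if \<Gamma>: "finite \<Gamma>" "\<Gamma> \<subseteq> multi_indices" for \<Gamma>
 proof -
  obtain J where J: "finite J" "\<And>\<nu> j. \<nu> \<in> \<Gamma> ==> \<nu> j ~= 0 ==> j \<in> J"
   using finite_multi_indices_bounded[OF \<Gamma>] by metis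
  have J0: "\<nu> j = 0" if "\<nu> \<in> \<Gamma>" "j \<notin> J" for \<nu> j using J(2)[OF that(1), of j] that(2) by blast
  define N where "N j = (if j \<in> J then r else 0)" for j
  have N: "N \<in> multi_indices" unfolding multi_indices_def N_def using J(1) by (auto intro: rev_finite_subset)
  let ?h = "%\<nu>. (norm (hcoef (T zero_index) \<nu>))^2"
  let ?w = "%\<mu>. \<Prod>j\<in>J. (inverse (b j)) ^ (2 * \<mu> j)"
  let ?bin = "%\<nu> \<mu>. \<Prod>j\<in>J. real (\<nu> j choose \<mu> j)"
  have "(\<Sum>\<nu>\<in>\<Gamma>. inverse ((kappa r b \<nu>)^2) * ?h \<nu>) = (\<Sum>\<nu>\<in>\<Gamma>. \<Sum>\<mu>\<in>{..N}. ?w \<mu> * (?bin \<nu> \<mu> * ?h \<nu>))"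
  proof (rule sum.cong[OF refl])
   fix \<nu> assume \<nu>: "\<nu> \<in> \<Gamma>"
   show "inverse ((kappa r b \<nu>)^2) * ?h \<nu> = (\<Sum>\<mu>\<in>{..N}. ?w \<mu> * (?bin \<nu> \<mu> * ?h \<nu>))"
   proof -
    have "inverse ((kappa r b \<nu>)^2) = (\<Sum>\<mu>\<in>{..N}. ?bin \<nu> \<mu> * ?w \<mu>)"
     unfolding N_def prod.distrib[symmetric] by (rule inverse_kappa_square[OF J(1)]) (rule J0[OF \<nu>])
    then show ?thesis by (simp only: sum_distrib_right) (simp only: mult_ac)
   qed
  qed
  also have "\<dots> = (\<Sum>\<mu>\<in>{..N}. ?w \<mu> * (\<Sum>\<nu>\<in>\<Gamma>. ?bin \<nu> \<mu> * ?h \<nu>))"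
   unfolding sum_distrib_left by (rule sum.swap)
  also have "\<dots> <= (\<Sum>\<mu>\<in>{..N}. (scale \<mu>)^2 * E (%y. (norm (T \<mu> y))^2))"
  proof (rule sum_mono)
   fix \<mu> assume "\<mu> \<in> {..N}"
   then have \<mu>N: "\<mu> <= N" by simp
   then have \<mu>: "\<mu> \<in> multi_indices" by (rule lower_multi[OF N])
   have \<mu>r: "\<mu> j <= r" for j using \<mu>N by (auto simp: le_fun_def N_def dest: spec[of _ j] split: if_splits)
   have \<mu>J: "\<mu> j = 0" if "j \<notin> J" for j using \<mu>N that by (auto simp: le_fun_def N_def dest: spec[of _ j])
   let ?f = "\<Prod>j\<in>J. fact (\<mu> j) :: real" and ?G = "{\<nu>\<in>\<Gamma>. \<mu> <= \<nu>}"
   \<comment> \<open>the binomial weight vanishes unless the index dominates \<open>\<mu>\<close>\<close>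
   have "(\<Sum>\<nu>\<in>\<Gamma>. ?bin \<nu> \<mu> * ?h \<nu>) = (\<Sum>\<nu>\<in>?G. ?bin \<nu> \<mu> * ?h \<nu>)"
   proof (rule sum.mono_neutral_right[OF \<Gamma>(1)])
    show "\<forall>\<nu>\<in>\<Gamma> - ?G. ?bin \<nu> \<mu> * ?h \<nu> = 0"
    proof
     fix \<nu> assume \<nu>: "\<nu> \<in> \<Gamma> - ?G"
     then obtain j where j: "\<nu> j < \<mu> j" by (auto simp: le_fun_def not_le)
     then have "j \<in> J" using \<mu>J[of j] by (cases "j \<in> J") auto
     then have "?bin \<nu> \<mu> = 0" using j J(1) by (intro prod_zero) (auto intro!: bexI[of _ j])
     then show "?bin \<nu> \<mu> * ?h \<nu> = 0" by simp
    qed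
   qed auto
   also have "\<dots> = (\<Sum>\<nu>\<in>?G. ?f * (norm (hcoef (T \<mu>) (sub_index \<nu> \<mu>)))^2)"
    using \<Gamma>(2) by (intro sum.cong refl hcoef_T_binomial J(1) J0 \<mu>) auto
   also have "\<dots> = ?f * (\<Sum>\<nu>\<in>(%\<nu>. sub_index \<nu> \<mu>) ` ?G. (norm (hcoef (T \<mu>) \<nu>))^2)"
   proof -
    have "inj_on (%\<nu>. sub_index \<nu> \<mu>) ?G"
    proof (rule inj_onI)
     fix \<nu> \<nu>' assume a: "\<nu> \<in> ?G" "\<nu>' \<in> ?G" and eq: "sub_index \<nu> \<mu> = sub_index \<nu>' \<mu>"
     have "\<nu> i = \<nu>' i" for i
     proof -
      have "\<nu> i - \<mu> i = \<nu>' i - \<mu> i" using eq by (rule fun_cong)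
      moreover have "\<mu> i <= \<nu> i" "\<mu> i <= \<nu>' i" using a by (auto simp: le_fun_def)
      ultimately show ?thesis by linarith
     qed
     then show "\<nu> = \<nu>'" by (rule ext)
    qed
    then show ?thesis by (simp add: sum.reindex sum_distrib_left)
   qed
   also have "\<dots> <= ?f * E (%y. (norm (T \<mu> y))^2)"
    using \<Gamma> sub_multi by (intro mult_left_mono bessel L2_T \<mu> prod_nonneg) auto
   finally have 1: "(\<Sum>\<nu>\<in>\<Gamma>. ?bin \<nu> \<mu> * ?h \<nu>) <= ?f * E (%y. (norm (T \<mu> y))^2)" .
   have w: "0 <= ?w \<mu>" using b(1) by (intro prod_nonneg) (simp add: less_imp_le)
   have "?w \<mu> * ?f <= (scale \<mu>)^2"
   proof -
    have "?w \<mu> * ?f = (\<Prod>j\<in>J. (inverse (b j)) ^ (2 * \<mu> j) * fact (\<mu> j))" by (rule prod.distrib[symmetric])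
    also have "\<dots> <= (\<Prod>j\<in>J. (\<sigma> j ^ \<mu> j)^2)"
    proof (rule prod_mono, rule conjI)
     fix j
     show "0 <= (inverse (b j)) ^ (2 * \<mu> j) * fact (\<mu> j)" using b(1)[of j] by simp
     have "(fact (\<mu> j) :: real) <= real (\<mu> j) ^ \<mu> j" using fact_le_power[of "\<mu> j"] by simp
     also have "\<dots> <= real r ^ \<mu> j" using \<mu>r[of j] by (intro power_mono) auto
     finally have "(inverse (b j)) ^ (2 * \<mu> j) * fact (\<mu> j) <= (inverse (b j)) ^ (2 * \<mu> j) * real r ^ \<mu> j"
      using b(1)[of j] by (intro mult_left_mono) simp_all
     also have "\<dots> = ((\<sigma> j)^2) ^ \<mu> j"
      unfolding b(2)[of j] power_mult power_mult_distrib by (simp add: mult.commute)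
     finally show "(inverse (b j)) ^ (2 * \<mu> j) * fact (\<mu> j) <= (\<sigma> j ^ \<mu> j)^2"
      by (simp only: power_mult[symmetric] mult.commute)
    qed
    also have "\<dots> = (\<Prod>j\<in>J. \<sigma> j ^ \<mu> j)^2" by (rule prod_power_distrib[symmetric])
    also have "(\<Prod>j\<in>J. \<sigma> j ^ \<mu> j) = scale \<mu>" by (rule scale_eq[OF J(1), symmetric]) (rule \<mu>J)
    finally show ?thesis .
   qed
   then have "?w \<mu> * (?f * E (%y. (norm (T \<mu> y))^2)) <= (scale \<mu>)^2 * E (%y. (norm (T \<mu> y))^2)"
    unfolding mult.assoc[symmetric] by (rule mult_right_mono) (simp add: integral_nonneg_AE)
   then show "?w \<mu> * (\<Sum>\<nu>\<in>\<Gamma>. ?bin \<nu> \<mu> * ?h \<nu>) <= (scale \<mu>)^2 * E (%y. (norm (T \<mu> y))^2)"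
    using mult_left_mono[OF 1 w] by linarith
  qed
  also have "\<dots> <= C" by (rule C[OF N])
  finally show ?thesis .
 qed
 then show ?thesis by blast
qed

text \<open>
  Outside \<open>\<Lambda>\<close> the weights are at most of order \<open>n powr (- 1 / q)\<close>, which is traded against the weighted square sum.
\<close>

theorem truncation_rate:
 fixes q :: real
 assumes b: "\<And>j. 0 < b j" "\<And>j. \<sigma> j = sqrt (real r) * inverse (b j)"
  and C1: "\<And>F. finite F ==> F \<subseteq> multi_indices ==> (\<Sum>\<nu>\<in>F. kappa r b \<nu> powr q) <= C1" and q: "0 < q"
 shows "\<exists>C\<ge>0. \<forall>n\<ge>1. \<forall>\<Lambda>. n_largest (kappa r b) n \<Lambda> \<longrightarrow>
  E (%y. (norm (T zero_index y - (hermite_sum \<Lambda> (hcoef (T zero_index)) y)))^2)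
   <= (C * real n powr (- (1 / q)))^2"
proof -
 obtain C0 where C0: "\<And>\<Gamma>. finite \<Gamma> ==> \<Gamma> \<subseteq> multi_indices ==>
  (\<Sum>\<nu>\<in>\<Gamma>. inverse ((kappa r b \<nu>)^2) * (norm (hcoef (T zero_index) \<nu>))^2) <= C0"
  using weighted_hermite_sum_bounded[OF b] by blast
 have C0n: "0 <= C0" using C0[of "{}"] by simp
 show ?thesis
 proof (intro exI[of _ "sqrt C0 * C1 powr (1 / q)"] conjI allI impI)
  show "0 <= sqrt C0 * C1 powr (1 / q)" using C0n by simp
  fix n :: nat and \<Lambda> assume n: "1 <= n" and \<Lambda>: "n_largest (kappa r b) n \<Lambda>"
  let ?k = "C1 powr (1 / q) * real n powr (- (1 / q))"
  have \<Lambda>': "finite \<Lambda>" "\<Lambda> \<subseteq> multi_indices" using \<Lambda> by (auto simp: n_largest_def)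
  show "E (%y. (norm (T zero_index y - (hermite_sum \<Lambda> (hcoef (T zero_index)) y)))^2)
   <= (sqrt C0 * C1 powr (1 / q) * real n powr (- (1 / q)))^2"
  proof (rule truncation_error_le[OF L2_T[OF zero_index_multi] \<Lambda>'])
   fix \<Gamma> assume \<Gamma>: "finite \<Gamma>" "\<Gamma> \<subseteq> multi_indices - \<Lambda>"
   have "(\<Sum>\<nu>\<in>\<Gamma>. (norm (hcoef (T zero_index) \<nu>))^2)
     <= (\<Sum>\<nu>\<in>\<Gamma>. ?k^2 * (inverse ((kappa r b \<nu>)^2) * (norm (hcoef (T zero_index) \<nu>))^2))"
   proof (rule sum_mono)
    fix \<nu> assume "\<nu> \<in> \<Gamma>"
    then have \<nu>: "\<nu> \<in> multi_indices - \<Lambda>" using \<Gamma> by blast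
    have pos: "0 < kappa r b \<nu>" using \<nu> by (intro kappa_pos) simp
    have le: "kappa r b \<nu> <= ?k" 
    proof (rule n_largest_tail_bound[where \<kappa> = "kappa r b" and \<mu> = \<nu> and \<Lambda> = \<Lambda>])
     show "(\<Sum>\<nu>\<in>F. kappa r b \<nu> powr q) <= C1" if "finite F" "F \<subseteq> multi_indices" for F
      using that by (rule C1)
    qed (rule q n \<Lambda> \<nu> less_imp_le[OF pos])+
    have "(kappa r b \<nu>)^2 <= ?k^2" by (rule power_mono[OF le less_imp_le[OF pos]])
    then have "(kappa r b \<nu>)^2 * inverse ((kappa r b \<nu>)^2) <= ?k^2 * inverse ((kappa r b \<nu>)^2)"
     by (rule mult_right_mono) (simp only: inverse_nonnegative_iff_nonnegative zero_le_power2)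
    moreover have "(kappa r b \<nu>)^2 * inverse ((kappa r b \<nu>)^2) = 1" by (rule right_inverse) (use pos in simp)
    ultimately have "1 <= ?k^2 * inverse ((kappa r b \<nu>)^2)" by (simp only:)
    then have "1 * (norm (hcoef (T zero_index) \<nu>))^2 <= ?k^2 * inverse ((kappa r b \<nu>)^2) * (norm (hcoef (T zero_index) \<nu>))^2"
     by (rule mult_right_mono) simp
    then show "(norm (hcoef (T zero_index) \<nu>))^2 <= ?k^2 * (inverse ((kappa r b \<nu>)^2) * (norm (hcoef (T zero_index) \<nu>))^2)"
     by (simp only: mult_1 mult.assoc)
   qed
   also have "\<dots> <= ?k^2 * C0"
    unfolding sum_distrib_left[symmetric] using \<Gamma> by (intro mult_left_mono C0) auto
   also have "\<dots> = (sqrt C0 * C1 powr (1 / q) * real n powr (- (1 / q)))^2"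
    using C0n by (simp add: power_mult_distrib)
   finally show "(\<Sum>\<nu>\<in>\<Gamma>. (norm (hcoef (T zero_index) \<nu>))^2) <= (sqrt C0 * C1 powr (1 / q) * real n powr (- (1 / q)))^2" .
  qed
 qed
qed

end

section \<open>The solution of the lognormal problem\<close>

context bounded_open
begin

lemma H10_diff: "v \<in> H10 D ==> w \<in> H10 D ==> (%x. v x - w x) \<in> H10 D"
 and G_diff: "v \<in> H10 D ==> w \<in> H10 D ==> G (%x. v x - w x) = G v - G w"
proof -
 assume vw: "v \<in> H10 D" "w \<in> H10 D"
 have eq: "(%x. v x - w x) = (%x. v x + (- 1) * w x)" by simp
 show "(%x. v x - w x) \<in> H10 D" unfolding eq by (intro H10_add H10_scale vw)
 show "G (%x. v x - w x) = G v - G w"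
  unfolding eq using G_add[OF H10_H1[OF vw(1)] H1_scale[OF H10_H1[OF vw(2)]], of "- 1"]
   G_scale[OF H10_H1[OF vw(2)], of "- 1"] by simp
qed

lemma V_norm_diff: "v \<in> H10 D ==> w \<in> H10 D ==> V_norm D (%x. v x - w x) = norm (G v - G w)"
 using V_norm_eq[OF H10_H1[OF H10_diff]] G_diff by simp

lemma H10_zero: "(%x. 0) \<in> H10 D" and G_zero: "G (%x. 0) = 0"
proof -
 obtain v where v: "v \<in> H10 D" "G v = 0"
  using subspace_0[OF V.V_subspace] unfolding energy_space_eq by auto
 show "(%x. 0) \<in> H10 D" using H10_scale[OF v(1), of 0] by simp
 show "G (%x. 0) = 0" using G_scale[OF H10_H1[OF v(1)], of 0] by simp
qed

lemma
 assumes "finite A" "\<And>i. i \<in> A ==> v i \<in> H10 D"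
 shows H10_sum: "(%x. \<Sum>i\<in>A. c i * v i x) \<in> H10 D"
  and G_sum: "G (%x. \<Sum>i\<in>A. c i * v i x) = (\<Sum>i\<in>A. c i *\<^sub>R G (v i))"
proof -
 have "(%x. \<Sum>i\<in>A. c i * v i x) \<in> H10 D \<and> G (%x. \<Sum>i\<in>A. c i * v i x) = (\<Sum>i\<in>A. c i *\<^sub>R G (v i))"
  using assms
 proof (induction rule: finite_induct)
  case empty
  show ?case by (simp add: H10_zero G_zero)
 next
  case (insert j A)
  have j: "v j \<in> H10 D" and A: "(%x. \<Sum>i\<in>A. c i * v i x) \<in> H10 D"
   "G (%x. \<Sum>i\<in>A. c i * v i x) = (\<Sum>i\<in>A. c i *\<^sub>R G (v i))"
   using insert by auto
  show ?case
   unfolding sum.insert[OF insert.hyps]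
   using H10_add[OF H10_scale[OF j, of "c j"] A(1)] G_add[OF H1_scale[OF H10_H1[OF j], of "c j"] H10_H1[OF A(1)]]
    G_scale[OF H10_H1[OF j], of "c j"] A(2) by simp
 qed
 then show "(%x. \<Sum>i\<in>A. c i * v i x) \<in> H10 D" "G (%x. \<Sum>i\<in>A. c i * v i x) = (\<Sum>i\<in>A. c i *\<^sub>R G (v i))" by auto
qed

lemma G_in: "v \<in> H10 D ==> G v \<in> energy_space"
 by (simp add: energy_space_eq)

text \<open>
  A function with a prescribed gradient class, needed to present approximations in the form that the definition of integrals of
  functions in \<open>H10 D\<close> requires.
\<close>

definition rep :: "('a, 'a) l2 => 'a => real" where "rep g = (SOME v. v \<in> H10 D \<and> G v = g)"

lemma assumes "g \<in> energy_space" shows rep_H10: "rep g \<in> H10 D" and G_rep: "G (rep g) = g"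
proof -
 have "\<exists>v. v \<in> H10 D \<and> G v = g" using assms unfolding energy_space_eq by auto
 from someI_ex[OF this] show "rep g \<in> H10 D" "G (rep g) = g" by (auto simp: rep_def)
qed

lemma V_simple_rep: "V.simple_vector s ==> V_simple D gauss_seq (%y. rep (s y))"
 unfolding V_simple_def using V.simple_vectorD(2) rep_H10
 by (auto intro: simple_function_compose1[OF V.simple_vectorD(1)])

lemma V_simpleD: assumes "V_simple D gauss_seq s"
 shows "s y \<in> H10 D" "V.simple_vector (%y. G (s y))" "finite (range s)" "{y. s y = v} \<in> sets gauss_seq"
proof -
 have s: "simple_function gauss_seq s" "\<And>y. s y \<in> H10 D" using assms by (auto simp: V_simple_def)
 show "s y \<in> H10 D" by (rule s)
 show "V.simple_vector (%y. G (s y))"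
  unfolding V.simple_vector_def using simple_function_compose1[OF s(1), of G] G_in[OF s(2)] by auto
 show "finite (range s)" using simple_functionD(1)[OF s(1)] by simp
 have "s -` {v} \<inter> space gauss_seq \<in> sets gauss_seq" by (rule simple_functionD(2)[OF s(1)])
 then show "{y. s y = v} \<in> sets gauss_seq" by (simp add: vimage_def)
qed

lemma V_measurableI:
 assumes F: "V.random_vector F" and w: "AE y in gauss_seq. w y \<in> H10 D \<and> G (w y) = F y"
 shows "V_measurable D gauss_seq w"
proof -
 obtain s where s: "\<And>i. V.simple_vector (s i)" "\<And>y. (%i. s i y) \<longlonglongrightarrow> F y" by (rule V.random_vectorE[OF F]) blast
 have "AE y in gauss_seq. w y \<in> H10 D \<and> (%i. V_norm D (%x. w y x - rep (s i y) x)) \<longlonglongrightarrow> 0"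
  using w
 proof eventually_elim
  case (elim y)
  have "V_norm D (%x. w y x - rep (s i y) x) = norm (F y - s i y)" for i
   using V_norm_diff[of "w y" "rep (s i y)"] elim rep_H10 G_rep V.simple_vectorD(2)[OF s(1)] by simp
  moreover have "(%i. norm (F y - s i y)) \<longlonglongrightarrow> norm (F y - F y)" by (intro tendsto_intros s)
  ultimately show ?case using elim by simp
 qed
 then show ?thesis
  unfolding V_measurable_def using V_simple_rep[OF s(1)] by (intro exI[of _ "%i y. rep (s i y)"]) auto
qed

lemma
 assumes s: "V_simple D gauss_seq s"
 shows V_simple_integral_H10: "V_simple_integral gauss_seq s \<in> H10 D"
  and G_V_simple_integral_inner: "G (V_simple_integral gauss_seq s) \<bullet> d = E (%y. G (s y) \<bullet> d)"
proof -
 note sD = V_simpleD[OF s]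
 have vH: "v \<in> H10 D" if "v \<in> range s" for v using that sD(1) by auto
 have eq: "V_simple_integral gauss_seq s = (%x. \<Sum>v\<in>range s. measure gauss_seq {y. s y = v} * v x)"
  by (simp add: V_simple_integral_def)
 show "V_simple_integral gauss_seq s \<in> H10 D"
  unfolding eq by (rule H10_sum[OF sD(3), of "%v. v"]) (rule vH)
 have "G (V_simple_integral gauss_seq s) = (\<Sum>v\<in>range s. measure gauss_seq {y. s y = v} *\<^sub>R G v)"
  unfolding eq by (rule G_sum[OF sD(3), of "%v. v"]) (rule vH)
 then have 1: "G (V_simple_integral gauss_seq s) \<bullet> d = (\<Sum>v\<in>range s. measure gauss_seq {y. s y = v} * (G v \<bullet> d))"
  by (simp add: inner_sum_left)
 have "G (s y) \<bullet> d = (\<Sum>v\<in>range s. indicator {y. s y = v} y * (G v \<bullet> d))" for y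
 proof -
  have "(\<Sum>v\<in>range s. indicator {y. s y = v} y * (G v \<bullet> d)) = (\<Sum>v\<in>range s. if v = s y then G v \<bullet> d else 0)"
   by (intro sum.cong) auto
  then show ?thesis using sD(3) by simp
 qed
 then have "E (%y. G (s y) \<bullet> d) = E (%y. (\<Sum>v\<in>range s. indicator {y. s y = v} y * (G v \<bullet> d)))" by simp
 also have "\<dots> = (\<Sum>v\<in>range s. \<integral>y. indicator {y. s y = v} y * (G v \<bullet> d) \<partial>gauss_seq)"
  using sD(4) by (intro Bochner_Integration.integral_sum integrable_mult_left integrable_real_indicator) (auto simp: less_top[symmetric])
 also have "\<dots> = (\<Sum>v\<in>range s. measure gauss_seq {y. s y = v} * (G v \<bullet> d))"
  using sD(4) by simp
 finally show "G (V_simple_integral gauss_seq s) \<bullet> d = E (%y. G (s y) \<bullet> d)" using 1 by simp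
qed

text \<open>
  Duality: test the difference with itself.
\<close>

lemma V_simple_integral_error:
 assumes F: "V.L2_vector F" and \<nu>: "\<nu> \<in> multi_indices" and s: "V_simple D gauss_seq s"
 shows "ennreal (norm (G (V_simple_integral gauss_seq s) - V.hcoef F \<nu>))
  <= (\<integral>\<^sup>+y. ennreal (norm (H \<nu> y *\<^sub>R F y - G (s y))) \<partial>gauss_seq)"
proof -
 let ?W = "%y. H \<nu> y *\<^sub>R F y"
 define d where "d = G (V_simple_integral gauss_seq s) - V.hcoef F \<nu>"
 have d: "d \<in> energy_space"
  unfolding d_def by (intro subspace_diff[OF V.V_subspace] G_in V_simple_integral_H10[OF s] V.hcoef_in[OF F \<nu>])
 have i1: "integrable gauss_seq (%y. (F y \<bullet> d) * H \<nu> y)" by (rule V.integrable_inner_hermite[OF F \<nu>])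
 have zero: "zero_index \<in> multi_indices" by (simp add: multi_indices_def)
 have "H zero_index y = 1" for y using hermite_multi_eq[of "{}" zero_index y] by simp
 then have i2: "integrable gauss_seq (%y. G (s y) \<bullet> d)"
  using V.integrable_inner_hermite[OF V.simple_vector_L2[OF V_simpleD(2)[OF s]] zero, of d] by simp
 have nm: "(%y. norm (?W y - G (s y))) \<in> borel_measurable gauss_seq"
  by (intro V.random_vector_norm V.random_vector_diff V.random_vector_scale V.L2_vectorD(1)[OF F]
    measurable_hermite_multi[OF \<nu>] V.random_vector_simple V_simpleD(2)[OF s])
 have "d \<bullet> d = G (V_simple_integral gauss_seq s) \<bullet> d - V.hcoef F \<nu> \<bullet> d"
  by (subst (1) d_def) (rule inner_diff_left)
 also have "\<dots> = E (%y. G (s y) \<bullet> d) - E (%y. (F y \<bullet> d) * H \<nu> y)"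
  by (simp only: G_V_simple_integral_inner[OF s] V.hcoef_inner[OF F \<nu> d])
 also have "\<dots> = E (%y. G (s y) \<bullet> d - (F y \<bullet> d) * H \<nu> y)"
  by (rule Bochner_Integration.integral_diff[symmetric, OF i2 i1])
 finally have dd: "(norm d)^2 = E (%y. G (s y) \<bullet> d - (F y \<bullet> d) * H \<nu> y)"
  by (simp only: power2_norm_eq_inner)
 have "ennreal ((norm d)^2) <= ennreal (norm (E (%y. G (s y) \<bullet> d - (F y \<bullet> d) * H \<nu> y)))"
  unfolding dd by (intro ennreal_leI) simp
 also have "\<dots> <= (\<integral>\<^sup>+y. ennreal (norm (G (s y) \<bullet> d - (F y \<bullet> d) * H \<nu> y)) \<partial>gauss_seq)"
  by (rule integral_norm_bound_ennreal[OF Bochner_Integration.integrable_diff[OF i2 i1]])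
 also have "\<dots> <= (\<integral>\<^sup>+y. ennreal (norm d) * ennreal (norm (?W y - G (s y))) \<partial>gauss_seq)"
 proof (rule nn_integral_mono)
  fix y
  have "G (s y) \<bullet> d - (F y \<bullet> d) * H \<nu> y = - ((?W y - G (s y)) \<bullet> d)"
   by (simp add: inner_diff_left mult.commute)
  then have "norm (G (s y) \<bullet> d - (F y \<bullet> d) * H \<nu> y) <= norm d * norm (?W y - G (s y))"
   using Cauchy_Schwarz_ineq2[of "?W y - G (s y)" d] by (simp add: mult.commute)
  then show "ennreal (norm (G (s y) \<bullet> d - (F y \<bullet> d) * H \<nu> y)) <= ennreal (norm d) * ennreal (norm (?W y - G (s y)))"
   by (simp add: ennreal_leI flip: ennreal_mult)
 qed
 also have "\<dots> = ennreal (norm d) * (\<integral>\<^sup>+y. ennreal (norm (?W y - G (s y))) \<partial>gauss_seq)"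
  by (rule nn_integral_cmult) (use nm in measurable)
 finally have "ennreal (norm d) * ennreal (norm d) <= ennreal (norm d) * (\<integral>\<^sup>+y. ennreal (norm (?W y - G (s y))) \<partial>gauss_seq)"
  by (simp add: power2_eq_square ennreal_mult)
 then have "ennreal (norm d) <= (\<integral>\<^sup>+y. ennreal (norm (?W y - G (s y))) \<partial>gauss_seq)"
  by (cases "d = 0") (simp_all add: ennreal_mult_le_mult_iff)
 then show ?thesis by (simp add: d_def)
qed

text \<open>
  The preceding estimate shows both that dominated simple approximations converge to the weakly defined coefficient,
  so an integral exists, and that every integral has this gradient, so the choice in the definition is harmless.
\<close>

lemma hermite_coeff_eq:
 assumes F: "V.L2_vector F" and u: "AE y in gauss_seq. u y \<in> H10 D \<and> G (u y) = F y" and \<nu>: "\<nu> \<in> multi_indices"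
 shows "hermite_coeff D u \<nu> \<in> H10 D \<and> G (hermite_coeff D u \<nu>) = V.hcoef F \<nu>"
proof -
 let ?h = "V.hcoef F \<nu>" and ?W = "%y. H \<nu> y *\<^sub>R F y"
 let ?w = "%y x. u y x * H \<nu> y"
 have W: "V.random_vector ?W" by (intro V.random_vector_scale V.L2_vectorD(1)[OF F] measurable_hermite_multi[OF \<nu>])
 have w: "AE y in gauss_seq. ?w y \<in> H10 D \<and> G (?w y) = ?W y"
  using u
 proof eventually_elim
  case (elim y)
  have "(%x. H \<nu> y * u y x) \<in> H10 D" "G (%x. H \<nu> y * u y x) = H \<nu> y *\<^sub>R G (u y)"
   using H10_scale[of "u y"] G_scale[OF H10_H1, of "u y"] elim by auto
  then show ?case using elim by (simp add: mult.commute)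
 qed
 have nn: "(\<integral>\<^sup>+y. ennreal (V_norm D (%x. ?w y x - s y x)) \<partial>gauss_seq) = (\<integral>\<^sup>+y. ennreal (norm (?W y - G (s y))) \<partial>gauss_seq)"
  if s: "V_simple D gauss_seq s" for s
 proof (rule nn_integral_cong_AE)
  show "AE y in gauss_seq. ennreal (V_norm D (%x. ?w y x - s y x)) = ennreal (norm (?W y - G (s y)))"
   using w
  proof eventually_elim
   case (elim y)
   have "V_norm D (%x. ?w y x - s y x) = norm (G (?w y) - G (s y))"
    by (rule V_norm_diff[OF conjunct1[OF elim] V_simpleD(1)[OF s]])
   then show ?case using elim by simp
  qed
 qed
 have rh: "rep ?h \<in> H10 D" "G (rep ?h) = ?h" using rep_H10 G_rep V.hcoef_in[OF F \<nu>] by auto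
 have vn: "ennreal (V_norm D (%x. V_simple_integral gauss_seq s x - h x)) = ennreal (norm (G (V_simple_integral gauss_seq s) - G h))"
  if "V_simple D gauss_seq s" "h \<in> H10 D" for s h
  using V_norm_diff[OF V_simple_integral_H10[OF that(1)] that(2)] by simp
 have "has_V_integral D gauss_seq ?w (rep ?h)"
 proof -
  obtain s where s: "\<And>i. V.simple_vector (s i)" "\<And>y. (%i. s i y) \<longlonglongrightarrow> ?W y" "\<And>i y. norm (s i y) <= 2 * norm (?W y)"
   by (rule V.random_vector_dominated[OF W]) blast
  let ?S = "%i y. rep (s i y)"
  have S: "V_simple D gauss_seq (?S i)" for i by (rule V_simple_rep[OF s(1)])
  have GS: "G (?S i y) = s i y" for i y by (rule G_rep[OF V.simple_vectorD(2)[OF s(1)]])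
  have nW: "integrable gauss_seq (%y. norm (?W y))"
   using V.integrable_norm_hermite[OF F \<nu>] by (simp add: mult.commute)
  have m: "(%y. norm (?W y - s i y)) \<in> borel_measurable gauss_seq" for i
   by (intro V.random_vector_norm V.random_vector_diff W V.random_vector_simple s)
  have dom: "norm (norm (?W y - s i y)) <= 3 * norm (?W y)" for i y
   using norm_triangle_ineq4[of "?W y" "s i y"] s(3)[of i y] unfolding real_norm_def abs_norm_cancel by linarith
  have i3: "integrable gauss_seq (%y. 3 * norm (?W y))" by (rule integrable_mult_right[OF nW])
  have "(%i. norm (?W y - s i y)) \<longlonglongrightarrow> norm (?W y - ?W y)" for y by (intro tendsto_norm tendsto_diff tendsto_const s)
  then have lim: "AE y in gauss_seq. (%i. norm (?W y - s i y)) \<longlonglongrightarrow> 0" by simp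
  have "(%i. \<integral>y. norm (?W y - s i y) \<partial>gauss_seq) \<longlonglongrightarrow> E (%y. 0)"
   by (rule integral_dominated_convergence[OF _ m i3 lim]) (use dom in auto)
  then have "(%i. ennreal (E (%y. norm (?W y - s i y)))) \<longlonglongrightarrow> ennreal 0" by (intro tendsto_ennrealI) simp
  moreover have "(\<integral>\<^sup>+y. ennreal (norm (?W y - s i y)) \<partial>gauss_seq) = ennreal (E (%y. norm (?W y - s i y)))" for i
  proof (rule nn_integral_eq_integral)
   show "integrable gauss_seq (%y. norm (?W y - s i y))"
   proof (rule Bochner_Integration.integrable_bound[OF i3 m], rule AE_I2)
    show "norm (norm (?W y - s i y)) <= norm (3 * norm (?W y))" for y using dom[of y i] by simp
   qed
  qed simp
  ultimately have l0: "(%i. \<integral>\<^sup>+y. ennreal (norm (?W y - s i y)) \<partial>gauss_seq) \<longlonglongrightarrow> 0" by simp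
  have "(%i. ennreal (norm (G (V_simple_integral gauss_seq (?S i)) - ?h))) \<longlonglongrightarrow> 0"
  proof (rule tendsto_sandwich[OF _ _ tendsto_const l0])
   show "\<forall>\<^sub>F i in sequentially. ennreal (norm (G (V_simple_integral gauss_seq (?S i)) - ?h)) <= (\<integral>\<^sup>+y. ennreal (norm (?W y - s i y)) \<partial>gauss_seq)"
    using V_simple_integral_error[OF F \<nu> S] by (simp add: GS)
  qed simp
  then have "(%i. norm (G (V_simple_integral gauss_seq (?S i)) - ?h)) \<longlonglongrightarrow> 0"
   unfolding ennreal_0[symmetric] by (subst (asm) tendsto_ennreal_iff) auto
  then have "(%i. V_norm D (%x. V_simple_integral gauss_seq (?S i) x - rep ?h x)) \<longlonglongrightarrow> 0"
   using V_norm_diff[OF V_simple_integral_H10[OF S] rh(1)] by (simp add: rh(2))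
  moreover have "(%i. \<integral>\<^sup>+y. ennreal (V_norm D (%x. ?w y x - ?S i y x)) \<partial>gauss_seq) \<longlonglongrightarrow> 0"
   unfolding nn[OF S] GS by (rule l0)
  ultimately show ?thesis
   unfolding has_V_integral_def using V_measurableI[OF W w] rh(1) S by (intro conjI exI[of _ ?S]) auto
 qed
 then have hV: "has_V_integral D gauss_seq ?w (hermite_coeff D u \<nu>)"
  unfolding hermite_coeff_def V_integral_def by (rule someI[of "has_V_integral D gauss_seq ?w"])
 let ?c = "hermite_coeff D u \<nu>"
 obtain s where c: "?c \<in> H10 D" and s: "\<And>i. V_simple D gauss_seq (s i)"
  and l1: "(%i. \<integral>\<^sup>+y. ennreal (V_norm D (%x. ?w y x - s i y x)) \<partial>gauss_seq) \<longlonglongrightarrow> 0"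
  and l2: "(%i. V_norm D (%x. V_simple_integral gauss_seq (s i) x - ?c x)) \<longlonglongrightarrow> 0"
  using hV unfolding has_V_integral_def by blast
 have "(%i. ennreal (V_norm D (%x. V_simple_integral gauss_seq (s i) x - ?c x))) \<longlonglongrightarrow> ennreal 0"
  by (rule tendsto_ennrealI[OF l2])
 then have "(%i. ennreal (V_norm D (%x. V_simple_integral gauss_seq (s i) x - ?c x))
   + (\<integral>\<^sup>+y. ennreal (V_norm D (%x. ?w y x - s i y x)) \<partial>gauss_seq)) \<longlonglongrightarrow> ennreal 0 + 0"
  by (rule tendsto_add[OF _ l1])
 moreover have "ennreal (norm (G ?c - ?h)) <= ennreal (V_norm D (%x. V_simple_integral gauss_seq (s i) x - ?c x))
   + (\<integral>\<^sup>+y. ennreal (V_norm D (%x. ?w y x - s i y x)) \<partial>gauss_seq)" for i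
 proof -
  let ?I = "G (V_simple_integral gauss_seq (s i))"
  have "norm (G ?c - ?h) <= norm (?I - G ?c) + norm (?I - ?h)"
   using norm_triangle_ineq4[of "?I - ?h" "?I - G ?c"] by (simp add: algebra_simps)
  then have "ennreal (norm (G ?c - ?h)) <= ennreal (norm (?I - G ?c)) + ennreal (norm (?I - ?h))"
   by (simp add: ennreal_leI flip: ennreal_plus)
  also have "\<dots> <= ennreal (norm (?I - G ?c)) + (\<integral>\<^sup>+y. ennreal (norm (?W y - G (s i y))) \<partial>gauss_seq)"
   by (intro add_left_mono V_simple_integral_error[OF F \<nu> s])
  finally show ?thesis unfolding vn[OF s c] nn[OF s] .
 qed
 ultimately have "ennreal (norm (G ?c - ?h)) <= ennreal 0 + 0" by (intro LIMSEQ_le_const) auto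
 then have "G ?c = ?h" by simp
 then show ?thesis using c by simp
qed

lemma truncation_L2_V:
 assumes F: "V.L2_vector F" and u: "AE y in gauss_seq. u y \<in> H10 D \<and> G (u y) = F y"
  and \<Lambda>: "finite \<Lambda>" "\<Lambda> \<subseteq> multi_indices"
 shows "(%y x. u y x - hermite_trunc D u \<Lambda> y x) \<in> L2_V D gauss_seq"
  and "L2_V_norm D gauss_seq (%y x. u y x - hermite_trunc D u \<Lambda> y x)
   = sqrt (E (%y. (norm (F y - (hermite_sum \<Lambda> (V.hcoef F) y)))^2))"
proof -
 let ?w = "%y x. u y x - hermite_trunc D u \<Lambda> y x"
 let ?E = "%y. F y - (hermite_sum \<Lambda> (V.hcoef F) y)"
 have h: "hermite_coeff D u \<nu> \<in> H10 D" "G (hermite_coeff D u \<nu>) = V.hcoef F \<nu>" if "\<nu> \<in> \<Lambda>" for \<nu>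
  using hermite_coeff_eq[OF F u, of \<nu>] that \<Lambda>(2) by auto
 have hV: "V.hcoef F \<nu> \<in> energy_space" if "\<nu> \<in> \<Lambda>" for \<nu>
  using V.hcoef_in[OF F] that \<Lambda>(2) by auto
 have t: "hermite_trunc D u \<Lambda> y \<in> H10 D" "G (hermite_trunc D u \<Lambda> y) = (hermite_sum \<Lambda> (V.hcoef F) y)" for y
 proof -
  have eq: "hermite_trunc D u \<Lambda> y = (%x. \<Sum>\<nu>\<in>\<Lambda>. H \<nu> y * hermite_coeff D u \<nu> x)"
   by (simp add: fun_eq_iff hermite_trunc_def mult.commute)
  show "hermite_trunc D u \<Lambda> y \<in> H10 D" unfolding eq by (rule H10_sum[OF \<Lambda>(1)]) (rule h)
  have "G (hermite_trunc D u \<Lambda> y) = (\<Sum>\<nu>\<in>\<Lambda>. H \<nu> y *\<^sub>R G (hermite_coeff D u \<nu>))"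
   unfolding eq by (rule G_sum[OF \<Lambda>(1)]) (rule h)
  also have "\<dots> = (hermite_sum \<Lambda> (V.hcoef F) y)" by (intro sum.cong refl) (simp add: h)
  finally show "G (hermite_trunc D u \<Lambda> y) = (hermite_sum \<Lambda> (V.hcoef F) y)" .
 qed
 have w: "AE y in gauss_seq. ?w y \<in> H10 D \<and> G (?w y) = ?E y"
  using u by eventually_elim (simp add: H10_diff G_diff t)
 have "V.random_vector ?E"
  by (intro V.random_vector_diff V.L2_vectorD(1)[OF F] V.random_vector_expansion \<Lambda> hV)
 then have meas: "V_measurable D gauss_seq ?w" by (rule V_measurableI[OF _ w])
 have "(\<integral>\<^sup>+y. ennreal ((V_norm D (?w y))^2) \<partial>gauss_seq) = (\<integral>\<^sup>+y. ennreal ((norm (?E y))^2) \<partial>gauss_seq)"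
 proof (rule nn_integral_cong_AE)
  show "AE y in gauss_seq. ennreal ((V_norm D (?w y))^2) = ennreal ((norm (?E y))^2)"
   using w
  proof eventually_elim
   case (elim y)
   then show ?case using V_norm_eq[OF H10_H1[OF conjunct1[OF elim]]] by simp
  qed
 qed
 also have "\<dots> = ennreal (E (%y. (norm (?E y))^2))"
  by (rule nn_integral_eq_integral[OF V.integrable_expansion_error[OF F \<Lambda> hV]]) simp_all
 finally have nn: "(\<integral>\<^sup>+y. ennreal ((V_norm D (?w y))^2) \<partial>gauss_seq) = ennreal (E (%y. (norm (?E y))^2))" .
 show "?w \<in> L2_V D gauss_seq" using meas nn by (simp add: L2_V_def)
 have "0 <= E (%y. (norm (?E y))^2)" by (intro integral_nonneg_AE) simp
 then show "L2_V_norm D gauss_seq ?w = sqrt (E (%y. (norm (?E y))^2))"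
  unfolding L2_V_norm_def nn by simp
qed

end

text \<open>
  A summable family has only finitely many terms above a positive level.
\<close>

lemma kappa_superlevel_finite:
 assumes C: "\<And>F. finite F ==> F \<subseteq> multi_indices ==> (\<Sum>\<nu>\<in>F. kappa r b \<nu> powr q) <= C" and q: "0 < (q::real)" and \<epsilon>: "0 < (\<epsilon>::real)"
 shows "finite {\<nu>\<in>multi_indices. \<epsilon> <= kappa r b \<nu>}"
proof (rule ccontr)
 let ?A = "{\<nu>\<in>multi_indices. \<epsilon> <= kappa r b \<nu>}"
 assume inf: "infinite ?A"
 have e: "0 < \<epsilon> powr q" using \<epsilon> by simp
 obtain n :: nat where n: "C < real n * \<epsilon> powr q" using reals_Archimedean3[OF e] by blast
 obtain B where B: "finite B" "card B = n" "B \<subseteq> ?A" using infinite_arbitrarily_large[OF inf] by blast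
 have "real n * \<epsilon> powr q = (\<Sum>\<nu>\<in>B. \<epsilon> powr q)" using B(2) by simp
 also have "\<dots> <= (\<Sum>\<nu>\<in>B. kappa r b \<nu> powr q)" using B(3) \<epsilon> q by (intro sum_mono powr_mono2) auto
 also have "\<dots> <= C" using B by (intro C) auto
 finally show False using n by simp
qed

lemma summable_power_of_powr:
 fixes a :: "nat => real"
 assumes a: "\<And>j. 0 < a j" and s: "summable (%j. a j powr q)" and q: "0 < q" "q <= real p"
 shows "summable (%j. a j ^ p)"
proof (rule summable_comparison_test_ev[OF _ s])
 have "\<forall>\<^sub>F j in sequentially. a j powr q < 1" by (rule order_tendstoD(2)[OF summable_LIMSEQ_zero[OF s]]) simp
 then show "\<forall>\<^sub>F j in sequentially. norm (a j ^ p) <= a j powr q"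
 proof eventually_elim
  case (elim j)
  have "a j <= 1"
  proof (rule ccontr)
   assume "\<not> a j <= 1"
   then have "1 <= a j powr q" using q by (intro ge_one_powr_ge_zero) auto
   then show False using elim by simp
  qed
  then have "a j powr real p <= a j powr q" using a[of j] q by (intro powr_mono') auto
  then show ?case using a[of j] by (simp add: powr_realpow)
 qed
qed

theorem theorem2p6:
  fixes D :: "(real ^ 'k) set"
    and f :: "real ^ 'k \<Rightarrow> real"
    and \<psi> :: "nat \<Rightarrow> real ^ 'k \<Rightarrow> real"
    and u :: "(nat \<Rightarrow> real) \<Rightarrow> real ^ 'k \<Rightarrow> real"
    and \<rho> b :: "nat \<Rightarrow> real"
    and q c :: real
    and r :: nat
  assumes "CARD('k) \<in> {1, 2, 3}"
    and "bounded D" and "lipschitz_domain D"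
    and "f \<in> L2_fun D"
    and "\<And>j. \<psi> j \<in> Linf_fun D"
    and "AE y in gauss_seq. weak_solution D (lognormal_coeff \<psi> y) f (u y)"
    and "\<And>j. 0 < \<rho> j"
    and "esssup (lebesgue_on D) (\<lambda>x. \<Sum>j. ennreal (\<rho> j * \<bar>\<psi> j x\<bar>)) < \<infinity>"
    and "0 < q"
    and "summable (\<lambda>j. inverse (\<rho> j) powr q)"
    and "1 \<le> r" and "q > 2 / real r"
    and "0 < c"
    and "esssup (lebesgue_on D) (\<lambda>x. \<Sum>j. ennreal (c * \<rho> j * \<bar>\<psi> j x\<bar>)) < ennreal (ln 2 / sqrt (real r))"
    and "b = (\<lambda>j. inverse (c * \<rho> j))"
  shows "\<exists>C::real. \<forall>n\<ge>1.
    (\<exists>\<Lambda>. downward_closed \<Lambda> \<and> n_largest (kappa r b) n \<Lambda>) \<and>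
    (\<forall>\<Lambda>. downward_closed \<Lambda> \<and> n_largest (kappa r b) n \<Lambda> \<longrightarrow>
       (\<lambda>y x. u y x - hermite_trunc D u \<Lambda> y x) \<in> L2_V D gauss_seq \<and>
       L2_V_norm D gauss_seq (\<lambda>y x. u y x - hermite_trunc D u \<Lambda> y x) \<le> C * real n powr (- (1 / q)))"
proof -
 note D_bounded = assms(2) and D_lip = assms(3) and f = assms(4) and \<psi>L = assms(5) and sol = assms(6)
  and \<rho> = assms(7) and q = assms(9) and sum = assms(10) and r = assms(11) and qr = assms(12) and c = assms(13)
  and ess = assms(14) and b = assms(15)
 interpret bounded_open D
  by standard (use D_bounded D_lip in \<open>auto simp: lipschitz_domain_def\<close>)
 have r0: "0 < sqrt (real r)" using r by simp
 define \<sigma> where "\<sigma> j = sqrt (real r) * (c * \<rho> j)" for j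
 have \<sigma>: "0 < \<sigma> j" for j using r0 c \<rho> by (simp add: \<sigma>_def)
 let ?f = "%x. \<Sum>j. ennreal (c * \<rho> j * \<bar>\<psi> j x\<bar>)"
 define e where "e = enn2real (esssup (lebesgue_on D) ?f)"
 have e: "esssup (lebesgue_on D) ?f = ennreal e" 
  unfolding e_def by (rule ennreal_enn2real[symmetric, OF order_less_trans[OF ess ennreal_less_top]])
 have e0: "0 <= e" by (simp add: e_def)
 define K where "K = sqrt (real r) * e"
 have K0: "0 <= K" using e0 r0 by (simp add: K_def)
 have "e < ln 2 / sqrt (real r)" using ess e0 unfolding e by (simp add: ennreal_less_iff)
 then have K: "K < ln 2" using r0 by (simp add: K_def pos_less_divide_eq mult.commute)
 have \<psi>m [measurable]: "\<psi> j \<in> borel_measurable (lebesgue_on D)" for j using \<psi>L[of j] by (simp add: Linf_fun_def)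
 let ?g = "%x. \<Sum>j. ennreal (\<sigma> j * \<bar>\<psi> j x\<bar>)"
 have g: "?g x = ennreal (sqrt (real r)) * ?f x" for x
 proof -
  have "ennreal (\<sigma> j * \<bar>\<psi> j x\<bar>) = ennreal (sqrt (real r)) * ennreal (c * \<rho> j * \<bar>\<psi> j x\<bar>)" for j
  proof -
   have "0 <= c * \<rho> j * \<bar>\<psi> j x\<bar>" using c \<rho>[of j] by simp
   then show ?thesis using r0 by (simp add: \<sigma>_def mult.assoc flip: ennreal_mult)
  qed
  then show ?thesis by simp
 qed
 define D0 where "D0 = {x\<in>D. ?g x <= ennreal K}"
 have D0: "D0 \<in> sets lebesgue"
 proof -
  have "{x\<in>space (lebesgue_on D). ?g x <= ennreal K} \<in> sets (lebesgue_on D)" by measurable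
  then have "D0 \<in> sets (lebesgue_on D)" by (simp add: D0_def)
  then show ?thesis using D_sets by (simp add: sets_restrict_space_iff)
 qed
 have AE_D0: "AE x in lebesgue_on D. x \<in> D0"
  using esssup_AE[where M = "lebesgue_on D" and f = ?f] AE_space
 proof eventually_elim
  case (elim x)
  have "?g x <= ennreal (sqrt (real r)) * ennreal e" unfolding g using elim(1) unfolding e by (intro mult_left_mono) auto
  also have "\<dots> = ennreal K" unfolding K_def using r0 e0 by (simp add: ennreal_mult)
  finally show ?case using elim(2) by (simp add: D0_def)
 qed
 \<comment> \<open>set to zero on the null set where the essential bound fails, the coefficients satisfy it everywhere\<close>
 define \<psi>' where "\<psi>' j x = indicator D0 x * \<psi> j x" for j x
 have \<psi>'m: "\<psi>' j \<in> borel_measurable lebesgue" for j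
 proof -
  have "(%x. indicator D x *\<^sub>R \<psi> j x) \<in> borel_measurable lebesgue"
   using \<psi>m[of j] D_sets by (subst (asm) borel_measurable_restrict_space_iff) auto
  then have "(%x. indicator D0 x * (indicator D x *\<^sub>R \<psi> j x)) \<in> borel_measurable lebesgue"
   using D0 by (intro borel_measurable_times borel_measurable_indicator)
  moreover have "(%x. indicator D0 x * (indicator D x *\<^sub>R \<psi> j x)) = \<psi>' j"
   by (auto simp: fun_eq_iff \<psi>'_def D0_def indicator_def)
  ultimately show ?thesis by simp
 qed
 have gK: "(\<Sum>j. ennreal (\<sigma> j * \<bar>\<psi>' j x\<bar>)) <= ennreal K" for x
  by (cases "x \<in> D0") (auto simp: \<psi>'_def D0_def K0)
 have nn: "0 <= \<sigma> j * \<bar>\<psi>' j x\<bar>" for j x using \<sigma>[of j] by simp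
 have sumx: "summable (%j. \<sigma> j * \<bar>\<psi>' j x\<bar>)" for x
 proof (rule summable_suminf_not_top[OF nn])
  show "(\<Sum>j. ennreal (\<sigma> j * \<bar>\<psi>' j x\<bar>)) ~= top"
   using order_le_less_trans[OF gK[of x] ennreal_less_top] by simp
 qed
 have sumK: "(\<Sum>j. \<sigma> j * \<bar>\<psi>' j x\<bar>) <= K" for x
 proof -
  have "ennreal (\<Sum>j. \<sigma> j * \<bar>\<psi>' j x\<bar>) <= ennreal K" using gK[of x] by (simp only: suminf_ennreal2[OF nn sumx])
  then show ?thesis using K0 by simp
 qed
 \<comment> \<open>an integer exponent, since moments of integer order suffice for the majorant\<close>
 define p where "p = Suc (nat \<lceil>q\<rceil>)"
 have p: "1 <= p" "q <= real p" unfolding p_def by linarith+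
 have sump: "summable (%j. inverse (\<sigma> j) ^ p)"
 proof -
  have "summable (%j. inverse (\<rho> j) ^ p)" by (rule summable_power_of_powr[OF _ sum q p(2)]) (simp add: \<rho>)
  from summable_mult[OF this, of "inverse (sqrt (real r) * c) ^ p"]
  show ?thesis by (simp add: \<sigma>_def power_mult_distrib mult_ac)
 qed
 obtain F where F: "F \<in> energy_space" "\<And>w. w \<in> H10 D ==> F \<bullet> G w = (\<integral>x. f x * w x \<partial>lebesgue_on D)"
  using load_functional[OF f] by blast
 interpret P: gaussian_problem \<psi>' \<sigma> K energy_space F p
  by unfold_locales (use \<psi>'m \<sigma> sumx sumK F(1) K p sump in auto)
 \<comment> \<open>the Taylor coefficient of order 0 is the gradient of the solution\<close>
 let ?U = "P.T zero_index"
 have U: "AE y in gauss_seq. u y \<in> H10 D \<and> G (u y) = ?U y"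
  using sol P.AE_good
 proof eventually_elim
  case (elim y)
  obtain B where B: "P.bounded_by B y" using P.good_bounded[OF elim(2), of 0] by auto
  let ?a = "%x. exp (P.exponent y x) * P.power_weight zero_index x"
  have uH: "u y \<in> H10 D" using elim(1) by (simp add: weak_solution_def)
  have M: "multiplier ?a" by (rule P.coeff_multiplier[OF B P.zero_index_multi])
  have "AE x in lebesgue_on D. lognormal_coeff \<psi> y x = ?a x"
   using AE_D0
  proof eventually_elim
   case (elim x)
   then show ?case by (simp add: lognormal_coeff_def P.exponent_def \<psi>'_def)
  qed
  then have "\<forall>g\<in>energy_space. mult_op ?a (G (u y)) \<bullet> g = F \<bullet> g"
   using weak_solution_iff[OF M _ uH F(2)] elim(1) by blast
  then have "form_solution energy_space (P.coeff_op y zero_index) F = G (u y)"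
   by (intro V.form_solution_eqI[OF P.coercive_coeff_op[OF B]] G_in uH) (simp add: P.coeff_op_def)
  then show ?case using uH elim(2) by (simp add: P.T_def P.taylor_zero)
 qed
 have b0: "0 < b j" for j unfolding b using c \<rho> by simp
 have "summable (%j. b j powr q)"
 proof -
  have "b j powr q = inverse c powr q * inverse (\<rho> j) powr q" for j
   unfolding b using c \<rho>[of j] by (simp add: powr_mult)
  then show ?thesis using summable_mult[OF sum] by simp
 qed
 from kappa_powr_sum_bounded[OF q qr r b0 this] obtain C1 where
  C1: "\<And>F. finite F ==> F \<subseteq> multi_indices ==> (\<Sum>\<nu>\<in>F. kappa r b \<nu> powr q) <= C1" by blast
 have \<sigma>b: "\<sigma> j = sqrt (real r) * inverse (b j)" for j by (simp add: \<sigma>_def b)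
 obtain C where C: "0 <= C" "\<And>n \<Lambda>. 1 <= n ==> n_largest (kappa r b) n \<Lambda> ==>
  E (%y. (norm (?U y - (hermite_sum \<Lambda> (V.hcoef ?U) y)))^2) <= (C * real n powr (- (1 / q)))^2"
 proof -
  have "\<exists>C\<ge>0. \<forall>n\<ge>1. \<forall>\<Lambda>. n_largest (kappa r b) n \<Lambda> \<longrightarrow>
   E (%y. (norm (?U y - (hermite_sum \<Lambda> (V.hcoef ?U) y)))^2) <= (C * real n powr (- (1 / q)))^2"
  proof (rule P.truncation_rate[of b r q C1])
   show "(\<Sum>\<nu>\<in>F. kappa r b \<nu> powr q) <= C1" if "finite F" "F \<subseteq> multi_indices" for F
    using that by (rule C1)
  qed (rule b0 \<sigma>b q)+
  then show thesis using that by blast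
 qed
 have L2: "V.L2_vector ?U" by (rule P.L2_T[OF P.zero_index_multi])
 show ?thesis
 proof (intro exI[of _ C] allI impI conjI)
  fix n :: nat assume n: "1 <= n"
  show "\<exists>\<Lambda>. downward_closed \<Lambda> \<and> n_largest (kappa r b) n \<Lambda>"
  proof (rule exists_n_largest_downward_closed[of "kappa r b"])
   show "finite {\<nu>\<in>multi_indices. \<epsilon> <= kappa r b \<nu>}" if "0 < \<epsilon>" for \<epsilon>
   proof (rule kappa_superlevel_finite[OF _ q that])
    show "(\<Sum>\<nu>\<in>F. kappa r b \<nu> powr q) <= C1" if "finite F" "F \<subseteq> multi_indices" for F
     using that by (rule C1)
   qed
  qed (fact kappa_pos kappa_antimono)+
  fix \<Lambda> assume "downward_closed \<Lambda> \<and> n_largest (kappa r b) n \<Lambda>"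
  then have nl: "n_largest (kappa r b) n \<Lambda>" by simp
  then have \<Lambda>: "finite \<Lambda>" "\<Lambda> \<subseteq> multi_indices" by (auto simp: n_largest_def)
  note T = truncation_L2_V[OF L2 U \<Lambda>]
  show "(%y x. u y x - hermite_trunc D u \<Lambda> y x) \<in> L2_V D gauss_seq" by (rule T(1))
  have "sqrt (E (%y. (norm (?U y - (hermite_sum \<Lambda> (V.hcoef ?U) y)))^2))
    <= sqrt ((C * real n powr (- (1 / q)))^2)"
   by (rule real_sqrt_le_mono[OF C(2)[OF n nl]])
  also have "\<dots> = C * real n powr (- (1 / q))" using C(1) by simp
  finally show "L2_V_norm D gauss_seq (%y x. u y x - hermite_trunc D u \<Lambda> y x) <= C * real n powr (- (1 / q))"
   unfolding T(2) .
 qed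
qed

end
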